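(* Let $b_1,b_2>0$. For every pair $(q,r)$ satisfying $$\frac1q\leq\frac13\Big(\frac12-\frac1r\Big),\quad 2\leq q,r\leq\infty,$$ there is a constant $C(q,r)$ such that for any $\varphi\in l^2(\mathbb{Z}\setminus\{0\})$ the solution $(u,v)\in C(\mathbb{R},l^2(\mathbb{Z}\setminus\{0\}))$ of the system $$ \left\{ \begin{array}{ll} i u_t(t,j) + b_1^{-2}(\Delta_d u)(t,j) = 0, & j\leq -1,\ t\neq 0,\\ i v_t(t,j) + b_2^{-2}(\Delta_d v)(t,j) = 0, & j\geq 1,\ t\neq 0,\\ u(t,0)=v(t,0), & t\neq 0,\\ b_1^{-2}(u(t,-1)-u(t,0))=b_2^{-2}(v(t,0)-v(t,1)), & t\neq 0,\\ u(0,j)=\varphi(j), & j\leq -1,\\ v(0,j)=\varphi(j), & j\geq 1, \end{array} \right. $$ satisfies $$\|(u,v)\|_{L^q(\mathbb{R},\,l^r(\mathbb{Z}\setminus\{0\}))}\leq C(q,r)\|\varphi\|_{l^2(\mathbb{Z}\setminus\{0\})}.$$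
   Context: $\Delta_d$ is the discrete Laplacian, $(\Delta_d w)(j)=w(j+1)-2w(j)+w(j-1)$. Functions are complex valued. The unknowns are $u(t,j)$ for $j\le -1$ and $v(t,j)$ for $j\ge 1$; the pair $(u,v)(t)$ is identified with the sequence on $\mathbb{Z}\setminus\{0\}$ equal to $u(t,j)$ for $j\le -1$ and $v(t,j)$ for $j\ge 1$. The values $u(t,0)$ and $v(t,0)$ are auxiliary quantities introduced only to couple the two equations; they are determined by the third and fourth lines of the system. The numbers $b_1,b_2$ are fixed (the constant $C(q,r)$ may depend on them). The convention $1/\infty=0$ is used. *)

theory Defs
  imports "HOL-Analysis.Analysis" "HOL-Probability.Essential_Supremum"
begin

text \<open>Real power of an extended nonnegative number; only used with exponents \<open>a > 0\<close>,
  whence \<open>\<infinity>\<close> raised to \<open>a\<close> is \<open>\<infinity>\<close>.\<close>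

definition ennpow :: "ennreal \<Rightarrow> real \<Rightarrow> ennreal" where
  "ennpow x a = (if x = \<infinity> then \<infinity> else ennreal (enn2real x powr a))"

text \<open>The usual norm of \<open>L\<^sup>p(M)\<close> for \<open>1 \<le> p \<le> \<infinity>\<close>, as a functional of the absolute value
  \<open>f\<close> of the function. It takes the value \<open>\<infinity>\<close> off \<open>L\<^sup>p(M)\<close>.\<close>

definition Lp_enorm :: "'a measure \<Rightarrow> ereal \<Rightarrow> ('a \<Rightarrow> ennreal) \<Rightarrow> ennreal" where
  "Lp_enorm M p f =
    (if p = \<infinity> then esssup M f
     else ennpow (\<integral>\<^sup>+ x. ennpow (f x) (real_of_ereal p) \<partial>M) (1 / real_of_ereal p))"

definition Zstar :: "int set" where
  "Zstar = UNIV - {0}"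

text \<open>Sequences on \<open>\<int> \<setminus> {0}\<close> are represented by functions on \<^typ>\<open>int\<close>
  whose value at \<open>0\<close> is irrelevant.\<close>

definition lr_enorm :: "ereal \<Rightarrow> (int \<Rightarrow> complex) \<Rightarrow> ennreal" where
  "lr_enorm r w = Lp_enorm (count_space Zstar) r (\<lambda>j. ennreal (cmod (w j)))"

definition LqLr_enorm :: "ereal \<Rightarrow> ereal \<Rightarrow> (real \<Rightarrow> int \<Rightarrow> complex) \<Rightarrow> ennreal" where
  "LqLr_enorm q r w = Lp_enorm lborel q (\<lambda>t. lr_enorm r (w t))"

definition in_l2 :: "(int \<Rightarrow> complex) \<Rightarrow> bool" where
  "in_l2 w \<longleftrightarrow> lr_enorm 2 w < \<infinity>"

text \<open>Membership in \<open>C(\<real>, l\<^sup>2(\<int> \<setminus> {0}))\<close>.\<close>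

definition C_l2 :: "(real \<Rightarrow> int \<Rightarrow> complex) \<Rightarrow> bool" where
  "C_l2 w \<longleftrightarrow>
    (\<forall>t. in_l2 (w t)) \<and>
    (\<forall>t. ((\<lambda>s. lr_enorm 2 (\<lambda>j. w s j - w t j)) \<longlongrightarrow> 0) (at t))"

definition discrete_laplacian :: "(int \<Rightarrow> complex) \<Rightarrow> int \<Rightarrow> complex" where
  "discrete_laplacian w j = w (j + 1) - 2 * w j + w (j - 1)"

text \<open>The sequence on \<open>\<int> \<setminus> {0}\<close> identified with the pair \<open>(u, v)(t)\<close>. The auxiliary
  values \<open>u(t,0)\<close> and \<open>v(t,0)\<close> do not enter it.\<close>

definition glue :: "(real \<Rightarrow> int \<Rightarrow> complex) \<Rightarrow> (real \<Rightarrow> int \<Rightarrow> complex) \<Rightarrow> real \<Rightarrow> int \<Rightarrow> complex"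
  where "glue u v t j = (if j \<le> -1 then u t j else if j \<ge> 1 then v t j else 0)"

text \<open>\<open>i w\<^sub>t + b\<^sup>-\<^sup>2 \<Delta>\<^sub>d w = 0\<close> at the point \<open>(t, j)\<close>, including the existence of
  the time derivative.\<close>

definition schroedinger_at :: "real \<Rightarrow> (real \<Rightarrow> int \<Rightarrow> complex) \<Rightarrow> real \<Rightarrow> int \<Rightarrow> bool" where
  "schroedinger_at b w t j \<longleftrightarrow>
    (\<exists>w'. ((\<lambda>s. w s j) has_vector_derivative w') (at t) \<and>
      \<i> * w' + complex_of_real (1 / b\<^sup>2) * discrete_laplacian (w t) j = 0)"

text \<open>The values \<open>u t j\<close> for \<open>j > 0\<close> and \<open>v t j\<close> for \<open>j < 0\<close> do not occur.\<close>

definition is_solution ::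
  "real \<Rightarrow> real \<Rightarrow> (int \<Rightarrow> complex) \<Rightarrow> (real \<Rightarrow> int \<Rightarrow> complex) \<Rightarrow> (real \<Rightarrow> int \<Rightarrow> complex) \<Rightarrow> bool"
  where
  "is_solution b1 b2 \<phi> u v \<longleftrightarrow>
    C_l2 (glue u v) \<and>
    (\<forall>t j. t \<noteq> 0 \<and> j \<le> -1 \<longrightarrow> schroedinger_at b1 u t j) \<and>
    (\<forall>t j. t \<noteq> 0 \<and> j \<ge> 1 \<longrightarrow> schroedinger_at b2 v t j) \<and>
    (\<forall>t. t \<noteq> 0 \<longrightarrow> u t 0 = v t 0) \<and>
    (\<forall>t. t \<noteq> 0 \<longrightarrow>
      complex_of_real (1 / b1\<^sup>2) * (u t (-1) - u t 0) =
      complex_of_real (1 / b2\<^sup>2) * (v t 0 - v t 1)) \<and>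
    (\<forall>j. j \<le> -1 \<longrightarrow> u 0 j = \<phi> j) \<and>
    (\<forall>j. j \<ge> 1 \<longrightarrow> v 0 j = \<phi> j)"

end

theory Submission
  imports Defs "HOL-Complex_Analysis.Complex_Analysis" "HOL-Probability.Characteristic_Functions"
begin

text \<open>By interpolation with the conservation of the \<open>l\<^sup>2\<close> norm everything follows
  from the endpoint \<open>(q, r) = (6, \<infinity>)\<close>. The operator is diagonalised by
  explicit scattering states, one family incident from each side. On either side of the interface a
  state is a combination of plane waves (or, for energies outside the band of the slower medium, an
  exponentially decaying wave) with bounded coefficients that do not depend on the position, so the
  solution is a sum of few oscillatory integrals \<open>\<integral> exp (i (2 A t cos \<theta> + m
  \<theta>)) F(\<theta>) d\<theta>\<close>. Each of them is estimated by duality: van der Corput's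
  lemma bounds the kernel by \<open>\<bar>t\<bar>\<^sup>-\<^sup>1\<^sup>/\<^sup>3\<close> uniformly
  in \<open>m\<close>, and fractional integration in time gives the \<open>L\<^sup>6\<close> bound.
  Since the coefficients of the scattering states extend holomorphically to the unit disc as
  functions of \<open>exp (i \<theta>)\<close>, their orthonormality is an instance of Cauchy's
  theorem on the left of the interface, and the eigenvalue equation propagates it to the right. A
  solution is unique because its pairing with the propagator kernel, truncated to
  \<open>\<bar>j\<bar> \<le> n\<close>, changes in time only through boundary terms, which vanish as
  \<open>n\<close> tends to infinity.\<close>

section \<open>Decay of oscillatory integrals\<close>

text \<open>The scattering coefficients have square-root singularities at the critical angle
  \<open>edge\<close>, where the transmitted wave turns evanescent, so they are kept out of the
  stationary phase estimates. Duality achieves this: its kernel contains only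
  \<open>cis (\<tau> * \<Lambda> x)\<close> and two position factors, while the coefficients belong
  to the input amplitude, of which only the L2 norm counts. The position factors are plane waves in
  the angle of the medium where the wave is observed, or powers of a monotone function of the angle;
  both admit bounds uniform in the position.

  Orthonormality is meant over sites, with the angle integrated. It is thus the completeness of the
  scattering states and holds because there is no bound state, which would show up as a zero of
  \<open>p + q * Q\<close> in the unit disc. The contour argument fixes one site in the medium with
  the wider band, placed on the left: the powers of \<open>cis \<theta>\<close> coming from that
  site remove the pole of the coefficients at the centre of the disc.\<close>

lemma oscillatory_integral_first:
  fixes \<phi> \<phi>' \<phi>'' :: "real \<Rightarrow> real"
  assumes "c \<le> d" and \<mu>: "\<mu> > 0"
    and d1: "\<And>x. (\<phi> has_real_derivative \<phi>' x) (at x)"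
    and d2: "\<And>x. (\<phi>' has_real_derivative \<phi>'' x) (at x)"
    and cont: "continuous_on UNIV \<phi>''"
    and pos: "\<And>x. x \<in> {c..d} \<Longrightarrow> \<phi>'' x \<ge> 0"
    and big: "(\<forall>x\<in>{c..d}. \<phi>' x \<ge> \<mu>) \<or> (\<forall>x\<in>{c..d}. \<phi>' x \<le> - \<mu>)"
  shows "norm (integral {c..d} (\<lambda>x. cis (\<phi> x))) \<le> 3 / \<mu>"
proof -
  have nz: "\<phi>' x \<noteq> 0" if "x \<in> {c..d}" for x using big \<mu> that by force
  have inv_le: "\<bar>1 / \<phi>' x\<bar> \<le> 1 / \<mu>" if "x \<in> {c..d}" for x
  proof -
    have "\<bar>\<phi>' x\<bar> \<ge> \<mu>" using big that \<mu> by force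
    then show ?thesis using \<mu> by (simp add: abs_divide frac_le)
  qed
  \<comment> \<open>Integration by parts with \<open>?u * ?v' = cis (\<phi> x)\<close>. The two
    boundary terms and the remaining integral contribute \<open>1 / \<mu>\<close> each, whence the
    3.\<close>
  let ?u = "\<lambda>x. complex_of_real (1 / \<phi>' x)"
  let ?u' = "\<lambda>x. complex_of_real (- \<phi>'' x / (\<phi>' x)\<^sup>2)"
  let ?v = "\<lambda>x. - \<i> * cis (\<phi> x)"
  let ?v' = "\<lambda>x. complex_of_real (\<phi>' x) * cis (\<phi> x)"
  have du_r: "((\<lambda>x. 1 / \<phi>' x) has_real_derivative (- \<phi>'' x / (\<phi>' x)\<^sup>2)) (at x)" if "x \<in> {c..d}" for x
    using nz[OF that] by (auto intro!: derivative_eq_intros d2 simp: power2_eq_square)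
  have du: "(?u has_vector_derivative ?u' x) (at x within {c..d})" if "x \<in> {c..d}" for x
    using du_r[OF that] by (intro has_vector_derivative_of_real)
       (simp add: has_real_derivative_iff_has_vector_derivative has_vector_derivative_at_within)
  have dcis: "((\<lambda>x. cis (\<phi> x)) has_vector_derivative (\<phi>' x *\<^sub>R (\<i> * cis (\<phi> x)))) (at x within {c..d})" for x
  proof -
    have "((\<lambda>x. cis (\<phi> x)) has_derivative (\<lambda>h. (h * \<phi>' x) *\<^sub>R (\<i> * cis (\<phi> x)))) (at x within {c..d})"
      using d1[of x] by (intro has_derivative_cis) (simp add: has_field_derivative_def has_derivative_at_withinI mult_commute_abs)
    then show ?thesis by (simp add: has_vector_derivative_def)
  qed
  have dv: "(?v has_vector_derivative ?v' x) (at x within {c..d})" for x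
  proof -
    have "((\<lambda>x. (- \<i>) * cis (\<phi> x)) has_vector_derivative ((- \<i>) * (\<phi>' x *\<^sub>R (\<i> * cis (\<phi> x))))) (at x within {c..d})"
      by (rule has_vector_derivative_mult_right[OF dcis])
    then show ?thesis by (simp add: scaleR_conv_of_real algebra_simps)
  qed
  have prodd: "((\<lambda>x. ?u x * ?v x) has_vector_derivative (?u x * ?v' x + ?u' x * ?v x)) (at x within {c..d})" if "x \<in> {c..d}" for x
    by (rule has_vector_derivative_mult[OF du[OF that] dv])
  have i1: "((\<lambda>x. ?u x * ?v' x + ?u' x * ?v x) has_integral (?u d * ?v d - ?u c * ?v c)) {c..d}"
    by (rule fundamental_theorem_of_calculus[OF \<open>c \<le> d\<close> prodd])
  have contphi: "continuous_on A \<phi>" for A using d1 DERIV_continuous_on has_field_derivative_at_within by metis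
  have contphi': "continuous_on A \<phi>'" for A using d2 DERIV_continuous_on has_field_derivative_at_within by metis
  have contphi'': "continuous_on A \<phi>''" for A using cont continuous_on_subset by blast
  have contcis: "continuous_on A (\<lambda>x. cis (\<phi> x))" for A
    unfolding cis_conv_exp by (intro continuous_intros contphi)
  have contu': "continuous_on {c..d} ?u'"
    by (intro continuous_intros contphi' contphi'') (auto simp: nz)
  have i2: "(\<lambda>x. ?u' x * ?v x) integrable_on {c..d}"
    by (intro integrable_continuous_real continuous_intros contu' contcis)
  \<comment> \<open>Since \<open>\<phi>'' x \<ge> 0\<close>, the norm of \<open>?u' * ?v\<close> is
    minus the derivative of \<open>1 / \<phi>'\<close>, so its integral telescopes to the end
    points, whatever the size of \<open>\<phi>''\<close>.\<close>
  have i3: "((\<lambda>x. \<phi>'' x / (\<phi>' x)\<^sup>2) has_integral (1 / \<phi>' c - 1 / \<phi>' d)) {c..d}"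
  proof -
    have "((\<lambda>x. - \<phi>'' x / (\<phi>' x)\<^sup>2) has_integral (1 / \<phi>' d - 1 / \<phi>' c)) {c..d}"
      by (rule fundamental_theorem_of_calculus[OF \<open>c \<le> d\<close>])
         (use du_r in \<open>simp add: has_real_derivative_iff_has_vector_derivative has_vector_derivative_at_within\<close>)
    from has_integral_neg[OF this] show ?thesis by simp
  qed
  have bound2: "norm (integral {c..d} (\<lambda>x. ?u' x * ?v x)) \<le> 1 / \<phi>' c - 1 / \<phi>' d"
  proof -
    have "norm (integral {c..d} (\<lambda>x. ?u' x * ?v x)) \<le> integral {c..d} (\<lambda>x. \<phi>'' x / (\<phi>' x)\<^sup>2)"
    proof (rule integral_norm_bound_integral[OF i2])
      show "(\<lambda>x. \<phi>'' x / (\<phi>' x)\<^sup>2) integrable_on {c..d}" using i3 by blast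
      show "norm (?u' x * ?v x) \<le> \<phi>'' x / (\<phi>' x)\<^sup>2" if "x \<in> {c..d}" for x
        using pos[OF that] by (simp add: norm_mult norm_divide norm_power)
    qed
    then show ?thesis using i3 by (simp add: integral_unique)
  qed
  have eq: "integral {c..d} (\<lambda>x. cis (\<phi> x)) = (?u d * ?v d - ?u c * ?v c) - integral {c..d} (\<lambda>x. ?u' x * ?v x)"
  proof -
    have "((\<lambda>x. (?u x * ?v' x + ?u' x * ?v x) - ?u' x * ?v x) has_integral
        (?u d * ?v d - ?u c * ?v c) - integral {c..d} (\<lambda>x. ?u' x * ?v x)) {c..d}"
      by (rule has_integral_diff[OF i1 integrable_integral[OF i2]])
    then have "((\<lambda>x. cis (\<phi> x)) has_integral
        (?u d * ?v d - ?u c * ?v c) - integral {c..d} (\<lambda>x. ?u' x * ?v x)) {c..d}"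
      by (rule has_integral_eq[rotated]) (simp add: nz)
    then show ?thesis by (simp add: integral_unique)
  qed
  have cd: "c \<in> {c..d}" "d \<in> {c..d}" using \<open>c \<le> d\<close> by auto
  have "1 / \<phi>' c - 1 / \<phi>' d \<le> 1 / \<mu>"
    using big
  proof
    assume "\<forall>x\<in>{c..d}. \<phi>' x \<ge> \<mu>"
    then have "1 / \<phi>' d \<ge> 0" using cd \<mu> by (meson divide_nonneg_pos less_le_trans zero_le_one)
    then show ?thesis using inv_le[OF cd(1)] by linarith
  next
    assume "\<forall>x\<in>{c..d}. \<phi>' x \<le> - \<mu>"
    then have "\<phi>' c < 0" using cd \<mu> by force
    then have "1 / \<phi>' c \<le> 0" by simp
    then show ?thesis using inv_le[OF cd(2)] by linarith
  qed
  moreover have "norm (?u d * ?v d) \<le> 1 / \<mu>" "norm (?u c * ?v c) \<le> 1 / \<mu>"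
    using inv_le[OF cd(1)] inv_le[OF cd(2)] by (simp_all add: norm_mult norm_divide)
  moreover have "norm (integral {c..d} (\<lambda>x. cis (\<phi> x))) \<le> norm (?u d * ?v d) + norm (?u c * ?v c) + norm (integral {c..d} (\<lambda>x. ?u' x * ?v x))"
    unfolding eq by (meson norm_triangle_ineq4 add_mono order_trans order_refl)
  ultimately show ?thesis using bound2 by linarith
qed

lemma norm_integral_cis_le_length:
  assumes "continuous_on {c..d} \<phi>" "c \<le> d"
  shows "norm (integral {c..d} (\<lambda>x. cis (\<phi> x))) \<le> d - c"
proof -
  have "norm (integral {c..d} (\<lambda>x. cis (\<phi> x))) \<le> 1 * (d - c)"
    by (rule integral_bound[OF \<open>c \<le> d\<close>])
       (auto simp: cis_conv_exp intro!: continuous_intros assms)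
  then show ?thesis by simp
qed

text \<open>A derivative that grows at rate at least \<mu> is small only near one point. A window of
  half-width \<open>1 / sqrt \<mu>\<close> around it is bounded by its length
  \<open>2 / sqrt \<mu>\<close>; outside, \<open>\<bar>\<phi>' x\<bar> \<ge> sqrt \<mu>\<close>, and
  the first-derivative test gives \<open>3 / sqrt \<mu>\<close> on either side.\<close>

lemma oscillatory_integral_second:
  fixes \<phi> \<phi>' \<phi>'' :: "real \<Rightarrow> real"
  assumes "c \<le> d" and \<mu>: "\<mu> > 0"
    and d1: "\<And>x. (\<phi> has_real_derivative \<phi>' x) (at x)"
    and d2: "\<And>x. (\<phi>' has_real_derivative \<phi>'' x) (at x)"
    and cont: "continuous_on UNIV \<phi>''"
    and big: "\<And>x. x \<in> {c..d} \<Longrightarrow> \<phi>'' x \<ge> \<mu>"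
  shows "norm (integral {c..d} (\<lambda>x. cis (\<phi> x))) \<le> 8 / sqrt \<mu>"
proof -
  have contphi: "continuous_on A \<phi>" for A using d1 DERIV_continuous_on has_field_derivative_at_within by metis
  have contphi': "continuous_on A \<phi>'" for A using d2 DERIV_continuous_on has_field_derivative_at_within by metis
  have intg: "(\<lambda>x. cis (\<phi> x)) integrable_on {e..f}" for e f
    unfolding cis_conv_exp by (intro integrable_continuous_real continuous_intros contphi)
  have growth: "\<phi>' y - \<phi>' x \<ge> \<mu> * (y - x)" if "x \<in> {c..d}" "y \<in> {c..d}" "x \<le> y" for x y
  proof (cases "x = y")
    case False
    then have "x < y" using that by auto
    then obtain z where z: "x < z" "z < y" "\<phi>' y - \<phi>' x = (y - x) * \<phi>'' z"
      using MVT2[of x y \<phi>' \<phi>''] d2 by blast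
    have "\<phi>'' z \<ge> \<mu>" using z that by (intro big) auto
    then show ?thesis using z that by (simp add: mult.commute mult_left_mono)
  qed auto
  text \<open>the point where \<open>\<phi>'\<close> changes sign, or an end point\<close>
  have "\<exists>x0\<in>{c..d}. (\<forall>x\<in>{c..d}. x < x0 \<longrightarrow> \<phi>' x \<le> - \<mu> * (x0 - x)) \<and> (\<forall>x\<in>{c..d}. x > x0 \<longrightarrow> \<phi>' x \<ge> \<mu> * (x - x0))"
  proof -
    consider "\<phi>' c \<ge> 0" | "\<phi>' d \<le> 0" | "\<phi>' c \<le> 0" "\<phi>' d \<ge> 0" by linarith
    then show ?thesis
    proof cases
      case 1
      then show ?thesis using growth[of c] \<open>c \<le> d\<close> by (intro bexI[of _ c]) force+
    next
      case 2
      show ?thesis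
      proof (intro bexI[of _ d] conjI ballI impI)
        fix x assume "x \<in> {c..d}" "x < d"
        then show "\<phi>' x \<le> - \<mu> * (d - x)" using growth[of x d] 2 \<open>c \<le> d\<close> by simp
      qed (use \<open>c \<le> d\<close> in auto)
    next
      case 3
      obtain x0 where x0: "x0 \<ge> c" "x0 \<le> d" "\<phi>' x0 = 0"
        using IVT'[of \<phi>' c 0 d] 3 \<open>c \<le> d\<close> contphi' by blast
      show ?thesis
      proof (intro bexI[of _ x0] conjI ballI impI)
        fix x assume "x \<in> {c..d}" "x < x0"
        then show "\<phi>' x \<le> - \<mu> * (x0 - x)" using growth[of x x0] x0 by simp
      next
        fix x assume "x \<in> {c..d}" "x > x0"
        then show "\<phi>' x \<ge> \<mu> * (x - x0)" using growth[of x0 x] x0 by simp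
      qed (use x0 in auto)
    qed
  qed
  then obtain x0 where x0: "x0 \<in> {c..d}"
    and lo: "\<And>x. x \<in> {c..d} \<Longrightarrow> x < x0 \<Longrightarrow> \<phi>' x \<le> - \<mu> * (x0 - x)"
    and hi: "\<And>x. x \<in> {c..d} \<Longrightarrow> x > x0 \<Longrightarrow> \<phi>' x \<ge> \<mu> * (x - x0)" by blast
  define \<delta> where "\<delta> = 1 / sqrt \<mu>"
  have \<delta>: "\<delta> > 0" using \<mu> by (simp add: \<delta>_def)
  have \<mu>\<delta>: "\<mu> * \<delta> = sqrt \<mu>" using \<mu> by (simp add: \<delta>_def real_div_sqrt)
  \<comment> \<open>Clipping lets an outer piece degenerate to a point, which covers windows
    reaching beyond \<open>c\<close> or \<open>d\<close>.\<close>
  define l where "l = max c (x0 - \<delta>)"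
  define r where "r = min d (x0 + \<delta>)"
  have lr: "c \<le> l" "l \<le> x0" "x0 \<le> r" "r \<le> d" using x0 \<delta> by (auto simp: l_def r_def)
  let ?I = "\<lambda>e f. integral {e..f} (\<lambda>x. cis (\<phi> x))"
  have split: "?I c d = ?I c l + ?I l r + ?I r d"
  proof -
    have A: "?I c l + ?I l d = ?I c d" by (rule Henstock_Kurzweil_Integration.integral_combine) (use lr intg in auto)
    have B: "?I l r + ?I r d = ?I l d" by (rule Henstock_Kurzweil_Integration.integral_combine) (use lr intg in auto)
    show ?thesis by (simp only: A[symmetric] B[symmetric] add.assoc)
  qed
  have n1: "norm (?I c l) \<le> 3 / sqrt \<mu>"
  proof (cases "c = l")
    case False
    then have l: "l = x0 - \<delta>" using lr by (auto simp: l_def)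
    show ?thesis
    proof (rule oscillatory_integral_first[OF _ _ d1 d2 cont])
      show "(\<forall>x\<in>{c..l}. sqrt \<mu> \<le> \<phi>' x) \<or> (\<forall>x\<in>{c..l}. \<phi>' x \<le> - sqrt \<mu>)"
      proof (rule disjI2, intro ballI)
        fix x assume x: "x \<in> {c..l}"
        have "\<phi>' x \<le> - \<mu> * (x0 - x)" using x lr l \<delta> by (intro lo) auto
        also have "\<dots> \<le> - (\<mu> * \<delta>)" using x l \<mu> by simp
        finally show "\<phi>' x \<le> - sqrt \<mu>" by (simp add: \<mu>\<delta>)
      qed
      show "\<phi>'' x \<ge> 0" if "x \<in> {c..l}" for x using big[of x] that lr \<mu> by force
    qed (use lr \<mu> in auto)
  qed (use \<mu> in simp)
  have n3: "norm (?I r d) \<le> 3 / sqrt \<mu>"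
  proof (cases "d = r")
    case False
    then have r: "r = x0 + \<delta>" using lr by (auto simp: r_def)
    show ?thesis
    proof (rule oscillatory_integral_first[OF _ _ d1 d2 cont])
      show "(\<forall>x\<in>{r..d}. sqrt \<mu> \<le> \<phi>' x) \<or> (\<forall>x\<in>{r..d}. \<phi>' x \<le> - sqrt \<mu>)"
      proof (rule disjI1, intro ballI)
        fix x assume x: "x \<in> {r..d}"
        have "\<mu> * \<delta> \<le> \<mu> * (x - x0)" using x r \<mu> by simp
        also have "\<dots> \<le> \<phi>' x" using x lr r \<delta> by (intro hi) auto
        finally show "sqrt \<mu> \<le> \<phi>' x" by (simp add: \<mu>\<delta>)
      qed
      show "\<phi>'' x \<ge> 0" if "x \<in> {r..d}" for x using big[of x] that lr \<mu> by force
    qed (use lr \<mu> in auto)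
  qed (use \<mu> in simp)
  have "norm (?I l r) \<le> r - l" using lr by (intro norm_integral_cis_le_length contphi) auto
  also have "\<dots> \<le> 2 * \<delta>" by (auto simp: l_def r_def)
  finally have n2: "norm (?I l r) \<le> 2 / sqrt \<mu>" by (simp add: \<delta>_def)
  have "norm (?I c d) \<le> norm (?I c l) + norm (?I l r) + norm (?I r d)"
    unfolding split by (meson norm_triangle_ineq add_mono order_trans order_refl)
  also have "\<dots> \<le> 8 / sqrt \<mu>" using n1 n2 n3 by simp
  finally show ?thesis .
qed

lemma oscillatory_integral_second_neg:
  fixes \<phi> \<phi>' \<phi>'' :: "real \<Rightarrow> real"
  assumes "c \<le> d" and \<mu>: "\<mu> > 0"
    and d1: "\<And>x. (\<phi> has_real_derivative \<phi>' x) (at x)"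
    and d2: "\<And>x. (\<phi>' has_real_derivative \<phi>'' x) (at x)"
    and cont: "continuous_on UNIV \<phi>''"
    and big: "\<And>x. x \<in> {c..d} \<Longrightarrow> \<phi>'' x \<le> - \<mu>"
  shows "norm (integral {c..d} (\<lambda>x. cis (\<phi> x))) \<le> 8 / sqrt \<mu>"
proof -
  have "norm (integral {c..d} (\<lambda>x. cis (- \<phi> x))) \<le> 8 / sqrt \<mu>"
    by (rule oscillatory_integral_second[where \<phi>' = "\<lambda>x. - \<phi>' x" and \<phi>'' = "\<lambda>x. - \<phi>'' x"])
       (use assms in \<open>force intro!: derivative_eq_intros continuous_intros\<close>)+
  moreover have "integral {c..d} (\<lambda>x. cis (- \<phi> x)) = cnj (integral {c..d} (\<lambda>x. cis (\<phi> x)))"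
    by (simp add: cis_cnj integral_cnj)
  ultimately show ?thesis by simp
qed

text \<open>The term \<open>m * x\<close> has vanishing second derivative, so the bound is uniform
  in \<open>m\<close>, that is, in the position on the lattice.\<close>

lemma cos_phase_on_monotone_piece:
  fixes \<tau> m \<mu> :: real
  assumes "c \<le> d" "\<mu> > 0"
    and "(\<forall>x\<in>{c..d}. \<tau> * cos x \<ge> \<mu>) \<or> (\<forall>x\<in>{c..d}. \<tau> * cos x \<le> - \<mu>)"
  shows "norm (integral {c..d} (\<lambda>x. cis (\<tau> * cos x + m * x))) \<le> 8 / sqrt \<mu>"
  using assms(3)
proof
  assume *: "\<forall>x\<in>{c..d}. \<tau> * cos x \<ge> \<mu>"
  show ?thesis
    by (rule oscillatory_integral_second_neg[where \<phi>' = "\<lambda>x. m - \<tau> * sin x" and \<phi>'' = "\<lambda>x. - \<tau> * cos x"])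
       (use assms * in \<open>force intro!: derivative_eq_intros continuous_intros\<close>)+
next
  assume *: "\<forall>x\<in>{c..d}. \<tau> * cos x \<le> - \<mu>"
  show ?thesis
    by (rule oscillatory_integral_second[where \<phi>' = "\<lambda>x. m - \<tau> * sin x" and \<phi>'' = "\<lambda>x. - \<tau> * cos x"])
       (use assms * in \<open>force intro!: derivative_eq_intros continuous_intros\<close>)+
qed

text \<open>The zero of the cosine at \<pi>/2 is simple, so the distance to it bounds the second
  derivative of the phase from below.\<close>

lemma cos_ge_linear:
  fixes x :: real
  assumes "0 \<le> x" "x \<le> pi / 2" shows "cos x \<ge> (pi / 2 - x) / 2"
proof -
  have *: "sin y \<ge> y / 2" if y: "0 \<le> y" "y \<le> pi / 2" for y :: real
  \<comment> \<open>Up to \<pi>/3 the derivative of the sine is at least 1/2; beyond,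
    \<open>sin y \<ge> sqrt 3 / 2\<close> exceeds \<open>pi / 4\<close>, hence
    \<open>y / 2\<close>.\<close>
  proof (cases "y \<le> pi / 3")
    case True
    have "sin 0 - 0 / 2 \<le> sin y - y / 2"
    proof (rule DERIV_nonneg_imp_nondecreasing[OF y(1)])
      fix z :: real assume z: "0 \<le> z" "z \<le> y"
      have "cos (pi / 3) \<le> cos z" using z True pi_gt_zero by (intro cos_monotone_0_pi_le) auto
      then have "0 \<le> cos z - 1 / 2" by (simp add: cos_60)
      then show "\<exists>l. ((\<lambda>x. sin x - x / 2) has_real_derivative l) (at z) \<and> 0 \<le> l"
        by (intro exI[of _ "cos z - 1 / 2"]) (auto intro!: derivative_eq_intros)
    qed
    then show ?thesis by simp
  next
    case False
    have "sin (pi / 3) \<le> sin y" using False y by (intro sin_monotone_2pi_le) auto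
    moreover have "sqrt 3 \<ge> 1.7" by (rule real_le_rsqrt) (simp add: power2_eq_square)
    moreover have "pi \<le> 3.2" using pi_approx by simp
    ultimately show ?thesis using y by (simp add: sin_60)
  qed
  show ?thesis using *[of "pi/2 - x"] assms by (simp add: cos_sin_eq)
qed

text \<open>Away from the inflection point \<open>\<pi>/2\<close> the second derivative of the phase controls the integral,
  and a window of width \<open>\<bar>\<tau>\<bar>\<^sup>-\<^sup>1\<^sup>/\<^sup>3\<close> around it is estimated trivially.\<close>

lemma cos_phase_decay:
  fixes \<tau> m :: real
  assumes cd: "0 \<le> c" "c \<le> d" "d \<le> pi" and \<tau>: "\<tau> \<noteq> 0"
  shows "norm (integral {c..d} (\<lambda>x. cis (\<tau> * cos x + m * x))) \<le> 26 * \<bar>\<tau>\<bar> powr (- 1 / 3)"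
proof -
  define \<delta> where "\<delta> = \<bar>\<tau>\<bar> powr (- 1 / 3)"
  have \<delta>: "\<delta> > 0" using \<tau> by (simp add: \<delta>_def)
  \<comment> \<open>At distance \<delta> from \<pi>/2 the cosine has modulus at least
    \<open>\<delta> / 2\<close>, so \<mu> bounds \<open>\<bar>\<tau> * cos x\<bar>\<close> there.
    With \<open>\<delta> = \<bar>\<tau>\<bar> powr (- 1 / 3)\<close> the outer bound
    \<open>8 / sqrt \<mu> = 8 * sqrt 2 * \<delta>\<close> has the size of the window, and 12 + 2 +
    12 = 26.\<close>
  define \<mu> where "\<mu> = \<bar>\<tau>\<bar> * \<delta> / 2"
  have \<mu>: "\<mu> > 0" using \<tau> \<delta> by (simp add: \<mu>_def)
  have "\<bar>\<tau>\<bar> * \<delta> = \<bar>\<tau>\<bar> powr (2 / 3)"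
    using \<tau> powr_add[of "\<bar>\<tau>\<bar>" 1 "- 1 / 3"] by (simp add: \<delta>_def)
  then have "1 / (\<bar>\<tau>\<bar> * \<delta>) = \<delta>\<^sup>2" using \<tau>
    by (simp add: \<delta>_def powr_minus_divide power_divide powr_power)
  then have "1 / \<mu> = 2 * \<delta>\<^sup>2" by (simp add: \<mu>_def)
  then have "sqrt (1 / \<mu>) = sqrt 2 * \<delta>" using \<delta> by (simp add: real_sqrt_mult)
  then have "8 / sqrt \<mu> = 8 * sqrt 2 * \<delta>" by (simp add: real_sqrt_divide)
  moreover have "sqrt 2 \<le> 1.5" by (rule real_le_lsqrt) (simp_all add: power2_eq_square)
  ultimately have \<mu>\<delta>: "8 / sqrt \<mu> \<le> 12 * \<delta>" using \<delta> by simp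
  \<comment> \<open>The cut points are clipped so that \<open>c \<le> l\<close>,
    \<open>l \<le> r\<close> and \<open>r \<le> d\<close> hold wherever the window lies; an outer
    piece that is not a point still keeps distance \<delta> from \<pi>/2.\<close>
  define l where "l = max c (min d (pi / 2 - \<delta>))"
  define r where "r = min d (max l (pi / 2 + \<delta>))"
  have lr: "c \<le> l" "l \<le> r" "r \<le> d" using cd by (auto simp: l_def r_def)
  let ?f = "\<lambda>x. cis (\<tau> * cos x + m * x)"
  let ?I = "\<lambda>e f. integral {e..f} ?f"
  have intg: "?f integrable_on {e..f}" for e f
    unfolding cis_conv_exp by (intro integrable_continuous_real continuous_intros)
  have split: "?I c d = ?I c l + ?I l r + ?I r d"
  proof -
    have A: "?I c l + ?I l d = ?I c d" by (rule Henstock_Kurzweil_Integration.integral_combine) (use lr intg in auto)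
    have B: "?I l r + ?I r d = ?I l d" by (rule Henstock_Kurzweil_Integration.integral_combine) (use lr intg in auto)
    show ?thesis by (simp only: A[symmetric] B[symmetric] add.assoc)
  qed
  have sgn: "(\<forall>x\<in>A. \<tau> * cos x \<ge> \<mu>) \<or> (\<forall>x\<in>A. \<tau> * cos x \<le> - \<mu>)"
    if "(\<forall>x\<in>A. cos x \<ge> \<delta> / 2) \<or> (\<forall>x\<in>A. cos x \<le> - (\<delta> / 2))" for A
  proof -
    consider "\<tau> > 0" | "\<tau> < 0" using \<tau> by linarith
    then show ?thesis
    proof cases
      case 1
      have "\<tau> * cos x \<ge> \<mu>" if "cos x \<ge> \<delta> / 2" for x
        using mult_left_mono[OF that, of \<tau>] 1 by (simp add: \<mu>_def)
      moreover have "\<tau> * cos x \<le> - \<mu>" if "cos x \<le> - (\<delta> / 2)" for x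
        using mult_left_mono[OF that, of \<tau>] 1 by (simp add: \<mu>_def)
      ultimately show ?thesis using that by blast
    next
      case 2
      have "\<tau> * cos x \<le> - \<mu>" if "cos x \<ge> \<delta> / 2" for x
        using mult_left_mono_neg[OF that, of \<tau>] 2 by (simp add: \<mu>_def)
      moreover have "\<tau> * cos x \<ge> \<mu>" if "cos x \<le> - (\<delta> / 2)" for x
        using mult_left_mono_neg[OF that, of \<tau>] 2 by (simp add: \<mu>_def)
      ultimately show ?thesis using that by blast
    qed
  qed
  have n1: "norm (?I c l) \<le> 12 * \<delta>"
  proof (cases "c = l")
    case False
    then have l: "l \<le> pi / 2 - \<delta>" using lr by (auto simp: l_def max_def split: if_splits)
    have "cos x \<ge> \<delta> / 2" if "x \<in> {c..l}" for x
      using cos_ge_linear[of x] that l cd \<delta> by auto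
    then have "norm (?I c l) \<le> 8 / sqrt \<mu>"
      using lr \<mu> sgn[of "{c..l}"] by (intro cos_phase_on_monotone_piece) auto
    then show ?thesis using \<mu>\<delta> by simp
  qed (use \<delta> in simp)
  have n3: "norm (?I r d) \<le> 12 * \<delta>"
  proof (cases "d = r")
    case False
    then have r: "r \<ge> pi / 2 + \<delta>" using lr by (auto simp: r_def)
    have "cos x \<le> - (\<delta> / 2)" if "x \<in> {r..d}" for x
      using cos_ge_linear[of "pi - x"] that r cd \<delta> by auto
    then have "norm (?I r d) \<le> 8 / sqrt \<mu>"
      using lr \<mu> sgn[of "{r..d}"] by (intro cos_phase_on_monotone_piece) auto
    then show ?thesis using \<mu>\<delta> by simp
  qed (use \<delta> in simp)
  have "norm (?I l r) \<le> r - l" using lr by (intro norm_integral_cis_le_length continuous_intros) auto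
  also have "\<dots> \<le> 2 * \<delta>" using \<delta> by (auto simp: l_def r_def)
  finally have n2: "norm (?I l r) \<le> 2 * \<delta>" .
  have "norm (?I c d) \<le> norm (?I c l) + norm (?I l r) + norm (?I r d)"
    unfolding split by (meson norm_triangle_ineq add_mono order_trans order_refl)
  also have "\<dots> \<le> 26 * \<delta>" using n1 n2 n3 by simp
  finally show ?thesis by (simp add: \<delta>_def)
qed

section \<open>Duality and fractional integration\<close>

lemma nn_integral_abs_diff_le:
  fixes f :: "real \<Rightarrow> ennreal" and t :: real
  assumes [measurable]: "f \<in> borel_measurable borel"
  shows "(\<integral>\<^sup>+ s. f \<bar>t - s\<bar> \<partial>lborel) \<le> 2 * (\<integral>\<^sup>+ u. f u * indicator {0..} u \<partial>lborel)"
proof -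
  have "(\<integral>\<^sup>+ s. f \<bar>t - s\<bar> \<partial>lborel) \<le>
      (\<integral>\<^sup>+ s. f (s - t) * indicator {0..} (s - t) + f (t - s) * indicator {0..} (t - s) \<partial>lborel)"
    by (rule nn_integral_mono) (auto simp: indicator_def abs_if)
  also have "\<dots> = (\<integral>\<^sup>+ s. f (s - t) * indicator {0..} (s - t) \<partial>lborel) +
      (\<integral>\<^sup>+ s. f (t - s) * indicator {0..} (t - s) \<partial>lborel)"
    by (rule nn_integral_add) auto
  also have "(\<integral>\<^sup>+ s. f (s - t) * indicator {0..} (s - t) \<partial>lborel) = (\<integral>\<^sup>+ u. f u * indicator {0..} u \<partial>lborel)"
    using nn_integral_real_affine[of "\<lambda>u. f u * indicator {0..} u" 1 "- t"] by simp
  also have "(\<integral>\<^sup>+ s. f (t - s) * indicator {0..} (t - s) \<partial>lborel) = (\<integral>\<^sup>+ u. f u * indicator {0..} u \<partial>lborel)"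
    using nn_integral_real_affine[of "\<lambda>u. f u * indicator {0..} u" "-1" "t"] by simp
  finally show ?thesis by (simp add: mult_2)
qed

lemma nn_integral_near_kernel:
  fixes t R :: real
  assumes R: "R > 0"
  shows "(\<integral>\<^sup>+ s. ennreal (\<bar>t - s\<bar> powr (- 1 / 3)) * indicator {..R} \<bar>t - s\<bar> \<partial>lborel) \<le> ennreal (3 * R powr (2 / 3))"
proof -
  have "((\<lambda>x. x powr (- 1 / 3)) has_integral (R powr (- 1 / 3 + 1) / (- 1 / 3 + 1))) {0..R}"
    using R by (intro has_integral_powr_from_0) auto
  then have "((\<lambda>x. x powr (- 1 / 3)) has_integral (3 / 2 * R powr (2 / 3))) {0..R}" by (simp add: mult.commute)
  then have "(\<integral>\<^sup>+ u. ennreal (u powr (- 1 / 3)) * indicator {0..R} u \<partial>lborel) = ennreal (3 / 2 * R powr (2 / 3))"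
    by (intro nn_integral_has_integral_lebesgue') auto
  moreover have "(\<integral>\<^sup>+ u. ennreal (u powr (- 1 / 3)) * indicator {..R} u * indicator {0..} u \<partial>lborel)
     = (\<integral>\<^sup>+ u. ennreal (u powr (- 1 / 3)) * indicator {0..R} u \<partial>lborel)"
    by (rule nn_integral_cong) (auto simp: indicator_def)
  ultimately have "2 * (\<integral>\<^sup>+ u. ennreal (u powr (- 1 / 3)) * indicator {..R} u * indicator {0..} u \<partial>lborel)
      = ennreal 2 * ennreal (3 / 2 * R powr (2 / 3))" by simp
  also have "\<dots> = ennreal (3 * R powr (2 / 3))" by (subst ennreal_mult[symmetric]) auto
  finally show ?thesis
    using nn_integral_abs_diff_le[of "\<lambda>u. ennreal (u powr (- 1 / 3)) * indicator {..R} u" t] by simp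
qed

text \<open>\<open>1 / (t - s)\<^sup>2\<close> is the sixth power of
  \<open>\<bar>t - s\<bar> powr (- 1 / 3)\<close>, which is what Young's inequality leaves of the
  kernel in the far range.\<close>

lemma nn_integral_far_kernel:
  fixes t R :: real
  assumes R: "R > 0"
  shows "(\<integral>\<^sup>+ s. ennreal (1 / (t - s)\<^sup>2) * indicator {R..} \<bar>t - s\<bar> \<partial>lborel) \<le> ennreal (2 / R)"
proof -
  have "(\<integral>\<^sup>+ u. ennreal (1 / u\<^sup>2) * indicator {R..} u \<partial>lborel) = ennreal (0 - (- 1 / R))"
  proof (rule nn_integral_FTC_atLeast)
    show "((\<lambda>x. - 1 / x) has_real_derivative 1 / x\<^sup>2) (at x)" if "R \<le> x" for x
      using that R by (auto intro!: derivative_eq_intros simp: power2_eq_square)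
    show "((\<lambda>x. - 1 / x :: real) \<longlongrightarrow> 0) at_top" by real_asymp
  qed auto
  moreover have "(\<integral>\<^sup>+ u. ennreal (1 / u\<^sup>2) * indicator {R..} u * indicator {0..} u \<partial>lborel)
     = (\<integral>\<^sup>+ u. ennreal (1 / u\<^sup>2) * indicator {R..} u \<partial>lborel)"
    using R by (intro nn_integral_cong) (auto simp: indicator_def)
  ultimately have "2 * (\<integral>\<^sup>+ u. ennreal (1 / u\<^sup>2) * indicator {R..} u * indicator {0..} u \<partial>lborel)
      = ennreal 2 * ennreal (1 / R)" by simp
  also have "\<dots> = ennreal (2 / R)" using R by (subst ennreal_mult[symmetric]) auto
  finally show ?thesis
    using nn_integral_abs_diff_le[of "\<lambda>u. ennreal (1 / u\<^sup>2) * indicator {R..} u" t] by simp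
qed

text \<open>The part of the double integral where \<open>G s \<le> G t\<close>: the near range \<open>\<bar>t - s\<bar> \<le> R\<close> uses the bound \<open>G s \<le> G t\<close>,
  the far range the elementary inequality \<open>x\<^sup>5 k \<le> \<epsilon> x\<^sup>6 + \<epsilon>\<^sup>-\<^sup>5 k\<^sup>6\<close>;
  \<open>R\<close> and \<open>\<epsilon>\<close> are chosen to balance the three contributions.\<close>

lemma hardy_littlewood_sobolev_inner:
  fixes G :: "real \<Rightarrow> real" and A :: "real set" and t :: real
  defines "N \<equiv> restrict_space lborel A"
  assumes A[measurable]: "A \<in> sets borel" and [measurable]: "G \<in> borel_measurable borel"
    and G0: "\<And>s. 0 \<le> G s" and X: "(\<integral>\<^sup>+ s. ennreal (G s ^ 6) \<partial>N) = ennreal X" "X > 0" and g: "G t > 0"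
  shows "(\<integral>\<^sup>+ s. ennreal (of_bool (G s \<le> G t) * (G s ^ 5 * \<bar>t - s\<bar> powr (- 1 / 3))) \<partial>N) \<le> ennreal (6 * G t * X powr (2 / 3))"
proof -
  define g where "g = G t"
  have g: "g > 0" using g by (simp add: g_def)
  \<comment> \<open>With these values the near range contributes 3 times, the term
    \<open>e * X\<close> once and the far tail twice \<open>g * X powr (2 / 3)\<close>, hence the
    6.\<close>
  define R where "R = X / g ^ 6"
  define e where "e = g * X powr (- 1 / 3)"
  have R: "R > 0" and e: "e > 0" using g X by (auto simp: R_def e_def)
  let ?near = "\<lambda>s. ennreal (\<bar>t - s\<bar> powr (- 1 / 3)) * indicator {..R} \<bar>t - s\<bar>"
  let ?far = "\<lambda>s. ennreal (1 / (t - s)\<^sup>2) * indicator {R..} \<bar>t - s\<bar>"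
  have young: "x ^ 5 * k \<le> e * x ^ 6 + k ^ 6 / e ^ 5" if "x \<ge> 0" "k \<ge> 0" for x k :: real
  proof (cases "k \<le> e * x")
    case True
    then have "x ^ 5 * k \<le> x ^ 5 * (e * x)" using that by (intro mult_left_mono) auto
    also have "\<dots> = e * x ^ 6" by (simp add: eval_nat_numeral)
    finally show ?thesis using that e by (simp add: add_increasing2)
  next
    case False
    then have "(e * x) ^ 5 \<le> k ^ 5" using that e by (intro power_mono) auto
    then have "(e * x) ^ 5 * k \<le> k ^ 5 * k" using that by (intro mult_right_mono) auto
    then have "x ^ 5 * k \<le> k ^ 6 / e ^ 5" using e by (simp add: field_simps power_mult_distrib eval_nat_numeral)
    then show ?thesis using that e by (simp add: add_increasing)
  qed
  have k6: "(\<bar>u\<bar> powr (- 1 / 3)) ^ 6 = 1 / u\<^sup>2" if "u \<noteq> 0" for u :: real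
    using that by (simp add: powr_power powr_minus_divide power_divide)
  have pw: "ennreal (of_bool (G s \<le> G t) * (G s ^ 5 * \<bar>t - s\<bar> powr (- 1 / 3)))
     \<le> ennreal (g ^ 5) * ?near s + (ennreal e * ennreal (G s ^ 6) + ennreal (1 / e ^ 5) * ?far s)" for s
  proof (cases "G s \<le> G t")
    case True
    show ?thesis
    proof (cases "\<bar>t - s\<bar> \<le> R")
      case near: True
      have "G s ^ 5 \<le> g ^ 5" using True G0 by (intro power_mono) (auto simp: g_def)
      then have "ennreal (G s ^ 5 * \<bar>t - s\<bar> powr (- 1 / 3)) \<le> ennreal (g ^ 5) * ennreal (\<bar>t - s\<bar> powr (- 1 / 3))"
        using g by (subst ennreal_mult[symmetric]) (auto intro!: ennreal_leI mult_right_mono)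
      then show ?thesis using True near by (simp add: add_increasing2)
    next
      case far: False
      then have "t - s \<noteq> 0" using R by auto
      from young[OF G0, of "\<bar>t - s\<bar> powr (- 1 / 3)" s] k6[OF this]
      have "G s ^ 5 * \<bar>t - s\<bar> powr (- 1 / 3) \<le> e * G s ^ 6 + 1 / e ^ 5 * (1 / (t - s)\<^sup>2)"
        by (simp add: mult.commute)
      then have "ennreal (G s ^ 5 * \<bar>t - s\<bar> powr (- 1 / 3)) \<le> ennreal e * ennreal (G s ^ 6) + ennreal (1 / e ^ 5) * ennreal (1 / (t - s)\<^sup>2)"
        using e G0[of s] by (simp flip: ennreal_mult ennreal_plus)
      then show ?thesis using True far by (simp add: add_increasing)
    qed
  qed simp
  have "(\<integral>\<^sup>+ s. ennreal (of_bool (G s \<le> G t) * (G s ^ 5 * \<bar>t - s\<bar> powr (- 1 / 3))) \<partial>N)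
     \<le> (\<integral>\<^sup>+ s. ennreal (g ^ 5) * ?near s + (ennreal e * ennreal (G s ^ 6) + ennreal (1 / e ^ 5) * ?far s) \<partial>N)"
    by (rule nn_integral_mono) (rule pw)
  also have "\<dots> = ennreal (g ^ 5) * (\<integral>\<^sup>+ s. ?near s \<partial>N) + (ennreal e * (\<integral>\<^sup>+ s. ennreal (G s ^ 6) \<partial>N) + ennreal (1 / e ^ 5) * (\<integral>\<^sup>+ s. ?far s \<partial>N))"
  proof -
    have *[measurable]: "f \<in> borel_measurable borel \<Longrightarrow> f \<in> borel_measurable N" for f :: "real \<Rightarrow> ennreal"
      unfolding N_def by (intro measurable_restrict_space1) simp
    have m: "?near \<in> borel_measurable N" "?far \<in> borel_measurable N" "(\<lambda>s. ennreal (G s ^ 6)) \<in> borel_measurable N"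
      by (intro *; measurable)+
    show ?thesis using m by (simp add: nn_integral_add nn_integral_cmult)
  qed
  also have "\<dots> \<le> ennreal (g ^ 5) * ennreal (3 * R powr (2 / 3)) + (ennreal e * ennreal X + ennreal (1 / e ^ 5) * ennreal (2 / R))"
  proof (intro add_mono mult_left_mono)
    have le: "(\<integral>\<^sup>+ s. f s \<partial>N) \<le> (\<integral>\<^sup>+ s. f s \<partial>lborel)" for f :: "real \<Rightarrow> ennreal"
      unfolding N_def by (subst nn_integral_restrict_space) (auto intro!: nn_integral_mono simp: indicator_def)
    show "(\<integral>\<^sup>+ s. ?near s \<partial>N) \<le> ennreal (3 * R powr (2 / 3))"
      using le nn_integral_near_kernel[OF R] by (rule order_trans)
    show "(\<integral>\<^sup>+ s. ?far s \<partial>N) \<le> ennreal (2 / R)"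
      using le nn_integral_far_kernel[OF R] by (rule order_trans)
  qed (use X in auto)
  also have "\<dots> = ennreal (g ^ 5 * (3 * R powr (2 / 3)) + (e * X + 1 / e ^ 5 * (2 / R)))"
    using g e R X by (simp flip: ennreal_mult ennreal_plus)
  also have "g ^ 5 * (3 * R powr (2 / 3)) + (e * X + 1 / e ^ 5 * (2 / R)) = 6 * g * X powr (2 / 3)"
  proof -
    define z where "z = X powr (1 / 3)"
    have z: "z > 0" using X by (simp add: z_def)
    have Xz: "X = z ^ 3" using X by (simp add: z_def powr_power)
    have X2: "X powr (2 / 3) = z ^ 2" using X by (simp add: z_def powr_power)
    have ez: "e = g / z" by (simp add: e_def z_def powr_minus_divide)
    have "R powr (2 / 3) = X powr (2 / 3) / (g ^ 6) powr (2 / 3)" using X g by (simp add: R_def powr_divide)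
    also have "(g ^ 6) powr (2 / 3) = g ^ 4"
      using g powr_powr[of g 6 "2/3"] by simp
    finally have R2: "R powr (2 / 3) = z ^ 2 / g ^ 4" by (simp add: X2)
    have "1 / e ^ 5 * (2 / R) = 2 * g * z ^ 2"
      unfolding ez R_def Xz using g z by (simp add: field_simps eval_nat_numeral)
    moreover have "e * X = g * z ^ 2" unfolding ez Xz using z by (simp add: field_simps eval_nat_numeral)
    moreover have "g ^ 5 * (3 * R powr (2 / 3)) = 3 * g * z ^ 2"
      unfolding R2 using g by (simp add: field_simps eval_nat_numeral)
    ultimately show ?thesis by (simp add: X2)
  qed
  finally show ?thesis by (simp add: g_def)
qed

text \<open>The diagonal case of the Hardy-Littlewood-Sobolev inequality for \<open>G ^ 5\<close>,
  whose squared norm in L^(6/5) is \<open>X powr (5 / 3)\<close>. The kernel is symmetric, so twice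
  the half with \<open>G s \<le> G t\<close> suffices, and there the inner integral times
  \<open>G t ^ 5\<close> is at most \<open>6 * X powr (2 / 3) * G t ^ 6\<close>.\<close>

lemma hardy_littlewood_sobolev_diagonal:
  fixes G :: "real \<Rightarrow> real" and A :: "real set"
  defines "N \<equiv> restrict_space lborel A"
  assumes A[measurable]: "A \<in> sets borel" and [measurable]: "G \<in> borel_measurable borel"
    and G0: "\<And>s. 0 \<le> G s" and X: "(\<integral>\<^sup>+ s. ennreal (G s ^ 6) \<partial>N) = ennreal X" "X > 0"
  shows "(\<integral>\<^sup>+ t. \<integral>\<^sup>+ s. ennreal (G t ^ 5 * G s ^ 5 * \<bar>t - s\<bar> powr (- 1 / 3)) \<partial>N \<partial>N) \<le> ennreal (12 * X powr (5 / 3))"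
proof -
  have sf: "sigma_finite_measure N" unfolding N_def
    by (rule sigma_finite_measure_restrict_space) (auto intro: sigma_finite_lborel)
  interpret sigma_finite_measure N by (rule sf)
  interpret pair_sigma_finite N N ..
  have idN[measurable]: "(\<lambda>x. x) \<in> borel_measurable N" unfolding N_def by (intro measurable_restrict_space1) simp
  have GN[measurable]: "G \<in> borel_measurable N" unfolding N_def by (intro measurable_restrict_space1) simp
  let ?k = "\<lambda>t s. of_bool (G s \<le> G t) * (G s ^ 5 * \<bar>t - s\<bar> powr (- 1 / 3))"
  let ?h = "\<lambda>t s. ennreal (G t ^ 5) * ennreal (?k t s)"
  have hm[measurable]: "(\<lambda>(t, s). ?h t s) \<in> borel_measurable (N \<Otimes>\<^sub>M N)"
    by (simp add: split_beta') measurable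
  have inner: "(\<integral>\<^sup>+ s. ?h t s \<partial>N) \<le> ennreal (6 * X powr (2 / 3)) * ennreal (G t ^ 6)" for t
  proof (cases "G t = 0")
    case False
    then have g: "G t > 0" using G0[of t] by simp
    have "(\<integral>\<^sup>+ s. ?h t s \<partial>N) = ennreal (G t ^ 5) * (\<integral>\<^sup>+ s. ennreal (?k t s) \<partial>N)"
      by (rule nn_integral_cmult) measurable
    also have "\<dots> \<le> ennreal (G t ^ 5) * ennreal (6 * G t * X powr (2 / 3))"
      unfolding N_def
      by (intro mult_left_mono hardy_littlewood_sobolev_inner A G0 X[unfolded N_def] g) (auto)
    also have "\<dots> = ennreal (6 * X powr (2 / 3)) * ennreal (G t ^ 6)"
      using g by (simp flip: ennreal_mult) (simp add: eval_nat_numeral mult_ac)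
    finally show ?thesis .
  qed simp
  have "(\<integral>\<^sup>+ t. \<integral>\<^sup>+ s. ennreal (G t ^ 5 * G s ^ 5 * \<bar>t - s\<bar> powr (- 1 / 3)) \<partial>N \<partial>N)
     \<le> (\<integral>\<^sup>+ t. \<integral>\<^sup>+ s. ?h t s + ?h s t \<partial>N \<partial>N)"
  proof (intro nn_integral_mono)
    fix t s
    show "ennreal (G t ^ 5 * G s ^ 5 * \<bar>t - s\<bar> powr (- 1 / 3)) \<le> ?h t s + ?h s t"
    proof (cases "G s \<le> G t")
      case True
      then have "?h t s = ennreal (G t ^ 5 * G s ^ 5 * \<bar>t - s\<bar> powr (- 1 / 3))"
        using G0 by (simp add: mult.assoc flip: ennreal_mult)
      then show ?thesis by (simp add: add_increasing2)
    next
      case False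
      then have "?h s t = ennreal (G t ^ 5 * G s ^ 5 * \<bar>t - s\<bar> powr (- 1 / 3))"
        using G0 by (simp add: mult_ac abs_minus_commute flip: ennreal_mult)
      then show ?thesis by (simp add: add_increasing)
    qed
  qed
  also have "\<dots> = (\<integral>\<^sup>+ t. (\<integral>\<^sup>+ s. ?h t s \<partial>N) + (\<integral>\<^sup>+ s. ?h s t \<partial>N) \<partial>N)"
    by (intro nn_integral_cong nn_integral_add) measurable
  also have "\<dots> = (\<integral>\<^sup>+ t. \<integral>\<^sup>+ s. ?h t s \<partial>N \<partial>N) + (\<integral>\<^sup>+ t. \<integral>\<^sup>+ s. ?h s t \<partial>N \<partial>N)"
    by (rule nn_integral_add) measurable
  also have "(\<integral>\<^sup>+ t. \<integral>\<^sup>+ s. ?h s t \<partial>N \<partial>N) = (\<integral>\<^sup>+ t. \<integral>\<^sup>+ s. ?h t s \<partial>N \<partial>N)"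
    using Fubini'[OF hm] by simp
  also have "(\<integral>\<^sup>+ t. \<integral>\<^sup>+ s. ?h t s \<partial>N \<partial>N) + (\<integral>\<^sup>+ t. \<integral>\<^sup>+ s. ?h t s \<partial>N \<partial>N) \<le>
      2 * (\<integral>\<^sup>+ t. ennreal (6 * X powr (2 / 3)) * ennreal (G t ^ 6) \<partial>N)"
    unfolding mult_2[symmetric] by (intro mult_left_mono nn_integral_mono inner) auto
  also have "(\<integral>\<^sup>+ t. ennreal (6 * X powr (2 / 3)) * ennreal (G t ^ 6) \<partial>N) = ennreal (6 * X powr (2 / 3)) * ennreal X"
    by (subst nn_integral_cmult) (auto simp: X)
  also have "2 * (ennreal (6 * X powr (2 / 3)) * ennreal X) = ennreal 2 * (ennreal (6 * X powr (2 / 3)) * ennreal X)" by simp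
  also have "\<dots> = ennreal (2 * (6 * X powr (2 / 3) * X))"
    using X by (subst (1 2) ennreal_mult) auto
  also have "2 * (6 * X powr (2 / 3) * X) = 12 * X powr (5 / 3)"
    using X powr_add[of X "2/3" 1] by simp
  finally show ?thesis .
qed


section \<open>Duality argument for a supremum of oscillatory integrals\<close>

lemma borel_measurable_cis [measurable]: "cis \<in> borel_measurable borel"
  unfolding cis_conv_exp[abs_def] by (intro borel_measurable_continuous_onI continuous_intros)

lemma borel_measurable_cnj [measurable]: "cnj \<in> borel_measurable borel"
  by (intro borel_measurable_continuous_onI continuous_intros)

lemma (in finite_measure) norm_integral_le_const:
  fixes h :: "'a \<Rightarrow> complex"
  assumes [measurable]: "h \<in> borel_measurable M" and b: "\<And>x. x \<in> space M \<Longrightarrow> norm (h x) \<le> B"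
  shows "norm (\<integral>x. h x \<partial>M) \<le> B * measure M (space M)"
proof -
  have i: "integrable M h" by (rule integrable_const_bound[where B = B]) (auto simp: b)
  have "norm (\<integral>x. h x \<partial>M) \<le> (\<integral>x. norm (h x) \<partial>M)" by (rule integral_norm_bound)
  also have "\<dots> \<le> (\<integral>x. B \<partial>M)" using i b by (intro integral_mono) auto
  finally show ?thesis by (simp add: mult.commute)
qed

text \<open>By Young's inequality with a free parameter no square root of the quadratic form is needed.\<close>

lemma tt_star_truncated:
  fixes \<Lambda> :: "'a \<Rightarrow> real" and g :: "nat \<Rightarrow> 'a \<Rightarrow> complex" and f :: "'a \<Rightarrow> complex"
    and W :: "nat \<Rightarrow> real \<Rightarrow> complex" and S C :: real and n :: nat
  assumes M: "finite_measure M"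
    and [measurable]: "\<Lambda> \<in> borel_measurable M" "\<And>i. g i \<in> borel_measurable M" "f \<in> borel_measurable M"
    and gb: "\<And>i x. x \<in> space M \<Longrightarrow> norm (g i x) \<le> 1" and fb: "\<And>x. x \<in> space M \<Longrightarrow> norm (f x) \<le> B"
    and W: "\<And>i t. W i t = (\<integral>x. cis (t * \<Lambda> x) * g i x * f x \<partial>M)"
    and C: "C > 0"
    and ker: "\<And>i j \<tau>. \<tau> \<noteq> 0 \<Longrightarrow> norm (\<integral>x. cis (\<tau> * \<Lambda> x) * g i x * cnj (g j x) \<partial>M) \<le> C * \<bar>\<tau>\<bar> powr (- 1 / 3)"
    and n: "n > 0"
  shows "(\<integral>\<^sup>+ t. ennreal (Max ((\<lambda>i. norm (W i t)) ` {..<n}) ^ 6) * indicator {-S..S} t \<partial>lborel)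
     \<le> ennreal ((12 * C * (\<integral>x. (norm (f x))\<^sup>2 \<partial>M)) ^ 3)"
proof -
  interpret M: finite_measure M by (rule M)
  \<comment> \<open>On a bounded time interval the bounded function \<open>G\<close> has a finite
    sixth moment \<open>X\<close>, so that a power of \<open>X\<close> can be cancelled at the
    end.\<close>
  define N where "N = restrict_space lborel {-S..S::real}"
  have setN[measurable]: "{-S..S} \<in> sets borel" by simp
  interpret N: finite_measure N unfolding N_def
    by (rule finite_measureI) (auto simp: space_restrict_space emeasure_restrict_space emeasure_lborel_Icc_eq)
  interpret NM: pair_sigma_finite N M ..
  interpret NN: pair_sigma_finite N N ..
  have BN: "f \<in> borel_measurable borel \<Longrightarrow> f \<in> borel_measurable N" for f :: "real \<Rightarrow> 'b::topological_space"
    unfolding N_def by (intro measurable_restrict_space1) simp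
  have idN: "(\<lambda>x. x) \<in> borel_measurable N" by (rule BN) simp
  have fstN: "(\<lambda>p. fst p) \<in> borel_measurable (N \<Otimes>\<^sub>M M)"
    by (rule measurable_compose[OF measurable_fst idN])
  have B0: "B \<ge> 0 \<or> space M = {}" using fb norm_ge_zero order_trans by blast
  have Wm[measurable]: "W i \<in> borel_measurable borel" for i
    unfolding W by (subst measurable_lborel2[symmetric], rule M.borel_measurable_lebesgue_integral) measurable
  define G where "G t = Max ((\<lambda>i. norm (W i t)) ` {..<n})" for t
  have Gm[measurable]: "G \<in> borel_measurable borel"
    unfolding G_def[abs_def] using n by (intro borel_measurable_Max) auto
  have G_ge: "norm (W i t) \<le> G t" if "i < n" for i t unfolding G_def using that by (intro Max_ge) auto
  have G0: "G t \<ge> 0" for t using G_ge[OF n, of t] norm_ge_zero order_trans by blast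
  \<comment> \<open>A selected index linearises the maximum; taking the least one makes the
    selection measurable in time.\<close>
  define J where "J t = (LEAST i. i < n \<and> norm (W i t) = G t)" for t
  have J: "J t < n" "norm (W (J t) t) = G t" for t
  proof -
    have "G t \<in> (\<lambda>i. norm (W i t)) ` {..<n}" unfolding G_def using n by (intro Max_in) auto
    then have "\<exists>i. i < n \<and> norm (W i t) = G t" by auto
    then have "J t < n \<and> norm (W (J t) t) = G t" unfolding J_def by (rule LeastI_ex)
    then show "J t < n" "norm (W (J t) t) = G t" by auto
  qed
  have Jm0: "J \<in> measurable borel (count_space UNIV)"
    unfolding J_def[abs_def] by (rule measurable_Least) measurable
  have Jm[measurable]: "J \<in> measurable N (count_space UNIV)"
    unfolding N_def using Jm0 by (intro measurable_restrict_space1) simp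
  have GNm[measurable]: "G \<in> borel_measurable N" "W i \<in> borel_measurable N" for i by (rule BN; measurable)+
  define BG where "BG = B * measure M (space M)"
  have Wb: "norm (W i t) \<le> BG" for i t
    unfolding W BG_def
  proof (rule M.norm_integral_le_const)
    show "norm (cis (t * \<Lambda> x) * g i x * f x) \<le> B" if "x \<in> space M" for x
      using mult_mono[OF gb[OF that, of i] fb[OF that]] by (simp add: norm_mult)
  qed measurable
  have GB: "G t \<le> BG" for t using Wb[of "J t" t] J[of t] by simp
  have BG0: "BG \<ge> 0" using GB G0 order_trans by blast
  \<comment> \<open>\<open>G t ^ 5\<close> times a phase is extremal in the duality of L^6 with
    L^(6/5): integrating \<open>\<Phi> t x * f x\<close> over \<open>x\<close> gives
    \<open>G t ^ 5 * norm (W (J t) t) = G t ^ 6\<close>.\<close>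
  define \<Phi> where "\<Phi> t x = complex_of_real (G t ^ 5) * cnj (sgn (W (J t) t)) * (cis (t * \<Lambda> x) * g (J t) x)" for t x
  have sgnWm[measurable]: "(\<lambda>t. W (J t) t) \<in> borel_measurable N"
    by (rule measurable_compose_countable[OF _ Jm]) measurable
  have gJm[measurable]: "(\<lambda>p. g (J (fst p)) (snd p)) \<in> borel_measurable (N \<Otimes>\<^sub>M M)"
    by (rule measurable_compose_countable[where f = "\<lambda>i p. g i (snd p)"]) measurable
  have sgn_eq: "sgn z = z / of_real (norm z)" for z :: complex by (simp add: sgn_div_norm scaleR_conv_of_real divide_inverse mult.commute)
  have \<Phi>m[measurable]: "(\<lambda>(t, x). \<Phi> t x) \<in> borel_measurable (N \<Otimes>\<^sub>M M)"
  proof -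
    have [measurable]: "(\<lambda>p. cis (fst p * \<Lambda> (snd p))) \<in> borel_measurable (N \<Otimes>\<^sub>M M)"
      by (rule measurable_compose[OF borel_measurable_times[OF fstN] borel_measurable_cis]) measurable
    have [measurable]: "(\<lambda>p. complex_of_real (G (fst p) ^ 5)) \<in> borel_measurable (N \<Otimes>\<^sub>M M)"
      by (rule measurable_compose[OF measurable_fst]) measurable
    have "(\<lambda>t. cnj (W (J t) t / complex_of_real (norm (W (J t) t)))) \<in> borel_measurable N" by measurable
    then have [measurable]: "(\<lambda>p. cnj (W (J (fst p)) (fst p) / complex_of_real (norm (W (J (fst p)) (fst p))))) \<in> borel_measurable (N \<Otimes>\<^sub>M M)"
      by (rule measurable_compose[OF measurable_fst])
    show ?thesis unfolding \<Phi>_def split_beta' sgn_eq by measurable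
  qed
  have sg: "norm (sgn z) \<le> 1" for z :: complex by (simp add: norm_sgn)
  have \<Phi>b: "norm (\<Phi> t x) \<le> G t ^ 5" if "x \<in> space M" for t x
  proof -
    have "norm (\<Phi> t x) = G t ^ 5 * (norm (sgn (W (J t) t)) * norm (g (J t) x))"
      using G0[of t] by (simp add: \<Phi>_def norm_mult norm_power)
    also have "\<dots> \<le> G t ^ 5 * (1 * 1)" using gb[OF that] sg G0[of t] by (intro mult_left_mono mult_mono) auto
    finally show ?thesis by simp
  qed
  have G5: "G t ^ 5 \<le> BG ^ 5" for t using GB G0 by (intro power_mono)
  have \<Phi>b': "norm (\<Phi> t x) \<le> BG ^ 5" if "x \<in> space M" for t x using \<Phi>b[OF that, of t] G5[of t] by linarith
  \<comment> \<open>The adjoint operator applied to the extremal function; \<open>A\<close> below is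
    the square of its L2 norm.\<close>
  define P where "P x = (\<integral>t. \<Phi> t x \<partial>N)" for x
  have Pm[measurable]: "P \<in> borel_measurable M"
    unfolding P_def[abs_def] by (rule N.borel_measurable_lebesgue_integral) measurable
  have \<Phi>it: "integrable N (\<lambda>t. \<Phi> t x)" if "x \<in> space M" for x
  proof (rule N.integrable_const_bound[where B = "BG ^ 5"])
    show "(\<lambda>t. \<Phi> t x) \<in> borel_measurable N" using \<Phi>m that by measurable
  qed (use \<Phi>b' that in auto)
  have Pb: "norm (P x) \<le> BG ^ 5 * measure N (space N)" if "x \<in> space M" for x
    unfolding P_def
  proof (rule N.norm_integral_le_const)
    show "(\<lambda>t. \<Phi> t x) \<in> borel_measurable N" using \<Phi>it[OF that] by (rule borel_measurable_integrable)
  qed (use \<Phi>b' that in auto)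
  define X where "X = (\<integral>t. G t ^ 6 \<partial>N)"
  have G6i: "integrable N (\<lambda>t. G t ^ 6)"
    by (rule N.integrable_const_bound[where B = "BG ^ 6"]) (use G0 GB in \<open>auto intro!: power_mono\<close>)
  have X0: "X \<ge> 0" unfolding X_def by (rule integral_nonneg_AE) auto
  have XN: "(\<integral>\<^sup>+ t. ennreal (G t ^ 6) \<partial>N) = ennreal X"
    unfolding X_def by (rule nn_integral_eq_integral[OF G6i]) auto
  have XL: "(\<integral>\<^sup>+ t. ennreal (G t ^ 6) * indicator {-S..S} t \<partial>lborel) = ennreal X"
    using XN unfolding N_def by (subst (asm) nn_integral_restrict_space) auto
  define F where "F = (\<integral>x. (norm (f x))\<^sup>2 \<partial>M)"
  have f2i: "integrable M (\<lambda>x. (norm (f x))\<^sup>2)"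
    by (rule M.integrable_const_bound[where B = "B ^ 2"]) (use fb in \<open>auto intro!: power_mono\<close>)
  have F0: "F \<ge> 0" unfolding F_def by (rule integral_nonneg_AE) auto
  have pairing: "complex_of_real X = (\<integral>x. P x * f x \<partial>M)"
  proof -
    have int: "integrable (N \<Otimes>\<^sub>M M) (\<lambda>(t, x). \<Phi> t x * f x)"
    proof -
      interpret P: finite_measure "N \<Otimes>\<^sub>M M" by (rule finite_measure_pair_measure) unfold_locales
      show ?thesis
      proof (rule P.integrable_const_bound[where B = "BG ^ 5 * B"])
        show "AE p in N \<Otimes>\<^sub>M M. norm (case p of (t, x) \<Rightarrow> \<Phi> t x * f x) \<le> BG ^ 5 * B"
        proof (rule AE_I2)
          fix p assume "p \<in> space (N \<Otimes>\<^sub>M M)"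
          then have "snd p \<in> space M" by (auto simp: space_pair_measure)
          then show "norm (case p of (t, x) \<Rightarrow> \<Phi> t x * f x) \<le> BG ^ 5 * B"
            using mult_mono[OF \<Phi>b'[of "snd p" "fst p"] fb[of "snd p"]] BG0 by (simp add: split_beta norm_mult)
        qed
      qed (use \<Phi>m in measurable)
    qed
    have "(\<integral>x. P x * f x \<partial>M) = (\<integral>x. \<integral>t. \<Phi> t x * f x \<partial>N \<partial>M)" by (simp add: P_def)
    also have "\<dots> = (\<integral>t. \<integral>x. \<Phi> t x * f x \<partial>M \<partial>N)" by (rule NM.Fubini_integral[OF int])
    also have "\<dots> = (\<integral>t. complex_of_real (G t ^ 6) \<partial>N)"
    proof (rule Bochner_Integration.integral_cong[OF refl])
      fix t
      have "(\<integral>x. \<Phi> t x * f x \<partial>M) = complex_of_real (G t ^ 5) * cnj (sgn (W (J t) t)) * W (J t) t"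
        unfolding W \<Phi>_def by (simp add: mult.assoc)
      also have "\<dots> = complex_of_real (G t ^ 5) * complex_of_real (norm (W (J t) t))"
        by (cases "W (J t) t = 0") (simp_all add: sgn_eq mult.assoc complex_norm_square[symmetric] mult.commute[of "cnj _"] power2_eq_square)
      also have "\<dots> = complex_of_real (G t ^ 6)" by (simp add: J eval_nat_numeral)
      finally show "(\<integral>x. \<Phi> t x * f x \<partial>M) = complex_of_real (G t ^ 6)" .
    qed
    also have "\<dots> = complex_of_real X" unfolding X_def by (rule integral_complex_of_real)
    finally show ?thesis by simp
  qed
  define A where "A = (\<integral>x. (norm (P x))\<^sup>2 \<partial>M)"
  have P2i: "integrable M (\<lambda>x. (norm (P x))\<^sup>2)"
    by (rule M.integrable_const_bound[where B = "(BG ^ 5 * measure N (space N)) ^ 2"]) (use Pb in \<open>auto intro!: power_mono\<close>)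
  have A0: "A \<ge> 0" unfolding A_def by (rule integral_nonneg_AE) auto
  \<comment> \<open>The operator meets its adjoint here: the square of \<open>P\<close> expands into
    a double time integral whose inner integral over \<open>x\<close> is the kernel bounded in
    \<open>ker\<close>, uniformly in the two selected indices.\<close>
  have Abound: "ennreal A \<le> ennreal C * (\<integral>\<^sup>+ t. \<integral>\<^sup>+ s. ennreal (G t ^ 5 * G s ^ 5 * \<bar>t - s\<bar> powr (- 1 / 3)) \<partial>N \<partial>N)"
  proof -
    let ?BP = "BG ^ 5 * measure N (space N)"
    interpret PM: finite_measure "N \<Otimes>\<^sub>M M" by (rule finite_measure_pair_measure) unfold_locales
    have BP0: "?BP \<ge> 0" using BG0 by simp
    have int1: "integrable (N \<Otimes>\<^sub>M M) (\<lambda>(t, x). \<Phi> t x * cnj (P x))"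
    proof (rule PM.integrable_const_bound[where B = "BG ^ 5 * ?BP"])
      show "AE p in N \<Otimes>\<^sub>M M. norm (case p of (t, x) \<Rightarrow> \<Phi> t x * cnj (P x)) \<le> BG ^ 5 * ?BP"
      proof (rule AE_I2)
        fix p assume "p \<in> space (N \<Otimes>\<^sub>M M)"
        then have "snd p \<in> space M" by (auto simp: space_pair_measure)
        then show "norm (case p of (t, x) \<Rightarrow> \<Phi> t x * cnj (P x)) \<le> BG ^ 5 * ?BP"
          using mult_mono[OF \<Phi>b'[of "snd p" "fst p"] Pb[of "snd p"]] BG0 by (simp add: split_beta norm_mult)
      qed
    qed (use \<Phi>m in measurable)
    have \<Phi>tm[measurable]: "(\<lambda>x. \<Phi> t x) \<in> borel_measurable M" for t
      unfolding \<Phi>_def by measurable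
    have int2: "integrable (N \<Otimes>\<^sub>M M) (\<lambda>(s, x). \<Phi> t x * cnj (\<Phi> s x))" for t
    proof (rule PM.integrable_const_bound[where B = "BG ^ 5 * BG ^ 5"])
      show "AE p in N \<Otimes>\<^sub>M M. norm (case p of (s, x) \<Rightarrow> \<Phi> t x * cnj (\<Phi> s x)) \<le> BG ^ 5 * BG ^ 5"
      proof (rule AE_I2)
        fix p assume "p \<in> space (N \<Otimes>\<^sub>M M)"
        then have "snd p \<in> space M" by (auto simp: space_pair_measure)
        then show "norm (case p of (s, x) \<Rightarrow> \<Phi> t x * cnj (\<Phi> s x)) \<le> BG ^ 5 * BG ^ 5"
          using mult_mono[OF \<Phi>b'[of "snd p" t] \<Phi>b'[of "snd p" "fst p"]] BG0 by (simp add: split_beta norm_mult)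
      qed
    qed (use \<Phi>m in measurable)
    have "complex_of_real A = (\<integral>x. P x * cnj (P x) \<partial>M)"
      unfolding A_def by (simp add: complex_norm_square[symmetric] flip: integral_complex_of_real)
    also have "\<dots> = (\<integral>x. \<integral>t. \<Phi> t x * cnj (P x) \<partial>N \<partial>M)" by (simp add: P_def)
    also have "\<dots> = (\<integral>t. \<integral>x. \<Phi> t x * cnj (P x) \<partial>M \<partial>N)" by (rule NM.Fubini_integral[OF int1])
    also have "\<dots> = (\<integral>t. \<integral>x. \<integral>s. \<Phi> t x * cnj (\<Phi> s x) \<partial>N \<partial>M \<partial>N)" by (simp add: P_def)
    also have "\<dots> = (\<integral>t. \<integral>s. \<integral>x. \<Phi> t x * cnj (\<Phi> s x) \<partial>M \<partial>N \<partial>N)"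
      by (intro Bochner_Integration.integral_cong refl NM.Fubini_integral[OF int2])
    finally have Aeq: "complex_of_real A = (\<integral>t. \<integral>s. \<integral>x. \<Phi> t x * cnj (\<Phi> s x) \<partial>M \<partial>N \<partial>N)" .
    have norm_int: "ennreal (norm (\<integral>y. h y \<partial>L)) \<le> (\<integral>\<^sup>+ y. ennreal (norm (h y)) \<partial>L)" for h :: "real \<Rightarrow> complex" and L
      by (cases "integrable L h") (auto intro: integral_norm_bound_ennreal simp: not_integrable_integral_eq)
    have "ennreal A = ennreal (norm (complex_of_real A))" using A0 by simp
    also have "\<dots> \<le> (\<integral>\<^sup>+ t. ennreal (norm (\<integral>s. \<integral>x. \<Phi> t x * cnj (\<Phi> s x) \<partial>M \<partial>N)) \<partial>N)"
      unfolding Aeq by (rule norm_int)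
    also have "\<dots> \<le> (\<integral>\<^sup>+ t. \<integral>\<^sup>+ s. ennreal (norm (\<integral>x. \<Phi> t x * cnj (\<Phi> s x) \<partial>M)) \<partial>N \<partial>N)"
      by (intro nn_integral_mono norm_int)
    also have "\<dots> \<le> (\<integral>\<^sup>+ t. \<integral>\<^sup>+ s. ennreal C * ennreal (G t ^ 5 * G s ^ 5 * \<bar>t - s\<bar> powr (- 1 / 3)) \<partial>N \<partial>N)"
    \<comment> \<open>The hypothesis \<open>ker\<close> excludes \<open>\<tau> = 0\<close>; the
      diagonal \<open>s = t\<close> is a null set.\<close>
    proof (rule nn_integral_mono, rule nn_integral_mono_AE)
      fix t :: real
      have "AE s in lborel. s \<noteq> t" by (rule AE_lborel_singleton)
      then have "AE s in N. s \<noteq> t" unfolding N_def by (subst AE_restrict_space_iff) auto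
      then show "AE s in N. ennreal (norm (\<integral>x. \<Phi> t x * cnj (\<Phi> s x) \<partial>M)) \<le> ennreal C * ennreal (G t ^ 5 * G s ^ 5 * \<bar>t - s\<bar> powr (- 1 / 3))"
      proof eventually_elim
        fix s assume st: "s \<noteq> t"
        have cc: "cis (t * \<Lambda> x) * cnj (cis (s * \<Lambda> x)) = cis ((t - s) * \<Lambda> x)" for x
          by (simp add: cis_cnj cis_mult left_diff_distrib)
        have e: "\<Phi> t x * cnj (\<Phi> s x) = (complex_of_real (G t ^ 5) * cnj (sgn (W (J t) t)) * (complex_of_real (G s ^ 5) * sgn (W (J s) s)))
            * (cis ((t - s) * \<Lambda> x) * g (J t) x * cnj (g (J s) x))" for x
          unfolding \<Phi>_def cc[symmetric] by (simp add: mult_ac)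
        have "norm (\<integral>x. \<Phi> t x * cnj (\<Phi> s x) \<partial>M) = G t ^ 5 * G s ^ 5 * (norm (sgn (W (J t) t)) * norm (sgn (W (J s) s)) * norm (\<integral>x. cis ((t - s) * \<Lambda> x) * g (J t) x * cnj (g (J s) x) \<partial>M))"
          unfolding e integral_mult_right_zero using G0[of t] G0[of s] by (simp add: norm_mult norm_power)
        also have "\<dots> \<le> G t ^ 5 * G s ^ 5 * (1 * 1 * (C * \<bar>t - s\<bar> powr (- 1 / 3)))"
          using ker[of "t - s" "J t" "J s"] st sg G0[of t] G0[of s] C by (intro mult_left_mono mult_mono) auto
        finally show "ennreal (norm (\<integral>x. \<Phi> t x * cnj (\<Phi> s x) \<partial>M)) \<le> ennreal C * ennreal (G t ^ 5 * G s ^ 5 * \<bar>t - s\<bar> powr (- 1 / 3))"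
          using C G0 by (simp add: mult_ac flip: ennreal_mult)
      qed
    qed
    also have "\<dots> = ennreal C * (\<integral>\<^sup>+ t. \<integral>\<^sup>+ s. ennreal (G t ^ 5 * G s ^ 5 * \<bar>t - s\<bar> powr (- 1 / 3)) \<partial>N \<partial>N)"
    proof -
      note idN[measurable]
      let ?k = "\<lambda>t s. ennreal (G t ^ 5 * G s ^ 5 * \<bar>t - s\<bar> powr (- 1 / 3))"
      have "(\<lambda>t. \<integral>\<^sup>+ s. ?k t s \<partial>N) \<in> borel_measurable N" by measurable
      moreover have "?k t \<in> borel_measurable N" for t by measurable
      ultimately show ?thesis by (simp add: nn_integral_cmult)
    qed
    finally show ?thesis .
  qed
  have "X \<le> (12 * C * F) ^ 3"
  proof (cases "X = 0")
    case False
    then have X: "X > 0" using X0 by simp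
    have "(\<integral>\<^sup>+ t. \<integral>\<^sup>+ s. ennreal (G t ^ 5 * G s ^ 5 * \<bar>t - s\<bar> powr (- 1 / 3)) \<partial>N \<partial>N) \<le> ennreal (12 * X powr (5 / 3))"
      unfolding N_def by (rule hardy_littlewood_sobolev_diagonal) (use X G0 XN in \<open>auto simp: N_def\<close>)
    then have "ennreal A \<le> ennreal C * ennreal (12 * X powr (5 / 3))"
      using Abound by (meson mult_left_mono order_trans zero_le)
    then have A1: "A \<le> 12 * C * X powr (5 / 3)"
      using C by (simp add: mult_ac flip: ennreal_mult)
    \<comment> \<open>This weight makes \<open>l * A \<le> X\<close>, so one of the two copies of
      \<open>X\<close> on the left absorbs it, and \<open>X \<le> F / l\<close> remains.\<close>
    define l where "l = X powr (- 2 / 3) / (12 * C)"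
    have l: "l > 0" using X C by (simp add: l_def)
    have "l * A \<le> l * (12 * C * X powr (5 / 3))" using A1 l by (intro mult_left_mono) auto
    also have "\<dots> = X powr (- 2 / 3) * X powr (5 / 3)" using C by (simp add: l_def)
    also have "\<dots> = X" using X by (simp add: powr_add[symmetric])
    finally have lA: "l * A \<le> X" .
    have "2 * X = 2 * norm (\<integral>x. P x * f x \<partial>M)" using pairing[symmetric] X by simp
    also have "\<dots> \<le> 2 * (\<integral>x. norm (P x * f x) \<partial>M)" by (simp add: integral_norm_bound)
    also have "\<dots> = (\<integral>x. 2 * norm (P x * f x) \<partial>M)" by simp
    also have "\<dots> \<le> (\<integral>x. l * (norm (P x))\<^sup>2 + (norm (f x))\<^sup>2 / l \<partial>M)"
    proof (rule integral_mono')
      show "integrable M (\<lambda>x. l * (norm (P x))\<^sup>2 + (norm (f x))\<^sup>2 / l)" using P2i f2i by auto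
      show "2 * norm (P x * f x) \<le> l * (norm (P x))\<^sup>2 + (norm (f x))\<^sup>2 / l" for x
      proof -
        have "0 \<le> (l * norm (P x) - norm (f x))\<^sup>2 / l" using l by simp
        also have "\<dots> = l * (norm (P x))\<^sup>2 + (norm (f x))\<^sup>2 / l - 2 * norm (P x * f x)"
          using l by (simp add: field_simps power2_eq_square norm_mult)
        finally show ?thesis by simp
      qed
    qed (use l in auto)
    also have "\<dots> = l * A + F / l" using P2i f2i by (simp add: A_def F_def)
    finally have "X \<le> F / l" using lA by simp
    also have "\<dots> = 12 * C * F * X powr (2 / 3)" using X C by (simp add: l_def powr_minus_divide)
    finally have "X powr (1 / 3) * X powr (2 / 3) \<le> 12 * C * F * X powr (2 / 3)"
      using X by (simp add: powr_add[symmetric])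
    then have "X powr (1 / 3) \<le> 12 * C * F" using X by simp
    then have "(X powr (1 / 3)) ^ 3 \<le> (12 * C * F) ^ 3" by (intro power_mono) auto
    then show ?thesis using X by (simp add: powr_power)
  qed (use C F0 in simp)
  then show ?thesis using XL unfolding G_def F_def by (simp add: ennreal_leI)
qed

text \<open>The truncated bound depends neither on the number of indices nor on the time interval,
  so monotone convergence along a common index \<open>k\<close> removes both cutoffs at
  once.\<close>

lemma tt_star:
  fixes \<Lambda> :: "'a \<Rightarrow> real" and g :: "nat \<Rightarrow> 'a \<Rightarrow> complex" and f :: "'a \<Rightarrow> complex" and C :: real
  assumes M: "finite_measure M"
    and m: "\<Lambda> \<in> borel_measurable M" "\<And>i. g i \<in> borel_measurable M" "f \<in> borel_measurable M"
    and gb: "\<And>i x. x \<in> space M \<Longrightarrow> norm (g i x) \<le> 1" and fb: "\<And>x. x \<in> space M \<Longrightarrow> norm (f x) \<le> B"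
    and C: "C > 0"
    and ker: "\<And>i j \<tau>. \<tau> \<noteq> 0 \<Longrightarrow> norm (\<integral>x. cis (\<tau> * \<Lambda> x) * g i x * cnj (g j x) \<partial>M) \<le> C * \<bar>\<tau>\<bar> powr (- 1 / 3)"
  shows "(\<integral>\<^sup>+ t. (SUP i. ennreal (norm (\<integral>x. cis (t * \<Lambda> x) * g i x * f x \<partial>M) ^ 6)) \<partial>lborel)
     \<le> ennreal ((12 * C * (\<integral>x. (norm (f x))\<^sup>2 \<partial>M)) ^ 3)"
proof -
  interpret M: finite_measure M by (rule M)
  define W where "W i t = (\<integral>x. cis (t * \<Lambda> x) * g i x * f x \<partial>M)" for i t
  define m where "m k t = Max ((\<lambda>i. norm (W i t)) ` {..<Suc k})" for k t
  define h where "h k t = ennreal (m k t ^ 6) * indicator {- real k..real k} t" for k t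
  note [measurable] = assms(2-4)
  have Wm[measurable]: "W i \<in> borel_measurable borel" for i
    unfolding W_def[abs_def] by (subst measurable_lborel2[symmetric], rule M.borel_measurable_lebesgue_integral) measurable
  have hm: "h k \<in> borel_measurable lborel" for k
  proof -
    have [measurable]: "m k \<in> borel_measurable borel"
      unfolding m_def[abs_def] by (intro borel_measurable_Max) auto
    show ?thesis unfolding h_def[abs_def] by measurable
  qed
  have m_ge: "norm (W i t) \<le> m k t" if "i \<le> k" for i k t
    unfolding m_def using that by (intro Max_ge) auto
  have m0: "0 \<le> m k t" for k t using m_ge[of 0 k t] by (meson norm_ge_zero order_trans le0)
  have mmono: "m k t \<le> m l t" if "k \<le> l" for k l t
    unfolding m_def using that by (intro Max_mono) auto
  have inc: "incseq h"
    unfolding incseq_def le_fun_def h_def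
    by (intro allI impI mult_mono ennreal_leI power_mono mmono m0) (auto simp: indicator_def)
  have le: "(SUP i. ennreal (norm (W i t) ^ 6)) \<le> (SUP k. h k t)" for t
  proof (rule SUP_least)
    fix i
    obtain l where l: "\<bar>t\<bar> \<le> real l" using real_arch_simple by blast
    have "ennreal (norm (W i t) ^ 6) \<le> h (max i l) t"
      using m_ge[of i "max i l" t] l by (auto simp: h_def indicator_def intro!: ennreal_leI power_mono)
    also have "\<dots> \<le> (SUP k. h k t)" by (rule SUP_upper) simp
    finally show "ennreal (norm (W i t) ^ 6) \<le> (SUP k. h k t)" .
  qed
  have "(\<integral>\<^sup>+ t. (SUP i. ennreal (norm (W i t) ^ 6)) \<partial>lborel) \<le> (\<integral>\<^sup>+ t. (SUP k. h k t) \<partial>lborel)"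
    by (intro nn_integral_mono le)
  also have "\<dots> = (SUP k. \<integral>\<^sup>+ t. h k t \<partial>lborel)"
    by (rule nn_integral_monotone_convergence_SUP[OF inc hm])
  also have "\<dots> \<le> ennreal ((12 * C * (\<integral>x. (norm (f x))\<^sup>2 \<partial>M)) ^ 3)"
  proof (rule SUP_least)
    fix k
    show "(\<integral>\<^sup>+ t. h k t \<partial>lborel) \<le> ennreal ((12 * C * (\<integral>x. (norm (f x))\<^sup>2 \<partial>M)) ^ 3)"
      unfolding h_def m_def by (rule tt_star_truncated[OF M assms(2-4) gb fb W_def C ker]) auto
  qed
  finally show ?thesis by (simp add: W_def)
qed

section \<open>Scattering states of the two-media Laplacian\<close>

text \<open>\<open>x\<close> and \<open>y\<close> are square roots of the factors by which the waves
  change per site, \<open>p\<close> and \<open>q\<close> are the roots of the coefficients of the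
  media. Half angles make the interface conditions linear: the coefficients \<open>R\<close> and
  \<open>T\<close> solve \<open>T = 1 + R\<close> and
  \<open>p * (1 / x - R * x) = q * T * y\<close>.\<close>

definition reflection :: "real \<Rightarrow> real \<Rightarrow> complex \<Rightarrow> complex \<Rightarrow> complex" where
  "reflection p q x y = (p / x - q * y) / (p * x + q * y)"

definition transmission :: "real \<Rightarrow> real \<Rightarrow> complex \<Rightarrow> complex \<Rightarrow> complex" where
  "transmission p q x y = p * (x + 1 / x) / (p * x + q * y)"

text \<open>A wave coming in from the left, its reflection, and the transmitted wave on the right.
  Exponents are natural numbers, so on the left the incident wave is a power of
  \<open>1 / x\<^sup>2\<close>. Site 0 is assigned to the left formula; the right one gives the same
  value.\<close>

definition mode :: "real \<Rightarrow> real \<Rightarrow> complex \<Rightarrow> complex \<Rightarrow> int \<Rightarrow> complex" where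
  "mode p q x y j =
    (if j \<le> 0 then (1 / x\<^sup>2) ^ nat (- j) + reflection p q x y * (x\<^sup>2) ^ nat (- j)
     else transmission p q x y * (y\<^sup>2) ^ nat j)"

text \<open>The root of \<open>1 - y\<^sup>2 = - 2 \<i> \<sigma> y\<close> whose square is the factor by which the transmitted wave
  changes per site: on the unit circle for \<open>0 \<le> \<sigma> \<le> 1\<close> and in \<open>(- 1, 0)\<close> for \<open>\<sigma> > 1\<close>.\<close>

definition half_mult :: "real \<Rightarrow> complex" where
  "half_mult \<sigma> = Complex (sqrt (max 0 (1 - \<sigma>\<^sup>2))) (\<sigma> - sqrt (max 0 (\<sigma>\<^sup>2 - 1)))"

text \<open>Equal energy on both sides means \<open>q * \<sigma> = p * sin (\<theta> / 2)\<close>.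
  The state incident from the right is the mirror image
  \<open>channel q p \<theta> (- j)\<close>.\<close>

definition channel :: "real \<Rightarrow> real \<Rightarrow> real \<Rightarrow> int \<Rightarrow> complex" where
  "channel p q \<theta> = mode p q (cis (\<theta> / 2)) (half_mult (p / q * sin (\<theta> / 2)))"

lemma complex_power2_eq: "(Complex a b)\<^sup>2 = Complex (a\<^sup>2 - b\<^sup>2) (2 * a * b)"
  by (simp add: power2_eq_square complex_eq_iff)

lemma half_mult_quadratic: "1 - (half_mult \<sigma>)\<^sup>2 = - 2 * \<i> * \<sigma> * half_mult \<sigma>"
proof (cases "\<sigma>\<^sup>2 \<le> 1")
  case True
  then show ?thesis
    by (simp add: half_mult_def complex_power2_eq complex_eq_iff power2_eq_square[of \<sigma>])
next
  case False
  then have "(sqrt (\<sigma>\<^sup>2 - 1))\<^sup>2 = \<sigma>\<^sup>2 - 1" by simp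
  then show ?thesis using False
    by (simp add: half_mult_def complex_power2_eq complex_eq_iff power2_eq_square algebra_simps)
qed

lemma half_mult_nonzero [simp]: "half_mult \<sigma> \<noteq> 0"
  using half_mult_quadratic[of \<sigma>] by force

lemma Re_half_mult: "0 \<le> Re (half_mult \<sigma>)"
  by (simp add: half_mult_def)

lemma Im_half_mult: "0 \<le> \<sigma> \<Longrightarrow> 0 \<le> Im (half_mult \<sigma>)"
  by (auto simp: half_mult_def max_def intro!: real_le_lsqrt)

lemma cis_half_quadratic: "1 - (cis (\<theta> / 2))\<^sup>2 = - 2 * \<i> * sin (\<theta> / 2) * cis (\<theta> / 2)"
  using sin_cos_squared_add3[of "\<theta> / 2"]
  by (simp add: complex_eq_iff power2_eq_square algebra_simps)

text \<open>The choice of root agrees with the plane waves \<open>cis (\<theta> / 2)\<close>, so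
  either medium can take the role of the incident one.\<close>

lemma half_mult_sin:
  assumes "0 \<le> \<theta>" "\<theta> \<le> pi" shows "half_mult (sin (\<theta> / 2)) = cis (\<theta> / 2)"
proof -
  have "cos (\<theta> / 2) \<ge> 0" using assms by (intro cos_ge_zero) auto
  then have "sqrt (1 - (sin (\<theta> / 2))\<^sup>2) = cos (\<theta> / 2)"
    by (intro real_sqrt_unique) (simp_all add: cos_squared_eq)
  moreover have "(sin (\<theta> / 2))\<^sup>2 \<le> 1" by (simp add: abs_square_le_1)
  ultimately show ?thesis by (simp add: half_mult_def complex_eq_iff)
qed

lemma half_mult_propagating:
  assumes "\<bar>\<sigma>\<bar> \<le> 1"
  shows "half_mult \<sigma> = Complex (sqrt (1 - \<sigma>\<^sup>2)) \<sigma>" "cnj (half_mult \<sigma>) = 1 / half_mult \<sigma>"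
    "norm (half_mult \<sigma>) = 1" "half_mult \<sigma> + 1 / half_mult \<sigma> = 2 * sqrt (1 - \<sigma>\<^sup>2)"
proof -
  have s: "\<sigma>\<^sup>2 \<le> 1" using assms by (simp add: abs_square_le_1)
  show 1: "half_mult \<sigma> = Complex (sqrt (1 - \<sigma>\<^sup>2)) \<sigma>" using s by (simp add: half_mult_def)
  have "cnj (half_mult \<sigma>) * half_mult \<sigma> = 1"
    using s by (simp add: 1 complex_eq_iff power2_eq_square)
  then show 2: "cnj (half_mult \<sigma>) = 1 / half_mult \<sigma>" by (simp add: field_simps)
  show "norm (half_mult \<sigma>) = 1" using s by (simp add: 1 cmod_def)
  show "half_mult \<sigma> + 1 / half_mult \<sigma> = 2 * sqrt (1 - \<sigma>\<^sup>2)"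
    unfolding 2[symmetric] by (simp add: 1 complex_eq_iff)
qed

text \<open>Beyond the band the root is purely imaginary. Its square is negative and at least -1, so
  the wave does not grow and alternates in sign.\<close>

lemma half_mult_evanescent:
  assumes "1 \<le> \<sigma>"
  shows "half_mult \<sigma> = \<i> * (\<sigma> - sqrt (\<sigma>\<^sup>2 - 1))" "cnj (half_mult \<sigma>) = - half_mult \<sigma>"
    "0 < \<sigma> - sqrt (\<sigma>\<^sup>2 - 1)" "\<sigma> - sqrt (\<sigma>\<^sup>2 - 1) \<le> 1"
    "half_mult \<sigma> + 1 / half_mult \<sigma> = - 2 * \<i> * sqrt (\<sigma>\<^sup>2 - 1)"
proof -
  have s: "\<sigma>\<^sup>2 \<ge> 1" using assms by (simp add: power2_eq_square mult_ge1_I)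
  show 1: "half_mult \<sigma> = \<i> * (\<sigma> - sqrt (\<sigma>\<^sup>2 - 1))"
    using s by (simp add: half_mult_def complex_eq_iff max_def)
  show "cnj (half_mult \<sigma>) = - half_mult \<sigma>" by (simp add: 1 complex_eq_iff)
  have "sqrt (\<sigma>\<^sup>2 - 1) < \<sigma>" using assms by (intro real_less_lsqrt) auto
  then show 3: "0 < \<sigma> - sqrt (\<sigma>\<^sup>2 - 1)" by simp
  have "\<sigma> - 1 \<le> sqrt (\<sigma>\<^sup>2 - 1)"
    by (rule real_le_rsqrt) (use assms in \<open>simp add: power2_eq_square algebra_simps\<close>)
  then show "\<sigma> - sqrt (\<sigma>\<^sup>2 - 1) \<le> 1" by simp
  have "1 / half_mult \<sigma> = half_mult \<sigma> - 2 * \<i> * \<sigma>"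
    using half_mult_quadratic[of \<sigma>] by (simp add: field_simps power2_eq_square)
  then show "half_mult \<sigma> + 1 / half_mult \<sigma> = - 2 * \<i> * sqrt (\<sigma>\<^sup>2 - 1)"
    by (simp add: 1 complex_eq_iff)
qed

lemma norm_half_mult_le: "0 \<le> \<sigma> \<Longrightarrow> norm (half_mult \<sigma>) \<le> 1"
proof (cases "\<sigma> \<le> 1")
  case False
  then have "norm (half_mult \<sigma>) = \<bar>\<sigma> - sqrt (\<sigma>\<^sup>2 - 1)\<bar>"
    using half_mult_evanescent(1)[of \<sigma>] by (simp add: norm_mult flip: of_real_diff)
  then show ?thesis using half_mult_evanescent(3,4)[of \<sigma>] False by simp
qed (simp add: half_mult_propagating(3))

lemma continuous_half_mult: "continuous_on A half_mult"
proof -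
  have "continuous_on A (\<lambda>\<sigma>. of_real (sqrt (max 0 (1 - \<sigma>\<^sup>2))) + \<i> * of_real (\<sigma> - sqrt (max 0 (\<sigma>\<^sup>2 - 1))))"
    by (intro continuous_intros)
  then show ?thesis
    by (rule continuous_on_eq) (simp add: half_mult_def complex_eq_iff)
qed

text \<open>Both roots lie in the closed first quadrant, so the two terms of the denominator cannot
  cancel. This bounds the scattering coefficients at all energies, the band edges included.\<close>

lemma norm_denominator_ge:
  fixes p q :: real and x y :: complex
  assumes "p > 0" "q > 0" and x: "Re x \<ge> 0" "Im x \<ge> 0" and y: "Re y \<ge> 0" "Im y \<ge> 0"
  shows "p * norm x \<le> norm (p * x + q * y)" "q * norm y \<le> norm (p * x + q * y)"
proof -
  have *: "norm (r * u) \<le> norm (r * u + s * v)" if "r > 0" "s > 0" "Re u \<ge> 0" "Im u \<ge> 0" "Re v \<ge> 0" "Im v \<ge> 0"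
    for r s :: real and u v :: complex
    unfolding cmod_def using that by (intro real_sqrt_le_mono add_mono power_mono) auto
  show "p * norm x \<le> norm (p * x + q * y)" using *[of p q x y] assms by (simp add: norm_mult)
  show "q * norm y \<le> norm (p * x + q * y)" using *[of q p y x] assms by (simp add: norm_mult add.commute)
qed

lemma power_recurrence:
  fixes Z \<mu> :: complex
  assumes "(1 - Z)\<^sup>2 = \<mu> * Z"
  shows "Z ^ Suc (Suc k) - 2 * Z ^ Suc k + Z ^ k = \<mu> * Z ^ Suc k"
proof -
  have "Z ^ Suc (Suc k) - 2 * Z ^ Suc k + Z ^ k = Z ^ k * (1 - Z)\<^sup>2"
    by (simp add: power2_eq_square algebra_simps)
  then show ?thesis using assms by simp
qed

context
  fixes p q s \<sigma> :: real and x y :: complex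
  assumes pq: "p > 0" "q > 0" "q * \<sigma> = p * s"
    and x: "1 - x\<^sup>2 = - 2 * \<i> * s * x" "x \<noteq> 0" and y: "1 - y\<^sup>2 = - 2 * \<i> * \<sigma> * y" "y \<noteq> 0"
    and d: "p * x + q * y \<noteq> 0"
begin

lemma mode_zero: "mode p q x y 0 = transmission p q x y"
proof -
  define D where "D = p * x + q * y"
  define N where "N = p / x - q * y"
  have "p * (x + 1 / x) = D + N" by (simp add: D_def N_def algebra_simps)
  moreover have "D \<noteq> 0" using d by (simp add: D_def)
  ultimately show ?thesis
    unfolding mode_def transmission_def reflection_def D_def[symmetric] N_def[symmetric]
    by (simp only: add_divide_distrib) simp
qed

text \<open>The characteristic equation \<open>(1 - Z)\<^sup>2 = - 4 * s\<^sup>2 * Z\<close> is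
  invariant under inversion of \<open>Z\<close>, so the incident and the reflected wave belong to
  the same eigenvalue.\<close>

lemma mode_left:
  assumes "j \<le> -1"
  shows "p\<^sup>2 * (mode p q x y (j + 1) - 2 * mode p q x y j + mode p q x y (j - 1)) = - 4 * p\<^sup>2 * s\<^sup>2 * mode p q x y j"
proof -
  obtain k where k: "j = - int (Suc k)" using assms by (intro that[of "nat (- j) - 1"]) auto
  have e: "nat (- j) = Suc k" "nat (- (j + 1)) = k" "nat (- (j - 1)) = Suc (Suc k)" using k by auto
  have X: "(1 - x\<^sup>2)\<^sup>2 = (- 4 * s\<^sup>2) * x\<^sup>2" unfolding x by (simp add: power2_eq_square)
  then have Y: "(1 - 1 / x\<^sup>2)\<^sup>2 = (- 4 * s\<^sup>2) * (1 / x\<^sup>2)"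
  proof -
    have "1 - 1 / x\<^sup>2 = - ((1 - x\<^sup>2) / x\<^sup>2)" using x(2) by (simp add: divide_simps)
    then have "(1 - 1 / x\<^sup>2)\<^sup>2 = (1 - x\<^sup>2)\<^sup>2 / (x\<^sup>2)\<^sup>2" by (simp only: power2_minus power_divide)
    then show ?thesis unfolding X by (simp add: power2_eq_square)
  qed
  define R where "R = reflection p q x y"
  have m: "mode p q x y j = (1 / x\<^sup>2) ^ Suc k + R * (x\<^sup>2) ^ Suc k"
     "mode p q x y (j + 1) = (1 / x\<^sup>2) ^ k + R * (x\<^sup>2) ^ k"
     "mode p q x y (j - 1) = (1 / x\<^sup>2) ^ Suc (Suc k) + R * (x\<^sup>2) ^ Suc (Suc k)"
    using assms unfolding mode_def R_def e by simp_all
  have "mode p q x y (j + 1) - 2 * mode p q x y j + mode p q x y (j - 1)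
    = ((1 / x\<^sup>2) ^ Suc (Suc k) - 2 * (1 / x\<^sup>2) ^ Suc k + (1 / x\<^sup>2) ^ k) + R * ((x\<^sup>2) ^ Suc (Suc k) - 2 * (x\<^sup>2) ^ Suc k + (x\<^sup>2) ^ k)"
    unfolding m by (simp add: algebra_simps del: power_Suc)
  also have "\<dots> = (- 4 * s\<^sup>2) * mode p q x y j"
    unfolding power_recurrence[OF X] power_recurrence[OF Y] m by (simp add: algebra_simps del: power_Suc)
  finally show ?thesis by simp
qed

lemma mode_right:
  assumes "j \<ge> 1"
  shows "q\<^sup>2 * (mode p q x y (j + 1) - 2 * mode p q x y j + mode p q x y (j - 1)) = - 4 * p\<^sup>2 * s\<^sup>2 * mode p q x y j"
proof -
  obtain k where k: "j = int (Suc k)" using assms by (intro that[of "nat j - 1"]) auto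
  define T where "T = transmission p q x y"
  have Y: "(1 - y\<^sup>2)\<^sup>2 = (- 4 * \<sigma>\<^sup>2) * y\<^sup>2" unfolding y by (simp add: power2_eq_square)
  have m: "mode p q x y j = T * (y\<^sup>2) ^ Suc k" "mode p q x y (j + 1) = T * (y\<^sup>2) ^ Suc (Suc k)"
    using k by (simp_all add: mode_def T_def nat_add_distrib)
  \<comment> \<open>For \<open>j = 1\<close> this is site 0, where \<open>mode\<close> uses the left
    formula; \<open>mode_zero\<close> reconciles the two.\<close>
  have m': "mode p q x y (j - 1) = T * (y\<^sup>2) ^ k"
  proof (cases "k = 0")
    case False
    then have "j - 1 > 0" "nat (j - 1) = k" using k by auto
    then show ?thesis by (simp add: mode_def T_def)
  qed (use k mode_zero in \<open>simp add: T_def\<close>)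
  have "mode p q x y (j + 1) - 2 * mode p q x y j + mode p q x y (j - 1)
     = T * ((y\<^sup>2) ^ Suc (Suc k) - 2 * (y\<^sup>2) ^ Suc k + (y\<^sup>2) ^ k)"
    unfolding m m' by (simp add: algebra_simps)
  also have "\<dots> = (- 4 * \<sigma>\<^sup>2) * mode p q x y j"
    unfolding power_recurrence[OF Y] m by (simp add: algebra_simps)
  finally have e: "mode p q x y (j + 1) - 2 * mode p q x y j + mode p q x y (j - 1) = (- 4 * \<sigma>\<^sup>2) * mode p q x y j" .
  have "q\<^sup>2 * \<sigma>\<^sup>2 = p\<^sup>2 * s\<^sup>2" using pq(3) by (metis power_mult_distrib)
  then have "complex_of_real (q\<^sup>2 * \<sigma>\<^sup>2) = complex_of_real (p\<^sup>2 * s\<^sup>2)" by simp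
  then show ?thesis unfolding e by (simp add: algebra_simps)
qed

text \<open>By the quadratic equations for \<open>x\<close> and \<open>y\<close>, and since
  \<open>q * \<sigma> = p * s\<close>, both sides contain the factor
  \<open>- 2 * \<i> * p * s\<close>. What remains is \<open>key\<close>, one of the two linear
  equations that determine the coefficients.\<close>

lemma mode_flux: "p\<^sup>2 * (mode p q x y (-1) - mode p q x y 0) = q\<^sup>2 * (mode p q x y 0 - mode p q x y 1)"
proof -
  define R where "R = reflection p q x y"
  define T where "T = transmission p q x y"
  have TR: "T = 1 + R" using mode_zero by (simp add: mode_def R_def T_def)
  have qs: "complex_of_real q * \<sigma> = p * s" using pq(3) by (metis of_real_mult)
  have a: "mode p q x y (-1) - mode p q x y 0 = (1 - x\<^sup>2) * (1 / x\<^sup>2 - R)"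
    using x(2) by (simp add: mode_def R_def field_simps)
  have b: "mode p q x y 0 - mode p q x y 1 = T * (1 - y\<^sup>2)"
    using mode_zero by (simp add: mode_def[of _ _ _ _ 1] T_def algebra_simps)
  have key: "p * (1 / x - R * x) = q * T * y"
  proof -
    define D where "D = p * x + q * y"
    define N where "N = p / x - q * y"
    have D: "D \<noteq> 0" using d by (simp add: D_def)
    have "p * (1 / x) * D - p * x * N = q * (p * (x + 1 / x)) * y"
      using x(2) by (simp add: D_def N_def divide_simps) (simp add: algebra_simps)
    moreover have "p * (1 / x - N / D * x) = (p * (1 / x) * D - p * x * N) / D"
      using D x(2) by (simp add: divide_simps) (simp add: algebra_simps)
    ultimately show ?thesis
      unfolding R_def T_def reflection_def transmission_def D_def[symmetric] N_def[symmetric] by simp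
  qed
  have "p\<^sup>2 * (mode p q x y (-1) - mode p q x y 0) = - 2 * \<i> * s * p * (p * (1 / x - R * x))"
    unfolding a x(1) using x(2) by (simp add: divide_simps) (simp add: algebra_simps power2_eq_square)
  also have "\<dots> = - 2 * \<i> * (p * s) * (q * T * y)" unfolding key by simp
  also have "\<dots> = q\<^sup>2 * (T * (1 - y\<^sup>2))" unfolding y(1) of_real_mult[symmetric] pq(3)[symmetric]
    by (simp add: power2_eq_square)
  finally show ?thesis unfolding b .
qed

end

section \<open>Contour integrals of the scattering coefficients\<close>

text \<open>The branch cut of \<open>csqrt\<close> meets the closed right half plane only at 0,
  where continuity follows from the size of the root alone.\<close>

lemma continuous_csqrt_halfplane: "continuous_on {z. 0 \<le> Re z} csqrt"
proof (rule continuous_on_eq_continuous_within[THEN iffD2], intro ballI)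
  fix z assume z: "z \<in> {z. 0 \<le> Re z}"
  show "continuous (at z within {z. 0 \<le> Re z}) csqrt"
  proof (cases "z = 0")
    case False
    then have "z \<notin> \<real>\<^sub>\<le>\<^sub>0" using z by (auto simp: complex_nonpos_Reals_iff complex_eq_iff)
    then show ?thesis by (rule continuous_at_imp_continuous_within[OF continuous_at_csqrt])
  next
    case True
    have "((\<lambda>z. sqrt (norm z)) \<longlongrightarrow> sqrt (norm (0::complex))) (at 0 within {z. 0 \<le> Re z})"
      by (intro tendsto_intros)
    then have "(csqrt \<longlongrightarrow> 0) (at 0 within {z. 0 \<le> Re z})"
      by (intro tendsto_norm_zero_cancel[where f = csqrt]) simp
    then show ?thesis using True by (simp add: continuous_within)
  qed
qed

text \<open>The root lies in the sector of arguments between -\<pi>/4 and \<pi>/4. A product of two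
  such roots has nonnegative real part, which is what fixes the sign of
  \<open>disc_root\<close>.\<close>

lemma csqrt_halfplane: "0 \<le> Re u \<Longrightarrow> \<bar>Im (csqrt u)\<bar> \<le> Re (csqrt u)"
proof -
  assume "0 \<le> Re u"
  then have "0 \<le> Re ((csqrt u)\<^sup>2)" by simp
  then have "(Im (csqrt u))\<^sup>2 \<le> (Re (csqrt u))\<^sup>2" unfolding Re_power2 by linarith
  then show ?thesis using Re_csqrt[of u] unfolding abs_le_square_iff[symmetric] by linarith
qed

lemma cnj_csqrt_halfplane: "0 \<le> Re u \<Longrightarrow> cnj (csqrt u) = csqrt (cnj u)"
proof (cases "u = 0")
  case False
  assume "0 \<le> Re u"
  then have "u \<notin> \<real>\<^sub>\<le>\<^sub>0" using False by (auto simp: complex_nonpos_Reals_iff complex_eq_iff)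
  then show ?thesis by (rule cnj_csqrt)
qed simp

text \<open>The square root of \<open>c (1 - \<zeta>)\<^sup>2 + 4 \<zeta>\<close> on the closed unit disc; the roots of this polynomial
  lie on the unit circle, so that both factors \<open>1 - \<zeta> w\<close> stay in the closed right half plane.\<close>

definition branch_point :: "real \<Rightarrow> complex" where
  "branch_point c = Complex (1 - 2 / c) (2 * sqrt (c - 1) / c)"

definition disc_root :: "real \<Rightarrow> complex \<Rightarrow> complex" where
  "disc_root c \<zeta> = complex_of_real (sqrt c) * (csqrt (1 - \<zeta> * branch_point c) * csqrt (1 - \<zeta> * cnj (branch_point c)))"

text \<open>On the upper unit semicircle this is \<open>y / x\<close> as a function of
  \<open>\<zeta> = x\<^sup>2\<close>, with \<open>c = (p / q)\<^sup>2\<close>: equal energy means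
  \<open>1 / y - y = sqrt c * (1 / x - x)\<close>, a quadratic equation for \<open>y / x\<close>
  whose discriminant has the root \<open>disc_root\<close>. The rationalised form of the solution is
  regular at 0.\<close>

definition mult_ratio :: "real \<Rightarrow> complex \<Rightarrow> complex" where
  "mult_ratio c \<zeta> = 2 / (disc_root c \<zeta> + complex_of_real (sqrt c) * (1 - \<zeta>))"

context
  fixes c :: real
  assumes c: "c \<ge> 1"
begin

lemma branch_point_mult: "branch_point c * cnj (branch_point c) = 1"
proof -
  have s: "(sqrt (c - 1))\<^sup>2 = c - 1" using c by simp
  have "(1 - 2 / c)\<^sup>2 + (2 * sqrt (c - 1) / c)\<^sup>2 = 1"
    unfolding power_divide power_mult_distrib s using c by (simp add: field_simps power2_eq_square)
  then show ?thesis
    by (simp add: branch_point_def complex_eq_iff power2_eq_square)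
qed

lemma branch_point_add: "branch_point c + cnj (branch_point c) = 2 - 4 / c"
  by (simp add: branch_point_def complex_eq_iff)

lemma norm_branch_point: "norm (branch_point c) = 1"
  using branch_point_mult by (simp add: complex_mod_sqrt_Re_mult_cnj)

lemma Re_branch_factor:
  assumes "norm \<zeta> \<le> 1"
  shows "0 \<le> Re (1 - \<zeta> * branch_point c)" "0 \<le> Re (1 - \<zeta> * cnj (branch_point c))"
proof -
  have "norm (\<zeta> * branch_point c) \<le> 1" "norm (\<zeta> * cnj (branch_point c)) \<le> 1"
    using assms norm_branch_point by (simp_all add: norm_mult)
  then have "Re (\<zeta> * branch_point c) \<le> 1" "Re (\<zeta> * cnj (branch_point c)) \<le> 1"
    by (meson complex_Re_le_cmod order_trans)+
  then show "0 \<le> Re (1 - \<zeta> * branch_point c)" "0 \<le> Re (1 - \<zeta> * cnj (branch_point c))" by simp_all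
qed

lemma Re_branch_factor_pos:
  assumes "norm \<zeta> < 1"
  shows "0 < Re (1 - \<zeta> * branch_point c)" "0 < Re (1 - \<zeta> * cnj (branch_point c))"
proof -
  have "norm (\<zeta> * branch_point c) < 1" "norm (\<zeta> * cnj (branch_point c)) < 1"
    using assms norm_branch_point by (simp_all add: norm_mult)
  then have "Re (\<zeta> * branch_point c) < 1" "Re (\<zeta> * cnj (branch_point c)) < 1"
    by (meson complex_Re_le_cmod le_less_trans)+
  then show "0 < Re (1 - \<zeta> * branch_point c)" "0 < Re (1 - \<zeta> * cnj (branch_point c))" by simp_all
qed

lemma disc_root_power2: fixes \<zeta> :: complex shows "(disc_root c \<zeta>)\<^sup>2 = complex_of_real c * (1 - \<zeta>)\<^sup>2 + 4 * \<zeta>"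
proof -
  have sc: "(complex_of_real (sqrt c))\<^sup>2 = c" using c by (metis of_real_power real_sqrt_pow2 zero_le_one order_trans)
  have "(disc_root c \<zeta>)\<^sup>2 = c * ((1 - \<zeta> * branch_point c) * (1 - \<zeta> * cnj (branch_point c)))"
    by (simp add: disc_root_def power_mult_distrib sc)
  also have "(1 - \<zeta> * branch_point c) * (1 - \<zeta> * cnj (branch_point c))
    = 1 - \<zeta> * (branch_point c + cnj (branch_point c)) + \<zeta>\<^sup>2 * (branch_point c * cnj (branch_point c))"
    by (simp add: algebra_simps power2_eq_square)
  also have "\<dots> = 1 - \<zeta> * (2 - 4 / c) + \<zeta>\<^sup>2" by (simp add: branch_point_mult branch_point_add)
  also have "c * \<dots> = c * (1 - \<zeta>)\<^sup>2 + 4 * \<zeta>" using c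
    by (simp add: algebra_simps power2_eq_square)
  finally show ?thesis .
qed

lemma Re_disc_root:
  assumes "norm \<zeta> \<le> 1" shows "0 \<le> Re (disc_root c \<zeta>)"
proof -
  define u where "u = csqrt (1 - \<zeta> * branch_point c)"
  define v where "v = csqrt (1 - \<zeta> * cnj (branch_point c))"
  have uv: "\<bar>Im u\<bar> \<le> Re u" "\<bar>Im v\<bar> \<le> Re v"
    unfolding u_def v_def by (intro csqrt_halfplane Re_branch_factor assms)+
  have "Im u * Im v \<le> \<bar>Im u\<bar> * \<bar>Im v\<bar>" by (metis abs_ge_self abs_mult)
  also have "\<dots> \<le> Re u * Re v" using uv by (intro mult_mono) auto
  finally have "0 \<le> Re (u * v)" by simp
  then show ?thesis using c by (simp add: disc_root_def u_def v_def)
qed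

lemma continuous_disc_root: "continuous_on (cball 0 1) (disc_root c)"
proof -
  have "continuous_on (cball 0 1) (\<lambda>\<zeta>. csqrt (1 - \<zeta> * branch_point c))"
    by (rule continuous_on_compose2[OF continuous_csqrt_halfplane], intro continuous_intros)
       (use Re_branch_factor(1) in \<open>auto simp del: minus_complex.sel\<close>)
  moreover have "continuous_on (cball 0 1) (\<lambda>\<zeta>. csqrt (1 - \<zeta> * cnj (branch_point c)))"
    by (rule continuous_on_compose2[OF continuous_csqrt_halfplane], intro continuous_intros)
       (use Re_branch_factor(2) in \<open>auto simp del: minus_complex.sel\<close>)
  ultimately show ?thesis unfolding disc_root_def[abs_def] by (intro continuous_on_mult continuous_on_const)
qed

lemma holomorphic_disc_root: "disc_root c holomorphic_on ball 0 1"
proof -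
  have "(\<lambda>\<zeta>. csqrt (1 - \<zeta> * branch_point c)) holomorphic_on ball 0 1"
  proof (rule holomorphic_on_csqrt')
    show "1 - \<zeta> * branch_point c \<notin> \<real>\<^sub>\<le>\<^sub>0" if "\<zeta> \<in> ball 0 1" for \<zeta>
      using Re_branch_factor_pos(1)[of \<zeta>] that by (auto simp del: minus_complex.sel simp: complex_nonpos_Reals_iff)
  qed (intro holomorphic_intros)
  moreover have "(\<lambda>\<zeta>. csqrt (1 - \<zeta> * cnj (branch_point c))) holomorphic_on ball 0 1"
  proof (rule holomorphic_on_csqrt')
    show "1 - \<zeta> * cnj (branch_point c) \<notin> \<real>\<^sub>\<le>\<^sub>0" if "\<zeta> \<in> ball 0 1" for \<zeta>
      using Re_branch_factor_pos(2)[of \<zeta>] that by (auto simp del: minus_complex.sel simp: complex_nonpos_Reals_iff)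
  qed (intro holomorphic_intros)
  ultimately show ?thesis unfolding disc_root_def[abs_def] by (intro holomorphic_on_mult holomorphic_on_const)
qed

lemma cnj_disc_root: "norm \<zeta> \<le> 1 \<Longrightarrow> disc_root c (cnj \<zeta>) = cnj (disc_root c \<zeta>)"
  using Re_branch_factor[of \<zeta>] by (simp add: disc_root_def cnj_csqrt_halfplane mult.commute)

text \<open>Multiplication by the conjugate expression gives \<open>4 * \<zeta>\<close>, so a zero
  could lie only at the centre, where the denominator is \<open>2 * sqrt c\<close>.\<close>

lemma mult_ratio_denominator_nonzero:
  assumes "norm \<zeta> \<le> 1" shows "disc_root c \<zeta> + complex_of_real (sqrt c) * (1 - \<zeta>) \<noteq> 0"
proof
  assume 0: "disc_root c \<zeta> + complex_of_real (sqrt c) * (1 - \<zeta>) = 0"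
  define r where "r = complex_of_real (sqrt c)"
  have rc: "r\<^sup>2 = c" unfolding r_def using c by (metis of_real_power real_sqrt_pow2 zero_le_one order_trans)
  have "(disc_root c \<zeta> + r * (1 - \<zeta>)) * (disc_root c \<zeta> - r * (1 - \<zeta>)) = (disc_root c \<zeta>)\<^sup>2 - r\<^sup>2 * (1 - \<zeta>)\<^sup>2"
    by (simp add: algebra_simps power2_eq_square)
  also have "\<dots> = 4 * \<zeta>" unfolding rc disc_root_power2 by simp
  finally have "\<zeta> = 0" using 0 by (simp add: r_def)
  then show False using 0 c by (simp add: disc_root_def)
qed

text \<open>A zero in the disc would be a bound state. Squaring leaves the single candidate
  \<open>\<zeta> = (1 + c) / (2 * c)\<close>, where \<open>disc_root\<close> would have to be
  negative: the candidate belongs to the other branch of the root.\<close>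

lemma mult_ratio_avoids:
  assumes "norm \<zeta> \<le> 1" shows "complex_of_real (sqrt c) + mult_ratio c \<zeta> \<noteq> 0"
proof
  assume "sqrt c + mult_ratio c \<zeta> = 0"
  define r where "r = complex_of_real (sqrt c)"
  have rc: "r\<^sup>2 = c" unfolding r_def using c by (metis of_real_power real_sqrt_pow2 zero_le_one order_trans)
  have r0: "r \<noteq> 0" using c by (simp add: r_def)
  define D where "D = disc_root c \<zeta> + r * (1 - \<zeta>)"
  have "D \<noteq> 0" using mult_ratio_denominator_nonzero[OF assms] by (simp add: D_def r_def)
  moreover have "r + 2 / D = 0"
    using \<open>sqrt c + mult_ratio c \<zeta> = 0\<close> by (simp add: mult_ratio_def D_def r_def)
  ultimately have "r * D = - 2" by (simp add: field_simps eq_neg_iff_add_eq_0)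
  moreover have "r * D = r * disc_root c \<zeta> + r\<^sup>2 * (1 - \<zeta>)"
    by (simp add: D_def algebra_simps power2_eq_square)
  ultimately have "r * disc_root c \<zeta> + c * (1 - \<zeta>) = - 2" unfolding rc by (simp only:)
  then have "r * disc_root c \<zeta> = - 2 - c * (1 - \<zeta>)" by (simp only: eq_diff_eq)
  then have rB: "r * disc_root c \<zeta> = - (2 + c * (1 - \<zeta>))" by simp
  then have "(r * disc_root c \<zeta>)\<^sup>2 = (2 + c * (1 - \<zeta>))\<^sup>2"
    by (simp only: power2_minus)
  then have "c * (c * (1 - \<zeta>)\<^sup>2 + 4 * \<zeta>) = (2 + c * (1 - \<zeta>))\<^sup>2"
    by (simp only: power_mult_distrib rc disc_root_power2)
  then have "4 * (2 * (complex_of_real c * \<zeta>)) = 4 * (1 + complex_of_real c)" by (simp add: power2_eq_square algebra_simps)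
  then have "2 * (complex_of_real c * \<zeta>) = 1 + complex_of_real c" by (subst (asm) mult_cancel_left) simp
  then have z: "\<zeta> = (1 + c) / (2 * c)" using c by (simp add: field_simps)
  have "complex_of_real c * (1 - \<zeta>) = complex_of_real ((c - 1) / 2)" unfolding z using c by (simp add: field_simps)
  with rB have "r * disc_root c \<zeta> = complex_of_real (- (2 + (c - 1) / 2))" by (simp only: of_real_minus of_real_add of_real_numeral)
  then have "Re (r * disc_root c \<zeta>) = - (2 + (c - 1) / 2)" by (simp only: Re_complex_of_real)
  then have "Re (r * disc_root c \<zeta>) < 0" using c by simp
  then show False using Re_disc_root[OF assms] c by (simp add: r_def mult_less_0_iff)
qed

lemma continuous_mult_ratio: "continuous_on (cball 0 1) (mult_ratio c)"
  unfolding mult_ratio_def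
  by (rule continuous_on_divide, intro continuous_intros, intro continuous_intros continuous_disc_root)
     (use mult_ratio_denominator_nonzero in auto)

lemma holomorphic_mult_ratio: "mult_ratio c holomorphic_on ball 0 1"
  unfolding mult_ratio_def
  by (rule holomorphic_on_divide, intro holomorphic_intros, intro holomorphic_intros holomorphic_disc_root)
     (use mult_ratio_denominator_nonzero in auto)

lemma cnj_mult_ratio: "norm \<zeta> \<le> 1 \<Longrightarrow> mult_ratio c (cnj \<zeta>) = cnj (mult_ratio c \<zeta>)"
  by (simp add: mult_ratio_def cnj_disc_root)

text \<open>Both \<open>disc_root c (cis \<theta>)\<close> and \<open>Z = x * (y + 1 / y)\<close>
  have the same square. Real parts decide the sign: that of \<open>disc_root\<close> is nonnegative,
  while \<open>Z\<close> is 0 or has positive real part, coming from the cosine of the half angle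
  inside the band and from its sine outside.\<close>

lemma mult_ratio_boundary:
  assumes \<theta>: "0 \<le> \<theta>" "\<theta> \<le> pi"
  shows "mult_ratio c (cis \<theta>) = half_mult (sqrt c * sin (\<theta> / 2)) / cis (\<theta> / 2)"
proof -
  define \<sigma> where "\<sigma> = sqrt c * sin (\<theta> / 2)"
  define x where "x = cis (\<theta> / 2)"
  define y where "y = half_mult \<sigma>"
  define r where "r = complex_of_real (sqrt c)"
  have rc: "r\<^sup>2 = c" unfolding r_def using c by (metis of_real_power real_sqrt_pow2 zero_le_one order_trans)
  have x0: "x \<noteq> 0" and y0: "y \<noteq> 0" by (simp_all add: x_def y_def)
  have xz: "x\<^sup>2 = cis \<theta>" by (simp add: x_def power2_eq_square cis_mult)
  have qx: "1 / x - x = - 2 * \<i> * sin (\<theta> / 2)"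
    using cis_half_quadratic[of \<theta>] x0 unfolding x_def[symmetric] by (simp add: field_simps power2_eq_square)
  have qy: "1 / y - y = - 2 * \<i> * \<sigma>"
    using half_mult_quadratic[of \<sigma>] y0 unfolding y_def[symmetric] by (simp add: field_simps power2_eq_square)
  have rel: "1 / y - y = r * (1 / x - x)" unfolding qx qy by (simp add: r_def \<sigma>_def)
  define Z where "Z = x * (y + 1 / y)"
  have "(y + 1 / y)\<^sup>2 = (1 / y - y)\<^sup>2 + 4" using y0 by (simp add: power2_eq_square algebra_simps)
  then have "Z\<^sup>2 = r\<^sup>2 * (x * (1 / x - x))\<^sup>2 + 4 * x\<^sup>2"
    unfolding Z_def rel by (simp only: power_mult_distrib rel) (simp add: power2_eq_square algebra_simps)
  also have "x * (1 / x - x) = 1 - cis \<theta>" using x0 xz by (simp add: right_diff_distrib power2_eq_square)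
  finally have Z2: "Z\<^sup>2 = (disc_root c (cis \<theta>))\<^sup>2" by (simp add: disc_root_power2 rc xz)
  have s0: "sin (\<theta> / 2) \<ge> 0" "cos (\<theta> / 2) \<ge> 0" using \<theta> by (auto intro!: sin_ge_zero cos_ge_zero)
  have \<sigma>0: "\<sigma> \<ge> 0" using s0 c by (simp add: \<sigma>_def)
  have ReZ: "Re Z > 0 \<or> Z = 0"
  proof (cases "\<sigma> \<le> 1")
    case True
    then have e: "y + 1 / y = 2 * sqrt (1 - \<sigma>\<^sup>2)" unfolding y_def using \<sigma>0 by (intro half_mult_propagating(4)) auto
    have "cos (\<theta> / 2) > 0 \<or> \<sigma> = 1"
    proof (rule ccontr)
      assume n: "\<not> (cos (\<theta> / 2) > 0 \<or> \<sigma> = 1)"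
      then have "cos (\<theta> / 2) = 0" using s0 by simp
      then have "(sin (\<theta> / 2))\<^sup>2 = 1" using sin_cos_squared_add[of "\<theta> / 2"] by simp
      then have "sin (\<theta> / 2) = 1" using s0 by (simp add: power2_eq_1_iff)
      then show False using True n c by (simp add: \<sigma>_def)
    qed
    moreover have "\<sigma>\<^sup>2 < 1 \<or> \<sigma> = 1" using True \<sigma>0 by (auto simp: power2_eq_1_iff less_le abs_square_le_1)
    ultimately show ?thesis unfolding Z_def e x_def by auto
  next
    case False
    then have e: "y + 1 / y = - 2 * \<i> * sqrt (\<sigma>\<^sup>2 - 1)" unfolding y_def by (intro half_mult_evanescent(5)) auto
    have "sin (\<theta> / 2) > 0" using False s0 by (cases "sin (\<theta> / 2) = 0") (auto simp: \<sigma>_def)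
    moreover have "\<sigma>\<^sup>2 > 1" using False by (simp add: one_less_power)
    ultimately show ?thesis unfolding Z_def e x_def by simp
  qed
  have B: "disc_root c (cis \<theta>) = Z"
  proof -
    have "disc_root c (cis \<theta>) = Z \<or> disc_root c (cis \<theta>) = - Z" using Z2 by (metis power2_eq_iff)
    moreover have "Z = 0" if "disc_root c (cis \<theta>) = - Z"
      using ReZ Re_disc_root[of "cis \<theta>"] that by auto
    ultimately show ?thesis by auto
  qed
  have "Z + r * (1 - cis \<theta>) = x * (y + 1 / y + r * (1 / x - x))"
    using x0 by (simp add: Z_def xz[symmetric] power2_eq_square algebra_simps)
  also have "\<dots> = 2 * x / y" unfolding rel[symmetric] by (simp add: algebra_simps)
  finally show ?thesis using x0 y0
    unfolding mult_ratio_def B r_def[symmetric] x_def[symmetric] \<sigma>_def[symmetric] y_def[symmetric] by simp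
qed

end

text \<open>The mean value property at the centre. By conjugation symmetry the two half circles
  contribute the same real part, so the angles in \<open>{0..pi}\<close> suffice; imaginary parts
  would cancel only over the full circle.\<close>

lemma integral_circle_Re:
  assumes cont: "continuous_on (cball 0 1) f" and hol: "f holomorphic_on ball 0 1"
    and sym: "\<And>\<zeta>. norm \<zeta> = 1 \<Longrightarrow> f (cnj \<zeta>) = cnj (f \<zeta>)"
  shows "((\<lambda>\<theta>. Re (f (cis \<theta>))) has_integral pi * Re (f 0)) {0..pi}"
proof -
  have "((\<lambda>u. f u / (u - 0)) has_contour_integral 2 * of_real pi * \<i> * f 0) (circlepath 0 1)"
    by (rule Cauchy_integral_circlepath[OF cont hol]) simp
  then have "((\<lambda>t. f (0 + 1 * cis t) / (0 + 1 * cis t - 0) * 1 * \<i> * cis t) has_integral 2 * of_real pi * \<i> * f 0) {0..2 * pi}"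
    unfolding circlepath_def by (subst (asm) has_contour_integral_part_circlepath_iff) simp_all
  then have "((\<lambda>t. \<i> * f (cis t)) has_integral \<i> * (2 * of_real pi * f 0)) {0..2 * pi}"
    by (simp add: mult_ac)
  then have "((\<lambda>t. - \<i> * (\<i> * f (cis t))) has_integral - \<i> * (\<i> * (2 * of_real pi * f 0))) {0..2 * pi}"
    by (rule has_integral_mult_right)
  then have "((\<lambda>t. f (cis t)) has_integral 2 * of_real pi * f 0) {0..2 * pi}" by simp
  from has_integral_Re[OF this] have full: "((\<lambda>t. Re (f (cis t))) has_integral 2 * pi * Re (f 0)) {0..2 * pi}" by simp
  have cc: "continuous_on A (\<lambda>t. Re (f (cis t)))" for A
    unfolding cis_conv_exp
    by (intro continuous_intros continuous_on_compose2[OF cont]) auto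
  have i: "(\<lambda>t. Re (f (cis t))) integrable_on {a..b}" for a b by (intro integrable_continuous_real cc)
  have "((\<lambda>t. 1 *\<^sub>R Re (f (cis (2 * pi - t)))) has_integral integral {pi..2 * pi} (\<lambda>t. Re (f (cis t)))) {0..pi}"
  proof -
    have "((\<lambda>t. Re (f (cis t))) has_integral integral {pi..2 * pi} (\<lambda>t. Re (f (cis t)))) {pi..2*pi}"
      using i by blast
    from has_integral_affinity[OF this[folded box_real], of "-1" "2 * pi"]
    show ?thesis by (simp add: image_affinity_atLeastAtMost_diff algebra_simps)
  qed
  moreover have "Re (f (cis (2 * pi - t))) = Re (f (cis t))" for t
  proof -
    have "cis (2 * pi - t) = cnj (cis t)" by (simp add: cis_cnj complex_eq_iff sin_diff cos_diff)
    then show ?thesis using sym[of "cis t"] by simp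
  qed
  ultimately have "integral {0..pi} (\<lambda>t. Re (f (cis t))) = integral {pi..2 * pi} (\<lambda>t. Re (f (cis t)))"
    by (simp add: integral_unique)
  moreover have "integral {0..pi} (\<lambda>t. Re (f (cis t))) + integral {pi..2 * pi} (\<lambda>t. Re (f (cis t))) = integral {0..2 * pi} (\<lambda>t. Re (f (cis t)))"
    by (rule Henstock_Kurzweil_Integration.integral_combine) (use i in auto)
  ultimately have "integral {0..pi} (\<lambda>t. Re (f (cis t))) = pi * Re (f 0)"
    using full by (simp add: integral_unique)
  then show ?thesis using i integrable_integral by metis
qed

section \<open>Angles of equal energy in the two media (Snell's law)\<close>

definition angle_map :: "real \<Rightarrow> real \<Rightarrow> real \<Rightarrow> real" where
  "angle_map p q \<theta> = 2 * arcsin (q / p * sin (\<theta> / 2))"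

text \<open>Implicit differentiation of \<open>p * sin (angle_map p q \<theta> / 2) = q * sin
  (\<theta> / 2)\<close>. For \<open>p = q\<close> and \<open>\<theta> = pi\<close> the quotient is
  0 by the convention for division by zero.\<close>

definition angle_map_deriv :: "real \<Rightarrow> real \<Rightarrow> real \<Rightarrow> real" where
  "angle_map_deriv p q \<theta> = q / p * cos (\<theta> / 2) / cos (angle_map p q \<theta> / 2)"

lemma half_angle_bounds:
  assumes "0 \<le> \<theta>" "\<theta> \<le> pi"
  shows "0 \<le> sin (\<theta> / 2)" "sin (\<theta> / 2) \<le> 1" "0 \<le> cos (\<theta> / 2)"
  using assms by (auto intro!: sin_ge_zero cos_ge_zero)

lemma channel_denominator:
  assumes "p > 0" "q > 0" "0 \<le> \<theta>" "\<theta> \<le> pi"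
  shows "p \<le> norm (complex_of_real p * cis (\<theta> / 2) + complex_of_real q * half_mult (p / q * sin (\<theta> / 2)))"
    "complex_of_real p * cis (\<theta> / 2) + complex_of_real q * half_mult (p / q * sin (\<theta> / 2)) \<noteq> 0"
proof -
  show *: "p \<le> norm (complex_of_real p * cis (\<theta> / 2) + complex_of_real q * half_mult (p / q * sin (\<theta> / 2)))"
    using norm_denominator_ge(1)[of p q "cis (\<theta> / 2)" "half_mult (p / q * sin (\<theta> / 2))"]
      assms half_angle_bounds[of \<theta>] Re_half_mult Im_half_mult[of "p / q * sin (\<theta> / 2)"] by simp
  show "complex_of_real p * cis (\<theta> / 2) + complex_of_real q * half_mult (p / q * sin (\<theta> / 2)) \<noteq> 0"
    using * assms(1) by force
qed

lemma continuous_on_cis [continuous_intros]: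
  "continuous_on A f \<Longrightarrow> continuous_on A (\<lambda>x. cis (f x))"
  unfolding cis_conv_exp by (intro continuous_intros)

lemma continuous_on_half_mult [continuous_intros]:
  "continuous_on A f \<Longrightarrow> continuous_on A (\<lambda>x. half_mult (f x))"
  by (rule continuous_on_compose2[OF continuous_half_mult[of UNIV]]) auto

lemma continuous_scattering:
  assumes "p > 0" "q > 0"
  shows "continuous_on {0..pi} (\<lambda>\<theta>. reflection p q (cis (\<theta> / 2)) (half_mult (p / q * sin (\<theta> / 2))))"
    "continuous_on {0..pi} (\<lambda>\<theta>. transmission p q (cis (\<theta> / 2)) (half_mult (p / q * sin (\<theta> / 2))))"
    "continuous_on {0..pi} (\<lambda>\<theta>. channel p q \<theta> j)"
proof -
  show R: "continuous_on {0..pi} (\<lambda>\<theta>. reflection p q (cis (\<theta> / 2)) (half_mult (p / q * sin (\<theta> / 2))))"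
    unfolding reflection_def using channel_denominator(2)[OF assms] assms
    by (intro continuous_intros) auto
  show T: "continuous_on {0..pi} (\<lambda>\<theta>. transmission p q (cis (\<theta> / 2)) (half_mult (p / q * sin (\<theta> / 2))))"
    unfolding transmission_def using channel_denominator(2)[OF assms] assms
    by (intro continuous_intros) auto
  show "continuous_on {0..pi} (\<lambda>\<theta>. channel p q \<theta> j)"
  proof (cases "j \<le> 0")
    case True
    have "continuous_on {0..pi} (\<lambda>\<theta>. (1 / (cis (\<theta> / 2))\<^sup>2) ^ nat (- j) +
        reflection p q (cis (\<theta> / 2)) (half_mult (p / q * sin (\<theta> / 2))) * ((cis (\<theta> / 2))\<^sup>2) ^ nat (- j))"
      by (intro continuous_intros R) auto
    then show ?thesis using True by (simp add: channel_def mode_def)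
  next
    case False
    have "continuous_on {0..pi} (\<lambda>\<theta>. transmission p q (cis (\<theta> / 2)) (half_mult (p / q * sin (\<theta> / 2))) *
        ((half_mult (p / q * sin (\<theta> / 2)))\<^sup>2) ^ nat j)"
      using assms by (intro continuous_intros T) auto
    then show ?thesis using False by (simp add: channel_def mode_def)
  qed
qed

lemma norm_scattering_le:
  fixes p q :: real and x y :: complex
  assumes "0 < q" "q \<le> p" and x: "norm x = 1" and y: "norm y \<le> 1" and d: "p \<le> norm (complex_of_real p * x + complex_of_real q * y)"
  shows "norm (reflection p q x y) \<le> 2" "norm (transmission p q x y) \<le> 2"
proof -
  have d0: "0 < norm (complex_of_real p * x + complex_of_real q * y)" using assms by linarith
  have "norm (complex_of_real p / x - complex_of_real q * y) \<le> norm (p / x) + norm (q * y)" by (rule norm_triangle_ineq4)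
  also have "\<dots> \<le> p + q" using assms by (simp add: norm_divide norm_mult mult_left_le)
  also have "\<dots> \<le> 2 * norm (complex_of_real p * x + complex_of_real q * y)" using assms by linarith
  finally show "norm (reflection p q x y) \<le> 2"
    unfolding reflection_def norm_divide using d0 by (simp only: pos_divide_le_eq)
  have "norm (p * (x + 1 / x)) \<le> p * 2"
    unfolding norm_mult using assms norm_triangle_ineq[of x "1 / x"] by (simp add: norm_divide)
  also have "\<dots> \<le> 2 * norm (complex_of_real p * x + complex_of_real q * y)" using d by simp
  finally show "norm (transmission p q x y) \<le> 2"
    unfolding transmission_def norm_divide using d0 by (simp only: pos_divide_le_eq)
qed

text \<open>The left medium is the one with the wider band; the opposite case is its mirror image.
  Under this convention only states incident from the left can have an evanescent part.\<close>

locale two_media =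
  fixes p q :: real
  assumes pq: "0 < q" "q \<le> p"
begin

text \<open>\<open>X\<close> and \<open>Y\<close> are the half-angle multipliers of the left and the
  right medium at equal energy. \<open>edge\<close> is the critical angle of the fast medium, beyond
  which the transmitted wave is evanescent.\<close>

abbreviation "X \<theta> \<equiv> cis (\<theta> / 2)"
abbreviation "Y \<theta> \<equiv> half_mult (p / q * sin (\<theta> / 2))"
abbreviation "edge \<equiv> angle_map p q pi"

lemma slow_sin_bounds:
  assumes "0 \<le> \<theta>" "\<theta> \<le> pi"
  shows "0 \<le> q / p * sin (\<theta> / 2)" "q / p * sin (\<theta> / 2) \<le> 1"
proof -
  show "0 \<le> q / p * sin (\<theta> / 2)" using half_angle_bounds[OF assms] pq by simp
  have "q / p \<le> 1" using pq by simp
  then show "q / p * sin (\<theta> / 2) \<le> 1" using half_angle_bounds[OF assms] pq by (intro mult_le_one) auto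
qed

lemma angle_map_props:
  assumes "0 \<le> \<theta>" "\<theta> \<le> pi"
  shows "0 \<le> angle_map p q \<theta>" "angle_map p q \<theta> \<le> pi" "sin (angle_map p q \<theta> / 2) = q / p * sin (\<theta> / 2)"
    "cis (angle_map p q \<theta> / 2) = half_mult (q / p * sin (\<theta> / 2))"
    "p / q * sin (angle_map p q \<theta> / 2) = sin (\<theta> / 2)" "Y (angle_map p q \<theta>) = cis (\<theta> / 2)"
proof -
  note u = slow_sin_bounds[OF assms]
  have "0 \<le> arcsin (q / p * sin (\<theta> / 2))"
    using arcsin_le_arcsin[of 0 "q / p * sin (\<theta> / 2)"] u by simp
  then show 1: "0 \<le> angle_map p q \<theta>" unfolding angle_map_def by simp
  show 2: "angle_map p q \<theta> \<le> pi" unfolding angle_map_def using u arcsin_ubound[of "q / p * sin (\<theta> / 2)"] by simp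
  show 3: "sin (angle_map p q \<theta> / 2) = q / p * sin (\<theta> / 2)" unfolding angle_map_def using u by simp
  show "cis (angle_map p q \<theta> / 2) = half_mult (q / p * sin (\<theta> / 2))" using half_mult_sin[OF 1 2] 3 by simp
  show 5: "p / q * sin (angle_map p q \<theta> / 2) = sin (\<theta> / 2)" unfolding 3 using pq by simp
  show "Y (angle_map p q \<theta>) = cis (\<theta> / 2)" unfolding 5 by (rule half_mult_sin[OF assms])
qed

lemma edge_bounds: "0 \<le> edge" "edge \<le> pi" using angle_map_props[of pi] by auto

lemma sin_half_edge: "sin (edge / 2) = q / p" using angle_map_props(3)[of pi] by simp

lemma fast_sin_le_1:
  assumes "0 \<le> \<theta>" "\<theta> \<le> edge" shows "p / q * sin (\<theta> / 2) \<le> 1" "0 \<le> p / q * sin (\<theta> / 2)"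
proof -
  have "sin (\<theta> / 2) \<le> sin (edge / 2)" using assms edge_bounds by (intro sin_monotone_2pi_le) auto
  then have "p / q * sin (\<theta> / 2) \<le> p / q * (q / p)" unfolding sin_half_edge using pq by (intro mult_left_mono) auto
  then show "p / q * sin (\<theta> / 2) \<le> 1" using pq by simp
  show "0 \<le> p / q * sin (\<theta> / 2)" using half_angle_bounds[of \<theta>] assms edge_bounds pq by simp
qed

lemma fast_sin_ge_1:
  assumes "edge \<le> \<theta>" "\<theta> \<le> pi" shows "1 \<le> p / q * sin (\<theta> / 2)"
proof -
  have "sin (edge / 2) \<le> sin (\<theta> / 2)" using assms edge_bounds by (intro sin_monotone_2pi_le) auto
  then have "p / q * (q / p) \<le> p / q * sin (\<theta> / 2)" unfolding sin_half_edge using pq by (intro mult_left_mono) auto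
  then show "1 \<le> p / q * sin (\<theta> / 2)" using pq by simp
qed

lemma continuous_angle_map: "continuous_on {0..pi} (angle_map p q)"
  unfolding angle_map_def using slow_sin_bounds by (intro continuous_intros) (force intro: order_trans[of _ 0])+

lemma angle_map_mono:
  assumes "0 \<le> s" "s \<le> t" "t \<le> pi" shows "angle_map p q s \<le> angle_map p q t"
proof -
  have "sin (s / 2) \<le> sin (t / 2)" using assms by (intro sin_monotone_2pi_le) auto
  then have "q / p * sin (s / 2) \<le> q / p * sin (t / 2)" using pq by (intro mult_left_mono) auto
  then show ?thesis unfolding angle_map_def using slow_sin_bounds[of s] slow_sin_bounds[of t] assms
    by (simp add: arcsin_le_arcsin)
qed

text \<open>Integrals over the slow angle become integrals over the fast angles below
  \<open>edge\<close>, so that both families of states can be combined in one variable.\<close>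

lemma has_integral_angle_substitution:
  fixes g :: "real \<Rightarrow> 'a::euclidean_space"
  assumes g: "continuous_on {0..edge} g"
  shows "((\<lambda>\<theta>. angle_map_deriv p q \<theta> *\<^sub>R g (angle_map p q \<theta>)) has_integral integral {0..edge} g) {0..pi}"
proof -
  have z: "angle_map p q 0 = 0" by (simp add: angle_map_def)
  have "((\<lambda>\<theta>. angle_map_deriv p q \<theta> *\<^sub>R g (angle_map p q \<theta>)) has_integral integral {angle_map p q 0..angle_map p q pi} g) {0..pi}"
  \<comment> \<open>For \<open>p = q\<close> the argument of \<open>arcsin\<close> reaches 1 at
    \<pi>, where the derivative does not exist; the rule tolerates this exceptional point.\<close>
  proof (rule has_integral_substitution_strong[where s = "{pi}" and c = 0 and d = edge])
    show "angle_map p q ` {0..pi} \<subseteq> {0..edge}" using angle_map_mono angle_map_props by auto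
    show "(angle_map p q has_field_derivative angle_map_deriv p q x) (at x within {0..pi})" if x: "x \<in> {0..pi} - {pi}" for x
    proof -
      define u where "u = q / p * sin (x / 2)"
      have xb: "0 \<le> x" "x \<le> pi" "x < pi" and "p \<noteq> 0" using x pq by auto
      have "sin (x / 2) < sin (pi / 2)" using xb by (intro sin_monotone_2pi) auto
      then have "q / p * sin (x / 2) < q / p" using mult_strict_left_mono[of "sin (x / 2)" 1 "q / p"] pq by simp
      also have "\<dots> \<le> 1" using pq by simp
      finally have u: "0 \<le> u" "u < 1" using slow_sin_bounds[OF xb(1,2)] by (simp_all add: u_def)
      have cu: "cos (angle_map p q x / 2) = sqrt (1 - u\<^sup>2)"
        using cos_arcsin[of u] u by (simp add: angle_map_def u_def)
      have pos: "sqrt (1 - u\<^sup>2) > 0" using u by (simp add: abs_square_less_1)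
      have d1: "(arcsin has_field_derivative inverse (sqrt (1 - u\<^sup>2))) (at (q / p * sin (x / 2)) within UNIV)"
        using u DERIV_arcsin[of u] by (simp add: u_def)
      have "((\<lambda>x. q / p * sin (x / 2)) has_field_derivative (q / p * (cos (x / 2) / 2))) (at x within {0..pi})"
        using \<open>p \<noteq> 0\<close> by (auto intro!: derivative_eq_intros simp: field_simps)
      from DERIV_chain2[OF d1 this]
      have "((\<lambda>x. 2 * arcsin (q / p * sin (x / 2))) has_field_derivative 2 * (inverse (sqrt (1 - u\<^sup>2)) * (q / p * (cos (x / 2) / 2)))) (at x within {0..pi})"
        by (intro DERIV_cmult)
      moreover have "2 * (inverse (sqrt (1 - u\<^sup>2)) * (q / p * (cos (x / 2) / 2))) = angle_map_deriv p q x"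
        unfolding angle_map_deriv_def cu using pos \<open>p \<noteq> 0\<close> by (simp add: field_simps)
      ultimately show ?thesis by (simp add: angle_map_def[abs_def])
    qed
  qed (use g continuous_angle_map edge_bounds z in auto)
  then show ?thesis by (simp add: z)
qed

text \<open>The two transmission coefficients share the denominator \<open>D\<close>, and their
  numerators differ by the quotient of half-angle cosines that is the derivative of
  \<open>angle_map\<close>. Hence the Jacobian of the change of angle can be traded for one
  coefficient.\<close>

lemma transmission_jacobian:
  assumes "0 \<le> \<theta>" "\<theta> \<le> pi"
  defines "t \<equiv> angle_map p q \<theta>"
  shows "transmission q p (Y t) (X t) = angle_map_deriv p q \<theta> * transmission p q (X t) (Y t)"
proof -
  have Yt: "Y t = cis (\<theta> / 2)" unfolding t_def by (rule angle_map_props(6)[OF assms(1,2)])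
  have c: "cis a + 1 / cis a = 2 * cos a" for a by (simp add: complex_eq_iff divide_inverse)
  define D where "D = p * X t + q * Y t"
  have e1: "transmission q p (Y t) (X t) = q * (2 * cos (\<theta> / 2)) / D"
    unfolding transmission_def D_def Yt c by (simp add: add.commute)
  have e2: "transmission p q (X t) (Y t) = p * (2 * cos (t / 2)) / D"
    unfolding transmission_def D_def c by simp
  have real: "q * cos (\<theta> / 2) = angle_map_deriv p q \<theta> * (p * cos (t / 2))"
  \<comment> \<open>This happens only for \<open>p = q\<close> and \<open>\<theta> = pi\<close>;
    there the derivative is 0 by convention and the left side vanishes too.\<close>
  proof (cases "cos (t / 2) = 0")
    case True
    have "(sin (t / 2))\<^sup>2 = 1" using sin_cos_squared_add[of "t / 2"] True by simp
    moreover have "0 \<le> sin (t / 2)"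
      unfolding t_def using half_angle_bounds angle_map_props[OF assms(1,2)] by blast
    ultimately have "sin (t / 2) = 1" by (simp add: power2_eq_1_iff)
    moreover have "p / q * sin (t / 2) = sin (\<theta> / 2)" unfolding t_def by (rule angle_map_props(5)[OF assms(1,2)])
    ultimately have e: "sin (\<theta> / 2) = p / q" by (metis mult.right_neutral)
    have "1 \<le> sin (\<theta> / 2)" unfolding e using pq by simp
    then have "sin (\<theta> / 2) = 1" using half_angle_bounds(2)[OF assms(1,2)] by linarith
    then have "cos (\<theta> / 2) = 0" using sin_cos_squared_add[of "\<theta> / 2"] by simp
    then show ?thesis by (simp add: angle_map_deriv_def)
  next
    case False
    have "p \<noteq> 0" using pq by simp
    then show ?thesis using False unfolding angle_map_deriv_def t_def[symmetric] by (simp add: divide_simps)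
  qed
  have "complex_of_real (q * cos (\<theta> / 2)) = complex_of_real (angle_map_deriv p q \<theta> * (p * cos (t / 2)))" using real by simp
  then show ?thesis unfolding e1 e2 by simp
qed

lemma slow_channel_eq:
  assumes "0 \<le> \<theta>" "\<theta> \<le> pi"
  shows "channel q p \<theta> j = mode q p (Y (angle_map p q \<theta>)) (X (angle_map p q \<theta>)) j"
  by (simp only: channel_def angle_map_props(4,6)[OF assms])

definition "rcoef (\<theta>::real) = reflection p q (X \<theta>) (Y \<theta>)"
definition "tcoef (\<theta>::real) = transmission p q (X \<theta>) (Y \<theta>)"
text \<open>The primed coefficients belong to incidence from the slow side but are still taken in
  the fast angle, so that all four are functions of one variable.\<close>

definition "rcoef' (\<theta>::real) = reflection q p (Y \<theta>) (X \<theta>)"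
definition "tcoef' (\<theta>::real) = transmission q p (Y \<theta>) (X \<theta>)"

lemma XY_D_nonzero: "0 \<le> \<theta> \<Longrightarrow> \<theta> \<le> pi \<Longrightarrow> p * X \<theta> + q * Y \<theta> \<noteq> 0"
  using channel_denominator(2)[of p q \<theta>] pq by simp

lemma continuous_coefficients:
  "continuous_on {0..pi} rcoef" "continuous_on {0..pi} tcoef" "continuous_on {0..pi} rcoef'" "continuous_on {0..pi} tcoef'"
proof -
  have D: "p * X \<theta> + q * Y \<theta> \<noteq> 0" "q * Y \<theta> + p * X \<theta> \<noteq> 0" if "\<theta> \<in> {0..pi}" for \<theta>
    using XY_D_nonzero[of \<theta>] that by (auto simp: add.commute)
  have q: "p / q \<noteq> 0" "q \<noteq> 0" using pq by auto
  show "continuous_on {0..pi} rcoef" unfolding rcoef_def[abs_def] reflection_def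
    using D q by (intro continuous_intros) auto
  show "continuous_on {0..pi} tcoef" unfolding tcoef_def[abs_def] transmission_def
    using D q by (intro continuous_intros) auto
  show "continuous_on {0..pi} rcoef'" unfolding rcoef'_def[abs_def] reflection_def
    using D q by (intro continuous_intros) auto
  show "continuous_on {0..pi} tcoef'" unfolding tcoef'_def[abs_def] transmission_def
    using D q by (intro continuous_intros) auto
qed

lemma power_unit_cnj: "norm z = 1 \<Longrightarrow> cnj ((z\<^sup>2) ^ n) = (1 / z\<^sup>2) ^ n"
proof -
  assume "norm z = 1"
  then have "z * cnj z = 1" by (simp add: complex_norm_square[symmetric])
  then have "cnj z = 1 / z" by (metis nonzero_mult_div_cancel_left mult_zero_left zero_neq_one)
  then show ?thesis by (simp add: power_divide)
qed

text \<open>Below the critical angle both multipliers are unimodular, so conjugation inverts them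
  and the claims become polynomial identities. They express the unitarity of the scattering matrix;
  \<open>tcoef'\<close> in place of a second \<open>tcoef\<close> accounts for the different flux in
  the two media.\<close>

lemma unitarity:
  assumes "0 \<le> \<theta>" "\<theta> \<le> edge"
  shows "rcoef \<theta> * cnj (rcoef \<theta>) + tcoef \<theta> * cnj (tcoef' \<theta>) = 1"
    "tcoef \<theta> * cnj (rcoef \<theta>) + rcoef' \<theta> * cnj (tcoef \<theta>) = 0"
proof -
  define x where "x = X \<theta>"
  define y where "y = Y \<theta>"
  have \<theta>: "0 \<le> \<theta>" "\<theta> \<le> pi" using assms edge_bounds by auto
  have x0: "x \<noteq> 0" "y \<noteq> 0" by (simp_all add: x_def y_def)
  have cx: "cnj x = 1 / x" by (simp only: x_def cis_cnj cis_inverse[symmetric] inverse_eq_divide)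
  have cy: "cnj y = 1 / y" unfolding y_def using fast_sin_le_1[OF assms] by (intro half_mult_propagating(2)) auto
  define D where "D = p * x + q * y"
  define D' where "D' = p / x + q / y"
  have D0: "D \<noteq> 0" unfolding D_def x_def y_def by (rule XY_D_nonzero[OF \<theta>])
  have cD: "cnj D = D'" by (simp add: D_def D'_def cx cy)
  have D'0: "D' \<noteq> 0" using D0 cD by (metis complex_cnj_zero_iff)
  have R: "rcoef \<theta> = (p / x - q * y) / D" "rcoef' \<theta> = (q / y - p * x) / D"
    unfolding rcoef_def rcoef'_def reflection_def x_def[symmetric] y_def[symmetric] D_def by (simp_all add: add.commute)
  have T: "tcoef \<theta> = p * (x + 1 / x) / D" "tcoef' \<theta> = q * (y + 1 / y) / D"
    unfolding tcoef_def tcoef'_def transmission_def x_def[symmetric] y_def[symmetric] D_def by (simp_all add: add.commute)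
  have cR: "cnj (rcoef \<theta>) = (p * x - q / y) / D'" and cT: "cnj (tcoef \<theta>) = p * (x + 1 / x) / D'" "cnj (tcoef' \<theta>) = q * (y + 1 / y) / D'"
    unfolding R T by (simp_all add: cx cy cD add.commute)
  have "(p / x - q * y) * (p * x - q / y) + p * (x + 1 / x) * (q * (y + 1 / y)) = D * D'"
  proof -
    define a b where "a = 1 / x" and "b = 1 / y"
    have "p / x = p * a" "q / y = q * b" by (simp_all add: a_def b_def)
    then show ?thesis unfolding D_def D'_def a_def[symmetric] b_def[symmetric]
      by (simp add: algebra_simps)
  qed
  then have "((p / x - q * y) * (p * x - q / y) + p * (x + 1 / x) * (q * (y + 1 / y))) / (D * D') = 1"
    using D0 D'0 by simp
  then show "rcoef \<theta> * cnj (rcoef \<theta>) + tcoef \<theta> * cnj (tcoef' \<theta>) = 1"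
    unfolding cR cT unfolding R T times_divide_times_eq add_divide_distrib[symmetric] .
  have "p * (x + 1 / x) * (p * x - q / y) + (q / y - p * x) * (p * (x + 1 / x)) = 0" by (simp add: algebra_simps)
  then show "tcoef \<theta> * cnj (rcoef \<theta>) + rcoef' \<theta> * cnj (tcoef \<theta>) = 0"
    unfolding cR cT unfolding R T times_divide_times_eq add_divide_distrib[symmetric] by simp
qed

text \<open>Total reflection: the right multiplier is imaginary, so the numerator of
  \<open>rcoef\<close> is the conjugate of its denominator and the quotient is a pure phase.\<close>

lemma unitarity_evanescent:
  assumes "edge \<le> \<theta>" "\<theta> \<le> pi"
  shows "rcoef \<theta> * cnj (rcoef \<theta>) = 1" "tcoef \<theta> * cnj (rcoef \<theta>) = cnj (tcoef \<theta>)"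
proof -
  define x where "x = X \<theta>"
  define y where "y = Y \<theta>"
  have \<theta>: "0 \<le> \<theta>" "\<theta> \<le> pi" using assms edge_bounds by auto
  have cx: "cnj x = 1 / x" by (simp only: x_def cis_cnj cis_inverse[symmetric] inverse_eq_divide)
  have cy: "cnj y = - y" unfolding y_def using fast_sin_ge_1[OF assms] by (intro half_mult_evanescent(2))
  define D where "D = p * x + q * y"
  define D' where "D' = p / x - q * y"
  have D0: "D \<noteq> 0" unfolding D_def x_def y_def by (rule XY_D_nonzero[OF \<theta>])
  have cD: "cnj D = D'" by (simp add: D_def D'_def cx cy)
  have cD': "cnj D' = D" using cD by (metis complex_cnj_cnj)
  have D'0: "D' \<noteq> 0" using D0 cD by (metis complex_cnj_zero_iff)
  have R: "rcoef \<theta> = D' / D"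
    unfolding rcoef_def reflection_def x_def[symmetric] y_def[symmetric] D_def D'_def by simp
  have T: "tcoef \<theta> = p * (x + 1 / x) / D"
    unfolding tcoef_def transmission_def x_def[symmetric] y_def[symmetric] D_def by simp
  show "rcoef \<theta> * cnj (rcoef \<theta>) = 1" unfolding R using D0 D'0 by (simp add: cD cD')
  show "tcoef \<theta> * cnj (rcoef \<theta>) = cnj (tcoef \<theta>)" unfolding R T using D0 D'0 by (simp add: cD cD' cx add.commute)
qed

text \<open>With \<open>y = Q * x\<close> both coefficients become functions of \<zeta> with a
  simple pole at 0 at most. One factor \<open>(X \<theta>)\<^sup>2\<close> clears it, hence the
  \<open>Suc n\<close>.\<close>

lemma disc_form:
  fixes \<theta> :: real and \<zeta> Q :: complex
  assumes "0 \<le> \<theta>" "\<theta> \<le> pi"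
  defines "\<zeta> \<equiv> cis \<theta>" and "Q \<equiv> mult_ratio ((p / q)\<^sup>2) (cis \<theta>)"
  shows "rcoef \<theta> * ((X \<theta>)\<^sup>2) ^ Suc n = \<zeta> ^ n * (p - q * \<zeta> * Q) / (p + q * Q)"
    "tcoef \<theta> * ((Y \<theta>)\<^sup>2) ^ m * ((X \<theta>)\<^sup>2) ^ Suc n = p * (1 + \<zeta>) * \<zeta> ^ n * (\<zeta> * Q\<^sup>2) ^ m / (p + q * Q)"
proof -
  define x where "x = X \<theta>"
  define y where "y = Y \<theta>"
  have x0: "x \<noteq> 0" by (simp add: x_def)
  have xz: "x\<^sup>2 = \<zeta>" by (simp add: x_def \<zeta>_def power2_eq_square cis_mult)
  have c1: "(p / q)\<^sup>2 \<ge> 1" using pq by simp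
  have sc: "sqrt ((p / q)\<^sup>2) = p / q" using pq by simp
  have "Q = y / x" unfolding Q_def mult_ratio_boundary[OF c1 assms(1,2)] sc x_def y_def ..
  then have y: "y = Q * x" using x0 by simp
  have D0: "p * x + q * y \<noteq> 0" unfolding x_def y_def by (rule XY_D_nonzero[OF assms(1,2)])
  have D: "p * x + q * y = (p + q * Q) * x" unfolding y by (simp add: algebra_simps)
  have E0: "p + q * Q \<noteq> 0" using D0 D by auto
  have y2: "y\<^sup>2 = \<zeta> * Q\<^sup>2" unfolding y xz[symmetric] by (simp add: power_mult_distrib mult.commute)
  have "rcoef \<theta> * \<zeta> = (p / x - q * y) * \<zeta> / ((p + q * Q) * x)"
    unfolding rcoef_def reflection_def x_def[symmetric] y_def[symmetric] D by simp
  also have "\<dots> = (p - q * \<zeta> * Q) / (p + q * Q)"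
    unfolding y xz[symmetric] using x0 E0 by (simp add: divide_simps) (simp add: algebra_simps power2_eq_square)
  finally have R: "rcoef \<theta> * \<zeta> = (p - q * \<zeta> * Q) / (p + q * Q)" .
  show "rcoef \<theta> * ((X \<theta>)\<^sup>2) ^ Suc n = \<zeta> ^ n * (p - q * \<zeta> * Q) / (p + q * Q)"
    unfolding x_def[symmetric] xz power_Suc mult.assoc[symmetric] R by (simp add: mult.commute)
  have "tcoef \<theta> * \<zeta> = p * (x + 1 / x) * \<zeta> / ((p + q * Q) * x)"
    unfolding tcoef_def transmission_def x_def[symmetric] y_def[symmetric] D by simp
  also have "\<dots> = p * (1 + \<zeta>) / (p + q * Q)"
    unfolding xz[symmetric] using x0 E0 by (simp add: divide_simps) (simp add: algebra_simps power2_eq_square)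
  finally have T: "tcoef \<theta> * \<zeta> = p * (1 + \<zeta>) / (p + q * Q)" .
  have "tcoef \<theta> * (y\<^sup>2) ^ m * (x\<^sup>2) ^ Suc n = (tcoef \<theta> * \<zeta>) * \<zeta> ^ n * (\<zeta> * Q\<^sup>2) ^ m"
    unfolding xz y2 by (simp add: mult_ac)
  then show "tcoef \<theta> * ((Y \<theta>)\<^sup>2) ^ m * ((X \<theta>)\<^sup>2) ^ Suc n = p * (1 + \<zeta>) * \<zeta> ^ n * (\<zeta> * Q\<^sup>2) ^ m / (p + q * Q)"
    unfolding T x_def[symmetric] y_def[symmetric] by simp
qed

text \<open>The integrands are boundary values of functions holomorphic in the disc that vanish at
  0. A reflected product at two nonzero sites has at least two factors
  \<open>(X \<theta>)\<^sup>2\<close>, one of which clears the pole; in the mixed case the zero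
  comes from \<open>(Y \<theta>)\<^sup>2 = \<zeta> * Q\<^sup>2\<close>.\<close>

lemma integral_scattering_zero:
  fixes n m :: nat and Q :: "complex \<Rightarrow> complex"
  defines "Q \<equiv> mult_ratio ((p / q)\<^sup>2)"
  shows "((\<lambda>\<theta>. Re (rcoef \<theta> * ((X \<theta>)\<^sup>2) ^ Suc (Suc n))) has_integral 0) {0..pi}"
    "((\<lambda>\<theta>. Re (tcoef \<theta> * ((Y \<theta>)\<^sup>2) ^ Suc m * ((X \<theta>)\<^sup>2) ^ Suc n)) has_integral 0) {0..pi}"
proof -
  have c1: "(p / q)\<^sup>2 \<ge> 1" using pq by simp
  have sc: "sqrt ((p / q)\<^sup>2) = p / q" using pq by simp
  have E0: "p + q * Q \<zeta> \<noteq> 0" if "norm \<zeta> \<le> 1" for \<zeta> :: complex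
  proof -
    have "complex_of_real (p / q) + Q \<zeta> \<noteq> 0" using mult_ratio_avoids[OF c1 that] unfolding sc Q_def .
    moreover have "p + q * Q \<zeta> = q * (complex_of_real (p / q) + Q \<zeta>)" using pq by (simp add: algebra_simps)
    ultimately show ?thesis using pq by simp
  qed
  note cont = continuous_mult_ratio[OF c1, folded Q_def] and hol = holomorphic_mult_ratio[OF c1, folded Q_def]
    and cnj = cnj_mult_ratio[OF c1, folded Q_def]
  define f where "f \<zeta> = \<zeta> ^ Suc n * (p - q * \<zeta> * Q \<zeta>) / (p + q * Q \<zeta>)" for \<zeta> :: complex
  have "((\<lambda>\<theta>. Re (f (cis \<theta>))) has_integral pi * Re (f 0)) {0..pi}"
  proof (rule integral_circle_Re)
    show "continuous_on (cball 0 1) f" unfolding f_def[abs_def]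
      by (rule continuous_on_divide, (intro continuous_intros cont)+) (use E0 in auto)
    show "f holomorphic_on ball 0 1" unfolding f_def[abs_def]
      by (rule holomorphic_on_divide, (intro holomorphic_intros hol)+) (use E0 in auto)
    show "f (cnj \<zeta>) = cnj (f \<zeta>)" if "norm \<zeta> = 1" for \<zeta>
      using cnj[of \<zeta>] that by (simp add: f_def)
  qed
  moreover have "f 0 = 0" by (simp add: f_def)
  ultimately have "((\<lambda>\<theta>. Re (f (cis \<theta>))) has_integral 0) {0..pi}" by simp
  then show "((\<lambda>\<theta>. Re (rcoef \<theta> * ((X \<theta>)\<^sup>2) ^ Suc (Suc n))) has_integral 0) {0..pi}"
  proof (rule has_integral_eq[rotated])
    fix \<theta> assume "\<theta> \<in> {0..pi}"
    then have "0 \<le> \<theta>" "\<theta> \<le> pi" by auto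
    from disc_form(1)[OF this, of "Suc n"]
    show "Re (f (cis \<theta>)) = Re (rcoef \<theta> * ((X \<theta>)\<^sup>2) ^ Suc (Suc n))" by (simp only: f_def Q_def)
  qed
  define g where "g \<zeta> = p * (1 + \<zeta>) * \<zeta> ^ n * (\<zeta> * (Q \<zeta>)\<^sup>2) ^ Suc m / (p + q * Q \<zeta>)" for \<zeta> :: complex
  have "((\<lambda>\<theta>. Re (g (cis \<theta>))) has_integral pi * Re (g 0)) {0..pi}"
  proof (rule integral_circle_Re)
    show "continuous_on (cball 0 1) g" unfolding g_def[abs_def]
      by (rule continuous_on_divide, (intro continuous_intros cont)+) (use E0 in auto)
    show "g holomorphic_on ball 0 1" unfolding g_def[abs_def]
      by (rule holomorphic_on_divide, (intro holomorphic_intros hol)+) (use E0 in auto)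
    show "g (cnj \<zeta>) = cnj (g \<zeta>)" if "norm \<zeta> = 1" for \<zeta>
      using cnj[of \<zeta>] that by (simp add: g_def)
  qed
  moreover have "g 0 = 0" by (simp add: g_def)
  ultimately have "((\<lambda>\<theta>. Re (g (cis \<theta>))) has_integral 0) {0..pi}" by simp
  then show "((\<lambda>\<theta>. Re (tcoef \<theta> * ((Y \<theta>)\<^sup>2) ^ Suc m * ((X \<theta>)\<^sup>2) ^ Suc n)) has_integral 0) {0..pi}"
  proof (rule has_integral_eq[rotated])
    fix \<theta> assume "\<theta> \<in> {0..pi}"
    then have "0 \<le> \<theta>" "\<theta> \<le> pi" by auto
    from disc_form(2)[OF this, of "Suc m" n]
    show "Re (g (cis \<theta>)) = Re (tcoef \<theta> * ((Y \<theta>)\<^sup>2) ^ Suc m * ((X \<theta>)\<^sup>2) ^ Suc n)" by (simp only: g_def Q_def)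
  qed
qed

end

section \<open>Gram matrix of the scattering states\<close>

context two_media
begin

lemma channel_fast:
  "j \<le> 0 \<Longrightarrow> channel p q \<theta> j = (1 / (X \<theta>)\<^sup>2) ^ nat (- j) + rcoef \<theta> * ((X \<theta>)\<^sup>2) ^ nat (- j)"
  "0 < j \<Longrightarrow> channel p q \<theta> j = tcoef \<theta> * ((Y \<theta>)\<^sup>2) ^ nat j"
  by (simp_all add: channel_def mode_def rcoef_def tcoef_def)

lemma channel_slow:
  assumes "0 \<le> \<theta>" "\<theta> \<le> pi"
  defines "t \<equiv> angle_map p q \<theta>"
  shows "j \<le> 0 \<Longrightarrow> channel q p \<theta> j = (1 / (Y t)\<^sup>2) ^ nat (- j) + rcoef' t * ((Y t)\<^sup>2) ^ nat (- j)"
    "0 < j \<Longrightarrow> channel q p \<theta> j = angle_map_deriv p q \<theta> * (tcoef t * ((X t)\<^sup>2) ^ nat j)"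
    "0 < j \<Longrightarrow> channel q p \<theta> j = tcoef' t * ((X t)\<^sup>2) ^ nat j"
proof -
  note e = slow_channel_eq[OF assms(1,2), folded t_def] transmission_jacobian[OF assms(1,2), folded t_def]
  show "j \<le> 0 \<Longrightarrow> channel q p \<theta> j = (1 / (Y t)\<^sup>2) ^ nat (- j) + rcoef' t * ((Y t)\<^sup>2) ^ nat (- j)"
    unfolding e(1) mode_def rcoef'_def by simp
  show "0 < j \<Longrightarrow> channel q p \<theta> j = tcoef' t * ((X t)\<^sup>2) ^ nat j"
    unfolding e(1) mode_def tcoef'_def by simp
  show "0 < j \<Longrightarrow> channel q p \<theta> j = angle_map_deriv p q \<theta> * (tcoef t * ((X t)\<^sup>2) ^ nat j)"
    unfolding e(1) mode_def e(2) tcoef_def by simp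
qed

lemma continuous_Y: "continuous_on A Y"
  using pq by (auto intro!: continuous_intros)

text \<open>States incident from the slow side occupy only energies in the slow band, that is, fast
  angles up to \<open>edge\<close>. There they add to the fast ones, and beyond \<open>edge\<close>
  the fast ones stand alone; in both ranges the result is the same real function
  \<open>h\<close>.\<close>

lemma gram_combine:
  fixes A B H :: "real \<Rightarrow> complex"
  assumes A: "continuous_on {0..pi} A" and H: "continuous_on {0..edge} H"
    and B: "\<And>\<theta>. 0 \<le> \<theta> \<Longrightarrow> \<theta> \<le> pi \<Longrightarrow> B \<theta> = angle_map_deriv p q \<theta> *\<^sub>R H (angle_map p q \<theta>)"
    and e1: "\<And>\<theta>. 0 \<le> \<theta> \<Longrightarrow> \<theta> \<le> edge \<Longrightarrow> A \<theta> + H \<theta> = complex_of_real (h \<theta>)"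
    and e2: "\<And>\<theta>. edge \<le> \<theta> \<Longrightarrow> \<theta> \<le> pi \<Longrightarrow> A \<theta> = complex_of_real (h \<theta>)"
    and h: "(h has_integral I) {0..pi}"
  shows "integral {0..pi} A + integral {0..pi} B = complex_of_real I"
proof -
  have "(B has_integral integral {0..edge} H) {0..pi}"
    by (rule has_integral_eq[OF _ has_integral_angle_substitution[OF H]]) (use B in auto)
  then have iB: "integral {0..pi} B = integral {0..edge} H" by (rule integral_unique)
  have iA: "A integrable_on {0..pi}" by (rule integrable_continuous_real[OF A])
  have A1: "A integrable_on {0..edge}" "A integrable_on {edge..pi}"
    by (rule integrable_subinterval_real[OF iA]; use edge_bounds in auto)+
  have "integral {0..pi} A + integral {0..pi} B = (integral {0..edge} A + integral {0..edge} H) + integral {edge..pi} A"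
  proof -
    have "integral {0..pi} A = integral {0..edge} A + integral {edge..pi} A"
      by (rule Henstock_Kurzweil_Integration.integral_combine[symmetric]) (use edge_bounds iA in auto)
    then show ?thesis unfolding iB by (simp only: add_ac)
  qed
  also have "integral {0..edge} A + integral {0..edge} H = integral {0..edge} (\<lambda>\<theta>. A \<theta> + H \<theta>)"
    by (rule Henstock_Kurzweil_Integration.integral_add[symmetric, OF A1(1) integrable_continuous_real[OF H]])
  also have "\<dots> = integral {0..edge} (\<lambda>\<theta>. complex_of_real (h \<theta>))"
    by (rule Henstock_Kurzweil_Integration.integral_cong) (use e1 in auto)
  also have "integral {edge..pi} A = integral {edge..pi} (\<lambda>\<theta>. complex_of_real (h \<theta>))"
    by (rule Henstock_Kurzweil_Integration.integral_cong) (use e2 in auto)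
  also have "integral {0..edge} (\<lambda>\<theta>. complex_of_real (h \<theta>)) + integral {edge..pi} (\<lambda>\<theta>. complex_of_real (h \<theta>)) = complex_of_real I"
  proof -
    have ih: "((\<lambda>\<theta>. complex_of_real (h \<theta>)) has_integral complex_of_real I) {0..pi}"
      using has_integral_linear[OF h bounded_linear_of_real] by (simp add: o_def)
    have "integral {0..edge} (\<lambda>\<theta>. complex_of_real (h \<theta>)) + integral {edge..pi} (\<lambda>\<theta>. complex_of_real (h \<theta>))
       = integral {0..pi} (\<lambda>\<theta>. complex_of_real (h \<theta>))"
      by (rule Henstock_Kurzweil_Integration.integral_combine) (use edge_bounds ih in auto)
    then show ?thesis using integral_unique[OF ih] by (rule trans)
  qed
  finally show ?thesis .
qed

lemma has_integral_cos_diff: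
  "((\<lambda>\<theta>. Re ((1 / (X \<theta>)\<^sup>2) ^ j * ((X \<theta>)\<^sup>2) ^ k)) has_integral (if j = k then pi else 0)) {0..pi}"
proof -
  define n where "n = (if k \<le> j then j - k else k - j)"
  have X2: "(X \<theta>)\<^sup>2 = cis \<theta>" for \<theta> by (simp add: power2_eq_square cis_mult)
  have "((\<lambda>\<theta>. Re ((\<lambda>\<zeta>. \<zeta> ^ n) (cis \<theta>))) has_integral pi * Re (0 ^ n)) {0..pi}"
    by (rule integral_circle_Re) (auto intro!: continuous_intros holomorphic_intros)
  moreover have "pi * Re (0 ^ n) = (if j = k then pi else 0)" by (auto simp: n_def)
  moreover have "Re ((1 / (X \<theta>)\<^sup>2) ^ j * ((X \<theta>)\<^sup>2) ^ k) = Re (cis \<theta> ^ n)" for \<theta>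
  proof -
    have "1 / (X \<theta>)\<^sup>2 = cis (- \<theta>)" unfolding X2 by (simp only: cis_inverse[symmetric] inverse_eq_divide)
    then have "(1 / (X \<theta>)\<^sup>2) ^ j * ((X \<theta>)\<^sup>2) ^ k = cis (real j * - \<theta>) * cis (real k * \<theta>)"
      unfolding X2 by (simp only: Complex.DeMoivre)
    also have "\<dots> = cis (real k * \<theta> - real j * \<theta>)" by (simp only: cis_mult) (simp add: algebra_simps)
    finally have "Re ((1 / (X \<theta>)\<^sup>2) ^ j * ((X \<theta>)\<^sup>2) ^ k) = cos (real k * \<theta> - real j * \<theta>)" by (simp only: cis.sel)
    also have "\<dots> = cos (real n * \<theta>)"
    proof (cases "k \<le> j")
      case True
      then have "real k * \<theta> - real j * \<theta> = - (real n * \<theta>)" by (simp add: n_def of_nat_diff algebra_simps)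
      then show ?thesis by simp
    next
      case False
      then have "real k * \<theta> - real j * \<theta> = real n * \<theta>" by (simp add: n_def of_nat_diff algebra_simps)
      then show ?thesis by simp
    qed
    finally show ?thesis by (simp add: Complex.DeMoivre)
  qed
  ultimately show ?thesis by simp
qed

text \<open>In the fast angle, unitarity collapses the products of two coefficients, and the sum
  over both families is twice the real part of a boundary value with vanishing integral, plus a
  Fourier term for \<open>j < 0\<close>. The condition on \<open>k\<close> provides the power of
  \<open>(X \<theta>)\<^sup>2\<close> that cancels the pole of the coefficients.\<close>

lemma gram_left:
  assumes k: "k \<le> -1" and j: "j \<noteq> 0"
  shows "integral {0..pi} (\<lambda>\<theta>. channel p q \<theta> j * cnj (channel p q \<theta> k))
    + integral {0..pi} (\<lambda>\<theta>. channel q p \<theta> (- j) * cnj (channel q p \<theta> (- k))) = (if j = k then 2 * pi else 0)"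
proof -
  define m where "m = nat (- k)"
  have m: "0 < m" using k by (simp add: m_def)
  then obtain m' where m': "m = Suc m'" using gr0_implies_Suc by blast
  have contA: "continuous_on {0..pi} (\<lambda>\<theta>. channel p q \<theta> j * cnj (channel p q \<theta> k))"
    using pq by (intro continuous_intros continuous_scattering(3)) auto
  have sub: "{0..edge} \<subseteq> {0..pi}" using edge_bounds by auto
  note cc = continuous_coefficients[THEN continuous_on_subset, OF sub]
  have x0: "X \<theta> \<noteq> 0" "Y \<theta> \<noteq> 0" for \<theta> by auto
  have cX: "cnj (((X \<theta>)\<^sup>2) ^ n) = (1 / (X \<theta>)\<^sup>2) ^ n" "cnj ((1 / (X \<theta>)\<^sup>2) ^ n) = ((X \<theta>)\<^sup>2) ^ n" for \<theta> n
  proof -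
    show *: "cnj (((X \<theta>)\<^sup>2) ^ n) = (1 / (X \<theta>)\<^sup>2) ^ n" by (rule power_unit_cnj) simp
    show "cnj ((1 / (X \<theta>)\<^sup>2) ^ n) = ((X \<theta>)\<^sup>2) ^ n" unfolding *[symmetric] by simp
  qed
  have fastk: "cnj (channel p q \<theta> k) = ((X \<theta>)\<^sup>2) ^ m + cnj (rcoef \<theta>) * (1 / (X \<theta>)\<^sup>2) ^ m" for \<theta>
    using k unfolding m_def by (subst channel_fast(1)) (auto simp: cX simp del: complex_cnj_power)
  have XX: "(X \<theta>)\<^sup>2 ^ n * (1 / (X \<theta>)\<^sup>2) ^ n = 1" "(1 / (X \<theta>)\<^sup>2) ^ n * (X \<theta>)\<^sup>2 ^ n = 1" for \<theta> n
    using x0 by (simp_all add: power_mult_distrib[symmetric] del: power_mult_distrib)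
  show ?thesis
  proof (cases "j < 0")
    case True
    define n where "n = nat (- j)"
    have n: "0 < n" using True by (simp add: n_def)
    then obtain n' where n': "n = Suc n'" using gr0_implies_Suc by blast
    have jk: "j = k \<longleftrightarrow> n = m" using True k by (auto simp: n_def m_def)
    \<comment> \<open>The Jacobian is drawn out of the factor with \<open>j\<close> only, turning
      its \<open>tcoef'\<close> into \<open>tcoef\<close>; the other factor keeps
      \<open>tcoef'\<close>, as the first unitarity relation requires.\<close>
    define H where "H \<theta> = tcoef \<theta> * cnj (tcoef' \<theta>) * (((X \<theta>)\<^sup>2) ^ n * (1 / (X \<theta>)\<^sup>2) ^ m)" for \<theta>
    define h where "h \<theta> = 2 * (Re ((1 / (X \<theta>)\<^sup>2) ^ n * ((X \<theta>)\<^sup>2) ^ m) + Re (rcoef \<theta> * ((X \<theta>)\<^sup>2) ^ Suc (Suc (n' + m'))))" for \<theta>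
    have nm: "Suc (Suc (n' + m')) = n + m" using n' m' by simp
    have fastj: "channel p q \<theta> j = (1 / (X \<theta>)\<^sup>2) ^ n + rcoef \<theta> * ((X \<theta>)\<^sup>2) ^ n" for \<theta>
      using True unfolding n_def by (subst channel_fast(1)) auto
    have hh: "complex_of_real (h \<theta>) = ((1 / (X \<theta>)\<^sup>2) ^ n * ((X \<theta>)\<^sup>2) ^ m + rcoef \<theta> * (((X \<theta>)\<^sup>2) ^ n * ((X \<theta>)\<^sup>2) ^ m))
       + (((X \<theta>)\<^sup>2) ^ n * (1 / (X \<theta>)\<^sup>2) ^ m + cnj (rcoef \<theta>) * ((1 / (X \<theta>)\<^sup>2) ^ n * (1 / (X \<theta>)\<^sup>2) ^ m))" for \<theta>
    proof -
      have "complex_of_real (h \<theta>) = complex_of_real (2 * Re ((1 / (X \<theta>)\<^sup>2) ^ n * ((X \<theta>)\<^sup>2) ^ m + rcoef \<theta> * (((X \<theta>)\<^sup>2) ^ n * ((X \<theta>)\<^sup>2) ^ m)))"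
        unfolding h_def nm power_add by (simp only: plus_complex.sel)
      also have "\<dots> = ((1 / (X \<theta>)\<^sup>2) ^ n * ((X \<theta>)\<^sup>2) ^ m + rcoef \<theta> * (((X \<theta>)\<^sup>2) ^ n * ((X \<theta>)\<^sup>2) ^ m))
         + cnj ((1 / (X \<theta>)\<^sup>2) ^ n * ((X \<theta>)\<^sup>2) ^ m + rcoef \<theta> * (((X \<theta>)\<^sup>2) ^ n * ((X \<theta>)\<^sup>2) ^ m))"
        by (rule complex_add_cnj[symmetric])
      finally show ?thesis by (simp only: complex_cnj_add complex_cnj_mult cX)
    qed
    have "integral {0..pi} (\<lambda>\<theta>. channel p q \<theta> j * cnj (channel p q \<theta> k))
       + integral {0..pi} (\<lambda>\<theta>. channel q p \<theta> (- j) * cnj (channel q p \<theta> (- k))) = complex_of_real (2 * ((if n = m then pi else 0) + 0))"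
    proof (rule gram_combine[where H = H and h = h])
      show "continuous_on {0..edge} H" unfolding H_def[abs_def]
        by (intro continuous_intros cc continuous_Y) auto
      show "channel q p \<theta> (- j) * cnj (channel q p \<theta> (- k)) = angle_map_deriv p q \<theta> *\<^sub>R H (angle_map p q \<theta>)"
        if "0 \<le> \<theta>" "\<theta> \<le> pi" for \<theta>
      proof -
        have "cnj (channel q p \<theta> (- k)) = cnj (tcoef' (angle_map p q \<theta>)) * (1 / (X (angle_map p q \<theta>))\<^sup>2) ^ m"
          using k unfolding m_def by (subst channel_slow(3)[OF that]) (auto simp: cX simp del: complex_cnj_power)
        moreover have "channel q p \<theta> (- j) = angle_map_deriv p q \<theta> * (tcoef (angle_map p q \<theta>) * ((X (angle_map p q \<theta>))\<^sup>2) ^ n)"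
          using True unfolding n_def by (subst channel_slow(2)[OF that]) auto
        ultimately show ?thesis by (simp add: H_def scaleR_conv_of_real mult_ac)
      qed
      show "channel p q \<theta> j * cnj (channel p q \<theta> k) + H \<theta> = complex_of_real (h \<theta>)" if "0 \<le> \<theta>" "\<theta> \<le> edge" for \<theta>
      proof -
        have u: "rcoef \<theta> * cnj (rcoef \<theta>) + tcoef \<theta> * cnj (tcoef' \<theta>) = 1" by (rule unitarity(1)[OF that])
        define Z W where "Z = (X \<theta>)\<^sup>2" and "W = 1 / (X \<theta>)\<^sup>2"
        have "channel p q \<theta> j * cnj (channel p q \<theta> k) + H \<theta> = (W ^ n + rcoef \<theta> * Z ^ n) * (Z ^ m + cnj (rcoef \<theta>) * W ^ m)
            + tcoef \<theta> * cnj (tcoef' \<theta>) * (Z ^ n * W ^ m)"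
          unfolding fastj fastk H_def Z_def W_def by simp
        also have "\<dots> = (W ^ n * Z ^ m + rcoef \<theta> * (Z ^ n * Z ^ m)) + cnj (rcoef \<theta>) * (W ^ n * W ^ m)
            + (rcoef \<theta> * cnj (rcoef \<theta>) + tcoef \<theta> * cnj (tcoef' \<theta>)) * (Z ^ n * W ^ m)"
          by (simp add: algebra_simps)
        also have "\<dots> = complex_of_real (h \<theta>)" unfolding u hh Z_def W_def by (simp only: mult_1 add_ac)
        finally show ?thesis .
      qed
      show "channel p q \<theta> j * cnj (channel p q \<theta> k) = complex_of_real (h \<theta>)" if "edge \<le> \<theta>" "\<theta> \<le> pi" for \<theta>
      proof -
        have u: "rcoef \<theta> * cnj (rcoef \<theta>) = 1" by (rule unitarity_evanescent(1)[OF that])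
        define Z W where "Z = (X \<theta>)\<^sup>2" and "W = 1 / (X \<theta>)\<^sup>2"
        have "channel p q \<theta> j * cnj (channel p q \<theta> k) = (W ^ n + rcoef \<theta> * Z ^ n) * (Z ^ m + cnj (rcoef \<theta>) * W ^ m)"
          unfolding fastj fastk Z_def W_def by simp
        also have "\<dots> = (W ^ n * Z ^ m + rcoef \<theta> * (Z ^ n * Z ^ m)) + cnj (rcoef \<theta>) * (W ^ n * W ^ m)
            + (rcoef \<theta> * cnj (rcoef \<theta>)) * (Z ^ n * W ^ m)"
          by (simp add: algebra_simps)
        also have "\<dots> = complex_of_real (h \<theta>)" unfolding u hh Z_def W_def by (simp only: mult_1 add_ac)
        finally show ?thesis .
      qed
      show "(h has_integral 2 * ((if n = m then pi else 0) + 0)) {0..pi}" unfolding h_def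
        by (intro has_integral_mult_right has_integral_add has_integral_cos_diff integral_scattering_zero(1))
    qed (rule contA)
    then show ?thesis using jk by auto
  next
    case False
    define n where "n = nat j"
    have n: "0 < n" "0 < j" using False j by (auto simp: n_def)
    then obtain n' where n': "n = Suc n'" using gr0_implies_Suc by blast
    \<comment> \<open>Only the factor with \<open>k\<close> is a transmitted wave now, so the
      Jacobian is drawn from it, leaving \<open>cnj (tcoef \<theta>)\<close> as in the second
      unitarity relation.\<close>
    define H where "H \<theta> = ((1 / (Y \<theta>)\<^sup>2) ^ n + rcoef' \<theta> * ((Y \<theta>)\<^sup>2) ^ n) * (cnj (tcoef \<theta>) * (1 / (X \<theta>)\<^sup>2) ^ m)" for \<theta>
    define h where "h \<theta> = 2 * Re (tcoef \<theta> * ((Y \<theta>)\<^sup>2) ^ Suc n' * ((X \<theta>)\<^sup>2) ^ Suc m')" for \<theta>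
    have fastj: "channel p q \<theta> j = tcoef \<theta> * ((Y \<theta>)\<^sup>2) ^ n" for \<theta>
      using n unfolding n_def by (subst channel_fast(2)) auto
    have hh: "complex_of_real (h \<theta>) = tcoef \<theta> * ((Y \<theta>)\<^sup>2) ^ n * ((X \<theta>)\<^sup>2) ^ m + cnj (tcoef \<theta>) * cnj (((Y \<theta>)\<^sup>2) ^ n) * (1 / (X \<theta>)\<^sup>2) ^ m" for \<theta>
    proof -
      have "complex_of_real (h \<theta>) = tcoef \<theta> * ((Y \<theta>)\<^sup>2) ^ n * ((X \<theta>)\<^sup>2) ^ m + cnj (tcoef \<theta> * ((Y \<theta>)\<^sup>2) ^ n * ((X \<theta>)\<^sup>2) ^ m)"
        unfolding h_def n'[symmetric] m'[symmetric] by (rule complex_add_cnj[symmetric])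
      then show ?thesis by (simp only: complex_cnj_mult cX)
    qed
    have "integral {0..pi} (\<lambda>\<theta>. channel p q \<theta> j * cnj (channel p q \<theta> k))
       + integral {0..pi} (\<lambda>\<theta>. channel q p \<theta> (- j) * cnj (channel q p \<theta> (- k))) = complex_of_real (2 * 0)"
    proof (rule gram_combine[where H = H and h = h])
      show "continuous_on {0..edge} H" unfolding H_def[abs_def]
        by (intro continuous_intros cc continuous_Y) auto
      show "channel q p \<theta> (- j) * cnj (channel q p \<theta> (- k)) = angle_map_deriv p q \<theta> *\<^sub>R H (angle_map p q \<theta>)"
        if "0 \<le> \<theta>" "\<theta> \<le> pi" for \<theta>
      proof -
        have "cnj (channel q p \<theta> (- k)) = angle_map_deriv p q \<theta> * (cnj (tcoef (angle_map p q \<theta>)) * (1 / (X (angle_map p q \<theta>))\<^sup>2) ^ m)"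
          using k unfolding m_def by (subst channel_slow(2)[OF that]) (auto simp: cX simp del: complex_cnj_power)
        moreover have "channel q p \<theta> (- j) = (1 / (Y (angle_map p q \<theta>))\<^sup>2) ^ n + rcoef' (angle_map p q \<theta>) * ((Y (angle_map p q \<theta>))\<^sup>2) ^ n"
          using n unfolding n_def by (subst channel_slow(1)[OF that]) auto
        ultimately show ?thesis by (simp add: H_def scaleR_conv_of_real mult_ac)
      qed
      show "channel p q \<theta> j * cnj (channel p q \<theta> k) + H \<theta> = complex_of_real (h \<theta>)" if "0 \<le> \<theta>" "\<theta> \<le> edge" for \<theta>
      proof -
        have u: "tcoef \<theta> * cnj (rcoef \<theta>) + rcoef' \<theta> * cnj (tcoef \<theta>) = 0" by (rule unitarity(2)[OF that])
        have cY: "cnj (((Y \<theta>)\<^sup>2) ^ n) = (1 / (Y \<theta>)\<^sup>2) ^ n"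
          using fast_sin_le_1[OF that] by (intro power_unit_cnj half_mult_propagating(3)) auto
        define Z W E where "Z = (X \<theta>)\<^sup>2" and "W = 1 / (X \<theta>)\<^sup>2" and "E = (Y \<theta>)\<^sup>2"
        have "channel p q \<theta> j * cnj (channel p q \<theta> k) + H \<theta> = tcoef \<theta> * E ^ n * (Z ^ m + cnj (rcoef \<theta>) * W ^ m)
            + (cnj (E ^ n) + rcoef' \<theta> * E ^ n) * (cnj (tcoef \<theta>) * W ^ m)"
          unfolding fastj fastk H_def Z_def W_def E_def cY by simp
        also have "\<dots> = tcoef \<theta> * E ^ n * Z ^ m + cnj (tcoef \<theta>) * cnj (E ^ n) * W ^ m
            + (tcoef \<theta> * cnj (rcoef \<theta>) + rcoef' \<theta> * cnj (tcoef \<theta>)) * (E ^ n * W ^ m)"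
          by (simp add: algebra_simps)
        also have "\<dots> = complex_of_real (h \<theta>)" unfolding u hh Z_def W_def E_def by simp
        finally show ?thesis .
      qed
      show "channel p q \<theta> j * cnj (channel p q \<theta> k) = complex_of_real (h \<theta>)" if "edge \<le> \<theta>" "\<theta> \<le> pi" for \<theta>
      proof -
        have u: "tcoef \<theta> * cnj (rcoef \<theta>) = cnj (tcoef \<theta>)" by (rule unitarity_evanescent(2)[OF that])
        \<comment> \<open>\<open>(Y \<theta>)\<^sup>2\<close> is real here, whereas below
          \<open>edge\<close> conjugation inverts it; leaving \<open>cnj\<close> unevaluated in
          \<open>hh\<close> covers both ranges.\<close>
        have "cnj (Y \<theta>) = - Y \<theta>" using fast_sin_ge_1[OF that] by (rule half_mult_evanescent(2))
        then have cY: "cnj (((Y \<theta>)\<^sup>2) ^ n) = ((Y \<theta>)\<^sup>2) ^ n" by simp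
        have "channel p q \<theta> j * cnj (channel p q \<theta> k) = tcoef \<theta> * ((Y \<theta>)\<^sup>2) ^ n * ((X \<theta>)\<^sup>2) ^ m
            + (tcoef \<theta> * cnj (rcoef \<theta>)) * ((Y \<theta>)\<^sup>2) ^ n * (1 / (X \<theta>)\<^sup>2) ^ m"
          unfolding fastj fastk by (simp only: distrib_left mult_ac)
        also have "\<dots> = complex_of_real (h \<theta>)" unfolding u hh cY ..
        finally show ?thesis .
      qed
      show "(h has_integral 2 * 0) {0..pi}" unfolding h_def
        by (intro has_integral_mult_right integral_scattering_zero(2))
    qed (rule contA)
    then show ?thesis using n k by auto
  qed
qed

end

section \<open>The endpoint estimate\<close>

lemma integral_restrict_lborel_Icc:
  fixes h :: "real \<Rightarrow> 'a::euclidean_space"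
  assumes h: "continuous_on {c..d} h"
  shows "(\<integral>x. h x \<partial>restrict_space lborel {c..d}) = integral {c..d} h"
proof -
  have "(\<integral>x. h x \<partial>restrict_space lborel {c..d}) = (LINT x:{c..d}|lborel. h x)"
    unfolding set_lebesgue_integral_def by (rule integral_restrict_space) simp
  also have "\<dots> = integral {c..d} h"
    by (rule set_borel_integral_eq_integral(2)[OF borel_integrable_atLeastAtMost'[OF h]])
  finally show ?thesis .
qed

lemma measurable_restrict_lborel_Icc:
  fixes h :: "real \<Rightarrow> 'a::topological_space"
  assumes "continuous_on {c..d} h"
  shows "h \<in> borel_measurable (restrict_space lborel {c..d})"
  using borel_measurable_continuous_on_restrict[OF assms]
  by (simp add: measurable_cong_sets[OF sets_restrict_space_cong[OF sets_lborel] refl])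

lemma finite_measure_restrict_lborel_Icc: "finite_measure (restrict_space lborel {c..d::real})"
  by (rule finite_measureI) (auto simp: space_restrict_space emeasure_restrict_space emeasure_lborel_Icc_eq)

lemma measurable_oscillatory_integral:
  fixes G :: "real \<Rightarrow> complex"
  assumes "continuous_on {c..d} G" "continuous_on {c..d} \<Lambda>"
  shows "(\<lambda>t. integral {c..d} (\<lambda>\<theta>. cis (t * \<Lambda> \<theta>) * G \<theta>)) \<in> borel_measurable borel"
proof -
  have "continuous_on (UNIV \<times> cbox c d) (\<lambda>(t, \<theta>). cis (t * \<Lambda> \<theta>) * G \<theta>)"
    unfolding split_beta'
    by (intro continuous_intros continuous_on_compose2[OF assms(1)] continuous_on_compose2[OF assms(2)]) auto
  then have "continuous_on UNIV (\<lambda>t. integral (cbox c d) (\<lambda>\<theta>. cis (t * \<Lambda> \<theta>) * G \<theta>))"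
    by (rule integral_continuous_on_param)
  then show ?thesis by (intro borel_measurable_continuous_onI) simp
qed

lemma tt_star_interval:
  fixes \<Lambda> :: "real \<Rightarrow> real" and g :: "nat \<Rightarrow> real \<Rightarrow> complex" and f :: "real \<Rightarrow> complex" and C :: real
  assumes \<Lambda>: "continuous_on {c..d} \<Lambda>" and g: "\<And>i. continuous_on {c..d} (g i)" and f: "continuous_on {c..d} f"
    and gb: "\<And>i x. x \<in> {c..d} \<Longrightarrow> norm (g i x) \<le> 1" and C: "C > 0"
    and ker: "\<And>i j \<tau>. \<tau> \<noteq> 0 \<Longrightarrow> norm (integral {c..d} (\<lambda>x. cis (\<tau> * \<Lambda> x) * g i x * cnj (g j x))) \<le> C * \<bar>\<tau>\<bar> powr (- 1 / 3)"
  shows "(\<integral>\<^sup>+ t. (SUP i. ennreal (norm (integral {c..d} (\<lambda>x. cis (t * \<Lambda> x) * (g i x * f x))) ^ 6)) \<partial>lborel)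
     \<le> ennreal ((12 * C * integral {c..d} (\<lambda>x. (norm (f x))\<^sup>2)) ^ 3)"
proof -
  have sp: "space (restrict_space lborel {c..d}) = {c..d}" by (simp add: space_restrict_space)
  have "bounded (f ` {c..d})" by (intro compact_imp_bounded compact_continuous_image f compact_Icc)
  then obtain B where "\<forall>y\<in>f ` {c..d}. norm y \<le> B" unfolding bounded_iff by blast
  then have B: "\<And>x. x \<in> {c..d} \<Longrightarrow> norm (f x) \<le> B" by simp
  have eq: "(\<integral>x. cis (t * \<Lambda> x) * g i x * h x \<partial>restrict_space lborel {c..d}) = integral {c..d} (\<lambda>x. cis (t * \<Lambda> x) * g i x * h x)"
    if "continuous_on {c..d} h" for t i h
    by (intro integral_restrict_lborel_Icc continuous_intros \<Lambda> g that)
  have eq2: "(\<integral>x. (norm (f x))\<^sup>2 \<partial>restrict_space lborel {c..d}) = integral {c..d} (\<lambda>x. (norm (f x))\<^sup>2)"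
    by (intro integral_restrict_lborel_Icc continuous_intros f)
  have "(\<integral>\<^sup>+ t. (SUP i. ennreal (norm (\<integral>x. cis (t * \<Lambda> x) * g i x * f x \<partial>restrict_space lborel {c..d}) ^ 6)) \<partial>lborel)
     \<le> ennreal ((12 * C * (\<integral>x. (norm (f x))\<^sup>2 \<partial>restrict_space lborel {c..d})) ^ 3)"
  proof (rule tt_star[OF finite_measure_restrict_lborel_Icc, where B = B])
    show "norm (\<integral>x. cis (\<tau> * \<Lambda> x) * g i x * cnj (g j x) \<partial>restrict_space lborel {c..d}) \<le> C * \<bar>\<tau>\<bar> powr (- 1 / 3)" if "\<tau> \<noteq> 0" for i j \<tau>
      using ker[OF that] by (subst eq) (auto intro!: continuous_intros g)
  qed (use \<Lambda> g f gb B C sp in \<open>auto intro!: measurable_restrict_lborel_Icc\<close>)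
  then show ?thesis unfolding eq[OF f] eq2 by (simp add: mult.assoc)
qed

lemma dispersion_sin_cos: "- 4 * A * (sin (\<theta> / 2))\<^sup>2 = 2 * A * cos \<theta> - 2 * A" for A \<theta> :: real
proof -
  have c: "cos \<theta> = 1 - 2 * (sin (\<theta> / 2))\<^sup>2" using cos_double_sin[of "\<theta> / 2"] by simp
  show ?thesis unfolding c by (simp add: algebra_simps)
qed

text \<open>The energy differs from \<open>2 * A * cos \<theta>\<close> by a constant, which
  contributes only a unimodular factor.\<close>

lemma free_kernel_bound:
  fixes A \<tau> m :: real
  assumes cd: "0 \<le> c" "c \<le> d" "d \<le> pi" and A: "A > 0" and \<tau>: "\<tau> \<noteq> 0"
  shows "norm (integral {c..d} (\<lambda>\<theta>. cis (\<tau> * (- 4 * A * (sin (\<theta> / 2))\<^sup>2)) * cis (m * \<theta>)))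
    \<le> 26 * (2 * A) powr (- 1 / 3) * \<bar>\<tau>\<bar> powr (- 1 / 3)"
proof -
  have e: "cis (\<tau> * (- 4 * A * (sin (\<theta> / 2))\<^sup>2)) * cis (m * \<theta>) = cis (- (2 * A * \<tau>)) * cis (2 * A * \<tau> * cos \<theta> + m * \<theta>)" for \<theta>
    unfolding dispersion_sin_cos cis_mult by (simp add: algebra_simps)
  have "norm (integral {c..d} (\<lambda>\<theta>. cis (\<tau> * (- 4 * A * (sin (\<theta> / 2))\<^sup>2)) * cis (m * \<theta>)))
     = norm (integral {c..d} (\<lambda>\<theta>. cis (2 * A * \<tau> * cos \<theta> + m * \<theta>)))"
    unfolding e Henstock_Kurzweil_Integration.integral_mult_right by (simp add: norm_mult)
  also have "\<dots> \<le> 26 * \<bar>2 * A * \<tau>\<bar> powr (- 1 / 3)"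
    using A \<tau> by (intro cos_phase_decay cd) auto
  also have "\<bar>2 * A * \<tau>\<bar> powr (- 1 / 3) = (2 * A) powr (- 1 / 3) * \<bar>\<tau>\<bar> powr (- 1 / 3)"
    using A by (simp add: abs_mult powr_mult)
  finally show ?thesis by simp
qed

text \<open>Scattering coefficients will be part of \<open>f\<close>, so the kernel consists of
  plane waves with frequencies \<open>m i - m j\<close>, and its decay is uniform in these.\<close>

lemma strichartz_oscillatory:
  fixes f :: "real \<Rightarrow> complex" and m :: "nat \<Rightarrow> real"
  assumes cd: "0 \<le> c" "c \<le> d" "d \<le> pi" and A: "A > 0" and f: "continuous_on {c..d} f"
  shows "(\<integral>\<^sup>+ t. (SUP i. ennreal (norm (integral {c..d} (\<lambda>\<theta>. cis (t * (- 4 * A * (sin (\<theta> / 2))\<^sup>2)) * (cis (m i * \<theta>) * f \<theta>))) ^ 6)) \<partial>lborel)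
     \<le> ennreal ((12 * (104 * (2 * A) powr (- 1 / 3)) * integral {c..d} (\<lambda>x. (norm (f x))\<^sup>2)) ^ 3)"
proof (rule tt_star_interval)
  fix i j and \<tau> :: real assume \<tau>: "\<tau> \<noteq> 0"
  have e: "cis (\<tau> * (- 4 * A * (sin (\<theta> / 2))\<^sup>2)) * cis (m i * \<theta>) * cnj (cis (m j * \<theta>))
      = cis (\<tau> * (- 4 * A * (sin (\<theta> / 2))\<^sup>2)) * cis ((m i - m j) * \<theta>)" for \<theta>
    by (simp add: cis_cnj cis_mult algebra_simps)
  \<comment> \<open>104 = 4 * 26 is the constant of the evanescent case; using it here too gives all
    pieces the same form of bound.\<close>
  have "26 * (2 * A) powr (- 1 / 3) * \<bar>\<tau>\<bar> powr (- 1 / 3) \<le> 104 * (2 * A) powr (- 1 / 3) * \<bar>\<tau>\<bar> powr (- 1 / 3)"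
    by (intro mult_right_mono) auto
  then show "norm (integral {c..d} (\<lambda>\<theta>. cis (\<tau> * (- 4 * A * (sin (\<theta> / 2))\<^sup>2)) * cis (m i * \<theta>) * cnj (cis (m j * \<theta>))))
     \<le> 104 * (2 * A) powr (- 1 / 3) * \<bar>\<tau>\<bar> powr (- 1 / 3)"
    unfolding e using free_kernel_bound[OF cd A \<tau>, of "m i - m j"] by linarith
qed (use A f in \<open>auto intro!: continuous_intros\<close>)

text \<open>The second mean value theorem replaces a monotone amplitude by its end values, at the
  price of bounds on all subintervals. It holds for real functions, so real and imaginary part
  contribute \<open>2 * K\<close> each.\<close>

lemma norm_integral_monotone_amplitude:
  fixes f :: "real \<Rightarrow> complex" and g :: "real \<Rightarrow> real"
  assumes cd: "c \<le> d" and f: "continuous_on {c..d} f" and g: "continuous_on {c..d} g"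
    and mono: "\<And>x y. c \<le> x \<Longrightarrow> x \<le> y \<Longrightarrow> y \<le> d \<Longrightarrow> g y \<le> g x"
    and bd: "\<And>x. x \<in> {c..d} \<Longrightarrow> \<bar>g x\<bar> \<le> 1"
    and K: "\<And>e e'. c \<le> e \<Longrightarrow> e \<le> e' \<Longrightarrow> e' \<le> d \<Longrightarrow> norm (integral {e..e'} f) \<le> K"
  shows "norm (integral {c..d} (\<lambda>x. g x * f x)) \<le> 4 * K"
proof -
  have part: "\<bar>integral {c..d} (\<lambda>x. g x * h x)\<bar> \<le> 2 * K"
    if h: "continuous_on {c..d} h" and hK: "\<And>e e'. c \<le> e \<Longrightarrow> e \<le> e' \<Longrightarrow> e' \<le> d \<Longrightarrow> \<bar>integral {e..e'} h\<bar> \<le> K" for h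
  proof -
    have hi: "h integrable_on {c..d}" by (rule integrable_continuous_real[OF h])
    obtain e where e: "e \<in> {c..d}"
      "integral {c..d} (\<lambda>x. (- g x) * h x) = (- g c) * integral {c..e} h + (- g d) * integral {e..d} h"
    proof (rule second_mean_value_theorem[OF hi cd, of "\<lambda>x. - g x"])
      show "- g x \<le> - g y" if "c \<le> x" "x \<le> y" "y \<le> d" for x y using mono[OF that] by simp
    qed blast
    have "\<bar>integral {c..d} (\<lambda>x. g x * h x)\<bar> = \<bar>integral {c..d} (\<lambda>x. (- g x) * h x)\<bar>" by simp
    also have "\<dots> \<le> \<bar>- g c\<bar> * \<bar>integral {c..e} h\<bar> + \<bar>- g d\<bar> * \<bar>integral {e..d} h\<bar>"
      unfolding e(2) abs_mult[symmetric] by (rule abs_triangle_ineq)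
    also have "\<dots> \<le> 1 * K + 1 * K"
      using bd[of c] bd[of d] hK[of c e] hK[of e d] e(1) cd by (intro add_mono mult_mono) auto
    finally show ?thesis by simp
  qed
  have fi: "f integrable_on {e..e'}" if "c \<le> e" "e' \<le> d" for e e'
    by (rule integrable_continuous_real[OF continuous_on_subset[OF f]]) (use that in auto)
  have gfi: "(\<lambda>x. g x * f x) integrable_on {c..d}"
    by (intro integrable_continuous_real continuous_intros f g)
  have "\<bar>integral {c..d} (\<lambda>x. g x * Re (f x))\<bar> \<le> 2 * K"
  proof (rule part)
    fix e e' assume e: "c \<le> e" "e \<le> e'" "e' \<le> d"
    have "integral {e..e'} (\<lambda>x. Re (f x)) = Re (integral {e..e'} f)"
      by (rule integral_unique[OF has_integral_Re[OF integrable_integral[OF fi]]]) (use e in auto)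
    then show "\<bar>integral {e..e'} (\<lambda>x. Re (f x))\<bar> \<le> K" using K[OF e] abs_Re_le_cmod order_trans by metis
  qed (intro continuous_intros f)
  moreover have "\<bar>integral {c..d} (\<lambda>x. g x * Im (f x))\<bar> \<le> 2 * K"
  proof (rule part)
    fix e e' assume e: "c \<le> e" "e \<le> e'" "e' \<le> d"
    have "integral {e..e'} (\<lambda>x. Im (f x)) = Im (integral {e..e'} f)"
      by (rule integral_unique[OF has_integral_Im[OF integrable_integral[OF fi]]]) (use e in auto)
    then show "\<bar>integral {e..e'} (\<lambda>x. Im (f x))\<bar> \<le> K" using K[OF e] abs_Im_le_cmod order_trans by metis
  qed (intro continuous_intros f)
  moreover have "Re (integral {c..d} (\<lambda>x. g x * f x)) = integral {c..d} (\<lambda>x. g x * Re (f x))"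
    using has_integral_Re[OF integrable_integral[OF gfi]] by (simp add: integral_unique)
  moreover have "Im (integral {c..d} (\<lambda>x. g x * f x)) = integral {c..d} (\<lambda>x. g x * Im (f x))"
    using has_integral_Im[OF integrable_integral[OF gfi]] by (simp add: integral_unique)
  ultimately show ?thesis using cmod_le[of "integral {c..d} (\<lambda>x. g x * f x)"] by linarith
qed

text \<open>The product of two position factors is, up to sign, the power
  \<open>r \<theta> ^ (n i + n j)\<close>, which is again decreasing with values in [0, 1].
  Monotonicity replaces bounds on its derivative, which would grow with the exponent.\<close>

lemma strichartz_evanescent:
  fixes f :: "real \<Rightarrow> complex" and r :: "real \<Rightarrow> real" and n :: "nat \<Rightarrow> nat"
  assumes cd: "0 \<le> c" "c \<le> d" "d \<le> pi" and A: "A > 0" and f: "continuous_on {c..d} f"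
    and r: "continuous_on {c..d} r" and r01: "\<And>x. x \<in> {c..d} \<Longrightarrow> 0 \<le> r x \<and> r x \<le> 1"
    and mono: "\<And>x y. c \<le> x \<Longrightarrow> x \<le> y \<Longrightarrow> y \<le> d \<Longrightarrow> r y \<le> r x"
  shows "(\<integral>\<^sup>+ t. (SUP i. ennreal (norm (integral {c..d} (\<lambda>\<theta>. cis (t * (- 4 * A * (sin (\<theta> / 2))\<^sup>2)) * (complex_of_real ((- r \<theta>) ^ n i) * f \<theta>))) ^ 6)) \<partial>lborel)
     \<le> ennreal ((12 * (104 * (2 * A) powr (- 1 / 3)) * integral {c..d} (\<lambda>x. (norm (f x))\<^sup>2)) ^ 3)"
proof (rule tt_star_interval)
  fix i j and \<tau> :: real assume \<tau>: "\<tau> \<noteq> 0"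
  let ?K = "26 * (2 * A) powr (- 1 / 3) * \<bar>\<tau>\<bar> powr (- 1 / 3)"
  let ?f = "\<lambda>\<theta>. cis (\<tau> * (- 4 * A * (sin (\<theta> / 2))\<^sup>2))"
  define N where "N = n i + n j"
  have e: "?f \<theta> * complex_of_real ((- r \<theta>) ^ n i) * cnj (complex_of_real ((- r \<theta>) ^ n j))
      = complex_of_real ((- 1) ^ N) * (complex_of_real (r \<theta> ^ N) * ?f \<theta>)" for \<theta>
  proof -
    have "(- r \<theta>) ^ n i * (- r \<theta>) ^ n j = (- 1) ^ N * r \<theta> ^ N"
      unfolding N_def power_add[symmetric] by (rule power_minus)
    then have "complex_of_real ((- r \<theta>) ^ n i) * complex_of_real ((- r \<theta>) ^ n j) = complex_of_real ((- 1) ^ N) * complex_of_real (r \<theta> ^ N)"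
      by (simp only: of_real_mult[symmetric])
    moreover have "?f \<theta> * complex_of_real ((- r \<theta>) ^ n i) * cnj (complex_of_real ((- r \<theta>) ^ n j))
      = (complex_of_real ((- r \<theta>) ^ n i) * complex_of_real ((- r \<theta>) ^ n j)) * ?f \<theta>"
      unfolding complex_cnj_complex_of_real by (rule trans[OF mult.assoc mult.commute])
    ultimately show ?thesis by (simp only: mult.assoc)
  qed
  have "norm (integral {c..d} (\<lambda>\<theta>. complex_of_real (r \<theta> ^ N) * ?f \<theta>)) \<le> 4 * ?K"
  proof (rule norm_integral_monotone_amplitude)
    show "norm (integral {e..e'} ?f) \<le> ?K" if "c \<le> e" "e \<le> e'" "e' \<le> d" for e e'
      using free_kernel_bound[of e e' A \<tau> 0] that cd A \<tau> by simp
    show "r y ^ N \<le> r x ^ N" if "c \<le> x" "x \<le> y" "y \<le> d" for x y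
      using mono[OF that] r01[of y] that by (intro power_mono) auto
    show "\<bar>r x ^ N\<bar> \<le> 1" if "x \<in> {c..d}" for x using r01[OF that] by (simp add: power_le_one)
  qed (use cd r in \<open>auto intro!: continuous_intros\<close>)
  then show "norm (integral {c..d} (\<lambda>\<theta>. ?f \<theta> * complex_of_real ((- r \<theta>) ^ n i) * cnj (complex_of_real ((- r \<theta>) ^ n j))))
     \<le> 104 * (2 * A) powr (- 1 / 3) * \<bar>\<tau>\<bar> powr (- 1 / 3)"
    unfolding e Henstock_Kurzweil_Integration.integral_mult_right by (simp add: norm_mult norm_power)
qed (use A f r r01 in \<open>auto intro!: continuous_intros simp: norm_power power_le_one\<close>)

lemma power6_add_le: "(a + b) ^ 6 \<le> 64 * (a ^ 6 + b ^ 6)" if "0 \<le> a" "0 \<le> b" for a b :: real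
proof -
  have "(a + b) ^ 6 \<le> (2 * max a b) ^ 6" using that by (intro power_mono) auto
  also have "\<dots> = 64 * (max a b) ^ 6" by (simp add: power_mult_distrib)
  also have "(max a b) ^ 6 \<le> a ^ 6 + b ^ 6" using that by (auto simp: max_def)
  finally show ?thesis by simp
qed

lemma norm_add_power6_le: "norm (a + b) ^ 6 \<le> 64 * (norm a ^ 6 + norm b ^ 6)" for a b :: complex
  by (rule order_trans[OF power_mono[OF norm_triangle_ineq norm_ge_zero] power6_add_le[OF norm_ge_zero norm_ge_zero]])

definition oscillation :: "real \<Rightarrow> real \<Rightarrow> real \<Rightarrow> real \<Rightarrow> (real \<Rightarrow> complex) \<Rightarrow> complex" where
  "oscillation A c d t f = integral {c..d} (\<lambda>\<theta>. cis (t * (- 4 * A * (sin (\<theta> / 2))\<^sup>2)) * f \<theta>)"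

lemma oscillation_add:
  assumes "continuous_on {c..d} f" "continuous_on {c..d} g"
  shows "oscillation A c d t (\<lambda>\<theta>. f \<theta> + g \<theta>) = oscillation A c d t f + oscillation A c d t g"
proof -
  have "oscillation A c d t (\<lambda>\<theta>. f \<theta> + g \<theta>) = integral {c..d} (\<lambda>\<theta>. cis (t * (- 4 * A * (sin (\<theta> / 2))\<^sup>2)) * f \<theta> + cis (t * (- 4 * A * (sin (\<theta> / 2))\<^sup>2)) * g \<theta>)"
    unfolding oscillation_def by (simp only: distrib_left)
  also have "\<dots> = oscillation A c d t f + oscillation A c d t g"
    unfolding oscillation_def
    by (rule Henstock_Kurzweil_Integration.integral_add) (intro integrable_continuous_real continuous_intros assms; simp)+
  finally show ?thesis .
qed

lemma oscillation_cong: "(\<And>\<theta>. \<theta> \<in> {c..d} \<Longrightarrow> f \<theta> = g \<theta>) \<Longrightarrow> oscillation A c d t f = oscillation A c d t g"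
  unfolding oscillation_def by (rule Henstock_Kurzweil_Integration.integral_cong) simp

lemma measurable_SUP_oscillation:
  assumes "\<And>n. continuous_on {c..d} (g n)"
  shows "(\<lambda>t. SUP n::nat. ennreal (norm (oscillation A c d t (g n)) ^ 6)) \<in> borel_measurable lborel"
proof -
  have [measurable]: "(\<lambda>t. oscillation A c d t (g n)) \<in> borel_measurable borel" for n
    unfolding oscillation_def by (intro measurable_oscillatory_integral assms continuous_intros) auto
  show ?thesis by measurable
qed

text \<open>The 4 is the square of the bound 2 on the scattering coefficients, and 48 = 12 *
  4.\<close>

lemma nn_integral_le_of_square_integral:
  fixes K N I :: real
  assumes "(\<integral>\<^sup>+ t. S t \<partial>lborel) \<le> ennreal ((12 * K * I) ^ 3)" "I \<le> 4 * N" "0 \<le> K" "K \<le> L" "0 \<le> I"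
  shows "(\<integral>\<^sup>+ t. S t \<partial>lborel) \<le> ennreal ((48 * L * N) ^ 3)"
proof -
  have "K * I \<le> L * (4 * N)" using assms by (intro mult_mono) auto
  moreover have "12 * K * I = 12 * (K * I)" "48 * L * N = 12 * (L * (4 * N))" by simp_all
  ultimately have "12 * K * I \<le> 48 * L * N" by linarith
  then have "(12 * K * I) ^ 3 \<le> (48 * L * N) ^ 3" using assms by (intro power_mono) auto
  then show ?thesis using assms(1) by (meson ennreal_leI order_trans)
qed

section \<open>Decomposition of the wave into oscillatory integrals\<close>

context two_media
begin

lemma angle_map_inverse:
  assumes "0 \<le> \<theta>" "\<theta> \<le> pi" shows "angle_map q p (angle_map p q \<theta>) = \<theta>"
  unfolding angle_map_def[of q p] angle_map_props(5)[OF assms] using assms by (simp add: arcsin_sin)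

lemma angle_map_image: "0 \<le> \<theta> \<Longrightarrow> \<theta> \<le> pi \<Longrightarrow> angle_map p q \<theta> \<in> {0..edge}"
  using angle_map_mono[of \<theta> pi] angle_map_props(1) by auto

lemma angle_map_inverse_range:
  assumes "0 \<le> \<theta>" "\<theta> \<le> edge" shows "angle_map q p \<theta> \<in> {0..pi}"
proof -
  note u = fast_sin_le_1[OF assms]
  have "0 \<le> arcsin (p / q * sin (\<theta> / 2))" using arcsin_le_arcsin[of 0 "p / q * sin (\<theta> / 2)"] u by simp
  moreover have "arcsin (p / q * sin (\<theta> / 2)) \<le> pi / 2" using arcsin_ubound[of "p / q * sin (\<theta> / 2)"] u by simp
  ultimately show ?thesis unfolding angle_map_def by simp
qed

lemma continuous_angle_map_inverse: "continuous_on {0..edge} (angle_map q p)"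
proof -
  have "continuous_on {0..edge} (\<lambda>\<theta>. arcsin (p / q * sin (\<theta> / 2)))"
  proof (rule continuous_on_arcsin)
    show "continuous_on {0..edge} (\<lambda>\<theta>. p / q * sin (\<theta> / 2))"
      by (rule continuous_on_mult_left) (intro continuous_intros; simp)
    show "\<forall>\<theta>\<in>{0..edge}. - 1 \<le> p / q * sin (\<theta> / 2) \<and> p / q * sin (\<theta> / 2) \<le> 1"
    proof
      fix \<theta> assume "\<theta> \<in> {0..edge}"
      then have "0 \<le> \<theta>" "\<theta> \<le> edge" by auto
      from fast_sin_le_1[OF this] show "- 1 \<le> p / q * sin (\<theta> / 2) \<and> p / q * sin (\<theta> / 2) \<le> 1" by linarith
    qed
  qed
  then show ?thesis unfolding angle_map_def[abs_def] by (rule continuous_on_mult_left)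
qed

lemma angle_map_deriv_nonneg:
  assumes "0 \<le> \<theta>" "\<theta> \<le> pi" shows "0 \<le> angle_map_deriv p q \<theta>"
proof -
  have "0 \<le> cos (\<theta> / 2)" by (rule half_angle_bounds(3)[OF assms])
  moreover have "0 \<le> cos (angle_map p q \<theta> / 2)"
    by (rule half_angle_bounds(3)[OF angle_map_props(1,2)[OF assms]])
  ultimately show ?thesis unfolding angle_map_deriv_def using pq
    by (intro divide_nonneg_nonneg mult_nonneg_nonneg) auto
qed

lemma coefficient_bounds:
  assumes "0 \<le> \<theta>" "\<theta> \<le> pi"
  shows "norm (rcoef \<theta>) \<le> 2" "norm (tcoef \<theta>) \<le> 2"
proof -
  have "0 \<le> p / q * sin (\<theta> / 2)" using half_angle_bounds(1)[OF assms] pq by (intro mult_nonneg_nonneg) auto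
  then have Y: "norm (Y \<theta>) \<le> 1" by (rule norm_half_mult_le)
  have d: "p \<le> norm (complex_of_real p * X \<theta> + complex_of_real q * Y \<theta>)"
    by (rule channel_denominator(1)) (use pq assms in auto)
  show "norm (rcoef \<theta>) \<le> 2" "norm (tcoef \<theta>) \<le> 2" unfolding rcoef_def tcoef_def
    by (rule norm_scattering_le[OF pq norm_cis Y d])+
qed

lemma coefficient_bounds':
  assumes "0 \<le> \<theta>" "\<theta> \<le> edge"
  shows "norm (rcoef' \<theta>) \<le> 2" "norm (tcoef' \<theta>) \<le> 2"
proof -
  define x y where "x = X \<theta>" and "y = Y \<theta>"
  have \<theta>: "0 \<le> \<theta>" "\<theta> \<le> pi" using assms edge_bounds by auto
  have x: "norm x = 1" by (simp add: x_def)
  have y: "norm y = 1" unfolding y_def using fast_sin_le_1[OF assms] by (intro half_mult_propagating(3)) auto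
  have d: "p \<le> norm (complex_of_real q * y + complex_of_real p * x)"
    using channel_denominator(1)[of p q \<theta>] pq \<theta> by (simp add: x_def y_def add.commute)
  then have d0: "0 < norm (complex_of_real q * y + complex_of_real p * x)" using pq by linarith
  have "norm (complex_of_real q / y - complex_of_real p * x) \<le> norm (complex_of_real q / y) + norm (complex_of_real p * x)" by (rule norm_triangle_ineq4)
  also have "\<dots> = q + p" using pq x y by (simp add: norm_divide norm_mult)
  also have "\<dots> \<le> 2 * norm (complex_of_real q * y + complex_of_real p * x)" using pq d by linarith
  finally show "norm (rcoef' \<theta>) \<le> 2"
    unfolding rcoef'_def reflection_def x_def[symmetric] y_def[symmetric] norm_divide using d0 by (simp only: pos_divide_le_eq)
  have "norm (complex_of_real q * (y + 1 / y)) \<le> q * 2"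
    unfolding norm_mult using pq norm_triangle_ineq[of y "1 / y"] y by (simp add: norm_divide)
  also have "\<dots> \<le> 2 * norm (complex_of_real q * y + complex_of_real p * x)" using pq d by linarith
  finally show "norm (tcoef' \<theta>) \<le> 2"
    unfolding tcoef'_def transmission_def x_def[symmetric] y_def[symmetric] norm_divide using d0 by (simp only: pos_divide_le_eq)
qed

lemma transmission_jacobian':
  "0 \<le> \<theta> \<Longrightarrow> \<theta> \<le> pi \<Longrightarrow> tcoef' (angle_map p q \<theta>) = angle_map_deriv p q \<theta> * tcoef (angle_map p q \<theta>)"
  using transmission_jacobian unfolding tcoef_def tcoef'_def by blast

text \<open>Beyond the critical angle \<open>(Y \<theta>)\<^sup>2 = - decay \<theta>\<close>, so the
  transmitted wave is a power of a real function at every site.\<close>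

definition decay :: "real \<Rightarrow> real" where
  "decay \<theta> = (p / q * sin (\<theta> / 2) - sqrt ((p / q * sin (\<theta> / 2))\<^sup>2 - 1))\<^sup>2"

lemma Y_decay:
  assumes "edge \<le> \<theta>" "\<theta> \<le> pi"
  shows "((Y \<theta>)\<^sup>2) ^ n = complex_of_real ((- decay \<theta>) ^ n)" "0 \<le> decay \<theta> \<and> decay \<theta> \<le> 1"
proof -
  note e = half_mult_evanescent[OF fast_sin_ge_1[OF assms]]
  have "(Y \<theta>)\<^sup>2 = complex_of_real (- decay \<theta>)"
    unfolding e(1) decay_def by (simp add: power_mult_distrib flip: of_real_diff of_real_power)
  then show "((Y \<theta>)\<^sup>2) ^ n = complex_of_real ((- decay \<theta>) ^ n)" by (simp only: of_real_power)
  show "0 \<le> decay \<theta> \<and> decay \<theta> \<le> 1" using e(3,4) unfolding decay_def by (simp add: power_le_one)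
qed

text \<open>\<open>\<sigma> - sqrt (\<sigma>\<^sup>2 - 1)\<close> is the reciprocal of the
  increasing function \<open>\<sigma> + sqrt (\<sigma>\<^sup>2 - 1)\<close>.\<close>

lemma decay_antimono:
  assumes "edge \<le> s" "s \<le> t" "t \<le> pi" shows "decay t \<le> decay s"
proof -
  define \<sigma> \<tau> where "\<sigma> = p / q * sin (s / 2)" and "\<tau> = p / q * sin (t / 2)"
  have \<sigma>: "1 \<le> \<sigma>" unfolding \<sigma>_def using assms by (intro fast_sin_ge_1) auto
  have "sin (s / 2) \<le> sin (t / 2)" using assms edge_bounds by (intro sin_monotone_2pi_le) auto
  then have st: "\<sigma> \<le> \<tau>" unfolding \<sigma>_def \<tau>_def using pq by (intro mult_left_mono) auto
  have inv: "u - sqrt (u\<^sup>2 - 1) = 1 / (u + sqrt (u\<^sup>2 - 1))" if "1 \<le> u" for u :: real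
  proof -
    have "1 \<le> u\<^sup>2" using that by simp
    then have "(u - sqrt (u\<^sup>2 - 1)) * (u + sqrt (u\<^sup>2 - 1)) = 1"
      by (simp add: algebra_simps power2_eq_square[symmetric])
    moreover have "u + sqrt (u\<^sup>2 - 1) > 0" using that \<open>1 \<le> u\<^sup>2\<close> by (intro add_pos_nonneg) auto
    ultimately show ?thesis by (simp add: field_simps)
  qed
  have "\<sigma>\<^sup>2 \<le> \<tau>\<^sup>2" using \<sigma> st by (intro power_mono) auto
  then have "\<sigma> + sqrt (\<sigma>\<^sup>2 - 1) \<le> \<tau> + sqrt (\<tau>\<^sup>2 - 1)" using st by (intro add_mono real_sqrt_le_mono) auto
  moreover have "0 < \<sigma> + sqrt (\<sigma>\<^sup>2 - 1)" using \<sigma> by (intro add_pos_nonneg) auto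
  ultimately have "\<tau> - sqrt (\<tau>\<^sup>2 - 1) \<le> \<sigma> - sqrt (\<sigma>\<^sup>2 - 1)"
    using \<sigma> st inv[of \<sigma>] inv[of \<tau>] by (simp add: frac_le)
  moreover have "0 < \<tau> - sqrt (\<tau>\<^sup>2 - 1)" using \<sigma> st by (intro half_mult_evanescent(3)) auto
  ultimately show ?thesis unfolding decay_def \<sigma>_def[symmetric] \<tau>_def[symmetric] by (intro power_mono) auto
qed

lemma continuous_decay: "continuous_on {edge..pi} decay"
proof -
  have "continuous_on {edge..pi} (\<lambda>\<theta>. p / q * sin (\<theta> / 2))"
    by (rule continuous_on_mult_left) (intro continuous_intros; simp)
  then show ?thesis unfolding decay_def[abs_def] by (intro continuous_intros; simp)
qed

lemma X_power: "((X \<theta>)\<^sup>2) ^ n = cis (real n * \<theta>)" "(1 / (X \<theta>)\<^sup>2) ^ n = cis (- real n * \<theta>)"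
proof -
  have e: "(X \<theta>)\<^sup>2 = cis \<theta>" by (simp add: power2_eq_square cis_mult)
  show "((X \<theta>)\<^sup>2) ^ n = cis (real n * \<theta>)" unfolding e by (rule Complex.DeMoivre)
  have "1 / (X \<theta>)\<^sup>2 = cis (- \<theta>)" unfolding e by (simp only: cis_inverse[symmetric] inverse_eq_divide)
  then show "(1 / (X \<theta>)\<^sup>2) ^ n = cis (- real n * \<theta>)" using Complex.DeMoivre[of "- \<theta>" n] by simp
qed

lemma dispersion_match:
  assumes "0 \<le> \<theta>" "\<theta> \<le> pi"
  shows "- 4 * p\<^sup>2 * (sin (angle_map p q \<theta> / 2))\<^sup>2 = - 4 * q\<^sup>2 * (sin (\<theta> / 2))\<^sup>2"
  unfolding angle_map_props(3)[OF assms] power_mult_distrib power_divide using pq by simp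

context
  fixes F1 F2 :: "real \<Rightarrow> complex"
  assumes F1: "continuous_on {0..pi} F1" and F2: "continuous_on {0..pi} F2"
begin

text \<open>\<open>F1\<close> and \<open>F2\<close> are the spectral amplitudes on the states
  incident from the left and from the right.\<close>

definition "wave t j = oscillation (p\<^sup>2) 0 pi t (\<lambda>\<theta>. channel p q \<theta> j * F1 \<theta>) + oscillation (q\<^sup>2) 0 pi t (\<lambda>\<theta>. channel q p \<theta> (- j) * F2 \<theta>)"

text \<open>Each amplitude is written in the angle of the medium in which its wave is observed,
  because only there the phase is linear in the site, as the uniform kernel bound demands.\<close>

definition "amp_transmitted_left \<theta> = tcoef \<theta> * F2 (angle_map q p \<theta>)"
definition "amp_transmitted_right \<theta> = tcoef' (angle_map p q \<theta>) * F1 (angle_map p q \<theta>)"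
definition "amp_reflected_right \<theta> = rcoef' (angle_map p q \<theta>) * F2 \<theta>"

lemma edge_subset: "{0..edge} \<subseteq> {0..pi}" "{edge..pi} \<subseteq> {0..pi}" using edge_bounds by auto

lemma continuous_amps:
  "continuous_on {0..pi} (\<lambda>\<theta>. rcoef \<theta> * F1 \<theta>)" "continuous_on {0..pi} (\<lambda>\<theta>. tcoef \<theta> * F1 \<theta>)"
  "continuous_on {0..edge} amp_transmitted_left" "continuous_on {0..pi} amp_transmitted_right" "continuous_on {0..pi} amp_reflected_right"
proof -
  note cc = continuous_coefficients
  show "continuous_on {0..pi} (\<lambda>\<theta>. rcoef \<theta> * F1 \<theta>)" "continuous_on {0..pi} (\<lambda>\<theta>. tcoef \<theta> * F1 \<theta>)"
    by (intro continuous_intros cc F1)+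
  have "continuous_on {0..edge} (\<lambda>\<theta>. F2 (angle_map q p \<theta>))"
    by (rule continuous_on_compose2[OF F2 continuous_angle_map_inverse]) (use angle_map_inverse_range in auto)
  then show "continuous_on {0..edge} amp_transmitted_left" unfolding amp_transmitted_left_def[abs_def]
    by (intro continuous_intros continuous_on_subset[OF cc(2) edge_subset(1)])
  have c: "continuous_on {0..pi} (\<lambda>\<theta>. h (angle_map p q \<theta>))" if "continuous_on {0..pi} h" for h :: "real \<Rightarrow> complex"
    by (rule continuous_on_compose2[OF that continuous_angle_map]) (use angle_map_props(1,2) in auto)
  show "continuous_on {0..pi} amp_transmitted_right" "continuous_on {0..pi} amp_reflected_right"
    unfolding amp_transmitted_right_def[abs_def] amp_reflected_right_def[abs_def] by (intro continuous_intros c cc F1 F2)+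
qed

text \<open>Incident and reflected wave stay in the fast angle, and the wave transmitted from the
  slow side is moved to it. No Jacobian is left over, since it is contained in the slow transmission
  coefficient.\<close>

lemma wave_left:
  assumes "j < 0"
  defines "n \<equiv> nat (- j)"
  shows "wave t j = oscillation (p\<^sup>2) 0 pi t (\<lambda>\<theta>. cis (- real n * \<theta>) * F1 \<theta>)
    + oscillation (p\<^sup>2) 0 pi t (\<lambda>\<theta>. cis (real n * \<theta>) * (rcoef \<theta> * F1 \<theta>))
    + oscillation (p\<^sup>2) 0 edge t (\<lambda>\<theta>. cis (real n * \<theta>) * amp_transmitted_left \<theta>)"
proof -
  have cf: "channel p q \<theta> j = cis (- real n * \<theta>) + rcoef \<theta> * cis (real n * \<theta>)" for \<theta>
    using channel_fast(1)[of j \<theta>] assms(1) unfolding X_power by (simp add: n_def)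
  have "oscillation (p\<^sup>2) 0 pi t (\<lambda>\<theta>. channel p q \<theta> j * F1 \<theta>)
    = oscillation (p\<^sup>2) 0 pi t (\<lambda>\<theta>. cis (- real n * \<theta>) * F1 \<theta> + cis (real n * \<theta>) * (rcoef \<theta> * F1 \<theta>))"
    unfolding cf distrib_right by (simp only: mult.assoc mult.left_commute)
  also have "\<dots> = oscillation (p\<^sup>2) 0 pi t (\<lambda>\<theta>. cis (- real n * \<theta>) * F1 \<theta>)
    + oscillation (p\<^sup>2) 0 pi t (\<lambda>\<theta>. cis (real n * \<theta>) * (rcoef \<theta> * F1 \<theta>))"
    by (intro oscillation_add continuous_intros F1 continuous_amps)
  finally have 1: "oscillation (p\<^sup>2) 0 pi t (\<lambda>\<theta>. channel p q \<theta> j * F1 \<theta>) = \<dots>" .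
  define H where "H \<theta> = cis (t * (- 4 * p\<^sup>2 * (sin (\<theta> / 2))\<^sup>2)) * (cis (real n * \<theta>) * amp_transmitted_left \<theta>)" for \<theta>
  have cH: "continuous_on {0..edge} H" unfolding H_def[abs_def] by (intro continuous_intros continuous_amps; simp)
  have "((\<lambda>\<theta>. cis (t * (- 4 * q\<^sup>2 * (sin (\<theta> / 2))\<^sup>2)) * (channel q p \<theta> (- j) * F2 \<theta>)) has_integral integral {0..edge} H) {0..pi}"
  proof (rule has_integral_eq[OF _ has_integral_angle_substitution[OF cH]])
    fix \<theta> assume "\<theta> \<in> {0..pi}"
    then have \<theta>: "0 \<le> \<theta>" "\<theta> \<le> pi" by auto
    show "angle_map_deriv p q \<theta> *\<^sub>R H (angle_map p q \<theta>) = cis (t * (- 4 * q\<^sup>2 * (sin (\<theta> / 2))\<^sup>2)) * (channel q p \<theta> (- j) * F2 \<theta>)"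
      using channel_slow(2)[OF \<theta>, of "- j"] assms(1)
      unfolding H_def amp_transmitted_left_def dispersion_match[OF \<theta>] angle_map_inverse[OF \<theta>] X_power n_def[symmetric]
      by (simp add: scaleR_conv_of_real mult_ac)
  qed
  then have "oscillation (q\<^sup>2) 0 pi t (\<lambda>\<theta>. channel q p \<theta> (- j) * F2 \<theta>) = oscillation (p\<^sup>2) 0 edge t (\<lambda>\<theta>. cis (real n * \<theta>) * amp_transmitted_left \<theta>)"
    unfolding oscillation_def H_def by (rule integral_unique)
  then show ?thesis unfolding wave_def 1 by simp
qed

text \<open>Only energies in the slow band can be moved to the slow angle, where they give a plane
  wave. The fast angles beyond \<open>edge\<close> carry the evanescent wave and remain as a
  separate integral.\<close>

lemma wave_right:
  assumes "0 < j"
  defines "n \<equiv> nat j"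
  shows "wave t j = (oscillation (q\<^sup>2) 0 pi t (\<lambda>\<theta>. cis (real n * \<theta>) * amp_transmitted_right \<theta>)
    + oscillation (p\<^sup>2) edge pi t (\<lambda>\<theta>. complex_of_real ((- decay \<theta>) ^ n) * (tcoef \<theta> * F1 \<theta>)))
    + (oscillation (q\<^sup>2) 0 pi t (\<lambda>\<theta>. cis (- real n * \<theta>) * F2 \<theta>)
    + oscillation (q\<^sup>2) 0 pi t (\<lambda>\<theta>. cis (real n * \<theta>) * amp_reflected_right \<theta>))"
proof -
  have "oscillation (q\<^sup>2) 0 pi t (\<lambda>\<theta>. channel q p \<theta> (- j) * F2 \<theta>)
    = oscillation (q\<^sup>2) 0 pi t (\<lambda>\<theta>. cis (- real n * \<theta>) * F2 \<theta> + cis (real n * \<theta>) * amp_reflected_right \<theta>)"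
  proof (rule oscillation_cong)
    fix \<theta> assume "\<theta> \<in> {0..pi}"
    then have \<theta>: "0 \<le> \<theta>" "\<theta> \<le> pi" by auto
    have cs: "channel q p \<theta> (- j) = cis (- real n * \<theta>) + rcoef' (angle_map p q \<theta>) * cis (real n * \<theta>)"
      using channel_slow(1)[OF \<theta>, of "- j"] assms(1) unfolding angle_map_props(6)[OF \<theta>] X_power by (simp add: n_def)
    show "channel q p \<theta> (- j) * F2 \<theta> = cis (- real n * \<theta>) * F2 \<theta> + cis (real n * \<theta>) * amp_reflected_right \<theta>"
      unfolding cs amp_reflected_right_def distrib_right by (simp only: mult.assoc mult.left_commute)
  qed
  also have "\<dots> = oscillation (q\<^sup>2) 0 pi t (\<lambda>\<theta>. cis (- real n * \<theta>) * F2 \<theta>)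
    + oscillation (q\<^sup>2) 0 pi t (\<lambda>\<theta>. cis (real n * \<theta>) * amp_reflected_right \<theta>)"
    by (intro oscillation_add continuous_intros F2 continuous_amps)
  finally have 2: "oscillation (q\<^sup>2) 0 pi t (\<lambda>\<theta>. channel q p \<theta> (- j) * F2 \<theta>) = \<dots>" .
  let ?G = "\<lambda>\<theta>. cis (t * (- 4 * p\<^sup>2 * (sin (\<theta> / 2))\<^sup>2)) * (channel p q \<theta> j * F1 \<theta>)"
  have cf: "channel p q \<theta> j = tcoef \<theta> * ((Y \<theta>)\<^sup>2) ^ n" for \<theta>
    using channel_fast(2)[of j] assms(1) by (simp add: n_def)
  have cG: "continuous_on {0..pi} ?G" using pq by (intro continuous_intros continuous_scattering(3) F1) auto
  have "integral {0..pi} ?G = integral {0..edge} ?G + integral {edge..pi} ?G"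
    by (rule Henstock_Kurzweil_Integration.integral_combine[symmetric])
       (use edge_bounds integrable_continuous_real[OF cG] in auto)
  also have "integral {edge..pi} ?G = oscillation (p\<^sup>2) edge pi t (\<lambda>\<theta>. complex_of_real ((- decay \<theta>) ^ n) * (tcoef \<theta> * F1 \<theta>))"
    unfolding oscillation_def
    by (rule Henstock_Kurzweil_Integration.integral_cong) (simp only: cf Y_decay(1) atLeastAtMost_iff mult_ac)
  also have "integral {0..edge} ?G = oscillation (q\<^sup>2) 0 pi t (\<lambda>\<theta>. cis (real n * \<theta>) * amp_transmitted_right \<theta>)"
  proof -
    have "((\<lambda>\<theta>. cis (t * (- 4 * q\<^sup>2 * (sin (\<theta> / 2))\<^sup>2)) * (cis (real n * \<theta>) * amp_transmitted_right \<theta>)) has_integral integral {0..edge} ?G) {0..pi}"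
    proof (rule has_integral_eq[OF _ has_integral_angle_substitution[OF continuous_on_subset[OF cG edge_subset(1)]]])
      fix \<theta> assume "\<theta> \<in> {0..pi}"
      then have \<theta>: "0 \<le> \<theta>" "\<theta> \<le> pi" by auto
      show "angle_map_deriv p q \<theta> *\<^sub>R ?G (angle_map p q \<theta>) = cis (t * (- 4 * q\<^sup>2 * (sin (\<theta> / 2))\<^sup>2)) * (cis (real n * \<theta>) * amp_transmitted_right \<theta>)"
        unfolding cf amp_transmitted_right_def transmission_jacobian'[OF \<theta>] dispersion_match[OF \<theta>] angle_map_props(6)[OF \<theta>] X_power
        by (simp add: scaleR_conv_of_real mult_ac)
    qed
    then show ?thesis unfolding oscillation_def by (rule integral_unique[symmetric])
  qed
  finally have 1: "oscillation (p\<^sup>2) 0 pi t (\<lambda>\<theta>. channel p q \<theta> j * F1 \<theta>) =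
     oscillation (q\<^sup>2) 0 pi t (\<lambda>\<theta>. cis (real n * \<theta>) * amp_transmitted_right \<theta>)
    + oscillation (p\<^sup>2) edge pi t (\<lambda>\<theta>. complex_of_real ((- decay \<theta>) ^ n) * (tcoef \<theta> * F1 \<theta>))"
    unfolding oscillation_def[of _ _ _ _ "\<lambda>\<theta>. channel p q \<theta> j * F1 \<theta>"] .
  show ?thesis unfolding wave_def 1 2 by simp
qed

text \<open>The derivative of \<open>angle_map\<close> can vanish at \<pi>, so a change of angle is
  not bounded in L2 as such. The transmitted amplitudes compensate: the derivative times the norm of
  \<open>tcoef\<close> is the norm of \<open>tcoef'\<close>, and both coefficients are at most
  2.\<close>

lemma square_integral_bounds:
  defines "N1 \<equiv> integral {0..pi} (\<lambda>\<theta>. (norm (F1 \<theta>))\<^sup>2)" and "N2 \<equiv> integral {0..pi} (\<lambda>\<theta>. (norm (F2 \<theta>))\<^sup>2)"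
  shows "0 \<le> N1" "0 \<le> N2"
    "integral {0..pi} (\<lambda>\<theta>. (norm (rcoef \<theta> * F1 \<theta>))\<^sup>2) \<le> 4 * N1"
    "integral {edge..pi} (\<lambda>\<theta>. (norm (tcoef \<theta> * F1 \<theta>))\<^sup>2) \<le> 4 * N1"
    "integral {0..edge} (\<lambda>\<theta>. (norm (amp_transmitted_left \<theta>))\<^sup>2) \<le> 4 * N2"
    "integral {0..pi} (\<lambda>\<theta>. (norm (amp_transmitted_right \<theta>))\<^sup>2) \<le> 4 * N1"
    "integral {0..pi} (\<lambda>\<theta>. (norm (amp_reflected_right \<theta>))\<^sup>2) \<le> 4 * N2"
proof -
  have sq: "(norm (u * v))\<^sup>2 \<le> 4 * (norm v)\<^sup>2" if "norm u \<le> 2" for u v :: complex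
  proof -
    have "(norm u)\<^sup>2 \<le> 2\<^sup>2" using that by (intro power_mono) auto
    then show ?thesis unfolding norm_mult power_mult_distrib by (intro mult_right_mono) auto
  qed
  have i1: "(\<lambda>\<theta>. (norm (F1 \<theta>))\<^sup>2) integrable_on {0..pi}" "(\<lambda>\<theta>. (norm (F2 \<theta>))\<^sup>2) integrable_on {0..pi}"
    by (intro integrable_continuous_real continuous_intros F1 F2)+
  show N: "0 \<le> N1" "0 \<le> N2" unfolding N1_def N2_def by (intro Henstock_Kurzweil_Integration.integral_nonneg i1; simp)+
  have le: "integral {c..d} f \<le> 4 * integral {c..d} g"
    if "continuous_on {c..d} f" "continuous_on {c..d} g" "\<And>x. x \<in> {c..d} \<Longrightarrow> f x \<le> 4 * g x" for c d and f g :: "real \<Rightarrow> real"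
  proof -
    have "integral {c..d} f \<le> integral {c..d} (\<lambda>x. 4 * g x)"
      by (intro Henstock_Kurzweil_Integration.integral_le integrable_continuous_real continuous_intros that)
    then show ?thesis by simp
  qed
  have sub: "integral {edge..pi} (\<lambda>\<theta>. (norm (F1 \<theta>))\<^sup>2) \<le> N1" "integral {0..edge} (\<lambda>\<theta>. (norm (F1 \<theta>))\<^sup>2) \<le> N1"
    unfolding N1_def using i1(1) edge_bounds
    by (auto intro!: integral_subset_le integrable_subinterval_real[OF i1(1)])
  show "integral {0..pi} (\<lambda>\<theta>. (norm (rcoef \<theta> * F1 \<theta>))\<^sup>2) \<le> 4 * N1"
    unfolding N1_def by (intro le continuous_intros continuous_amps F1 sq coefficient_bounds) auto
  have "integral {edge..pi} (\<lambda>\<theta>. (norm (tcoef \<theta> * F1 \<theta>))\<^sup>2) \<le> 4 * integral {edge..pi} (\<lambda>\<theta>. (norm (F1 \<theta>))\<^sup>2)"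
    using edge_bounds
    by (intro le continuous_intros continuous_on_subset[OF continuous_amps(2) edge_subset(2)] continuous_on_subset[OF F1 edge_subset(2)] sq coefficient_bounds) auto
  then show "integral {edge..pi} (\<lambda>\<theta>. (norm (tcoef \<theta> * F1 \<theta>))\<^sup>2) \<le> 4 * N1" using sub(1) by linarith
  show "integral {0..pi} (\<lambda>\<theta>. (norm (amp_reflected_right \<theta>))\<^sup>2) \<le> 4 * N2"
    unfolding N2_def
  proof (intro le continuous_intros continuous_amps F2)
    show "(norm (amp_reflected_right \<theta>))\<^sup>2 \<le> 4 * (norm (F2 \<theta>))\<^sup>2" if "\<theta> \<in> {0..pi}" for \<theta>
      unfolding amp_reflected_right_def using angle_map_image[of \<theta>] that by (intro sq coefficient_bounds') auto
  qed
  have tt: "norm (tcoef' (angle_map p q \<theta>)) = angle_map_deriv p q \<theta> * norm (tcoef (angle_map p q \<theta>))"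
    "norm (tcoef' (angle_map p q \<theta>)) \<le> 2" "norm (tcoef (angle_map p q \<theta>)) \<le> 2" "0 \<le> angle_map_deriv p q \<theta>" if "\<theta> \<in> {0..pi}" for \<theta>
  proof -
    have \<theta>: "0 \<le> \<theta>" "\<theta> \<le> pi" using that by auto
    show n: "0 \<le> angle_map_deriv p q \<theta>" by (rule angle_map_deriv_nonneg[OF \<theta>])
    show "norm (tcoef' (angle_map p q \<theta>)) = angle_map_deriv p q \<theta> * norm (tcoef (angle_map p q \<theta>))"
      unfolding transmission_jacobian'[OF \<theta>] norm_mult using n by simp
    show "norm (tcoef' (angle_map p q \<theta>)) \<le> 2"
      using angle_map_image[OF \<theta>] by (intro coefficient_bounds'(2)) auto
    show "norm (tcoef (angle_map p q \<theta>)) \<le> 2" by (rule coefficient_bounds(2)[OF angle_map_props(1,2)[OF \<theta>]])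
  qed
  have c3: "continuous_on {0..edge} (\<lambda>\<theta>. (norm (amp_transmitted_left \<theta>))\<^sup>2)" by (intro continuous_intros continuous_amps)
  show "integral {0..edge} (\<lambda>\<theta>. (norm (amp_transmitted_left \<theta>))\<^sup>2) \<le> 4 * N2"
  proof (rule has_integral_le[OF has_integral_angle_substitution[OF c3]])
    show "((\<lambda>\<theta>. 4 * (norm (F2 \<theta>))\<^sup>2) has_integral 4 * N2) {0..pi}"
      unfolding N2_def by (intro has_integral_mult_right integrable_integral i1)
    fix \<theta> assume \<theta>: "\<theta> \<in> {0..pi}"
    note t = tt[OF \<theta>]
    have "angle_map_deriv p q \<theta> *\<^sub>R (norm (amp_transmitted_left (angle_map p q \<theta>)))\<^sup>2
       = (angle_map_deriv p q \<theta> * norm (tcoef (angle_map p q \<theta>))) * norm (tcoef (angle_map p q \<theta>)) * (norm (F2 \<theta>))\<^sup>2"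
      using \<theta> by (simp add: amp_transmitted_left_def angle_map_inverse norm_mult power2_eq_square mult_ac)
    also have "\<dots> \<le> 2 * 2 * (norm (F2 \<theta>))\<^sup>2"
      unfolding t(1)[symmetric] using t by (intro mult_right_mono mult_mono) auto
    finally show "angle_map_deriv p q \<theta> *\<^sub>R (norm (amp_transmitted_left (angle_map p q \<theta>)))\<^sup>2 \<le> 4 * (norm (F2 \<theta>))\<^sup>2" by simp
  qed
  have c1: "continuous_on {0..edge} (\<lambda>\<theta>. 4 * (norm (F1 \<theta>))\<^sup>2)"
    by (intro continuous_intros continuous_on_subset[OF F1 edge_subset(1)])
  have "integral {0..pi} (\<lambda>\<theta>. (norm (amp_transmitted_right \<theta>))\<^sup>2) \<le> integral {0..edge} (\<lambda>\<theta>. 4 * (norm (F1 \<theta>))\<^sup>2)"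
  proof (rule has_integral_le[OF _ has_integral_angle_substitution[OF c1]])
    show "((\<lambda>\<theta>. (norm (amp_transmitted_right \<theta>))\<^sup>2) has_integral integral {0..pi} (\<lambda>\<theta>. (norm (amp_transmitted_right \<theta>))\<^sup>2)) {0..pi}"
      by (intro integrable_integral integrable_continuous_real continuous_intros continuous_amps)
    fix \<theta> assume \<theta>: "\<theta> \<in> {0..pi}"
    note t = tt[OF \<theta>]
    have "(norm (amp_transmitted_right \<theta>))\<^sup>2 = norm (tcoef' (angle_map p q \<theta>)) * (angle_map_deriv p q \<theta> * norm (tcoef (angle_map p q \<theta>))) * (norm (F1 (angle_map p q \<theta>)))\<^sup>2"
      unfolding t(1)[symmetric] by (simp add: amp_transmitted_right_def norm_mult power2_eq_square mult_ac)
    also have "\<dots> \<le> 2 * (angle_map_deriv p q \<theta> * 2) * (norm (F1 (angle_map p q \<theta>)))\<^sup>2"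
      using t by (intro mult_right_mono mult_mono mult_left_mono) auto
    finally show "(norm (amp_transmitted_right \<theta>))\<^sup>2 \<le> angle_map_deriv p q \<theta> *\<^sub>R (4 * (norm (F1 (angle_map p q \<theta>)))\<^sup>2)" by simp
  qed
  then show "integral {0..pi} (\<lambda>\<theta>. (norm (amp_transmitted_right \<theta>))\<^sup>2) \<le> 4 * N1" using sub(2) by simp
qed

lemma strichartz_wave:
  defines "N \<equiv> integral {0..pi} (\<lambda>\<theta>. (norm (F1 \<theta>))\<^sup>2) + integral {0..pi} (\<lambda>\<theta>. (norm (F2 \<theta>))\<^sup>2)"
    and "L \<equiv> 104 * (2 * p\<^sup>2) powr (- 1 / 3) + 104 * (2 * q\<^sup>2) powr (- 1 / 3)"
  shows "(\<integral>\<^sup>+ t. (SUP j\<in>{j. j \<noteq> 0}. ennreal (norm (wave t j) ^ 6)) \<partial>lborel) \<le> ennreal (28672 * (48 * L * N) ^ 3)"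
proof -
  define S1 where "S1 t = (SUP n. ennreal (norm (oscillation (p\<^sup>2) 0 pi t (\<lambda>\<theta>. cis (- real n * \<theta>) * F1 \<theta>)) ^ 6))" for t
  define S2 where "S2 t = (SUP n. ennreal (norm (oscillation (p\<^sup>2) 0 pi t (\<lambda>\<theta>. cis (real n * \<theta>) * (rcoef \<theta> * F1 \<theta>))) ^ 6))" for t
  define S3 where "S3 t = (SUP n. ennreal (norm (oscillation (p\<^sup>2) 0 edge t (\<lambda>\<theta>. cis (real n * \<theta>) * amp_transmitted_left \<theta>)) ^ 6))" for t
  define S4 where "S4 t = (SUP n. ennreal (norm (oscillation (q\<^sup>2) 0 pi t (\<lambda>\<theta>. cis (real n * \<theta>) * amp_transmitted_right \<theta>)) ^ 6))" for t
  define S5 where "S5 t = (SUP n. ennreal (norm (oscillation (p\<^sup>2) edge pi t (\<lambda>\<theta>. complex_of_real ((- decay \<theta>) ^ n) * (tcoef \<theta> * F1 \<theta>))) ^ 6))" for t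
  define S6 where "S6 t = (SUP n. ennreal (norm (oscillation (q\<^sup>2) 0 pi t (\<lambda>\<theta>. cis (- real n * \<theta>) * F2 \<theta>)) ^ 6))" for t
  define S7 where "S7 t = (SUP n. ennreal (norm (oscillation (q\<^sup>2) 0 pi t (\<lambda>\<theta>. cis (real n * \<theta>) * amp_reflected_right \<theta>)) ^ 6))" for t
  note S_defs = S1_def S2_def S3_def S4_def S5_def S6_def S7_def
  let ?B = "ennreal ((48 * L * N) ^ 3)"
  note cedge = continuous_on_subset[OF continuous_amps(2) edge_subset(2)]
  have m: "S1 \<in> borel_measurable lborel" "S2 \<in> borel_measurable lborel" "S3 \<in> borel_measurable lborel" "S4 \<in> borel_measurable lborel"
    "S5 \<in> borel_measurable lborel" "S6 \<in> borel_measurable lborel" "S7 \<in> borel_measurable lborel"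
    unfolding S_defs[abs_def]
    by (rule measurable_SUP_oscillation, intro continuous_intros continuous_amps F1 F2 cedge continuous_decay)+
  note sb = square_integral_bounds
  have p2: "0 < p\<^sup>2" "0 < q\<^sup>2" using pq by auto
  have Kp: "0 \<le> 104 * (2 * p\<^sup>2) powr (- 1 / 3)" "104 * (2 * p\<^sup>2) powr (- 1 / 3) \<le> L"
    "0 \<le> 104 * (2 * q\<^sup>2) powr (- 1 / 3)" "104 * (2 * q\<^sup>2) powr (- 1 / 3) \<le> L" by (simp_all add: L_def)
  have nn: "0 \<le> integral {c..d} (\<lambda>\<theta>. (norm (f \<theta>))\<^sup>2)" if "continuous_on {c..d} f" for c d and f :: "real \<Rightarrow> complex"
    by (intro Henstock_Kurzweil_Integration.integral_nonneg integrable_continuous_real continuous_intros that) simp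
  have e: "0 \<le> edge" "edge \<le> pi" by (rule edge_bounds)+
  have i1: "(\<integral>\<^sup>+ t. S1 t \<partial>lborel) \<le> ?B"
    by (rule nn_integral_le_of_square_integral[OF strichartz_oscillatory[of 0 pi "p\<^sup>2" F1 "\<lambda>n. - real n", folded oscillation_def, folded S1_def]])
       (use p2 F1 Kp nn[OF F1] sb(1,2) in \<open>simp_all add: N_def\<close>)
  have i2: "(\<integral>\<^sup>+ t. S2 t \<partial>lborel) \<le> ?B"
    by (rule nn_integral_le_of_square_integral[OF strichartz_oscillatory[of 0 pi "p\<^sup>2" "\<lambda>\<theta>. rcoef \<theta> * F1 \<theta>" "\<lambda>n. real n", folded oscillation_def, folded S2_def]])
       (use p2 continuous_amps Kp nn[OF continuous_amps(1)] sb(1-3) in \<open>simp_all only: N_def, simp_all\<close>)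
  have i3: "(\<integral>\<^sup>+ t. S3 t \<partial>lborel) \<le> ?B"
    by (rule nn_integral_le_of_square_integral[OF strichartz_oscillatory[of 0 edge "p\<^sup>2" amp_transmitted_left "\<lambda>n. real n", folded oscillation_def, folded S3_def]])
       (use p2 e continuous_amps Kp nn[OF continuous_amps(3)] sb(1,2,5) in \<open>simp_all add: N_def\<close>)
  have i4: "(\<integral>\<^sup>+ t. S4 t \<partial>lborel) \<le> ?B"
    by (rule nn_integral_le_of_square_integral[OF strichartz_oscillatory[of 0 pi "q\<^sup>2" amp_transmitted_right "\<lambda>n. real n", folded oscillation_def, folded S4_def]])
       (use p2 e continuous_amps Kp nn[OF continuous_amps(4)] sb(1,2,6) in \<open>simp_all add: N_def\<close>)
  have i5: "(\<integral>\<^sup>+ t. S5 t \<partial>lborel) \<le> ?B"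
    by (rule nn_integral_le_of_square_integral[OF strichartz_evanescent[of edge pi "p\<^sup>2" "\<lambda>\<theta>. tcoef \<theta> * F1 \<theta>" decay "\<lambda>n. n", folded oscillation_def, folded S5_def]])
       (use p2 e cedge Kp nn[OF cedge] sb(1,2,4) continuous_decay Y_decay(2) decay_antimono in \<open>simp_all add: N_def\<close>)
  have i6: "(\<integral>\<^sup>+ t. S6 t \<partial>lborel) \<le> ?B"
    by (rule nn_integral_le_of_square_integral[OF strichartz_oscillatory[of 0 pi "q\<^sup>2" F2 "\<lambda>n. - real n", folded oscillation_def, folded S6_def]])
       (use p2 F2 Kp nn[OF F2] sb(1,2) in \<open>simp_all add: N_def\<close>)
  have i7: "(\<integral>\<^sup>+ t. S7 t \<partial>lborel) \<le> ?B"
    by (rule nn_integral_le_of_square_integral[OF strichartz_oscillatory[of 0 pi "q\<^sup>2" amp_reflected_right "\<lambda>n. real n", folded oscillation_def, folded S7_def]])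
       (use p2 e continuous_amps Kp nn[OF continuous_amps(5)] sb(1,2,7) in \<open>simp_all add: N_def\<close>)
  let ?S = "\<lambda>t. S1 t + (S2 t + (S3 t + (S4 t + (S5 t + (S6 t + S7 t)))))"
  \<comment> \<open>Two nested uses of the inequality for sixth powers cost 64 * 64 = 4096. Each of
    the seven suprema obeys the same bound, and 4096 * 7 = 28672.\<close>
  have pw: "ennreal (norm (wave t j) ^ 6) \<le> ennreal 4096 * ?S t" if "j \<noteq> 0" for t j
  proof -
    define n where "n = nat \<bar>j\<bar>"
    have up: "ennreal (norm (oscillation (p\<^sup>2) 0 pi t (\<lambda>\<theta>. cis (- real n * \<theta>) * F1 \<theta>)) ^ 6) \<le> S1 t"
      "ennreal (norm (oscillation (p\<^sup>2) 0 pi t (\<lambda>\<theta>. cis (real n * \<theta>) * (rcoef \<theta> * F1 \<theta>))) ^ 6) \<le> S2 t"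
      "ennreal (norm (oscillation (p\<^sup>2) 0 edge t (\<lambda>\<theta>. cis (real n * \<theta>) * amp_transmitted_left \<theta>)) ^ 6) \<le> S3 t"
      "ennreal (norm (oscillation (q\<^sup>2) 0 pi t (\<lambda>\<theta>. cis (real n * \<theta>) * amp_transmitted_right \<theta>)) ^ 6) \<le> S4 t"
      "ennreal (norm (oscillation (p\<^sup>2) edge pi t (\<lambda>\<theta>. complex_of_real ((- decay \<theta>) ^ n) * (tcoef \<theta> * F1 \<theta>))) ^ 6) \<le> S5 t"
      "ennreal (norm (oscillation (q\<^sup>2) 0 pi t (\<lambda>\<theta>. cis (- real n * \<theta>) * F2 \<theta>)) ^ 6) \<le> S6 t"
      "ennreal (norm (oscillation (q\<^sup>2) 0 pi t (\<lambda>\<theta>. cis (real n * \<theta>) * amp_reflected_right \<theta>)) ^ 6) \<le> S7 t"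
      unfolding S_defs by (rule SUP_upper; simp)+
    show ?thesis
    proof (cases "j < 0")
      case True
      have w: "\<exists>a b c. wave t j = a + b + c \<and> ennreal (norm a ^ 6) \<le> S1 t \<and> ennreal (norm b ^ 6) \<le> S2 t \<and> ennreal (norm c ^ 6) \<le> S3 t"
        using wave_left[OF True, of t] True up(1-3) unfolding n_def by (auto simp: abs_if)
      then obtain a b c where abc: "wave t j = a + b + c" "ennreal (norm a ^ 6) \<le> S1 t" "ennreal (norm b ^ 6) \<le> S2 t" "ennreal (norm c ^ 6) \<le> S3 t" by blast
      have "norm (wave t j) ^ 6 \<le> 64 * (64 * (norm a ^ 6 + norm b ^ 6) + norm c ^ 6)"
        unfolding abc(1) using norm_add_power6_le[of "a + b" c] norm_add_power6_le[of a b] by simp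
      also have "\<dots> \<le> 4096 * (norm a ^ 6 + (norm b ^ 6 + norm c ^ 6))" by simp
      finally have "ennreal (norm (wave t j) ^ 6) \<le> ennreal (4096 * (norm a ^ 6 + (norm b ^ 6 + norm c ^ 6)))" by (rule ennreal_leI)
      also have "\<dots> = ennreal 4096 * (ennreal (norm a ^ 6) + (ennreal (norm b ^ 6) + ennreal (norm c ^ 6)))"
        by (subst ennreal_mult) (simp_all del: ennreal_numeral)
      also have "\<dots> \<le> ennreal 4096 * ?S t"
        using abc by (intro mult_left_mono add_mono) (auto intro: add_increasing2)
      finally show ?thesis .
    next
      case False
      then have j: "0 < j" using that by simp
      have w: "\<exists>a b c d. wave t j = (a + b) + (c + d) \<and> ennreal (norm a ^ 6) \<le> S4 t \<and> ennreal (norm b ^ 6) \<le> S5 t \<and> ennreal (norm c ^ 6) \<le> S6 t \<and> ennreal (norm d ^ 6) \<le> S7 t"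
        using wave_right[OF j, of t] j up(4-7) unfolding n_def by (auto simp: abs_if)
      then obtain a b c d where abc: "wave t j = (a + b) + (c + d)" "ennreal (norm a ^ 6) \<le> S4 t" "ennreal (norm b ^ 6) \<le> S5 t" "ennreal (norm c ^ 6) \<le> S6 t" "ennreal (norm d ^ 6) \<le> S7 t" by blast
      have "norm (wave t j) ^ 6 \<le> 4096 * (norm a ^ 6 + (norm b ^ 6 + (norm c ^ 6 + norm d ^ 6)))"
        unfolding abc(1) using norm_add_power6_le[of "a + b" "c + d"] norm_add_power6_le[of a b] norm_add_power6_le[of c d] by simp
      then have "ennreal (norm (wave t j) ^ 6) \<le> ennreal (4096 * (norm a ^ 6 + (norm b ^ 6 + (norm c ^ 6 + norm d ^ 6))))" by (rule ennreal_leI)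
      also have "\<dots> = ennreal 4096 * (ennreal (norm a ^ 6) + (ennreal (norm b ^ 6) + (ennreal (norm c ^ 6) + ennreal (norm d ^ 6))))"
        by (subst ennreal_mult) (simp_all del: ennreal_numeral)
      also have "\<dots> \<le> ennreal 4096 * (S4 t + (S5 t + (S6 t + S7 t)))"
        using abc by (intro mult_left_mono add_mono) auto
      also have "\<dots> \<le> ennreal 4096 * ?S t" by (intro mult_left_mono) (simp_all add: add_increasing)
      finally show ?thesis .
    qed
  qed
  have "(\<integral>\<^sup>+ t. (SUP j\<in>{j. j \<noteq> 0}. ennreal (norm (wave t j) ^ 6)) \<partial>lborel) \<le> (\<integral>\<^sup>+ t. ennreal 4096 * ?S t \<partial>lborel)"
    by (intro nn_integral_mono SUP_least pw) simp
  also have "\<dots> = ennreal 4096 * ((\<integral>\<^sup>+ t. S1 t \<partial>lborel) + ((\<integral>\<^sup>+ t. S2 t \<partial>lborel) + ((\<integral>\<^sup>+ t. S3 t \<partial>lborel)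
     + ((\<integral>\<^sup>+ t. S4 t \<partial>lborel) + ((\<integral>\<^sup>+ t. S5 t \<partial>lborel) + ((\<integral>\<^sup>+ t. S6 t \<partial>lborel) + (\<integral>\<^sup>+ t. S7 t \<partial>lborel)))))))"
    using m by (simp add: nn_integral_cmult nn_integral_add)
  also have "\<dots> \<le> ennreal 4096 * (?B + (?B + (?B + (?B + (?B + (?B + ?B))))))"
    by (intro mult_left_mono add_mono i1 i2 i3 i4 i5 i6 i7) simp
  also have "\<dots> = ennreal (28672 * (48 * L * N) ^ 3)"
  proof -
    have 0: "0 \<le> (48 * L * N) ^ 3" using sb(1,2) by (simp add: L_def N_def)
    have "?B + (?B + (?B + (?B + (?B + (?B + ?B))))) = ennreal (7 * (48 * L * N) ^ 3)"
      using 0 by (simp flip: ennreal_plus)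
    then have "ennreal 4096 * (?B + (?B + (?B + (?B + (?B + (?B + ?B)))))) = ennreal 4096 * ennreal (7 * (48 * L * N) ^ 3)" by simp
    also have "\<dots> = ennreal (4096 * (7 * (48 * L * N) ^ 3))" using 0 by (intro ennreal_mult[symmetric]) auto
    finally show ?thesis by simp
  qed
  finally show ?thesis .
qed

end

end

section \<open>Evolutions with a spectral representation\<close>

lemma norm_cis_minus_1: "norm (cis x - 1) \<le> \<bar>x\<bar>"
  using iexp_approx1[of x 0] by (simp add: cis_conv_exp)

lemma norm_cis_taylor: "norm (cis x - 1 - \<i> * x) \<le> x\<^sup>2"
proof -
  have "norm (cis x - 1 - \<i> * x) \<le> x\<^sup>2 / 2"
    using iexp_approx1[of x 1] by (simp add: cis_conv_exp power2_eq_square diff_diff_eq)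
  then show ?thesis using zero_le_power2[of x] by linarith
qed

lemma norm_cis_diff: "norm (cis x - cis y) \<le> \<bar>x - y\<bar>"
proof -
  have "cis x - cis y = cis y * (cis (x - y) - 1)" by (simp add: right_diff_distrib cis_mult)
  then show ?thesis using norm_cis_minus_1[of "x - y"] by (simp add: norm_mult)
qed

text \<open>As \<Lambda> is bounded, the second-order Taylor remainder of \<open>cis\<close> is of
  size \<open>(s - t)\<^sup>2\<close> uniformly in \<open>x\<close>, and it is integrated over a
  finite measure.\<close>

lemma (in finite_measure) has_vector_derivative_oscillatory_integral:
  fixes h :: "'a \<Rightarrow> complex" and \<Lambda> :: "'a \<Rightarrow> real"
  assumes [measurable]: "h \<in> borel_measurable M" "\<Lambda> \<in> borel_measurable M"
    and h: "\<And>x. x \<in> space M \<Longrightarrow> norm (h x) \<le> B" and L: "\<And>x. x \<in> space M \<Longrightarrow> \<bar>\<Lambda> x\<bar> \<le> L"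
  shows "((\<lambda>t. \<integral>x. cis (t * \<Lambda> x) * h x \<partial>M) has_vector_derivative (\<integral>x. \<i> * \<Lambda> x * (cis (t * \<Lambda> x) * h x) \<partial>M)) (at t)"
proof -
  let ?c = "L\<^sup>2 * B * measure M (space M)"
  have int: "integrable M (\<lambda>x. cis (s * \<Lambda> x) * h x)" for s
    by (rule integrable_const_bound[where B = B]) (auto simp: norm_mult h)
  have int': "integrable M (\<lambda>x. \<i> * \<Lambda> x * (cis (t * \<Lambda> x) * h x))"
  proof (rule integrable_const_bound[where B = "L * B"])
    show "AE x in M. norm (\<i> * \<Lambda> x * (cis (t * \<Lambda> x) * h x)) \<le> L * B"
    proof (rule AE_I2)
      fix x assume "x \<in> space M"
      from mult_mono[OF L[OF this] h[OF this]] show "norm (\<i> * \<Lambda> x * (cis (t * \<Lambda> x) * h x)) \<le> L * B"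
        using L[OF \<open>x \<in> space M\<close>] by (simp add: norm_mult)
    qed
  qed measurable
  have est: "norm ((\<integral>x. cis (s * \<Lambda> x) * h x \<partial>M) - (\<integral>x. cis (t * \<Lambda> x) * h x \<partial>M) - (s - t) *\<^sub>R (\<integral>x. \<i> * \<Lambda> x * (cis (t * \<Lambda> x) * h x) \<partial>M))
     \<le> ?c * (s - t)\<^sup>2" for s
  proof -
    have "(\<integral>x. cis (s * \<Lambda> x) * h x \<partial>M) - (\<integral>x. cis (t * \<Lambda> x) * h x \<partial>M) - (s - t) *\<^sub>R (\<integral>x. \<i> * \<Lambda> x * (cis (t * \<Lambda> x) * h x) \<partial>M)
       = (\<integral>x. cis (s * \<Lambda> x) * h x - cis (t * \<Lambda> x) * h x - (s - t) *\<^sub>R (\<i> * \<Lambda> x * (cis (t * \<Lambda> x) * h x)) \<partial>M)"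
      using int int' by simp
    also have "norm \<dots> \<le> ((s - t)\<^sup>2 * L\<^sup>2 * B) * measure M (space M)"
    proof (rule norm_integral_le_const)
      fix x assume x: "x \<in> space M"
      have "cis (s * \<Lambda> x) = cis (t * \<Lambda> x) * cis ((s - t) * \<Lambda> x)" by (simp add: cis_mult algebra_simps)
      then have "cis (s * \<Lambda> x) * h x - cis (t * \<Lambda> x) * h x - (s - t) *\<^sub>R (\<i> * \<Lambda> x * (cis (t * \<Lambda> x) * h x))
         = (cis (t * \<Lambda> x) * h x) * (cis ((s - t) * \<Lambda> x) - 1 - \<i> * ((s - t) * \<Lambda> x))"
        by (simp add: scaleR_conv_of_real algebra_simps)
      then have "norm (cis (s * \<Lambda> x) * h x - cis (t * \<Lambda> x) * h x - (s - t) *\<^sub>R (\<i> * \<Lambda> x * (cis (t * \<Lambda> x) * h x)))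
         = norm (h x) * norm (cis ((s - t) * \<Lambda> x) - 1 - \<i> * ((s - t) * \<Lambda> x))" by (simp add: norm_mult)
      also have "\<dots> \<le> B * ((s - t) * \<Lambda> x)\<^sup>2" using h[OF x] norm_cis_taylor[of "(s - t) * \<Lambda> x"]
        by (intro mult_mono) (auto intro: order_trans[OF norm_ge_zero])
      also have "\<dots> \<le> B * ((s - t)\<^sup>2 * L\<^sup>2)"
      proof -
        have "(\<Lambda> x)\<^sup>2 \<le> L\<^sup>2" using L[OF x] by (metis abs_ge_zero power2_abs power_mono)
        moreover have "0 \<le> B" using h[OF x] norm_ge_zero order_trans by blast
        ultimately show ?thesis by (simp add: power_mult_distrib mult_left_mono)
      qed
      finally show "norm (cis (s * \<Lambda> x) * h x - cis (t * \<Lambda> x) * h x - (s - t) *\<^sub>R (\<i> * \<Lambda> x * (cis (t * \<Lambda> x) * h x))) \<le> (s - t)\<^sup>2 * L\<^sup>2 * B"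
        by (simp add: mult_ac)
    qed measurable
    finally show ?thesis by (simp add: mult_ac)
  qed
  show ?thesis unfolding has_vector_derivative_def has_derivative_within
  proof (intro conjI)
    show "((\<lambda>s. (1 / norm (s - t)) *\<^sub>R ((\<integral>x. cis (s * \<Lambda> x) * h x \<partial>M) - ((\<integral>x. cis (t * \<Lambda> x) * h x \<partial>M) + (s - t) *\<^sub>R (\<integral>x. \<i> * \<Lambda> x * (cis (t * \<Lambda> x) * h x) \<partial>M)))) \<longlongrightarrow> 0) (at t)"
    proof (rule Lim_null_comparison)
      show "\<forall>\<^sub>F s in at t. norm ((1 / norm (s - t)) *\<^sub>R ((\<integral>x. cis (s * \<Lambda> x) * h x \<partial>M) - ((\<integral>x. cis (t * \<Lambda> x) * h x \<partial>M) + (s - t) *\<^sub>R (\<integral>x. \<i> * \<Lambda> x * (cis (t * \<Lambda> x) * h x) \<partial>M)))) \<le> ?c * \<bar>s - t\<bar>"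
        unfolding eventually_at_filter
      proof (intro always_eventually allI impI)
        fix s assume "s \<noteq> t"
        then have pos: "\<bar>s - t\<bar> > 0" by simp
        have "norm ((\<integral>x. cis (s * \<Lambda> x) * h x \<partial>M) - ((\<integral>x. cis (t * \<Lambda> x) * h x \<partial>M) + (s - t) *\<^sub>R (\<integral>x. \<i> * \<Lambda> x * (cis (t * \<Lambda> x) * h x) \<partial>M))) \<le> ?c * (\<bar>s - t\<bar> * \<bar>s - t\<bar>)"
          using est[of s] by (simp only: diff_diff_eq power2_eq_square abs_mult_self_eq)
        then show "norm ((1 / norm (s - t)) *\<^sub>R ((\<integral>x. cis (s * \<Lambda> x) * h x \<partial>M) - ((\<integral>x. cis (t * \<Lambda> x) * h x \<partial>M) + (s - t) *\<^sub>R (\<integral>x. \<i> * \<Lambda> x * (cis (t * \<Lambda> x) * h x) \<partial>M)))) \<le> ?c * \<bar>s - t\<bar>"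
          using pos by (simp add: divide_simps mult_ac)
      qed
      show "((\<lambda>s. ?c * \<bar>s - t\<bar>) \<longlongrightarrow> 0) (at t)" by (rule tendsto_eq_intros | simp)+
    qed
  qed (rule bounded_linear_scaleR_left)
qed

text \<open>The facts about scattering states on which existence and uniqueness rest, separated from
  the explicit formulas and from the question which medium is faster. \<open>\<Psi> j\<close> is the
  value at site \<open>j\<close>, the auxiliary site 0 included, as a function of the spectral
  parameter.\<close>

locale spectral_family = finite_measure M for M :: "'m measure" +
  fixes a b :: real and \<Psi> :: "int \<Rightarrow> 'm \<Rightarrow> complex" and \<Lambda> :: "'m \<Rightarrow> real" and B L :: real
  assumes ab: "0 < a" "0 < b"
    and measurable_\<Psi>[measurable]: "\<And>j. \<Psi> j \<in> borel_measurable M" and measurable_\<Lambda>[measurable]: "\<Lambda> \<in> borel_measurable M"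
    and \<Psi>_bound: "\<And>j x. x \<in> space M \<Longrightarrow> norm (\<Psi> j x) \<le> B" and \<Lambda>_bound: "\<And>x. x \<in> space M \<Longrightarrow> \<bar>\<Lambda> x\<bar> \<le> L"
    and left: "\<And>j x. j \<le> -1 \<Longrightarrow> x \<in> space M \<Longrightarrow> a * (\<Psi> (j + 1) x - 2 * \<Psi> j x + \<Psi> (j - 1) x) = \<Lambda> x * \<Psi> j x"
    and right: "\<And>j x. j \<ge> 1 \<Longrightarrow> x \<in> space M \<Longrightarrow> b * (\<Psi> (j + 1) x - 2 * \<Psi> j x + \<Psi> (j - 1) x) = \<Lambda> x * \<Psi> j x"
    and flux: "\<And>x. x \<in> space M \<Longrightarrow> a * (\<Psi> (-1) x - \<Psi> 0 x) = b * (\<Psi> 0 x - \<Psi> 1 x)"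
begin

text \<open>The generalised Fourier transform of the datum cut off to \<open>K\<close>; for finite
  \<open>K\<close> it is a bounded function.\<close>

definition synth :: "int set \<Rightarrow> (int \<Rightarrow> complex) \<Rightarrow> 'm \<Rightarrow> complex" where
  "synth K \<phi> x = (\<Sum>k\<in>K. \<phi> k * cnj (\<Psi> k x))"

definition evol :: "int set \<Rightarrow> (int \<Rightarrow> complex) \<Rightarrow> real \<Rightarrow> int \<Rightarrow> complex" where
  "evol K \<phi> t j = (\<integral>x. cis (t * \<Lambda> x) * (\<Psi> j x * synth K \<phi> x) \<partial>M)"

lemma measurable_synth[measurable]: "synth K \<phi> \<in> borel_measurable M"
  unfolding synth_def[abs_def] by measurable

lemma synth_bound: "x \<in> space M \<Longrightarrow> norm (synth K \<phi> x) \<le> (\<Sum>k\<in>K. norm (\<phi> k)) * B"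
  unfolding synth_def sum_distrib_right
  by (rule order_trans[OF norm_sum]) (auto intro!: sum_mono mult_left_mono \<Psi>_bound simp: norm_mult)

lemma integrable_bounded: "h \<in> borel_measurable M \<Longrightarrow> (\<And>x. x \<in> space M \<Longrightarrow> norm (h x) \<le> c) \<Longrightarrow> integrable M h"
  for h :: "'m \<Rightarrow> 'z::{banach, second_countable_topology}"
  by (rule integrable_const_bound[where B = c]) auto

lemma norm_mult_bound: "norm u \<le> c \<Longrightarrow> norm v \<le> d \<Longrightarrow> norm (u * v) \<le> c * d" for u v :: complex
  unfolding norm_mult by (intro mult_mono) (auto intro: order_trans[OF norm_ge_zero])

lemma norm_cis_mult: "norm (cis u * v) = norm v"
  by (simp add: norm_mult)

lemma integrable_evol: "integrable M (\<lambda>x. cis (t * \<Lambda> x) * (\<Psi> j x * synth K \<phi> x))"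
  by (rule integrable_bounded[where c = "B * ((\<Sum>k\<in>K. norm (\<phi> k)) * B)"])
     (auto intro!: norm_mult_bound \<Psi>_bound synth_bound simp: norm_cis_mult)

lemma evol_mono_diff:
  assumes "K \<subseteq> K'" "finite K'"
  shows "evol K' \<phi> t j - evol K \<phi> t j = evol (K' - K) \<phi> t j"
proof -
  have "synth K' \<phi> x = synth K \<phi> x + synth (K' - K) \<phi> x" for x
    unfolding synth_def using sum.subset_diff[OF assms] by (simp add: add.commute)
  then show ?thesis
    unfolding evol_def
    by (subst Bochner_Integration.integral_diff[symmetric, OF integrable_evol integrable_evol]) (simp add: algebra_simps)
qed

definition kernel :: "real \<Rightarrow> int \<Rightarrow> int \<Rightarrow> complex" where
  "kernel t j k = (\<integral>x. cis (t * \<Lambda> x) * (\<Psi> j x * cnj (\<Psi> k x)) \<partial>M)"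

lemma integrable_kernel: "integrable M (\<lambda>x. cis (t * \<Lambda> x) * (\<Psi> j x * cnj (\<Psi> k x)))"
  by (rule integrable_bounded[where c = "B * B"])
     (auto intro!: norm_mult_bound \<Psi>_bound simp: norm_cis_mult)

lemma evol_kernel: "evol K \<phi> t j = (\<Sum>k\<in>K. \<phi> k * kernel t j k)"
proof -
  have "evol K \<phi> t j = (\<integral>x. (\<Sum>k\<in>K. \<phi> k * (cis (t * \<Lambda> x) * (\<Psi> j x * cnj (\<Psi> k x)))) \<partial>M)"
    unfolding evol_def synth_def by (simp add: sum_distrib_left mult_ac)
  also have "\<dots> = (\<Sum>k\<in>K. \<phi> k * kernel t j k)"
    using integrable_kernel by (simp add: Bochner_Integration.integral_sum kernel_def)
  finally show ?thesis .
qed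

lemma norm_kernel_le: "norm (kernel t j k) \<le> B * B * measure M (space M)"
  unfolding kernel_def
proof (rule norm_integral_le_const)
  show "norm (cis (t * \<Lambda> x) * (\<Psi> j x * cnj (\<Psi> k x))) \<le> B * B" if "x \<in> space M" for x
    using norm_mult_bound[OF \<Psi>_bound[OF that] \<Psi>_bound[OF that], of j k] by (simp add: norm_mult)
qed measurable

definition kernel_deriv :: "real \<Rightarrow> int \<Rightarrow> int \<Rightarrow> complex" where
  "kernel_deriv t j k = (\<integral>x. \<i> * \<Lambda> x * (cis (t * \<Lambda> x) * (\<Psi> j x * cnj (\<Psi> k x))) \<partial>M)"

lemma kernel_has_derivative: "((\<lambda>t. kernel t j k) has_vector_derivative kernel_deriv t j k) (at t)"
  unfolding kernel_def kernel_deriv_def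
  by (rule has_vector_derivative_oscillatory_integral[where B = "B * B" and L = L])
     (auto intro!: norm_mult_bound \<Psi>_bound \<Lambda>_bound)

text \<open>\<Lambda> is real, so conjugating the eigenvalue equation lets the operator act on the
  second index as well. Comparing both forms at time 0 determines the Gram matrix, and the second
  one is the adjoint equation in the uniqueness proof.\<close>

lemma kernel_deriv_eq:
  assumes c: "\<And>x. x \<in> space M \<Longrightarrow> complex_of_real c * (\<Psi> (j + 1) x - 2 * \<Psi> j x + \<Psi> (j - 1) x) = \<Lambda> x * \<Psi> j x"
  shows "kernel_deriv t j k = \<i> * c * (kernel t (j + 1) k - 2 * kernel t j k + kernel t (j - 1) k)"
    "kernel_deriv t k j = \<i> * c * (kernel t k (j + 1) - 2 * kernel t k j + kernel t k (j - 1))"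
proof -
  have "kernel_deriv t j k = (\<integral>x. \<i> * c * (cis (t * \<Lambda> x) * (\<Psi> (j + 1) x * cnj (\<Psi> k x)) - 2 * (cis (t * \<Lambda> x) * (\<Psi> j x * cnj (\<Psi> k x)))
      + cis (t * \<Lambda> x) * (\<Psi> (j - 1) x * cnj (\<Psi> k x))) \<partial>M)"
    unfolding kernel_deriv_def
  proof (rule Bochner_Integration.integral_cong[OF refl])
    fix x assume x: "x \<in> space M"
    have "\<i> * \<Lambda> x * (cis (t * \<Lambda> x) * (\<Psi> j x * cnj (\<Psi> k x))) = \<i> * cis (t * \<Lambda> x) * cnj (\<Psi> k x) * (\<Lambda> x * \<Psi> j x)"
      by (simp add: mult_ac)
    also have "\<dots> = \<i> * c * (cis (t * \<Lambda> x) * (\<Psi> (j + 1) x * cnj (\<Psi> k x)) - 2 * (cis (t * \<Lambda> x) * (\<Psi> j x * cnj (\<Psi> k x)))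
      + cis (t * \<Lambda> x) * (\<Psi> (j - 1) x * cnj (\<Psi> k x)))"
      unfolding c[OF x, symmetric] by (simp add: algebra_simps)
    finally show "\<i> * \<Lambda> x * (cis (t * \<Lambda> x) * (\<Psi> j x * cnj (\<Psi> k x))) = \<dots>" .
  qed
  then show "kernel_deriv t j k = \<i> * c * (kernel t (j + 1) k - 2 * kernel t j k + kernel t (j - 1) k)"
    using integrable_kernel by (simp add: kernel_def)
  have "kernel_deriv t k j = (\<integral>x. \<i> * c * (cis (t * \<Lambda> x) * (\<Psi> k x * cnj (\<Psi> (j + 1) x)) - 2 * (cis (t * \<Lambda> x) * (\<Psi> k x * cnj (\<Psi> j x)))
      + cis (t * \<Lambda> x) * (\<Psi> k x * cnj (\<Psi> (j - 1) x))) \<partial>M)"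
    unfolding kernel_deriv_def
  proof (rule Bochner_Integration.integral_cong[OF refl])
    fix x assume x: "x \<in> space M"
    have c': "c * (cnj (\<Psi> (j + 1) x) - 2 * cnj (\<Psi> j x) + cnj (\<Psi> (j - 1) x)) = \<Lambda> x * cnj (\<Psi> j x)"
      using arg_cong[OF c[OF x], of cnj] by simp
    have "\<i> * \<Lambda> x * (cis (t * \<Lambda> x) * (\<Psi> k x * cnj (\<Psi> j x))) = \<i> * cis (t * \<Lambda> x) * \<Psi> k x * (\<Lambda> x * cnj (\<Psi> j x))"
      by (simp add: mult_ac)
    also have "\<dots> = \<i> * c * (cis (t * \<Lambda> x) * (\<Psi> k x * cnj (\<Psi> (j + 1) x)) - 2 * (cis (t * \<Lambda> x) * (\<Psi> k x * cnj (\<Psi> j x)))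
      + cis (t * \<Lambda> x) * (\<Psi> k x * cnj (\<Psi> (j - 1) x)))"
      unfolding c'[symmetric] by (simp add: algebra_simps)
    finally show "\<i> * \<Lambda> x * (cis (t * \<Lambda> x) * (\<Psi> k x * cnj (\<Psi> j x))) = \<dots>" .
  qed
  then show "kernel_deriv t k j = \<i> * c * (kernel t k (j + 1) - 2 * kernel t k j + kernel t k (j - 1))"
    using integrable_kernel by (simp add: kernel_def)
qed

lemma kernel_flux:
  "a * (kernel t (-1) k - kernel t 0 k) = b * (kernel t 0 k - kernel t 1 k)"
  "a * (kernel t k (-1) - kernel t k 0) = b * (kernel t k 0 - kernel t k 1)"
proof -
  have "(\<integral>x. a * (cis (t * \<Lambda> x) * (\<Psi> (-1) x * cnj (\<Psi> k x)) - cis (t * \<Lambda> x) * (\<Psi> 0 x * cnj (\<Psi> k x))) \<partial>M)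
     = (\<integral>x. b * (cis (t * \<Lambda> x) * (\<Psi> 0 x * cnj (\<Psi> k x)) - cis (t * \<Lambda> x) * (\<Psi> 1 x * cnj (\<Psi> k x))) \<partial>M)"
  proof (rule Bochner_Integration.integral_cong[OF refl])
    fix x assume x: "x \<in> space M"
    have "a * (cis (t * \<Lambda> x) * (\<Psi> (-1) x * cnj (\<Psi> k x)) - cis (t * \<Lambda> x) * (\<Psi> 0 x * cnj (\<Psi> k x)))
       = cis (t * \<Lambda> x) * cnj (\<Psi> k x) * (a * (\<Psi> (-1) x - \<Psi> 0 x))" by (simp add: algebra_simps)
    also have "\<dots> = b * (cis (t * \<Lambda> x) * (\<Psi> 0 x * cnj (\<Psi> k x)) - cis (t * \<Lambda> x) * (\<Psi> 1 x * cnj (\<Psi> k x)))"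
      unfolding flux[OF x] by (simp add: algebra_simps)
    finally show "a * (cis (t * \<Lambda> x) * (\<Psi> (-1) x * cnj (\<Psi> k x)) - cis (t * \<Lambda> x) * (\<Psi> 0 x * cnj (\<Psi> k x))) = \<dots>" .
  qed
  then show "a * (kernel t (-1) k - kernel t 0 k) = b * (kernel t 0 k - kernel t 1 k)"
    using integrable_kernel by (simp add: kernel_def)
  have "(\<integral>x. a * (cis (t * \<Lambda> x) * (\<Psi> k x * cnj (\<Psi> (-1) x)) - cis (t * \<Lambda> x) * (\<Psi> k x * cnj (\<Psi> 0 x))) \<partial>M)
     = (\<integral>x. b * (cis (t * \<Lambda> x) * (\<Psi> k x * cnj (\<Psi> 0 x)) - cis (t * \<Lambda> x) * (\<Psi> k x * cnj (\<Psi> 1 x))) \<partial>M)"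
  proof (rule Bochner_Integration.integral_cong[OF refl])
    fix x assume x: "x \<in> space M"
    have f: "a * (cnj (\<Psi> (-1) x) - cnj (\<Psi> 0 x)) = b * (cnj (\<Psi> 0 x) - cnj (\<Psi> 1 x))"
      using arg_cong[OF flux[OF x], of cnj] by simp
    have "a * (cis (t * \<Lambda> x) * (\<Psi> k x * cnj (\<Psi> (-1) x)) - cis (t * \<Lambda> x) * (\<Psi> k x * cnj (\<Psi> 0 x)))
       = cis (t * \<Lambda> x) * \<Psi> k x * (a * (cnj (\<Psi> (-1) x) - cnj (\<Psi> 0 x)))" by (simp add: algebra_simps)
    also have "\<dots> = b * (cis (t * \<Lambda> x) * (\<Psi> k x * cnj (\<Psi> 0 x)) - cis (t * \<Lambda> x) * (\<Psi> k x * cnj (\<Psi> 1 x)))"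
      unfolding f by (simp add: algebra_simps)
    finally show "a * (cis (t * \<Lambda> x) * (\<Psi> k x * cnj (\<Psi> (-1) x)) - cis (t * \<Lambda> x) * (\<Psi> k x * cnj (\<Psi> 0 x))) = \<dots>" .
  qed
  then show "a * (kernel t k (-1) - kernel t k 0) = b * (kernel t k 0 - kernel t k 1)"
    using integrable_kernel by (simp add: kernel_def)
qed

text \<open>The operator may act on either index of the Gram matrix. For \<open>k = - 1\<close> this determines the column
  \<open>k = 0\<close>, hence \<open>k = 1\<close> by the flux condition, and the three-term recurrence gives the later ones.\<close>

lemma orthonormal_extend:
  assumes l: "\<And>j k. j \<noteq> 0 \<Longrightarrow> k \<le> -1 \<Longrightarrow> kernel 0 j k = (if j = k then 1 else 0)"
  shows "j \<noteq> 0 \<Longrightarrow> k \<noteq> 0 \<Longrightarrow> kernel 0 j k = (if j = k then 1 else 0)"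
proof -
  define G where "G j k = kernel 0 j k" for j k
  have herm: "G k j = cnj (G j k)" for j k
  proof -
    have "(\<integral>x. cnj (cis (0 * \<Lambda> x) * (\<Psi> j x * cnj (\<Psi> k x))) \<partial>M) = cnj (G j k)"
      unfolding G_def kernel_def by (rule integral_bounded_linear[OF bounded_linear_cnj integrable_kernel])
    then show ?thesis unfolding G_def kernel_def by (simp add: mult.commute)
  qed
  have Gl: "G j k = (if j = k then 1 else 0)" if "j \<noteq> 0" "k \<le> -1" for j k using l[OF that] by (simp add: G_def)
  have ab0: "complex_of_real (a + b) \<noteq> 0" "complex_of_real a \<noteq> 0" "complex_of_real b \<noteq> 0" using ab by (auto simp del: of_real_add)
  have fl: "(a + b) * G j 0 = a * G j (-1) + b * G j 1" for j
    using kernel_flux(2)[of 0 j] unfolding G_def by (simp add: algebra_simps)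
  have rr: "G j (k + 1) - 2 * G j k + G j (k - 1) = G (j + 1) k - 2 * G j k + G (j - 1) k" if "1 \<le> j" "1 \<le> k" for j k
  proof -
    have "\<i> * b * (kernel 0 (j + 1) k - 2 * kernel 0 j k + kernel 0 (j - 1) k) = \<i> * b * (kernel 0 j (k + 1) - 2 * kernel 0 j k + kernel 0 j (k - 1))"
      using kernel_deriv_eq(1)[OF right[OF that(1)], of 0 k] kernel_deriv_eq(2)[OF right[OF that(2)], of 0 j] by (simp only:)
    then show ?thesis using ab0 by (simp add: G_def)
  qed
  have rl: "a * (G j 0 - 2 * G j (-1) + G j (-2)) = b * (G (j + 1) (-1) - 2 * G j (-1) + G (j - 1) (-1))" if "1 \<le> j" for j
  proof -
    have "\<i> * b * (kernel 0 (j + 1) (-1) - 2 * kernel 0 j (-1) + kernel 0 (j - 1) (-1)) = \<i> * a * (kernel 0 j (-1 + 1) - 2 * kernel 0 j (-1) + kernel 0 j (-1 - 1))"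
      using kernel_deriv_eq(1)[OF right[OF that], of 0 "-1"] kernel_deriv_eq(2)[OF left[of "-1"], of 0 j] by simp
    then show ?thesis by (simp add: G_def)
  qed
  \<comment> \<open>Column 0 is not a Kronecker symbol: the auxiliary value is the weighted mean of
    its two neighbours, whence \<open>b / (a + b)\<close> for \<open>j = 1\<close>.\<close>
  have G0: "(a + b) * G j 0 = (if j = 1 then b else 0)" if "1 \<le> j" for j
  proof (cases "j = 1")
    case True
    have "(a + b) * G (-1) 0 = a" using fl[of "-1"] Gl[of "-1" "-1"] Gl[of 1 "-1"] herm[of 1 "-1"] by simp
    then have "cnj ((a + b) * G (-1) 0) = a" by simp
    then have "(a + b) * G 0 (-1) = a" unfolding herm[of 0 "-1"] by simp
    moreover have "a * G 1 0 = b * G 0 (-1)" using rl[of 1] Gl[of 1 "-1"] Gl[of 1 "-2"] Gl[of 2 "-1"] by simp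
    ultimately have "a * ((a + b) * G 1 0) = a * b" by (metis mult.commute mult.left_commute of_real_mult)
    then show ?thesis using ab0 True by simp
  next
    case False
    have "a * G j 0 = 0" using rl[OF that] Gl[of j "-1"] Gl[of j "-2"] Gl[of "j + 1" "-1"] Gl[of "j - 1" "-1"] that False by simp
    then show ?thesis using ab0 False by simp
  qed
  have G1: "G j 1 = (if j = 1 then 1 else 0)" if "1 \<le> j" for j
    using G0[OF that] fl[of j] Gl[of j "-1"] that ab0 by (auto split: if_splits)
  have G0': "G 0 j = G j 0" if "1 \<le> j" for j
  proof -
    have "cnj ((a + b) * G j 0) = (a + b) * G j 0" unfolding G0[OF that] by simp
    then have "cnj (G j 0) = G j 0" using ab0 by simp
    then show ?thesis using herm[of 0 j] by simp
  qed
  have G00: "G j 0 = 0" if "2 \<le> j" for j using G0[of j] that ab0 by simp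
  \<comment> \<open>A new column is obtained from the two preceding ones, so two columns are carried
    through the induction.\<close>
  have main: "(\<forall>j\<ge>1. G j (int n + 1) = (if j = int n + 1 then 1 else 0)) \<and> (\<forall>j\<ge>1. G j (int n + 2) = (if j = int n + 2 then 1 else 0))" for n
  proof (induction n)
    case 0
    have "G j 2 = (if j = 2 then 1 else 0)" if "1 \<le> j" for j
    proof -
      have "G j 2 = G (j + 1) 1 + G (j - 1) 1 - G j 0" using rr[OF that, of 1] by (simp add: algebra_simps)
      then show ?thesis using G1[of "j + 1"] G1[of "j - 1"] G00[of j] G0'[of 1] that by (cases "j = 1"; cases "j = 2") auto
    qed
    then show ?case using G1 by auto
  next
    case (Suc n)
    have "G j (int n + 3) = (if j = int n + 3 then 1 else 0)" if "1 \<le> j" for j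
    proof -
      have e: "G j (int n + 3) = G (j + 1) (int n + 2) + G (j - 1) (int n + 2) - G j (int n + 1)"
        using rr[OF that, of "int n + 2"] by (simp add: algebra_simps)
      have c: "G (j + 1) (int n + 2) = (if j + 1 = int n + 2 then 1 else 0)" "G j (int n + 1) = (if j = int n + 1 then 1 else 0)"
        using Suc that by auto
      \<comment> \<open>For \<open>j = 1\<close> this is an entry of row 0, which symmetry reads off
        from column 0.\<close>
      have d: "G (j - 1) (int n + 2) = (if j - 1 = int n + 2 then 1 else 0)"
        using Suc that G0'[of "int n + 2"] G00[of "int n + 2"] by (cases "j = 1") auto
      show ?thesis unfolding e c d by auto
    qed
    then show ?case using Suc by (auto simp: algebra_simps)
  qed
  assume jk: "j \<noteq> 0" "k \<noteq> 0"
  have "G j k = (if j = k then 1 else 0)"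
  proof (cases "k \<le> -1 \<or> j \<le> -1")
    case True
    then show ?thesis using Gl[of j k] Gl[of k j] herm[of j k] jk by auto
  next
    case False
    then have "1 \<le> j" "1 \<le> k" using jk by auto
    then show ?thesis using main[of "nat (k - 1)"] by auto
  qed
  then show "kernel 0 j k = (if j = k then 1 else 0)" by (simp add: G_def)
qed

end

text \<open>Orthonormality of the sites over the spectral parameter expresses completeness of the
  states: it makes \<open>synth\<close> isometric and lets the evolution reproduce the datum at time
  0.\<close>

locale spectral_representation = spectral_family M a b \<Psi> \<Lambda> B L
  for M :: "'m measure" and a b :: real and \<Psi> :: "int \<Rightarrow> 'm \<Rightarrow> complex" and \<Lambda> :: "'m \<Rightarrow> real" and B L :: real +
  assumes orthonormal: "\<And>j k. j \<noteq> 0 \<Longrightarrow> k \<noteq> 0 \<Longrightarrow> (\<integral>x. \<Psi> j x * cnj (\<Psi> k x) \<partial>M) = (if j = k then 1 else 0)"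
begin

lemma parseval:
  assumes K: "finite K" "0 \<notin> K"
  shows "(\<integral>x. (norm (synth K \<phi> x))\<^sup>2 \<partial>M) = (\<Sum>k\<in>K. (norm (\<phi> k))\<^sup>2)"
proof -
  have e: "complex_of_real ((norm (synth K \<phi> x))\<^sup>2) = (\<Sum>k\<in>K. \<Sum>l\<in>K. \<phi> k * cnj (\<phi> l) * (\<Psi> l x * cnj (\<Psi> k x)))" for x
    unfolding complex_norm_square synth_def cnj_sum sum_product by (simp add: mult_ac)
  have i: "integrable M (\<lambda>x. \<Psi> l x * cnj (\<Psi> k x))" for k l
    by (rule integrable_bounded[where c = "B * B"]) (auto intro!: norm_mult_bound \<Psi>_bound)
  have "complex_of_real (\<integral>x. (norm (synth K \<phi> x))\<^sup>2 \<partial>M) = (\<integral>x. complex_of_real ((norm (synth K \<phi> x))\<^sup>2) \<partial>M)"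
    by (rule integral_complex_of_real[symmetric])
  also have "\<dots> = (\<Sum>k\<in>K. \<Sum>l\<in>K. \<phi> k * cnj (\<phi> l) * (\<integral>x. \<Psi> l x * cnj (\<Psi> k x) \<partial>M))"
    unfolding e using i by (simp add: Bochner_Integration.integral_sum)
  also have "\<dots> = (\<Sum>k\<in>K. \<Sum>l\<in>K. if l = k then \<phi> k * cnj (\<phi> l) else 0)"
  proof (intro sum.cong refl)
    fix k l assume "k \<in> K" "l \<in> K"
    then have "k \<noteq> 0" "l \<noteq> 0" using K by auto
    then show "\<phi> k * cnj (\<phi> l) * (\<integral>x. \<Psi> l x * cnj (\<Psi> k x) \<partial>M) = (if l = k then \<phi> k * cnj (\<phi> l) else 0)"
      by (simp add: orthonormal)
  qed
  also have "\<dots> = complex_of_real (\<Sum>k\<in>K. (norm (\<phi> k))\<^sup>2)"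
    using K by (simp add: sum.delta complex_norm_square del: of_real_power)
  finally show ?thesis by (simp only: of_real_eq_iff)
qed

text \<open>\<open>g\<close> is the orthogonal projection of \<open>h\<close> onto the span of the
  conjugated states, and the inequality is the nonnegativity of the squared norm of
  \<open>h - g\<close>.\<close>

lemma bessel:
  fixes h :: "'m \<Rightarrow> complex"
  assumes J: "finite J" "0 \<notin> J" and [measurable]: "h \<in> borel_measurable M" and hb: "\<And>x. x \<in> space M \<Longrightarrow> norm (h x) \<le> c"
  shows "(\<Sum>j\<in>J. (norm (\<integral>x. \<Psi> j x * h x \<partial>M))\<^sup>2) \<le> (\<integral>x. (norm (h x))\<^sup>2 \<partial>M)"
proof -
  define \<gamma> where "\<gamma> j = (\<integral>x. \<Psi> j x * h x \<partial>M)" for j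
  define S where "S = (\<Sum>j\<in>J. (norm (\<gamma> j))\<^sup>2)"
  define g where "g = synth J \<gamma>"
  have [measurable]: "g \<in> borel_measurable M" by (simp add: g_def)
  define D where "D = (\<Sum>k\<in>J. norm (\<gamma> k)) * B"
  have gb: "norm (g x) \<le> D" if "x \<in> space M" for x unfolding g_def D_def by (rule synth_bound[OF that])
  have i1: "integrable M (\<lambda>x. \<Psi> j x * h x)" for j
    by (rule integrable_bounded[where c = "B * c"]) (auto intro!: norm_mult_bound \<Psi>_bound hb)
  have ih: "integrable M (\<lambda>x. (norm (h x))\<^sup>2)"
    by (rule integrable_bounded[where c = "c\<^sup>2"]) (use hb in \<open>auto intro!: power_mono\<close>)
  have ig: "integrable M (\<lambda>x. (norm (g x))\<^sup>2)"
    by (rule integrable_bounded[where c = "D\<^sup>2"]) (use gb in \<open>auto intro!: power_mono\<close>)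
  have igh: "integrable M (\<lambda>x. cnj (g x) * h x)"
    by (rule integrable_bounded[where c = "D * c"]) (auto intro!: norm_mult_bound hb gb)
  have "(\<integral>x. cnj (g x) * h x \<partial>M) = (\<integral>x. (\<Sum>j\<in>J. cnj (\<gamma> j) * (\<Psi> j x * h x)) \<partial>M)"
    unfolding g_def synth_def by (simp add: sum_distrib_right mult.assoc)
  also have "\<dots> = (\<Sum>j\<in>J. cnj (\<gamma> j) * \<gamma> j)" using i1 by (simp add: Bochner_Integration.integral_sum \<gamma>_def)
  also have "\<dots> = complex_of_real S" by (simp add: S_def complex_norm_square mult.commute del: of_real_power)
  finally have gh: "(\<integral>x. cnj (g x) * h x \<partial>M) = complex_of_real S" .
  have gg: "(\<integral>x. (norm (g x))\<^sup>2 \<partial>M) = S" unfolding g_def S_def by (rule parseval[OF J])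
  define r where "r x = Re (cnj (g x) * h x)" for x
  have ir: "integrable M r" unfolding r_def[abs_def] by (rule integrable_Re[OF igh])
  have r: "(\<integral>x. r x \<partial>M) = S" unfolding r_def using integral_Re[OF igh] gh by (simp only: Re_complex_of_real)
  have "0 \<le> (\<integral>x. (norm (h x - g x))\<^sup>2 \<partial>M)" by simp
  also have "\<dots> = (\<integral>x. (norm (h x))\<^sup>2 + (norm (g x))\<^sup>2 - 2 * r x \<partial>M)"
  proof (rule Bochner_Integration.integral_cong[OF refl])
    fix x show "(norm (h x - g x))\<^sup>2 = (norm (h x))\<^sup>2 + (norm (g x))\<^sup>2 - 2 * r x"
      unfolding cmod_power2 r_def by (simp add: power2_eq_square algebra_simps)
  qed
  also have "\<dots> = (\<integral>x. (norm (h x))\<^sup>2 \<partial>M) - S"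
    using ih ig ir by (simp add: gg r)
  finally show ?thesis by (simp add: S_def \<gamma>_def)
qed

lemma norm_multiplier_sq: "norm m \<le> c \<Longrightarrow> (norm (m * z))\<^sup>2 \<le> c\<^sup>2 * (norm z)\<^sup>2" for m z :: complex
  unfolding norm_mult power_mult_distrib by (intro mult_right_mono power_mono) auto

text \<open>A function of the operator is bounded by the supremum of its symbol, because
  \<open>synth\<close> is isometric and the way back is a contraction by \<open>bessel\<close>. The
  symbols \<open>cis (t * \<Lambda> x)\<close> and differences of two of them give the l2 bound and
  the continuity in time, uniformly in \<open>K\<close>.\<close>

lemma multiplier_bound:
  fixes m :: "'m \<Rightarrow> complex"
  assumes J: "finite J" "0 \<notin> J" and K: "finite K" "0 \<notin> K" and [measurable]: "m \<in> borel_measurable M"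
    and mb: "\<And>x. x \<in> space M \<Longrightarrow> norm (m x) \<le> c"
  shows "(\<Sum>j\<in>J. (norm (\<integral>x. \<Psi> j x * (m x * synth K \<phi> x) \<partial>M))\<^sup>2) \<le> c\<^sup>2 * (\<Sum>k\<in>K. (norm (\<phi> k))\<^sup>2)"
proof -
  define D where "D = (\<Sum>k\<in>K. norm (\<phi> k)) * B"
  have i: "integrable M (\<lambda>x. (norm (synth K \<phi> x))\<^sup>2)"
    by (rule integrable_bounded[where c = "D\<^sup>2"]) (use synth_bound in \<open>auto intro!: power_mono simp: D_def\<close>)
  have "(\<Sum>j\<in>J. (norm (\<integral>x. \<Psi> j x * (m x * synth K \<phi> x) \<partial>M))\<^sup>2) \<le> (\<integral>x. (norm (m x * synth K \<phi> x))\<^sup>2 \<partial>M)"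
    by (rule bessel[OF J, where c = "c * D"]) (auto intro!: norm_mult_bound mb synth_bound simp: D_def)
  also have "\<dots> \<le> (\<integral>x. c\<^sup>2 * (norm (synth K \<phi> x))\<^sup>2 \<partial>M)"
  proof (rule integral_mono)
    show "integrable M (\<lambda>x. (norm (m x * synth K \<phi> x))\<^sup>2)"
      by (rule integrable_bounded[where c = "(c * D)\<^sup>2"])
         (auto intro!: power_mono norm_mult_bound mb synth_bound simp: D_def)
  qed (use i norm_multiplier_sq[OF mb] in auto)
  also have "\<dots> = c\<^sup>2 * (\<Sum>k\<in>K. (norm (\<phi> k))\<^sup>2)" using parseval[OF K] by simp
  finally show ?thesis .
qed

lemma evol_bound:
  assumes "finite J" "0 \<notin> J" "finite K" "0 \<notin> K"
  shows "(\<Sum>j\<in>J. (norm (evol K \<phi> t j))\<^sup>2) \<le> (\<Sum>k\<in>K. (norm (\<phi> k))\<^sup>2)"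
proof -
  have "evol K \<phi> t j = (\<integral>x. \<Psi> j x * (cis (t * \<Lambda> x) * synth K \<phi> x) \<partial>M)" for j
    unfolding evol_def by (simp add: mult_ac)
  then show ?thesis using multiplier_bound[OF assms, of "\<lambda>x. cis (t * \<Lambda> x)" 1 \<phi>] by simp
qed

lemma evol_lipschitz:
  assumes "finite J" "0 \<notin> J" "finite K" "0 \<notin> K"
  shows "(\<Sum>j\<in>J. (norm (evol K \<phi> s j - evol K \<phi> t j))\<^sup>2) \<le> (L * \<bar>s - t\<bar>)\<^sup>2 * (\<Sum>k\<in>K. (norm (\<phi> k))\<^sup>2)"
proof -
  have e: "evol K \<phi> s j - evol K \<phi> t j = (\<integral>x. \<Psi> j x * ((cis (s * \<Lambda> x) - cis (t * \<Lambda> x)) * synth K \<phi> x) \<partial>M)" for j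
    unfolding evol_def
    by (subst Bochner_Integration.integral_diff[symmetric, OF integrable_evol integrable_evol]) (simp add: algebra_simps)
  have "norm (cis (s * \<Lambda> x) - cis (t * \<Lambda> x)) \<le> L * \<bar>s - t\<bar>" if "x \<in> space M" for x
  proof -
    have "norm (cis (s * \<Lambda> x) - cis (t * \<Lambda> x)) \<le> \<bar>s * \<Lambda> x - t * \<Lambda> x\<bar>" by (rule norm_cis_diff)
    also have "\<dots> = \<bar>\<Lambda> x\<bar> * \<bar>s - t\<bar>" by (simp add: left_diff_distrib[symmetric] abs_mult mult.commute)
    also have "\<dots> \<le> L * \<bar>s - t\<bar>" using \<Lambda>_bound[OF that] by (rule mult_right_mono) simp
    finally show ?thesis .
  qed
  then show ?thesis unfolding e by (intro multiplier_bound assms) auto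
qed

lemma evol_0:
  assumes "finite K" "0 \<notin> K" "j \<noteq> 0"
  shows "evol K \<phi> 0 j = (if j \<in> K then \<phi> j else 0)"
proof -
  have i: "integrable M (\<lambda>x. \<Psi> j x * cnj (\<Psi> k x))" for k
    by (rule integrable_bounded[where c = "B * B"]) (auto intro!: norm_mult_bound \<Psi>_bound)
  have "evol K \<phi> 0 j = (\<integral>x. (\<Sum>k\<in>K. \<phi> k * (\<Psi> j x * cnj (\<Psi> k x))) \<partial>M)"
    unfolding evol_def synth_def by (simp add: sum_distrib_left mult_ac)
  also have "\<dots> = (\<Sum>k\<in>K. \<phi> k * (\<integral>x. \<Psi> j x * cnj (\<Psi> k x) \<partial>M))"
    using i by (simp add: Bochner_Integration.integral_sum)
  also have "\<dots> = (\<Sum>k\<in>K. if j = k then \<phi> k else 0)"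
  proof (rule sum.cong[OF refl])
    fix k assume "k \<in> K"
    then have "k \<noteq> 0" using assms by auto
    then show "\<phi> k * (\<integral>x. \<Psi> j x * cnj (\<Psi> k x) \<partial>M) = (if j = k then \<phi> k else 0)"
      using assms(3) by (simp add: orthonormal)
  qed
  also have "\<dots> = (if j \<in> K then \<phi> j else 0)" using assms(1) by (simp add: sum.delta')
  finally show ?thesis .
qed

lemma kernel_0: "j \<noteq> 0 \<Longrightarrow> k \<noteq> 0 \<Longrightarrow> kernel 0 j k = (if j = k then 1 else 0)"
  using orthonormal by (simp add: kernel_def)

end

section \<open>The solution of the coupled system\<close>

definition window :: "nat \<Rightarrow> int set" where
  "window n = {- int n..int n} - {0}"

lemma window_simps [simp]: "finite (window n)" "0 \<notin> window n" "window n \<subseteq> Zstar"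
  by (auto simp: window_def Zstar_def)

lemma window_mono: "n \<le> m \<Longrightarrow> window n \<subseteq> window m"
  by (auto simp: window_def)

lemma lr_enorm_2: "lr_enorm 2 w = ennpow (\<integral>\<^sup>+ j. ennreal ((cmod (w j))\<^sup>2) \<partial>count_space Zstar) (1 / 2)"
proof -
  have "real_of_ereal 2 = 2" by simp
  moreover have "ennpow (ennreal (cmod z)) 2 = ennreal ((cmod z)\<^sup>2)" for z by (simp add: ennpow_def)
  ultimately show ?thesis by (simp add: lr_enorm_def Lp_enorm_def)
qed

text \<open>Norms on \<open>Zstar\<close> are suprema of finite sums over growing windows, which is
  how estimates for finite sets of sites reach them.\<close>

lemma nn_integral_Zstar:
  "(\<integral>\<^sup>+ j. f j \<partial>count_space Zstar) = (SUP n. \<Sum>j\<in>window n. f j)"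
proof -
  let ?g = "\<lambda>n j. f j * indicator (window n) j"
  have "(\<integral>\<^sup>+ j. f j \<partial>count_space Zstar) = (\<integral>\<^sup>+ j. (SUP n. ?g n j) \<partial>count_space Zstar)"
  proof (rule nn_integral_cong)
    fix j assume "j \<in> space (count_space Zstar)"
    then have "j \<in> window (nat \<bar>j\<bar>)" by (auto simp: window_def Zstar_def)
    then have "f j \<le> (SUP n. ?g n j)" by (intro SUP_upper2[of "nat \<bar>j\<bar>"]) auto
    moreover have "(SUP n. ?g n j) \<le> f j" by (rule SUP_least) (simp add: indicator_def)
    ultimately show "f j = (SUP n. ?g n j)" by (rule antisym)
  qed
  also have "\<dots> = (SUP n. \<integral>\<^sup>+ j. ?g n j \<partial>count_space Zstar)"
  proof (rule nn_integral_monotone_convergence_SUP)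
    show "incseq ?g" unfolding incseq_def le_fun_def
    proof (intro allI impI)
      fix m n :: nat and j assume "m \<le> n"
      then show "?g m j \<le> ?g n j" using window_mono[of m n] by (auto simp: indicator_def)
    qed
  qed simp
  also have "\<dots> = (SUP n. \<Sum>j\<in>window n. f j)"
  proof (rule SUP_cong[OF refl])
    fix n
    have "(\<integral>\<^sup>+ j. ?g n j \<partial>count_space Zstar) = (\<Sum>j\<in>window n. ?g n j)"
      by (rule nn_integral_count_space') (auto simp: indicator_def Zstar_def window_def)
    then show "(\<integral>\<^sup>+ j. ?g n j \<partial>count_space Zstar) = (\<Sum>j\<in>window n. f j)" by simp
  qed
  finally show ?thesis .
qed

lemma nn_integral_Zstar_le:
  fixes f :: "int \<Rightarrow> real"
  assumes f: "\<And>j. 0 \<le> f j" and le: "\<And>n. (\<Sum>j\<in>window n. f j) \<le> c"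
  shows "(\<integral>\<^sup>+ j. ennreal (f j) \<partial>count_space Zstar) \<le> ennreal c"
  unfolding nn_integral_Zstar using f le by (intro SUP_least) (simp add: sum_ennreal ennreal_leI)

lemma lr_enorm_2_le:
  assumes "\<And>n. (\<Sum>j\<in>window n. (cmod (w j))\<^sup>2) \<le> c\<^sup>2" "0 \<le> c"
  shows "lr_enorm 2 w \<le> ennreal c"
proof -
  have E: "(\<integral>\<^sup>+ j. ennreal ((cmod (w j))\<^sup>2) \<partial>count_space Zstar) \<le> ennreal (c\<^sup>2)"
    by (rule nn_integral_Zstar_le) (use assms in auto)
  then obtain e where e: "(\<integral>\<^sup>+ j. ennreal ((cmod (w j))\<^sup>2) \<partial>count_space Zstar) = ennreal e" "0 \<le> e"
    by (metis ennreal_cases ennreal_less_top infinity_ennreal_def leD)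
  then have "e \<le> c\<^sup>2" using E by simp
  then have "sqrt e \<le> c" using assms(2) by (simp add: real_le_lsqrt e)
  then show ?thesis unfolding lr_enorm_2 e(1) using e(2) by (simp add: ennpow_def powr_half_sqrt ennreal_leI)
qed

lemma lr_enorm_2_sum_le:
  assumes "lr_enorm 2 w \<le> ennreal c" "0 \<le> c" and J: "finite J" "0 \<notin> J"
  shows "(\<Sum>j\<in>J. (cmod (w j))\<^sup>2) \<le> c\<^sup>2"
proof -
  define E where "E = (\<integral>\<^sup>+ j. ennreal ((cmod (w j))\<^sup>2) \<partial>count_space Zstar)"
  have le: "ennpow E (1 / 2) \<le> ennreal c" using assms(1) unfolding lr_enorm_2 E_def .
  have "E \<noteq> \<infinity>" using le by (auto simp: ennpow_def top_unique)
  then obtain e where e: "E = ennreal e" "0 \<le> e" by (cases E) auto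
  have "sqrt e \<le> c" using le e assms(2) by (simp add: ennpow_def powr_half_sqrt)
  then have ec: "e \<le> c\<^sup>2" using e(2) by (simp add: sqrt_le_D)
  have JZ: "J \<subseteq> Zstar" using J by (auto simp: Zstar_def)
  have "ennreal (\<Sum>j\<in>J. (cmod (w j))\<^sup>2) = (\<Sum>j\<in>J. ennreal ((cmod (w j))\<^sup>2) * indicator J j)" by (simp add: sum_ennreal)
  also have "\<dots> = (\<integral>\<^sup>+ j. ennreal ((cmod (w j))\<^sup>2) * indicator J j \<partial>count_space Zstar)"
    by (rule nn_integral_count_space'[symmetric]) (use J JZ in auto)
  also have "\<dots> \<le> E" unfolding E_def by (rule nn_integral_mono) (auto simp: indicator_def)
  finally have "(\<Sum>j\<in>J. (cmod (w j))\<^sup>2) \<le> e" using e by simp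
  then show ?thesis using ec by simp
qed

lemma lr_enorm_2_component:
  assumes "lr_enorm 2 w \<le> ennreal c" "0 \<le> c" "j \<noteq> 0"
  shows "cmod (w j) \<le> c"
  using lr_enorm_2_sum_le[OF assms(1,2), of "{j}"] assms(2,3) by (auto intro: power2_le_imp_le)

lemma in_l2_finite: "in_l2 w \<Longrightarrow> \<exists>c\<ge>0. lr_enorm 2 w = ennreal c"
  unfolding in_l2_def by (cases "lr_enorm 2 w") auto

section \<open>Discrete Green formula across the interface\<close>

lemma green_formula_nat:
  fixes f g :: "int \<Rightarrow> complex"
  shows "(\<Sum>j\<in>{1..int n}. (f (j + 1) - 2 * f j + f (j - 1)) * g j - f j * (g (j + 1) - 2 * g j + g (j - 1)))
    = (f (int n + 1) * g (int n) - f (int n) * g (int n + 1)) - (f 1 * g 0 - f 0 * g 1)"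
proof (induction n)
  case (Suc n)
  have "{1..int (Suc n)} = insert (int n + 1) {1..int n}" by auto
  then show ?case using Suc by (simp add: algebra_simps)
qed simp

text \<open>Summation by parts on either side leaves boundary terms at the ends of the window and
  next to the interface. The weights \<open>a\<close> and \<open>b\<close> turn the latter into a
  combination of the two flux conditions, so they cancel.\<close>

lemma green_formula:
  fixes f g :: "int \<Rightarrow> complex" and a b :: real and c :: "int \<Rightarrow> real"
  assumes f: "a * (f (-1) - f 0) = b * (f 0 - f 1)" and g: "a * (g (-1) - g 0) = b * (g 0 - g 1)"
  defines "c \<equiv> \<lambda>j::int. if j < 0 then a else b"
  shows "(\<Sum>j\<in>window n. c j * ((f (j + 1) - 2 * f j + f (j - 1)) * g j - f j * (g (j + 1) - 2 * g j + g (j - 1))))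
    = b * (f (int n + 1) * g (int n) - f (int n) * g (int n + 1)) + a * (f (- int n - 1) * g (- int n) - f (- int n) * g (- int n - 1))"
proof -
  let ?h = "\<lambda>j. (f (j + 1) - 2 * f j + f (j - 1)) * g j - f j * (g (j + 1) - 2 * g j + g (j - 1))"
  have w: "window n = {1..int n} \<union> {- int n..-1}" by (auto simp: window_def)
  have "(\<Sum>j\<in>window n. c j * ?h j) = (\<Sum>j\<in>{1..int n}. c j * ?h j) + (\<Sum>j\<in>{- int n..-1}. c j * ?h j)"
    unfolding w by (rule sum.union_disjoint) auto
  also have "(\<Sum>j\<in>{1..int n}. c j * ?h j) = b * (\<Sum>j\<in>{1..int n}. ?h j)"
    unfolding sum_distrib_left by (rule sum.cong) (auto simp: c_def)
  also have "(\<Sum>j\<in>{- int n..-1}. c j * ?h j) = a * (\<Sum>j\<in>{- int n..-1}. ?h j)"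
    unfolding sum_distrib_left by (rule sum.cong) (auto simp: c_def)
  also have "(\<Sum>j\<in>{- int n..-1}. ?h j) = (\<Sum>j\<in>{1..int n}. ?h (- j))"
    by (rule sum.reindex_bij_witness[of _ uminus uminus]) auto
  also have "\<dots> = (\<Sum>j\<in>{1..int n}. (f (- (j + 1)) - 2 * f (- j) + f (- (j - 1))) * g (- j) - f (- j) * (g (- (j + 1)) - 2 * g (- j) + g (- (j - 1))))"
    by (rule sum.cong) (simp_all add: algebra_simps)
  also have "\<dots> = (f (- (int n + 1)) * g (- int n) - f (- int n) * g (- (int n + 1))) - (f (- 1) * g (- 0) - f (- 0) * g (- 1))"
    by (rule green_formula_nat[where n = n and f = "\<lambda>j. f (- j)" and g = "\<lambda>j. g (- j)"])
  finally have "(\<Sum>j\<in>window n. c j * ?h j) = b * ((f (int n + 1) * g (int n) - f (int n) * g (int n + 1)) - (f 1 * g 0 - f 0 * g 1))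
     + a * ((f (- (int n + 1)) * g (- int n) - f (- int n) * g (- (int n + 1))) - (f (- 1) * g 0 - f 0 * g (- 1)))"
    unfolding green_formula_nat by simp
  moreover have "b * (A - U) + a * (B - V) = b * A + a * B - (b * U + a * V)" for A U B V :: complex
    by (simp add: algebra_simps)
  moreover have "b * (f 1 * g 0 - f 0 * g 1) + a * (f (- 1) * g 0 - f 0 * g (- 1)) = 0"
  proof -
    have f1: "b * f 1 + a * f (-1) = (a + b) * f 0" using f by (simp add: algebra_simps)
    have g1: "b * g 1 + a * g (-1) = (a + b) * g 0" using g by (simp add: algebra_simps)
    have "b * (f 1 * g 0 - f 0 * g 1) + a * (f (- 1) * g 0 - f 0 * g (- 1))
       = (b * f 1 + a * f (-1)) * g 0 - f 0 * (b * g 1 + a * g (-1))" by (simp add: algebra_simps)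
    then show ?thesis unfolding f1 g1 by simp
  qed
  moreover have "- (int n + 1) = - int n - 1" by simp
  ultimately show ?thesis by (simp only: diff_zero)
qed

section \<open>Limit of the evolutions of truncated data\<close>

context spectral_representation
begin

lemma evol_flux: "a * (evol K \<phi> t (-1) - evol K \<phi> t 0) = b * (evol K \<phi> t 0 - evol K \<phi> t 1)"
proof -
  have "a * (evol K \<phi> t (-1) - evol K \<phi> t 0) = (\<Sum>k\<in>K. \<phi> k * (a * (kernel t (-1) k - kernel t 0 k)))"
    unfolding evol_kernel sum_subtractf[symmetric] sum_distrib_left by (simp add: algebra_simps)
  also have "\<dots> = b * (evol K \<phi> t 0 - evol K \<phi> t 1)"
    unfolding kernel_flux evol_kernel sum_subtractf[symmetric] sum_distrib_left by (simp add: algebra_simps)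
  finally show ?thesis .
qed

text \<open>The l2 estimates do not see site 0; the flux condition recovers its value as a weighted
  mean of the neighbours, and with it convergence there.\<close>

lemma evol_zero: "evol K \<phi> t 0 = (a * evol K \<phi> t (-1) + b * evol K \<phi> t 1) / (a + b)"
proof -
  have "(a + b) * evol K \<phi> t 0 = a * evol K \<phi> t (-1) + b * evol K \<phi> t 1"
    using evol_flux[of K \<phi> t] by (simp add: algebra_simps)
  moreover have "complex_of_real (a + b) \<noteq> 0" using ab by (simp del: of_real_add)
  ultimately show ?thesis by (simp add: nonzero_eq_divide_eq mult.commute)
qed

lemma evol_has_derivative:
  assumes "\<And>x. x \<in> space M \<Longrightarrow> complex_of_real c * (\<Psi> (j + 1) x - 2 * \<Psi> j x + \<Psi> (j - 1) x) = \<Lambda> x * \<Psi> j x"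
  shows "((\<lambda>t. evol K \<phi> t j) has_vector_derivative \<i> * c * (evol K \<phi> t (j + 1) - 2 * evol K \<phi> t j + evol K \<phi> t (j - 1))) (at t)"
proof -
  have "((\<lambda>t. \<Sum>k\<in>K. \<phi> k * kernel t j k) has_vector_derivative (\<Sum>k\<in>K. \<phi> k * kernel_deriv t j k)) (at t)"
    by (intro has_vector_derivative_sum has_vector_derivative_mult_right kernel_has_derivative)
  also have "(\<Sum>k\<in>K. \<phi> k * kernel_deriv t j k) = \<i> * c * (evol K \<phi> t (j + 1) - 2 * evol K \<phi> t j + evol K \<phi> t (j - 1))"
  proof -
    have kd: "kernel_deriv t j k = \<i> * c * (kernel t (j + 1) k - 2 * kernel t j k + kernel t (j - 1) k)" for k
      by (rule kernel_deriv_eq(1)[OF assms])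
    show ?thesis
      unfolding evol_kernel kd sum_distrib_left sum_subtractf[symmetric] sum.distrib[symmetric]
      by (rule sum.cong) (simp_all add: algebra_simps)
  qed
  finally show ?thesis by (simp only: evol_kernel)
qed

context
  fixes \<phi> :: "int \<Rightarrow> complex" and N :: real
  assumes N: "0 \<le> N" and l2: "\<And>J. finite J \<Longrightarrow> 0 \<notin> J \<Longrightarrow> (\<Sum>j\<in>J. (cmod (\<phi> j))\<^sup>2) \<le> N\<^sup>2"
begin

definition "mass n = (\<Sum>j\<in>window n. (cmod (\<phi> j))\<^sup>2)"
definition "total_mass = (SUP n. mass n)"
abbreviation "approx n \<equiv> evol (window n) \<phi>"
definition "sol t j = lim (\<lambda>n. approx n t j)"

lemma mass_le: "mass n \<le> N\<^sup>2" unfolding mass_def by (rule l2) auto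

lemma mass_incseq: "incseq mass"
  unfolding incseq_def mass_def using window_mono by (auto intro!: sum_mono2)

lemma mass_tendsto: "mass \<longlonglongrightarrow> total_mass"
  unfolding total_mass_def using mass_le by (intro LIMSEQ_incseq_SUP mass_incseq bdd_aboveI2) auto

lemma mass_le_total: "mass n \<le> total_mass"
  by (rule incseq_le[OF mass_incseq mass_tendsto])

text \<open>The l2 norm of the datum off the window, written through limits of finite sums.\<close>

definition "tail n = sqrt (total_mass - mass n)"

lemma tail_nonneg: "0 \<le> tail n" by (simp add: tail_def mass_le_total)

lemma tail_power2: "(tail n)\<^sup>2 = total_mass - mass n" by (simp add: tail_def mass_le_total)

lemma tail_tendsto: "tail \<longlonglongrightarrow> 0"
proof -
  have "(\<lambda>n. sqrt (total_mass - mass n)) \<longlonglongrightarrow> sqrt (total_mass - total_mass)"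
    by (intro tendsto_intros mass_tendsto)
  then show ?thesis by (simp add: tail_def[abs_def])
qed

text \<open>The evolution is linear in the datum, so the difference evolves from the part of \<phi>
  in \<open>window m - window n\<close>. The bound does not depend on time, which later permits
  differentiation of the limit.\<close>

lemma approx_diff:
  assumes "n \<le> m" "finite J" "0 \<notin> J"
  shows "(\<Sum>j\<in>J. (cmod (approx m t j - approx n t j))\<^sup>2) \<le> (tail n)\<^sup>2"
proof -
  have "(\<Sum>j\<in>J. (cmod (approx m t j - approx n t j))\<^sup>2) \<le> (\<Sum>k\<in>window m - window n. (cmod (\<phi> k))\<^sup>2)"
    unfolding evol_mono_diff[OF window_mono[OF assms(1)] window_simps(1)]
    by (rule evol_bound) (use assms in auto)
  also have "\<dots> = mass m - mass n"
    unfolding mass_def by (rule sum_diff) (use window_mono[OF assms(1)] in auto)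
  also have "\<dots> \<le> (tail n)\<^sup>2" unfolding tail_power2 using mass_le_total by simp
  finally show ?thesis .
qed

lemma approx_diff1: "n \<le> m \<Longrightarrow> j \<noteq> 0 \<Longrightarrow> cmod (approx m t j - approx n t j) \<le> tail n"
  using approx_diff[of n m "{j}" t] tail_nonneg[of n] by (auto intro: power2_le_imp_le)

lemma approx_tendsto_nonzero: "j \<noteq> 0 \<Longrightarrow> (\<lambda>n. approx n t j) \<longlonglongrightarrow> sol t j"
proof -
  assume j: "j \<noteq> 0"
  have "Cauchy (\<lambda>n. approx n t j)"
  proof (rule metric_CauchyI)
    fix e :: real assume e: "0 < e"
    then obtain n where n: "tail n < e / 2"
      using order_tendstoD(2)[OF tail_tendsto, of "e / 2"] by (auto simp: eventually_sequentially)
    show "\<exists>n0. \<forall>m\<ge>n0. \<forall>l\<ge>n0. dist (approx m t j) (approx l t j) < e"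
    proof (intro exI[of _ n] allI impI)
      fix m l assume "n \<le> m" "n \<le> l"
      then have "cmod (approx m t j - approx n t j) < e / 2" "cmod (approx l t j - approx n t j) < e / 2"
        using approx_diff1[of n _ j t] n j by force+
      then show "dist (approx m t j) (approx l t j) < e"
        using norm_triangle_ineq4[of "approx m t j - approx n t j" "approx l t j - approx n t j"] by (simp add: dist_norm)
    qed
  qed
  then show ?thesis unfolding sol_def using Cauchy_convergent convergent_LIMSEQ_iff by blast
qed

lemma approx_tendsto: "(\<lambda>n. approx n t j) \<longlonglongrightarrow> sol t j"
proof (cases "j = 0")
  case True
  have "(\<lambda>n. (a * approx n t (-1) + b * approx n t 1) / (a + b)) \<longlonglongrightarrow> (a * sol t (-1) + b * sol t 1) / (a + b)"
    using ab by (intro tendsto_intros approx_tendsto_nonzero) (auto simp flip: of_real_add)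
  then have "(\<lambda>n. approx n t 0) \<longlonglongrightarrow> (a * sol t (-1) + b * sol t 1) / (a + b)" by (simp only: evol_zero)
  then show ?thesis unfolding True sol_def using limI by metis
qed (rule approx_tendsto_nonzero)

lemma sol_diff:
  assumes "finite J" "0 \<notin> J"
  shows "(\<Sum>j\<in>J. (cmod (sol t j - approx n t j))\<^sup>2) \<le> (tail n)\<^sup>2"
proof (rule tendsto_upperbound)
  show "(\<lambda>m. \<Sum>j\<in>J. (cmod (approx m t j - approx n t j))\<^sup>2) \<longlonglongrightarrow> (\<Sum>j\<in>J. (cmod (sol t j - approx n t j))\<^sup>2)"
    by (intro tendsto_intros approx_tendsto)
  show "\<forall>\<^sub>F m in sequentially. (\<Sum>j\<in>J. (cmod (approx m t j - approx n t j))\<^sup>2) \<le> (tail n)\<^sup>2"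
    by (intro eventually_sequentiallyI[of n] approx_diff assms)
qed simp

lemma sol_diff1: "cmod (sol t j - approx n t j) \<le> tail n"
proof (cases "j = 0")
  case True
  have nz: "cmod (sol t j - approx n t j) \<le> tail n" if "j \<noteq> 0" for j
    using sol_diff[of "{j}" t n] tail_nonneg[of n] that by (auto intro: power2_le_imp_le)
  have fl: "a * (sol t (-1) - sol t 0) = b * (sol t 0 - sol t 1)"
  proof (rule LIMSEQ_unique)
    show "(\<lambda>n. a * (approx n t (-1) - approx n t 0)) \<longlonglongrightarrow> a * (sol t (-1) - sol t 0)"
      by (intro tendsto_intros approx_tendsto)
    show "(\<lambda>n. a * (approx n t (-1) - approx n t 0)) \<longlonglongrightarrow> b * (sol t 0 - sol t 1)"
      unfolding evol_flux by (intro tendsto_intros approx_tendsto)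
  qed
  have "(a + b) * (sol t 0 - approx n t 0) = a * (sol t (-1) - approx n t (-1)) + b * (sol t 1 - approx n t 1)"
    using fl evol_flux[of "window n" \<phi> t] by (simp add: algebra_simps)
  then have "(a + b) * cmod (sol t 0 - approx n t 0) = cmod (a * (sol t (-1) - approx n t (-1)) + b * (sol t 1 - approx n t 1))"
    using ab by (metis abs_of_pos add_pos_pos norm_mult norm_of_real)
  also have "\<dots> \<le> a * cmod (sol t (-1) - approx n t (-1)) + b * cmod (sol t 1 - approx n t 1)"
    using ab by (intro order_trans[OF norm_triangle_ineq]) (simp add: norm_mult)
  also have "\<dots> \<le> a * tail n + b * tail n" using ab by (intro add_mono mult_left_mono nz) auto
  finally have "(a + b) * cmod (sol t 0 - approx n t 0) \<le> (a + b) * tail n" by (simp add: algebra_simps)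
  then show ?thesis using ab True by simp
next
  case False
  then show ?thesis using sol_diff[of "{j}" t n] tail_nonneg[of n] by (auto intro: power2_le_imp_le)
qed

lemma sol_flux: "a * (sol t (-1) - sol t 0) = b * (sol t 0 - sol t 1)"
proof (rule LIMSEQ_unique)
  show "(\<lambda>n. a * (approx n t (-1) - approx n t 0)) \<longlonglongrightarrow> a * (sol t (-1) - sol t 0)"
    by (intro tendsto_intros approx_tendsto)
  show "(\<lambda>n. a * (approx n t (-1) - approx n t 0)) \<longlonglongrightarrow> b * (sol t 0 - sol t 1)"
    unfolding evol_flux by (intro tendsto_intros approx_tendsto)
qed

lemma sol_initial: "j \<noteq> 0 \<Longrightarrow> sol 0 j = \<phi> j"
proof -
  assume j: "j \<noteq> 0"
  have "approx n 0 j = \<phi> j" if "n \<ge> nat \<bar>j\<bar>" for n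
    using that j by (subst evol_0) (auto simp: window_def)
  then have "(\<lambda>n. approx n 0 j) \<longlonglongrightarrow> \<phi> j"
    by (intro tendsto_eventually) (auto simp: eventually_sequentially)
  then show ?thesis using approx_tendsto LIMSEQ_unique by blast
qed

text \<open>The derivatives of the approximations converge uniformly in time, so the limit may be
  differentiated. The factor 4 in the estimate is the sum 2 + 1 + 1 of the weights of the
  Laplacian.\<close>

lemma sol_has_derivative:
  assumes c: "\<And>x. x \<in> space M \<Longrightarrow> complex_of_real c * (\<Psi> (j + 1) x - 2 * \<Psi> j x + \<Psi> (j - 1) x) = \<Lambda> x * \<Psi> j x"
  shows "((\<lambda>t. sol t j) has_vector_derivative \<i> * c * (sol t (j + 1) - 2 * sol t j + sol t (j - 1))) (at t)"
proof -
  define V where "V w s = \<i> * c * (w s (j + 1) - 2 * w s j + w s (j - 1))" for w :: "real \<Rightarrow> int \<Rightarrow> complex" and s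
  have "\<exists>g. \<forall>x\<in>UNIV. (\<lambda>n. approx n x j) \<longlonglongrightarrow> g x \<and> (g has_derivative (\<lambda>h. h *\<^sub>R V sol x)) (at x within UNIV)"
  proof (rule has_derivative_sequence[where f' = "\<lambda>n x h. h *\<^sub>R V (approx n) x"])
    show "((\<lambda>x. approx n x j) has_derivative (\<lambda>h. h *\<^sub>R V (approx n) x)) (at x within UNIV)" for n x
      using evol_has_derivative[OF c, of "window n" \<phi> x] unfolding V_def has_vector_derivative_def .
    show "(\<lambda>n. approx n 0 j) \<longlonglongrightarrow> sol 0 j" by (rule approx_tendsto)
    fix e :: real assume e: "0 < e"
    have Vd: "cmod (V (approx n) x - V sol x) \<le> 4 * \<bar>c\<bar> * tail n" for n x
    proof -
      have "V (approx n) x - V sol x = \<i> * c * (2 * (sol x j - approx n x j) - (sol x (j + 1) - approx n x (j + 1)) - (sol x (j - 1) - approx n x (j - 1)))"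
        unfolding V_def by (simp add: algebra_simps)
      then have "cmod (V (approx n) x - V sol x) = \<bar>c\<bar> * cmod (2 * (sol x j - approx n x j) - (sol x (j + 1) - approx n x (j + 1)) - (sol x (j - 1) - approx n x (j - 1)))"
        by (simp add: norm_mult)
      also have "\<dots> \<le> \<bar>c\<bar> * (2 * tail n + tail n + tail n)"
      proof (rule mult_left_mono)
        have "cmod (2 * (sol x j - approx n x j) - (sol x (j + 1) - approx n x (j + 1)) - (sol x (j - 1) - approx n x (j - 1)))
          \<le> cmod (2 * (sol x j - approx n x j)) + cmod (sol x (j + 1) - approx n x (j + 1)) + cmod (sol x (j - 1) - approx n x (j - 1))"
          by (meson norm_triangle_ineq4 order_trans add_right_mono)
        also have "\<dots> \<le> 2 * tail n + tail n + tail n"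
          by (intro add_mono sol_diff1) (subst norm_mult, simp add: sol_diff1)
        finally show "cmod (2 * (sol x j - approx n x j) - (sol x (j + 1) - approx n x (j + 1)) - (sol x (j - 1) - approx n x (j - 1))) \<le> 2 * tail n + tail n + tail n" .
      qed simp
      finally show ?thesis by (simp add: algebra_simps)
    qed
    have "(\<lambda>n. 4 * \<bar>c\<bar> * tail n) \<longlonglongrightarrow> 4 * \<bar>c\<bar> * 0" by (intro tendsto_intros tail_tendsto)
    then have "\<forall>\<^sub>F n in sequentially. 4 * \<bar>c\<bar> * tail n < e" using e by (intro order_tendstoD(2)) auto
    then show "\<forall>\<^sub>F n in sequentially. \<forall>x\<in>UNIV. \<forall>h. cmod (h *\<^sub>R V (approx n) x - h *\<^sub>R V sol x) \<le> e * norm h"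
    proof eventually_elim
      case (elim n)
      show ?case
      proof (intro ballI allI)
        fix x h :: real
        have "cmod (h *\<^sub>R V (approx n) x - h *\<^sub>R V sol x) = \<bar>h\<bar> * cmod (V (approx n) x - V sol x)"
          unfolding scaleR_diff_right[symmetric] by simp
        also have "\<dots> \<le> \<bar>h\<bar> * e" using order_trans[OF Vd less_imp_le[OF elim]] by (intro mult_left_mono) auto
        finally show "cmod (h *\<^sub>R V (approx n) x - h *\<^sub>R V sol x) \<le> e * norm h" by (simp add: mult.commute)
      qed
    qed
  qed auto
  then obtain g where g: "\<And>x. (\<lambda>n. approx n x j) \<longlonglongrightarrow> g x" "\<And>x. (g has_derivative (\<lambda>h. h *\<^sub>R V sol x)) (at x)" by auto
  have "g = (\<lambda>t. sol t j)" using LIMSEQ_unique[OF g(1) approx_tendsto] by auto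
  then show ?thesis using g(2)[of t] unfolding V_def has_vector_derivative_def by simp
qed

lemma sol_bound:
  assumes "finite J" "0 \<notin> J" shows "(\<Sum>j\<in>J. (cmod (sol t j))\<^sup>2) \<le> N\<^sup>2"
proof (rule tendsto_upperbound)
  show "(\<lambda>m. \<Sum>j\<in>J. (cmod (approx m t j))\<^sup>2) \<longlonglongrightarrow> (\<Sum>j\<in>J. (cmod (sol t j))\<^sup>2)"
    by (intro tendsto_intros approx_tendsto)
  have "(\<Sum>j\<in>J. (cmod (approx m t j))\<^sup>2) \<le> N\<^sup>2" for m
    using evol_bound[OF assms window_simps(1,2), of m \<phi> t] mass_le[of m] by (simp add: mass_def)
  then show "\<forall>\<^sub>F m in sequentially. (\<Sum>j\<in>J. (cmod (approx m t j))\<^sup>2) \<le> N\<^sup>2" by simp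
qed simp

text \<open>The increment is split into two tails and the increment of a truncated evolution.
  Letting \<open>n\<close> grow afterwards leaves Lipschitz dependence on time.\<close>

lemma sol_increment:
  assumes J: "finite J" "0 \<notin> J"
  shows "(\<Sum>j\<in>J. (cmod (sol s j - sol t j))\<^sup>2) \<le> 3 * (2 * (tail n)\<^sup>2 + (L * \<bar>s - t\<bar>)\<^sup>2 * N\<^sup>2)"
proof -
  have sq: "(cmod (x + y + z))\<^sup>2 \<le> 3 * ((cmod x)\<^sup>2 + (cmod y)\<^sup>2 + (cmod z)\<^sup>2)" for x y z :: complex
  proof -
    have "cmod (x + y + z) \<le> cmod x + cmod y + cmod z" by (meson norm_triangle_ineq order_trans add_right_mono)
    then have "(cmod (x + y + z))\<^sup>2 \<le> (cmod x + cmod y + cmod z)\<^sup>2" by (intro power_mono) auto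
    also have "\<dots> \<le> 3 * ((cmod x)\<^sup>2 + (cmod y)\<^sup>2 + (cmod z)\<^sup>2)"
    proof -
      have "0 \<le> (cmod x - cmod y)\<^sup>2 + (cmod y - cmod z)\<^sup>2 + (cmod x - cmod z)\<^sup>2" by simp
      then show ?thesis by (simp add: power2_eq_square algebra_simps)
    qed
    finally show ?thesis .
  qed
  have "(\<Sum>j\<in>J. (cmod (sol s j - sol t j))\<^sup>2) \<le>
     (\<Sum>j\<in>J. 3 * ((cmod (sol s j - approx n s j))\<^sup>2 + (cmod (approx n s j - approx n t j))\<^sup>2 + (cmod (sol t j - approx n t j))\<^sup>2))"
  proof (rule sum_mono)
    fix j
    have "sol s j - sol t j = (sol s j - approx n s j) + (approx n s j - approx n t j) + (- (sol t j - approx n t j))" by simp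
    then show "(cmod (sol s j - sol t j))\<^sup>2 \<le> 3 * ((cmod (sol s j - approx n s j))\<^sup>2 + (cmod (approx n s j - approx n t j))\<^sup>2 + (cmod (sol t j - approx n t j))\<^sup>2)"
      using sq[of "sol s j - approx n s j" "approx n s j - approx n t j" "- (sol t j - approx n t j)"] by (simp only: norm_minus_cancel)
  qed
  also have "\<dots> = 3 * ((\<Sum>j\<in>J. (cmod (sol s j - approx n s j))\<^sup>2) + (\<Sum>j\<in>J. (cmod (approx n s j - approx n t j))\<^sup>2) + (\<Sum>j\<in>J. (cmod (sol t j - approx n t j))\<^sup>2))"
    by (simp add: sum.distrib sum_distrib_left)
  also have "\<dots> \<le> 3 * ((tail n)\<^sup>2 + (L * \<bar>s - t\<bar>)\<^sup>2 * N\<^sup>2 + (tail n)\<^sup>2)"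
  proof (intro mult_left_mono add_mono sol_diff J)
    have "(\<Sum>j\<in>J. (cmod (approx n s j - approx n t j))\<^sup>2) \<le> (L * \<bar>s - t\<bar>)\<^sup>2 * mass n"
      unfolding mass_def by (rule evol_lipschitz) (use J in auto)
    also have "\<dots> \<le> (L * \<bar>s - t\<bar>)\<^sup>2 * N\<^sup>2" by (intro mult_left_mono mass_le) simp
    finally show "(\<Sum>j\<in>J. (cmod (approx n s j - approx n t j))\<^sup>2) \<le> (L * \<bar>s - t\<bar>)\<^sup>2 * N\<^sup>2" .
  qed simp
  finally show ?thesis by (simp add: algebra_simps)
qed

lemma sol_continuous: "((\<lambda>s. lr_enorm 2 (\<lambda>j. sol s j - sol t j)) \<longlongrightarrow> 0) (at t)"
proof -
  have key: "lr_enorm 2 (\<lambda>j. sol s j - sol t j) \<le> ennreal (sqrt 3 * L * N * \<bar>s - t\<bar>)" for s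
  proof (rule lr_enorm_2_le)
    have L0: "0 \<le> L \<or> space M = {}" using \<Lambda>_bound abs_ge_zero order_trans by blast
    fix m
    have "(\<Sum>j\<in>window m. (cmod (sol s j - sol t j))\<^sup>2) \<le> 3 * (2 * 0\<^sup>2 + (L * \<bar>s - t\<bar>)\<^sup>2 * N\<^sup>2)"
    proof (rule tendsto_lowerbound)
      show "(\<lambda>n. 3 * (2 * (tail n)\<^sup>2 + (L * \<bar>s - t\<bar>)\<^sup>2 * N\<^sup>2)) \<longlonglongrightarrow> 3 * (2 * 0\<^sup>2 + (L * \<bar>s - t\<bar>)\<^sup>2 * N\<^sup>2)"
        by (intro tendsto_intros tail_tendsto)
      show "\<forall>\<^sub>F n in sequentially. (\<Sum>j\<in>window m. (cmod (sol s j - sol t j))\<^sup>2) \<le> 3 * (2 * (tail n)\<^sup>2 + (L * \<bar>s - t\<bar>)\<^sup>2 * N\<^sup>2)"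
        by (intro always_eventually allI sol_increment window_simps)
    qed simp
    then show "(\<Sum>j\<in>window m. (cmod (sol s j - sol t j))\<^sup>2) \<le> (sqrt 3 * L * N * \<bar>s - t\<bar>)\<^sup>2"
      by (simp add: power_mult_distrib mult_ac)
  next
    \<comment> \<open>\<open>L\<close> bounds \<open>\<bar>\<Lambda> x\<bar>\<close> and is
      therefore nonnegative as soon as \<open>M\<close> has a point; that \<open>\<Psi> 1\<close>
      has norm 1 provides one.\<close>
    have "space M \<noteq> {}"
    proof
      assume "space M = {}"
      then have "(\<integral>x. \<Psi> 1 x * cnj (\<Psi> 1 x) \<partial>M) = 0" by (subst Bochner_Integration.integral_cong[where N = M and g = "\<lambda>_. 0"]) auto
      then show False using orthonormal[of 1 1] by simp
    qed
    then have "0 \<le> L" using \<Lambda>_bound abs_ge_zero order_trans by blast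
    then show "0 \<le> sqrt 3 * L * N * \<bar>s - t\<bar>" using N by simp
  qed
  have "((\<lambda>s. ennreal (sqrt 3 * L * N * \<bar>s - t\<bar>)) \<longlongrightarrow> ennreal (sqrt 3 * L * N * \<bar>t - t\<bar>)) (at t)"
    by (intro tendsto_intros)
  then have lim: "((\<lambda>s. ennreal (sqrt 3 * L * N * \<bar>s - t\<bar>)) \<longlongrightarrow> 0) (at t)" by simp
  show ?thesis
    by (rule tendsto_sandwich[OF _ _ tendsto_const lim]) (use key in auto)
qed

text \<open>One sequence serves for both \<open>u\<close> and \<open>v\<close>, so the coupling at
  site 0 holds by construction.\<close>

lemma solution_exists:
  assumes b: "a = 1 / b1\<^sup>2" "b = 1 / b2\<^sup>2"
  shows "is_solution b1 b2 \<phi> sol sol"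
proof -
  have gl: "glue sol sol t j = (if j = 0 then 0 else sol t j)" for t j by (auto simp: glue_def)
  have cong: "lr_enorm 2 f = lr_enorm 2 g" if "\<And>j. j \<noteq> 0 \<Longrightarrow> f j = g j" for f g
    unfolding lr_enorm_2 by (intro arg_cong2[where f = ennpow] nn_integral_cong refl) (auto simp: Zstar_def that)
  have "lr_enorm 2 (glue sol sol t) \<le> ennreal N" for t
  proof (rule lr_enorm_2_le[OF _ N])
    fix n
    have "(\<Sum>j\<in>window n. (cmod (glue sol sol t j))\<^sup>2) = (\<Sum>j\<in>window n. (cmod (sol t j))\<^sup>2)"
      by (rule sum.cong) (auto simp: gl window_def)
    then show "(\<Sum>j\<in>window n. (cmod (glue sol sol t j))\<^sup>2) \<le> N\<^sup>2" using sol_bound[of "window n" t] by simp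
  qed
  then have "in_l2 (glue sol sol t)" for t unfolding in_l2_def
    by (metis ennreal_less_top infinity_ennreal_def le_less_trans)
  moreover have "((\<lambda>s. lr_enorm 2 (\<lambda>j. glue sol sol s j - glue sol sol t j)) \<longlongrightarrow> 0) (at t)" for t
  proof -
    have "lr_enorm 2 (\<lambda>j. glue sol sol s j - glue sol sol t j) = lr_enorm 2 (\<lambda>j. sol s j - sol t j)" for s
      by (rule cong) (simp add: gl)
    then show ?thesis using sol_continuous[of t] by (simp only:)
  qed
  moreover have "schroedinger_at b1 sol t j" if "j \<le> -1" for t j
    unfolding schroedinger_at_def
    by (intro exI conjI, rule sol_has_derivative[of a, OF left[OF that]])
       (simp_all add: b discrete_laplacian_def add_divide_distrib[symmetric])
  moreover have "schroedinger_at b2 sol t j" if "j \<ge> 1" for t j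
    unfolding schroedinger_at_def
    by (intro exI conjI, rule sol_has_derivative[of b, OF right[OF that]])
       (simp_all add: b discrete_laplacian_def add_divide_distrib[symmetric])
  ultimately show ?thesis
    unfolding is_solution_def C_l2_def using sol_flux b sol_initial by auto
qed

section \<open>Uniqueness\<close>

lemma Cl2_locally_bounded:
  assumes "C_l2 w"
  shows "\<exists>D. \<forall>s\<in>{x..y}. \<forall>j. j \<noteq> 0 \<longrightarrow> cmod (w s j) \<le> D"
proof (rule ccontr)
  \<comment> \<open>Near each time \<open>l\<close> the entries are bounded by the norm at
    \<open>l\<close> plus 1, uniformly in the site; times at which entries exceed every bound would
    accumulate in the compact interval.\<close>
  assume "\<not> ?thesis"
  then have "\<forall>n. \<exists>s j. s \<in> {x..y} \<and> j \<noteq> 0 \<and> cmod (w s j) > real n" by (meson not_le)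
  then obtain S J where SJ: "\<And>n. S n \<in> {x..y}" "\<And>n. J n \<noteq> 0" "\<And>n. cmod (w (S n) (J n)) > real n" by metis
  obtain l r where l: "strict_mono r" "(S \<circ> r) \<longlonglongrightarrow> l"
    using compact_Icc[of x y] SJ(1) unfolding compact_def by metis
  obtain c where c: "0 \<le> c" "lr_enorm 2 (w l) = ennreal c" using assms in_l2_finite unfolding C_l2_def by blast
  have "((\<lambda>s. lr_enorm 2 (\<lambda>j. w s j - w l j)) \<longlongrightarrow> 0) (at l)" using assms unfolding C_l2_def by blast
  then have "\<forall>\<^sub>F s in at l. lr_enorm 2 (\<lambda>j. w s j - w l j) < 1" by (rule order_tendstoD) simp
  then have ev: "\<forall>\<^sub>F s in nhds l. s \<noteq> l \<longrightarrow> lr_enorm 2 (\<lambda>j. w s j - w l j) < 1" by (simp add: eventually_at_filter)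
  have bnd: "\<forall>\<^sub>F s in nhds l. \<forall>j. j \<noteq> 0 \<longrightarrow> cmod (w s j) \<le> c + 1"
    using ev
  proof eventually_elim
    case (elim s)
    show ?case
    proof (intro allI impI)
      fix j :: int assume j: "j \<noteq> 0"
      have wl: "cmod (w l j) \<le> c" by (rule lr_enorm_2_component) (use c j in auto)
      show "cmod (w s j) \<le> c + 1"
      proof (cases "s = l")
        case False
        then have "lr_enorm 2 (\<lambda>j. w s j - w l j) \<le> ennreal 1" using elim by simp
        from lr_enorm_2_component[OF this _ j] have "cmod (w s j - w l j) \<le> 1" by simp
        then show ?thesis using wl norm_triangle_ineq2[of "w s j" "w l j"] by linarith
      qed (use wl in simp)
    qed
  qed
  have "\<forall>\<^sub>F n in sequentially. \<forall>j. j \<noteq> 0 \<longrightarrow> cmod (w ((S \<circ> r) n) j) \<le> c + 1"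
    using l(2) bnd by (auto simp: filterlim_iff)
  moreover have "\<forall>\<^sub>F n in sequentially. c + 1 \<le> real n"
    using filterlim_real_sequentially by (auto simp: filterlim_at_top)
  ultimately have "\<forall>\<^sub>F n in sequentially. False"
  proof eventually_elim
    case (elim n)
    have "real n \<le> real (r n)" using seq_suble[OF l(1)] by simp
    then show ?case using elim SJ(2,3)[of "r n"] by force
  qed
  then show False by simp
qed

text \<open>The equations are assumed only away from time 0; continuity of the single entries
  carries the uniqueness argument across it.\<close>

lemma Cl2_continuous:
  assumes "C_l2 w" "j \<noteq> 0" shows "continuous_on UNIV (\<lambda>s. w s j)"
proof -
  have "((\<lambda>s. w s j) \<longlongrightarrow> w t j) (at t)" for t
  proof (rule tendstoI)
    fix e :: real assume e: "0 < e"
    have "((\<lambda>s. lr_enorm 2 (\<lambda>j. w s j - w t j)) \<longlongrightarrow> 0) (at t)" using assms unfolding C_l2_def by blast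
    then have "\<forall>\<^sub>F s in at t. lr_enorm 2 (\<lambda>j. w s j - w t j) < ennreal (e / 2)" by (rule order_tendstoD) (use e in simp)
    then show "\<forall>\<^sub>F s in at t. dist (w s j) (w t j) < e"
    proof eventually_elim
      case (elim s)
      then have "cmod (w s j - w t j) \<le> e / 2" using e assms(2)
        by (intro lr_enorm_2_component[where w = "\<lambda>j. w s j - w t j"]) auto
      then show ?case using e by (simp add: dist_norm)
    qed
  qed
  then show ?thesis by (simp add: continuous_on_def)
qed

text \<open>The solution \<open>w\<close> is paired with row \<open>k\<close> of the propagator run
  backwards from \<open>t\<close>. For large windows the pairing at \<open>s = t\<close> is
  \<open>w t k\<close>, at \<open>s = 0\<close> it is the truncated evolution of the datum, and the
  two differ by a time integral of boundary terms near \<open>n\<close> and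
  \<open>- n\<close>.\<close>

lemma solution_unique:
  assumes b: "a = 1 / b1\<^sup>2" "b = 1 / b2\<^sup>2" and s: "is_solution b1 b2 \<phi> u v" and k: "k \<noteq> 0"
  shows "glue u v t k = sol t k"
proof -
  define w where "w s j = (if j \<le> 0 then u s j else v s j)" for s j
  note s' = s[unfolded is_solution_def]
  have Cl: "C_l2 (glue u v)" using s' by blast
  have wg: "w s j = glue u v s j" if "j \<noteq> 0" for s j using that by (auto simp: w_def glue_def)
  have wcont: "continuous_on UNIV (\<lambda>s. w s j)" if "j \<noteq> 0" for j
    using Cl2_continuous[OF Cl that] by (simp add: wg[OF that])
  have wflux: "a * (w s (-1) - w s 0) = b * (w s 0 - w s 1)" if "s \<noteq> 0" for s
  proof -
    have "u s 0 = v s 0" "a * (u s (-1) - u s 0) = b * (v s 0 - v s 1)" using s' that by (auto simp: b)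
    then show ?thesis by (simp add: w_def)
  qed
  define c where "c j = (if j < 0 then a else b)" for j :: int
  have wderiv: "((\<lambda>s. w s j) has_vector_derivative \<i> * c j * (w s (j + 1) - 2 * w s j + w s (j - 1))) (at s)"
    if "s \<noteq> 0" "j \<noteq> 0" for s j
  proof (cases "j < 0")
    case True
    then have "schroedinger_at b1 u s j" using s' that by auto
    then obtain w' where w': "((\<lambda>s. u s j) has_vector_derivative w') (at s)" "\<i> * w' + complex_of_real a * discrete_laplacian (u s) j = 0"
      unfolding schroedinger_at_def b by blast
    have "w' = \<i> * a * discrete_laplacian (u s) j"
    proof -
      have "\<i> * (\<i> * w' + complex_of_real a * discrete_laplacian (u s) j) = 0" using w'(2) by simp
      then show ?thesis by (simp add: algebra_simps eq_neg_iff_add_eq_0)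
    qed
    moreover have "discrete_laplacian (u s) j = w s (j + 1) - 2 * w s j + w s (j - 1)" using True by (simp add: discrete_laplacian_def w_def)
    moreover have "(\<lambda>s. u s j) = (\<lambda>s. w s j)" using True by (simp add: w_def)
    ultimately show ?thesis using w'(1) True by (simp add: c_def)
  next
    case False
    then have "schroedinger_at b2 v s j" using s' that by auto
    then obtain w' where w': "((\<lambda>s. v s j) has_vector_derivative w') (at s)" "\<i> * w' + complex_of_real b * discrete_laplacian (v s) j = 0"
      unfolding schroedinger_at_def b by blast
    have "w' = \<i> * b * discrete_laplacian (v s) j"
    proof -
      have "\<i> * (\<i> * w' + complex_of_real b * discrete_laplacian (v s) j) = 0" using w'(2) by simp
      then show ?thesis by (simp add: algebra_simps eq_neg_iff_add_eq_0)
    qed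
    moreover have "v s 0 = w s 0" using s' that by (auto simp: w_def)
    then have "discrete_laplacian (v s) j = w s (j + 1) - 2 * w s j + w s (j - 1)" using False that
      by (cases "j = 1") (auto simp: discrete_laplacian_def w_def)
    moreover have "(\<lambda>s. v s j) = (\<lambda>s. w s j)" using False that by (simp add: w_def)
    ultimately show ?thesis using w'(1) False that by (simp add: c_def)
  qed
  \<comment> \<open>In its second index the kernel solves the same equation with time reversed, so
    in the derivative of the products with \<open>w\<close> all interior terms cancel by the Green
    formula.\<close>
  define \<kappa> where "\<kappa> s j = kernel (t - s) k j" for s j
  have \<kappa>flux: "a * (\<kappa> s (-1) - \<kappa> s 0) = b * (\<kappa> s 0 - \<kappa> s 1)" for s unfolding \<kappa>_def by (rule kernel_flux)
  have \<kappa>deriv: "((\<lambda>s. \<kappa> s j) has_vector_derivative - (\<i> * c j * (\<kappa> s (j + 1) - 2 * \<kappa> s j + \<kappa> s (j - 1)))) (at s)"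
    if "j \<noteq> 0" for s j
  proof -
    have r: "complex_of_real (c j) * (\<Psi> (j + 1) x - 2 * \<Psi> j x + \<Psi> (j - 1) x) = \<Lambda> x * \<Psi> j x" if "x \<in> space M" for x
      using left[of j x] right[of j x] \<open>j \<noteq> 0\<close> that by (auto simp: c_def)
    have "((\<lambda>s. t - s) has_vector_derivative - 1) (at s)" by (auto intro!: derivative_eq_intros)
    from vector_diff_chain_at[OF this kernel_has_derivative[of k j "t - s"]]
    have "((\<lambda>s. kernel (t - s) k j) has_vector_derivative - kernel_deriv (t - s) k j) (at s)" by (simp add: o_def)
    moreover have "kernel_deriv (t - s) k j = \<i> * c j * (kernel (t - s) k (j + 1) - 2 * kernel (t - s) k j + kernel (t - s) k (j - 1))"
      by (rule kernel_deriv_eq(2)) (rule r)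
    ultimately show ?thesis unfolding \<kappa>_def by (simp only:)
  qed
  define p where "p n s = (\<Sum>j\<in>window n. w s j * \<kappa> s j)" for n s
  \<comment> \<open>At \<open>s = 0\<close> no derivative is assumed and \<open>D\<close> gets an
    arbitrary value; the pairing is continuous there, and one point does not affect the
    integral.\<close>
  define D where "D n s = (if s = 0 then 0 else \<i> * (b * (w s (int n + 1) * \<kappa> s (int n) - w s (int n) * \<kappa> s (int n + 1))
     + a * (w s (- int n - 1) * \<kappa> s (- int n) - w s (- int n) * \<kappa> s (- int n - 1))))" for n s
  have pderiv: "(p n has_vector_derivative D n s) (at s)" if "s \<noteq> 0" for n s
  proof -
    have "(p n has_vector_derivative (\<Sum>j\<in>window n. w s j * (- (\<i> * c j * (\<kappa> s (j + 1) - 2 * \<kappa> s j + \<kappa> s (j - 1))))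
        + \<i> * c j * (w s (j + 1) - 2 * w s j + w s (j - 1)) * \<kappa> s j)) (at s)"
      unfolding p_def[abs_def]
    proof (rule has_vector_derivative_sum)
      fix j assume "j \<in> window n"
      then have "j \<noteq> 0" by (auto simp: window_def)
      then show "((\<lambda>s. w s j * \<kappa> s j) has_vector_derivative w s j * (- (\<i> * c j * (\<kappa> s (j + 1) - 2 * \<kappa> s j + \<kappa> s (j - 1))))
        + \<i> * c j * (w s (j + 1) - 2 * w s j + w s (j - 1)) * \<kappa> s j) (at s)"
        by (intro has_vector_derivative_mult wderiv \<kappa>deriv that)
    qed
    also have "(\<Sum>j\<in>window n. w s j * (- (\<i> * c j * (\<kappa> s (j + 1) - 2 * \<kappa> s j + \<kappa> s (j - 1))))
        + \<i> * c j * (w s (j + 1) - 2 * w s j + w s (j - 1)) * \<kappa> s j) =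
       \<i> * (\<Sum>j\<in>window n. c j * ((w s (j + 1) - 2 * w s j + w s (j - 1)) * \<kappa> s j - w s j * (\<kappa> s (j + 1) - 2 * \<kappa> s j + \<kappa> s (j - 1))))"
      unfolding sum_distrib_left by (rule sum.cong) (simp_all add: algebra_simps)
    also have "\<dots> = D n s"
      unfolding c_def using green_formula[where f = "w s" and g = "\<kappa> s", OF wflux[OF that] \<kappa>flux] that
      by (simp only: D_def if_False)
    finally show ?thesis .
  qed
  have \<kappa>cont: "continuous_on UNIV (\<lambda>s. \<kappa> s j)" if "j \<noteq> 0" for j
    using \<kappa>deriv[OF that] by (meson continuous_at_imp_continuous_on has_vector_derivative_continuous)
  have pcont: "continuous_on UNIV (p n)" for n
    unfolding p_def[abs_def] by (intro continuous_on_sum continuous_on_mult wcont \<kappa>cont) (auto simp: window_def)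
  define \<beta> where "\<beta> = B * B * measure M (space M)"
  have \<kappa>b: "cmod (\<kappa> s j) \<le> \<beta>" for s j unfolding \<kappa>_def \<beta>_def by (rule norm_kernel_le)
  have \<beta>0: "0 \<le> \<beta>" using \<kappa>b[of 0 0] norm_ge_zero order_trans by blast
  have Db: "cmod (D n s) \<le> b * ((cmod (w s (int n + 1)) + cmod (w s (int n))) * \<beta>) + a * ((cmod (w s (- int n - 1)) + cmod (w s (- int n))) * \<beta>)" for n s
  proof -
    have t2: "cmod (x * y - z * y') \<le> (cmod x + cmod z) * \<beta>" if "cmod y \<le> \<beta>" "cmod y' \<le> \<beta>" for x y z y'
    proof -
      have "cmod (x * y - z * y') \<le> cmod x * cmod y + cmod z * cmod y'" by (metis norm_mult norm_triangle_ineq4)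
      also have "\<dots> \<le> cmod x * \<beta> + cmod z * \<beta>" using that by (intro add_mono mult_left_mono) auto
      finally show ?thesis by (simp add: distrib_right)
    qed
    have pos: "0 \<le> b * ((cmod (w s (int n + 1)) + cmod (w s (int n))) * \<beta>) + a * ((cmod (w s (- int n - 1)) + cmod (w s (- int n))) * \<beta>)"
      using ab \<beta>0 by (intro add_nonneg_nonneg mult_nonneg_nonneg) auto
    show ?thesis
    proof (cases "s = 0")
      case False
      have "cmod (D n s) = cmod (b * (w s (int n + 1) * \<kappa> s (int n) - w s (int n) * \<kappa> s (int n + 1))
         + a * (w s (- int n - 1) * \<kappa> s (- int n) - w s (- int n) * \<kappa> s (- int n - 1)))"
        unfolding D_def using False by (simp add: norm_mult)
      also have "\<dots> \<le> b * cmod (w s (int n + 1) * \<kappa> s (int n) - w s (int n) * \<kappa> s (int n + 1))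
         + a * cmod (w s (- int n - 1) * \<kappa> s (- int n) - w s (- int n) * \<kappa> s (- int n - 1))"
        using ab by (intro order_trans[OF norm_triangle_ineq]) (simp add: norm_mult)
      also have "\<dots> \<le> b * ((cmod (w s (int n + 1)) + cmod (w s (int n))) * \<beta>) + a * ((cmod (w s (- int n - 1)) + cmod (w s (- int n))) * \<beta>)"
        using ab by (intro add_mono mult_left_mono t2 \<kappa>b) auto
      finally show ?thesis .
    qed (use pos in \<open>simp add: D_def\<close>)
  qed
  \<comment> \<open>Square summability along an injective sequence of sites. The index is shifted by
    one because \<open>f 0\<close> may be site 0, which the norm does not see.\<close>
  have wnull: "(\<lambda>n. w s (f n)) \<longlonglongrightarrow> 0" if inj: "inj f" and nz: "\<And>n. n > 0 \<Longrightarrow> f n \<noteq> 0" for s and f :: "nat \<Rightarrow> int"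
  proof -
    obtain d where d: "0 \<le> d" "lr_enorm 2 (glue u v s) = ennreal d" using Cl in_l2_finite unfolding C_l2_def by blast
    have "summable (\<lambda>n. (cmod (glue u v s (f (Suc n))))\<^sup>2)"
    proof (rule summableI_nonneg_bounded)
      fix n
      have "(\<Sum>i<n. (cmod (glue u v s (f (Suc i))))\<^sup>2) = (\<Sum>j\<in>(\<lambda>i. f (Suc i)) ` {..<n}. (cmod (glue u v s j))\<^sup>2)"
        using inj by (subst sum.reindex) (auto simp: inj_on_def inj_def)
      also have "\<dots> \<le> d\<^sup>2"
      proof (rule lr_enorm_2_sum_le)
        show "0 \<notin> (\<lambda>i. f (Suc i)) ` {..<n}" using nz[of "Suc _"] by (auto simp: image_iff)
      qed (use d in auto)
      finally show "(\<Sum>i<n. (cmod (glue u v s (f (Suc i))))\<^sup>2) \<le> d\<^sup>2" .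
    qed simp
    then have "(\<lambda>n. (cmod (glue u v s (f (Suc n))))\<^sup>2) \<longlonglongrightarrow> 0" by (rule summable_LIMSEQ_zero)
    then have "(\<lambda>n. sqrt ((cmod (glue u v s (f (Suc n))))\<^sup>2)) \<longlonglongrightarrow> sqrt 0" by (rule tendsto_real_sqrt)
    then have "(\<lambda>n. glue u v s (f (Suc n))) \<longlonglongrightarrow> 0" by (simp add: tendsto_norm_zero_iff)
    then have "(\<lambda>n. w s (f (Suc n))) \<longlonglongrightarrow> 0" using wg[OF nz[OF zero_less_Suc]] by simp
    then show ?thesis by (rule LIMSEQ_imp_Suc)
  qed
  have Dnull: "(\<lambda>n. D n s) \<longlonglongrightarrow> 0" for s
  proof (rule Lim_null_comparison[OF always_eventually[OF allI[OF Db]]])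
    have 1: "(\<lambda>n. w s (int n + 1)) \<longlonglongrightarrow> 0" "(\<lambda>n. w s (int n)) \<longlonglongrightarrow> 0"
      "(\<lambda>n. w s (- int n - 1)) \<longlonglongrightarrow> 0" "(\<lambda>n. w s (- int n)) \<longlonglongrightarrow> 0"
      by (rule wnull; auto simp: inj_def)+
    have "(\<lambda>n. b * ((cmod (w s (int n + 1)) + cmod (w s (int n))) * \<beta>) + a * ((cmod (w s (- int n - 1)) + cmod (w s (- int n))) * \<beta>))
       \<longlonglongrightarrow> b * ((cmod 0 + cmod 0) * \<beta>) + a * ((cmod 0 + cmod 0) * \<beta>)"
      by (intro tendsto_intros 1)
    then show "(\<lambda>n. b * ((cmod (w s (int n + 1)) + cmod (w s (int n))) * \<beta>) + a * ((cmod (w s (- int n - 1)) + cmod (w s (- int n))) * \<beta>)) \<longlonglongrightarrow> 0" by simp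
  qed
  have diff: "(\<lambda>n. p n y - p n x) \<longlonglongrightarrow> 0" if "x \<le> y" for x y
  proof -
    obtain E where E: "\<And>s j. s \<in> {x..y} \<Longrightarrow> j \<noteq> 0 \<Longrightarrow> cmod (w s j) \<le> E"
      using Cl2_locally_bounded[OF Cl, of x y] wg by metis
    have ft: "(D n has_integral (p n y - p n x)) {x..y}" for n
      by (rule fundamental_theorem_of_calculus_interior_strong[where S = "{0}"])
         (use that pderiv continuous_on_subset[OF pcont] in auto)
    \<comment> \<open>\<open>D 0\<close> contains the value of \<open>w\<close> at site 0, which the
      l2 bound does not control; the shift avoids it.\<close>
    have "(\<lambda>n. integral {x..y} (D (Suc n))) \<longlonglongrightarrow> integral {x..y} (\<lambda>s. 0)"
    proof (rule dominated_convergence(2))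
      show "D (Suc n) integrable_on {x..y}" for n using ft by blast
      show "(\<lambda>s. b * ((E + E) * \<beta>) + a * ((E + E) * \<beta>)) integrable_on {x..y}"
        by (rule integrable_continuous_real) (rule continuous_on_const)
      show "cmod (D (Suc n) s) \<le> b * ((E + E) * \<beta>) + a * ((E + E) * \<beta>)" if "s \<in> {x..y}" for n s
      proof (rule order_trans[OF Db])
        have "cmod (w s (int (Suc n) + 1)) \<le> E" "cmod (w s (int (Suc n))) \<le> E"
          "cmod (w s (- int (Suc n) - 1)) \<le> E" "cmod (w s (- int (Suc n))) \<le> E"
          by (rule E[OF that]; simp)+
        then show "b * ((cmod (w s (int (Suc n) + 1)) + cmod (w s (int (Suc n)))) * \<beta>)
            + a * ((cmod (w s (- int (Suc n) - 1)) + cmod (w s (- int (Suc n)))) * \<beta>) \<le> b * ((E + E) * \<beta>) + a * ((E + E) * \<beta>)"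
          using ab \<beta>0 by (intro add_mono mult_left_mono mult_right_mono) auto
      qed
      show "(\<lambda>n. D (Suc n) s) \<longlonglongrightarrow> 0" for s using Dnull by (rule LIMSEQ_Suc)
    qed
    then have "(\<lambda>n. p (Suc n) y - p (Suc n) x) \<longlonglongrightarrow> 0" using integral_unique[OF ft] by simp
    then show ?thesis by (rule LIMSEQ_imp_Suc)
  qed
  have pt0: "(\<lambda>n. p n t - p n 0) \<longlonglongrightarrow> 0"
  proof (cases "0 \<le> t")
    case False
    then have "(\<lambda>n. - (p n 0 - p n t)) \<longlonglongrightarrow> - 0" by (intro tendsto_minus diff) auto
    then show ?thesis by simp
  qed (rule diff)
  have "\<forall>\<^sub>F n in sequentially. p n t = w t k"
  proof (rule eventually_sequentiallyI)
    fix n assume n: "nat \<bar>k\<bar> \<le> n"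
    then have kn: "k \<in> window n" using k by (auto simp: window_def)
    have "p n t = (\<Sum>j\<in>window n. if k = j then w t j else 0)"
      unfolding p_def \<kappa>_def using k by (intro sum.cong) (auto simp: kernel_0 window_def)
    also have "\<dots> = w t k" using kn by (simp add: sum.delta')
    finally show "p n t = w t k" .
  qed
  then have "(\<lambda>n. p n t) \<longlonglongrightarrow> w t k" by (rule tendsto_eventually)
  moreover have "p n 0 = approx n t k" for n
  proof -
    have "w 0 j = \<phi> j" if "j \<in> window n" for j
      using s' that by (auto simp: window_def w_def)
    then show ?thesis unfolding p_def \<kappa>_def evol_kernel by (intro sum.cong) auto
  qed
  ultimately have "(\<lambda>n. p n t - (p n t - p n 0)) \<longlonglongrightarrow> w t k - 0"
    using pt0 by (intro tendsto_diff)
  then have "(\<lambda>n. approx n t k) \<longlonglongrightarrow> w t k" using \<open>\<And>n. p n 0 = approx n t k\<close> by simp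
  then show ?thesis using approx_tendsto LIMSEQ_unique wg[OF k] by metis
qed

section \<open>Endpoint estimate for the solution\<close>

lemma approx_measurable: "(\<lambda>t. approx n t j) \<in> borel_measurable borel"
proof -
  have "continuous_on UNIV (\<lambda>t. kernel t j k)" for k
    using kernel_has_derivative by (meson continuous_at_imp_continuous_on has_vector_derivative_continuous)
  then have "continuous_on UNIV (\<lambda>t. approx n t j)" unfolding evol_kernel
    by (intro continuous_on_sum continuous_on_mult continuous_on_const)
  then show ?thesis by (rule borel_measurable_continuous_onI)
qed

lemma sol_measurable: "(\<lambda>t. sol t j) \<in> borel_measurable borel"
  by (rule borel_measurable_LIMSEQ_metric[OF approx_measurable approx_tendsto])

text \<open>Fatou's lemma: a supremum of limits is at most the lower limit of the suprema, and the
  bounds for truncated data involve only \<open>mass n \<le> N\<^sup>2\<close>.\<close>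

lemma sol_strichartz:
  assumes "0 \<le> C"
    and st: "\<And>K. finite K \<Longrightarrow> 0 \<notin> K \<Longrightarrow>
      (\<integral>\<^sup>+ t. (SUP j\<in>{j. j \<noteq> 0}. ennreal (cmod (evol K \<phi> t j) ^ 6)) \<partial>lborel) \<le> ennreal (C * (\<Sum>k\<in>K. (cmod (\<phi> k))\<^sup>2) ^ 3)"
  shows "(\<integral>\<^sup>+ t. (SUP j\<in>{j. j \<noteq> 0}. ennreal (cmod (sol t j) ^ 6)) \<partial>lborel) \<le> ennreal (C * N ^ 6)"
proof -
  let ?h = "\<lambda>n t. (SUP j\<in>{j. j \<noteq> 0}. ennreal (cmod (approx n t j) ^ 6))"
  have m: "?h n \<in> borel_measurable lborel" for n
  proof -
    note [measurable] = approx_measurable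
    show ?thesis by (intro borel_measurable_SUP) (auto, measurable)
  qed
  have "(SUP j\<in>{j. j \<noteq> 0}. ennreal (cmod (sol t j) ^ 6)) \<le> liminf (\<lambda>n. ?h n t)" for t
  proof (rule SUP_least)
    fix j :: int assume "j \<in> {j. j \<noteq> 0}"
    have "(\<lambda>n. ennreal (cmod (approx n t j) ^ 6)) \<longlonglongrightarrow> ennreal (cmod (sol t j) ^ 6)"
      by (intro tendsto_intros approx_tendsto)
    then have "ennreal (cmod (sol t j) ^ 6) = liminf (\<lambda>n. ennreal (cmod (approx n t j) ^ 6))"
      by (intro lim_imp_Liminf[symmetric]) simp_all
    also have "\<dots> \<le> liminf (\<lambda>n. ?h n t)"
      by (rule Liminf_mono) (use \<open>j \<in> _\<close> in \<open>auto intro!: always_eventually SUP_upper\<close>)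
    finally show "ennreal (cmod (sol t j) ^ 6) \<le> liminf (\<lambda>n. ?h n t)" .
  qed
  then have "(\<integral>\<^sup>+ t. (SUP j\<in>{j. j \<noteq> 0}. ennreal (cmod (sol t j) ^ 6)) \<partial>lborel) \<le> (\<integral>\<^sup>+ t. liminf (\<lambda>n. ?h n t) \<partial>lborel)"
    by (intro nn_integral_mono)
  also have "\<dots> \<le> liminf (\<lambda>n. \<integral>\<^sup>+ t. ?h n t \<partial>lborel)" by (rule nn_integral_liminf[OF m])
  also have "\<dots> \<le> liminf (\<lambda>n. ennreal (C * N ^ 6))"
  proof (rule Liminf_mono, rule always_eventually, rule allI)
    fix n
    have "(\<integral>\<^sup>+ t. ?h n t \<partial>lborel) \<le> ennreal (C * mass n ^ 3)" unfolding mass_def by (rule st) auto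
    also have "\<dots> \<le> ennreal (C * (N\<^sup>2) ^ 3)"
      using assms(1) mass_le by (intro ennreal_leI mult_left_mono power_mono) (auto simp: mass_def sum_nonneg)
    finally show "(\<integral>\<^sup>+ t. ?h n t \<partial>lborel) \<le> ennreal (C * N ^ 6)" by simp
  qed
  also have "\<dots> = ennreal (C * N ^ 6)" by (simp add: Liminf_const)
  finally show ?thesis .
qed

end

end

section \<open>The spectral representation of the two-media Laplacian\<close>

text \<open>Two copies of an interval, one for each direction of incidence, are laid out on one
  symmetric interval, so that their disjoint union becomes an ordinary measure space. They share
  only the point 0, a null set.\<close>

definition two_sided :: "(real \<Rightarrow> 'a) \<Rightarrow> (real \<Rightarrow> 'a) \<Rightarrow> real \<Rightarrow> 'a" where
  "two_sided h1 h2 \<theta> = (if 0 \<le> \<theta> then h1 \<theta> else h2 (- \<theta>))"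

lemma two_sided_integral:
  fixes h1 h2 :: "real \<Rightarrow> 'a::euclidean_space"
  assumes h1: "continuous_on {0..c} h1" and h2: "continuous_on {0..c} h2"
  shows "two_sided h1 h2 \<in> borel_measurable (restrict_space lborel {- c..c})"
    "(\<integral>\<theta>. two_sided h1 h2 \<theta> \<partial>restrict_space lborel {- c..c}) = integral {0..c} h1 + integral {0..c} h2"
proof -
  have i: "integrable lborel (\<lambda>x. indicator {0..c} x *\<^sub>R h x)" "(\<integral>x. indicator {0..c} x *\<^sub>R h x \<partial>lborel) = integral {0..c} h"
    if "continuous_on {0..c} h" for h :: "real \<Rightarrow> 'a"
  proof -
    have s: "set_integrable lborel {0..c} h" by (rule borel_integrable_compact[OF compact_Icc that, folded set_integrable_def])
    then show "integrable lborel (\<lambda>x. indicator {0..c} x *\<^sub>R h x)" by (simp add: set_integrable_def)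
    show "(\<integral>x. indicator {0..c} x *\<^sub>R h x \<partial>lborel) = integral {0..c} h"
      using set_borel_integral_eq_integral(2)[OF s] by (simp add: set_lebesgue_integral_def)
  qed
  define g1 g2 where "g1 x = indicator {0..c} x *\<^sub>R h1 x" and "g2 x = indicator {0..c} (- x) *\<^sub>R h2 (- x)" for x :: real
  have I1: "integrable lborel g1" "integral\<^sup>L lborel g1 = integral {0..c} h1" unfolding g1_def[abs_def] by (rule i[OF h1])+
  have I2: "integrable lborel g2" "integral\<^sup>L lborel g2 = integral {0..c} h2"
    using lborel_integrable_real_affine[OF i(1)[OF h2], of "-1" 0] lborel_integral_real_affine[of "-1" "\<lambda>x. indicator {0..c} x *\<^sub>R h2 x" 0] i(2)[OF h2]
    by (simp_all add: g2_def[abs_def])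
  have [measurable]: "g1 \<in> borel_measurable borel" "g2 \<in> borel_measurable borel" using I1(1) I2(1) by auto
  have e: "indicator {- c..c} x *\<^sub>R two_sided h1 h2 x = (if 0 \<le> x then g1 x else g2 x)" for x
    by (auto simp: two_sided_def g1_def g2_def indicator_def)
  have m: "(\<lambda>x. indicator {- c..c} x *\<^sub>R two_sided h1 h2 x) \<in> borel_measurable lborel" unfolding e by measurable
  then show "two_sided h1 h2 \<in> borel_measurable (restrict_space lborel {- c..c})"
    by (subst borel_measurable_restrict_space_iff) auto
  have "(\<integral>\<theta>. two_sided h1 h2 \<theta> \<partial>restrict_space lborel {- c..c}) = (\<integral>x. indicator {- c..c} x *\<^sub>R two_sided h1 h2 x \<partial>lborel)"
    by (rule integral_restrict_space) simp
  also have "\<dots> = (\<integral>x. g1 x + g2 x \<partial>lborel)"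
  proof (rule integral_cong_AE[OF m])
    have "AE x in lborel. x \<noteq> (0::real)" by (rule AE_lborel_singleton)
    then show "AE x in lborel. indicator {- c..c} x *\<^sub>R two_sided h1 h2 x = g1 x + g2 x"
      unfolding e by eventually_elim (auto simp: g1_def g2_def indicator_def)
  qed measurable
  also have "\<dots> = integral {0..c} h1 + integral {0..c} h2" using I1 I2 by simp
  finally show "(\<integral>\<theta>. two_sided h1 h2 \<theta> \<partial>restrict_space lborel {- c..c}) = integral {0..c} h1 + integral {0..c} h2" .
qed

context two_media
begin

lemma channel_bound:
  assumes "0 \<le> \<theta>" "\<theta> \<le> pi"
  shows "norm (channel p q \<theta> j) \<le> 3" "norm (channel q p \<theta> j) \<le> 3"
proof -
  have nX: "norm (X x) = 1" for x by simp
  have c2: "norm (r * v ^ m) \<le> 2" if "norm v \<le> 1" "norm r \<le> 2" for v r :: complex and m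
  proof -
    have "norm (r * v ^ m) \<le> 2 * 1"
      unfolding norm_mult norm_power using that by (intro mult_mono) (auto simp: power_le_one)
    then show ?thesis by simp
  qed
  have b: "norm (u ^ n + r * v ^ m) \<le> 3" if "norm u = 1" "norm v \<le> 1" "norm r \<le> 2" for u v r :: complex and n m
    using norm_triangle_ineq[of "u ^ n" "r * v ^ m"] c2[OF that(2,3), of m] that(1) by (simp add: norm_power)
  have c: "norm (r * v ^ m) \<le> 3" if "norm v \<le> 1" "norm r \<le> 2" for v r :: complex and m
    using c2[OF that, of m] by simp
  have \<sigma>: "0 \<le> p / q * sin (\<theta> / 2)" using half_angle_bounds(1)[OF assms] pq by (intro mult_nonneg_nonneg) auto
  have Y: "norm ((Y \<theta>)\<^sup>2) \<le> 1" using norm_half_mult_le[OF \<sigma>] by (simp add: norm_power power_le_one)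
  have X: "norm ((X x)\<^sup>2) = 1" "norm (1 / (X x)\<^sup>2) = 1" for x by (simp_all add: norm_power norm_divide)
  show "norm (channel p q \<theta> j) \<le> 3"
  proof (cases "j \<le> 0")
    case True
    show ?thesis unfolding channel_fast(1)[OF True] by (intro b X coefficient_bounds assms) (simp add: norm_power)
  next
    case False
    then have j: "0 < j" by simp
    show ?thesis unfolding channel_fast(2)[OF j] by (intro c Y coefficient_bounds assms)
  qed
  define t where "t = angle_map p q \<theta>"
  have t: "0 \<le> t" "t \<le> edge" using angle_map_image[OF assms] by (auto simp: t_def)
  have nY: "norm (Y t) = 1" using fast_sin_le_1[OF t] by (intro half_mult_propagating(3)) auto
  then have Yt: "norm ((Y t)\<^sup>2) = 1" "norm (1 / (Y t)\<^sup>2) = 1" by (simp_all add: norm_power norm_divide)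
  show "norm (channel q p \<theta> j) \<le> 3"
  proof (cases "j \<le> 0")
    case True
    show ?thesis unfolding channel_slow(1)[OF assms True, folded t_def] by (intro b Yt coefficient_bounds' t) (rule eq_refl[OF Yt(1)])
  next
    case False
    then have j: "0 < j" by simp
    show ?thesis unfolding channel_slow(3)[OF assms j, folded t_def]
      by (intro c coefficient_bounds' t) (simp add: norm_power)
  qed
qed

end

lemma channel_recurrence:
  fixes p q \<theta> :: real and j :: int
  assumes "p > 0" "q > 0" "0 \<le> \<theta>" "\<theta> \<le> pi"
  shows "j \<le> -1 \<Longrightarrow> complex_of_real (p\<^sup>2) * (channel p q \<theta> (j + 1) - 2 * channel p q \<theta> j + channel p q \<theta> (j - 1)) = complex_of_real (- 4 * p\<^sup>2 * (sin (\<theta> / 2))\<^sup>2) * channel p q \<theta> j"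
    "j \<ge> 1 \<Longrightarrow> complex_of_real (q\<^sup>2) * (channel p q \<theta> (j + 1) - 2 * channel p q \<theta> j + channel p q \<theta> (j - 1)) = complex_of_real (- 4 * p\<^sup>2 * (sin (\<theta> / 2))\<^sup>2) * channel p q \<theta> j"
    "complex_of_real (p\<^sup>2) * (channel p q \<theta> (-1) - channel p q \<theta> 0) = complex_of_real (q\<^sup>2) * (channel p q \<theta> 0 - channel p q \<theta> 1)"
proof -
  have s: "q * (p / q * sin (\<theta> / 2)) = p * sin (\<theta> / 2)" using assms by simp
  note m = cis_half_quadratic[of \<theta>] cis_neq_zero half_mult_quadratic half_mult_nonzero channel_denominator(2)[OF assms]
  note l = mode_left[OF assms(1,2) s m] mode_right[OF assms(1,2) s m] mode_flux[OF assms(1,2) s m]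
  show "j \<le> -1 \<Longrightarrow> complex_of_real (p\<^sup>2) * (channel p q \<theta> (j + 1) - 2 * channel p q \<theta> j + channel p q \<theta> (j - 1)) = complex_of_real (- 4 * p\<^sup>2 * (sin (\<theta> / 2))\<^sup>2) * channel p q \<theta> j"
    unfolding channel_def by (rule l(1))
  show "j \<ge> 1 \<Longrightarrow> complex_of_real (q\<^sup>2) * (channel p q \<theta> (j + 1) - 2 * channel p q \<theta> j + channel p q \<theta> (j - 1)) = complex_of_real (- 4 * p\<^sup>2 * (sin (\<theta> / 2))\<^sup>2) * channel p q \<theta> j"
    unfolding channel_def by (rule l(2))
  show "complex_of_real (p\<^sup>2) * (channel p q \<theta> (-1) - channel p q \<theta> 0) = complex_of_real (q\<^sup>2) * (channel p q \<theta> 0 - channel p q \<theta> 1)"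
    unfolding channel_def by (rule l(3))
qed

lemma two_sided_prop:
  assumes "\<And>\<theta>. 0 \<le> \<theta> \<Longrightarrow> \<theta> \<le> c \<Longrightarrow> P (h1 \<theta>)" "\<And>\<theta>. 0 \<le> \<theta> \<Longrightarrow> \<theta> \<le> c \<Longrightarrow> P (h2 \<theta>)"
    "\<theta> \<in> space (restrict_space lborel {- c..c})"
  shows "P (two_sided h1 h2 \<theta>)"
  using assms by (auto simp: two_sided_def space_restrict_space)

text \<open>Nonnegative angles stand for incidence from the left, negative ones for incidence from the right.\<close>

definition channels :: "real \<Rightarrow> real \<Rightarrow> int \<Rightarrow> real \<Rightarrow> complex" where
  "channels p q j = two_sided (\<lambda>\<theta>. channel p q \<theta> j / sqrt (2 * pi)) (\<lambda>\<theta>. channel q p \<theta> (- j) / sqrt (2 * pi))"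

definition dispersion :: "real \<Rightarrow> real \<Rightarrow> real \<Rightarrow> real" where
  "dispersion p q = two_sided (\<lambda>\<theta>. - 4 * p\<^sup>2 * (sin (\<theta> / 2))\<^sup>2) (\<lambda>\<theta>. - 4 * q\<^sup>2 * (sin (\<theta> / 2))\<^sup>2)"

abbreviation circle :: "real measure" where
  "circle \<equiv> restrict_space lborel {- pi..pi}"

context two_media
begin

lemma p_pos: "0 < p" using pq by simp

lemma continuous_channels:
  "continuous_on {0..pi} (\<lambda>\<theta>. channel p q \<theta> j)" "continuous_on {0..pi} (\<lambda>\<theta>. channel q p \<theta> j)"
  using continuous_scattering(3) pq p_pos by auto

lemma continuous_normalized:
  "continuous_on {0..pi} (\<lambda>\<theta>. channel p q \<theta> j / sqrt (2 * pi))" "continuous_on {0..pi} (\<lambda>\<theta>. channel q p \<theta> j / sqrt (2 * pi))"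
  by (intro continuous_intros continuous_channels; simp)+

lemma continuous_dispersion: "continuous_on A (\<lambda>\<theta>. - 4 * r\<^sup>2 * (sin (\<theta> / 2))\<^sup>2 :: real)"
  by (intro continuous_intros) auto

lemma normalized_bound: "0 \<le> \<theta> \<Longrightarrow> \<theta> \<le> pi \<Longrightarrow> norm (channel p q \<theta> j / sqrt (2 * pi)) \<le> 3"
    "0 \<le> \<theta> \<Longrightarrow> \<theta> \<le> pi \<Longrightarrow> norm (channel q p \<theta> j / sqrt (2 * pi)) \<le> 3"
proof -
  have s: "1 \<le> sqrt (2 * pi)" using pi_gt3 by simp
  have *: "norm (z / sqrt (2 * pi)) \<le> 3" if "norm z \<le> 3" for z :: complex
  proof -
    have "norm (z / sqrt (2 * pi)) = norm z / sqrt (2 * pi)" by (simp add: norm_divide)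
    also have "\<dots> \<le> norm z / 1" using s by (intro divide_left_mono) auto
    finally show ?thesis using that by simp
  qed
  show "0 \<le> \<theta> \<Longrightarrow> \<theta> \<le> pi \<Longrightarrow> norm (channel p q \<theta> j / sqrt (2 * pi)) \<le> 3"
    "0 \<le> \<theta> \<Longrightarrow> \<theta> \<le> pi \<Longrightarrow> norm (channel q p \<theta> j / sqrt (2 * pi)) \<le> 3"
    by (intro * channel_bound; assumption)+
qed

lemma scaled_recurrence:
  fixes A B D c l s :: complex
  assumes "c * (A - 2 * B + D) = l * B"
  shows "c * (A / s - 2 * (B / s) + D / s) = l * (B / s)" "c * (D / s - 2 * (B / s) + A / s) = l * (B / s)"
proof -
  have "A / s - 2 * (B / s) + D / s = (A - 2 * B + D) / s" by (simp add: add_divide_distrib diff_divide_distrib)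
  then show 1: "c * (A / s - 2 * (B / s) + D / s) = l * (B / s)" using assms by simp
  have e: "D / s - 2 * (B / s) + A / s = A / s - 2 * (B / s) + D / s" by (simp add: algebra_simps)
  show "c * (D / s - 2 * (B / s) + A / s) = l * (B / s)" unfolding e by (rule 1)
qed

lemma scaled_flux: "c * (A - B) = d * (B - D) \<Longrightarrow> c * (A / s - B / s) = d * (B / s - D / s)"
  for A B D c d s :: complex
  by (metis diff_divide_distrib times_divide_eq_right)

text \<open>A state incident from the right is a mirrored state with the media exchanged, so its
  equation on one side is the recurrence of \<open>channel q p\<close> on the other.\<close>

lemma spectral_family: "spectral_family circle (p\<^sup>2) (q\<^sup>2) (channels p q) (dispersion p q) 3 (4 * p\<^sup>2)"
  unfolding spectral_family_def spectral_family_axioms_def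
proof (intro conjI allI impI)
  show "finite_measure circle" by (rule finite_measure_restrict_lborel_Icc)
  show "0 < p\<^sup>2" "0 < q\<^sup>2" using pq by auto
  show "channels p q j \<in> borel_measurable circle" for j unfolding channels_def
    by (intro two_sided_integral continuous_normalized)
  show "dispersion p q \<in> borel_measurable circle" unfolding dispersion_def
    by (intro two_sided_integral continuous_dispersion)
  fix \<theta> assume \<theta>: "\<theta> \<in> space circle"
  show "cmod (channels p q j \<theta>) \<le> 3" for j unfolding channels_def
    by (rule two_sided_prop[OF _ _ \<theta>]) (intro normalized_bound; assumption)+
  have m: "4 * p\<^sup>2 * (sin u)\<^sup>2 \<le> 4 * p\<^sup>2" "4 * q\<^sup>2 * (sin u)\<^sup>2 \<le> 4 * p\<^sup>2" for u :: real
  proof -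
    have "q\<^sup>2 \<le> p\<^sup>2" using pq by (intro power_mono) auto
    moreover have "(sin u)\<^sup>2 \<le> 1" by (simp add: abs_square_le_1)
    ultimately have "q\<^sup>2 * (sin u)\<^sup>2 \<le> p\<^sup>2 * 1" "p\<^sup>2 * (sin u)\<^sup>2 \<le> p\<^sup>2 * 1" by (intro mult_mono; simp)+
    then show "4 * p\<^sup>2 * (sin u)\<^sup>2 \<le> 4 * p\<^sup>2" "4 * q\<^sup>2 * (sin u)\<^sup>2 \<le> 4 * p\<^sup>2" by simp_all
  qed
  show "\<bar>dispersion p q \<theta>\<bar> \<le> 4 * p\<^sup>2" unfolding dispersion_def
    by (rule two_sided_prop[OF _ _ \<theta>]) (use m in \<open>simp_all add: abs_mult\<close>)
  have c: "0 \<le> \<theta> \<and> \<theta> \<le> pi \<or> \<not> 0 \<le> \<theta> \<and> 0 \<le> - \<theta> \<and> - \<theta> \<le> pi" using \<theta> by (auto simp: space_restrict_space)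
  note r = channel_recurrence[OF p_pos pq(1)] and r' = channel_recurrence[OF pq(1) p_pos]
  show "complex_of_real (p\<^sup>2) * (channels p q (j + 1) \<theta> - 2 * channels p q j \<theta> + channels p q (j - 1) \<theta>) = complex_of_real (dispersion p q \<theta>) * channels p q j \<theta>"
    if j: "j \<le> -1" for j
    using c
  proof (elim disjE conjE)
    assume t: "0 \<le> \<theta>" "\<theta> \<le> pi"
    show ?thesis using t scaled_recurrence(1)[OF r(1)[OF t j], of "sqrt (2 * pi)"] by (simp add: channels_def dispersion_def two_sided_def)
  next
    assume n: "\<not> 0 \<le> \<theta>" and t: "0 \<le> - \<theta>" "- \<theta> \<le> pi"
    have j': "1 \<le> - j" using j by simp
    have e: "- (j + 1) = - j - 1" "- (j - 1) = - j + 1" by simp_all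
    show ?thesis using n scaled_recurrence(2)[OF r'(2)[OF t j'], of "sqrt (2 * pi)"]
      unfolding channels_def dispersion_def two_sided_def e by simp
  qed
  show "complex_of_real (q\<^sup>2) * (channels p q (j + 1) \<theta> - 2 * channels p q j \<theta> + channels p q (j - 1) \<theta>) = complex_of_real (dispersion p q \<theta>) * channels p q j \<theta>"
    if j: "1 \<le> j" for j
    using c
  proof (elim disjE conjE)
    assume t: "0 \<le> \<theta>" "\<theta> \<le> pi"
    show ?thesis using t scaled_recurrence(1)[OF r(2)[OF t j], of "sqrt (2 * pi)"] by (simp add: channels_def dispersion_def two_sided_def)
  next
    assume n: "\<not> 0 \<le> \<theta>" and t: "0 \<le> - \<theta>" "- \<theta> \<le> pi"
    have j': "- j \<le> - 1" using j by simp
    have e: "- (j + 1) = - j - 1" "- (j - 1) = - j + 1" by simp_all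
    show ?thesis using n scaled_recurrence(2)[OF r'(1)[OF t j'], of "sqrt (2 * pi)"]
      unfolding channels_def dispersion_def two_sided_def e by simp
  qed
  show "complex_of_real (p\<^sup>2) * (channels p q (- 1) \<theta> - channels p q 0 \<theta>) = complex_of_real (q\<^sup>2) * (channels p q 0 \<theta> - channels p q 1 \<theta>)"
    using c
  proof (elim disjE conjE)
    assume t: "0 \<le> \<theta>" "\<theta> \<le> pi"
    show ?thesis using t scaled_flux[OF r(3)[OF t], of "sqrt (2 * pi)"] by (simp add: channels_def two_sided_def)
  next
    assume n: "\<not> 0 \<le> \<theta>" and t: "0 \<le> - \<theta>" "- \<theta> \<le> pi"
    have "complex_of_real (p\<^sup>2) * (channel q p (- \<theta>) 1 - channel q p (- \<theta>) 0) = complex_of_real (q\<^sup>2) * (channel q p (- \<theta>) 0 - channel q p (- \<theta>) (-1))"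
      using arg_cong[OF r'(3)[OF t], of uminus] by (simp add: algebra_simps)
    from scaled_flux[OF this, of "sqrt (2 * pi)"] show ?thesis using n
      unfolding channels_def two_sided_def by simp
  qed
qed

lemma gram_channels:
  "(\<integral>\<theta>. channels p q j \<theta> * cnj (channels p q k \<theta>) \<partial>circle)
    = (integral {0..pi} (\<lambda>\<theta>. channel p q \<theta> j * cnj (channel p q \<theta> k))
      + integral {0..pi} (\<lambda>\<theta>. channel q p \<theta> (- j) * cnj (channel q p \<theta> (- k)))) / (2 * pi)"
proof -
  have s: "complex_of_real (sqrt (2 * pi)) * complex_of_real (sqrt (2 * pi)) = 2 * pi"
    by (simp flip: of_real_mult)
  have e: "channels p q j \<theta> * cnj (channels p q k \<theta>) = two_sided (\<lambda>\<theta>. channel p q \<theta> j * cnj (channel p q \<theta> k) / (2 * pi))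
     (\<lambda>\<theta>. channel q p \<theta> (- j) * cnj (channel q p \<theta> (- k)) / (2 * pi)) \<theta>" for \<theta>
    unfolding s[symmetric] channels_def by (simp add: two_sided_def)
  have c: "continuous_on {0..pi} (\<lambda>\<theta>. channel p q \<theta> j * cnj (channel p q \<theta> k) / (2 * pi))"
    "continuous_on {0..pi} (\<lambda>\<theta>. channel q p \<theta> (- j) * cnj (channel q p \<theta> (- k)) / (2 * pi))"
    by (intro continuous_intros continuous_channels; simp)+
  show ?thesis unfolding e two_sided_integral(2)[OF c] Henstock_Kurzweil_Integration.integral_divide add_divide_distrib ..
qed

lemma spectral_representation: "spectral_representation circle (p\<^sup>2) (q\<^sup>2) (channels p q) (dispersion p q) 3 (4 * p\<^sup>2)"
proof -
  interpret spectral_family circle "p\<^sup>2" "q\<^sup>2" "channels p q" "dispersion p q" 3 "4 * p\<^sup>2" by (rule spectral_family)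
  have k0: "kernel 0 j k = (\<integral>\<theta>. channels p q j \<theta> * cnj (channels p q k \<theta>) \<partial>circle)" for j k
    by (simp add: kernel_def)
  have "kernel 0 j k = (if j = k then 1 else 0)" if "j \<noteq> 0" "k \<le> -1" for j k
    unfolding k0 gram_channels gram_left[OF that(2,1)] by simp
  then have "kernel 0 j k = (if j = k then 1 else 0)" if "j \<noteq> 0" "k \<noteq> 0" for j k
    using orthonormal_extend that by blast
  then show ?thesis
    unfolding spectral_representation_def spectral_representation_axioms_def k0 using spectral_family by blast
qed

end

context two_media
begin

lemma strichartz_channels:
  obtains C where "0 \<le> C" "\<And>\<phi> K. finite K \<Longrightarrow> 0 \<notin> K \<Longrightarrow>
    (\<integral>\<^sup>+ t. (SUP j\<in>{j. j \<noteq> 0}. ennreal (cmod (spectral_family.evol circle (channels p q) (dispersion p q) K \<phi> t j) ^ 6)) \<partial>lborel)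
      \<le> ennreal (C * (\<Sum>k\<in>K. (cmod (\<phi> k))\<^sup>2) ^ 3)"
proof -
  interpret spectral_representation circle "p\<^sup>2" "q\<^sup>2" "channels p q" "dispersion p q" 3 "4 * p\<^sup>2"
    by (rule spectral_representation)
  define L where "L = 104 * (2 * p\<^sup>2) powr (- 1 / 3) + 104 * (2 * q\<^sup>2) powr (- 1 / 3)"
  define C where "C = 28672 * (48 * L / (2 * pi)) ^ 3"
  have C: "0 \<le> C" by (simp add: C_def L_def)
  have main: "(\<integral>\<^sup>+ t. (SUP j\<in>{j. j \<noteq> 0}. ennreal (cmod (evol K \<phi> t j) ^ 6)) \<partial>lborel)
      \<le> ennreal (C * (\<Sum>k\<in>K. (cmod (\<phi> k))\<^sup>2) ^ 3)" if K: "finite K" "0 \<notin> K" for \<phi> K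
  proof -
    let ?s = "complex_of_real (sqrt (2 * pi))"
    have ss: "?s * ?s = 2 * pi" by (simp flip: of_real_mult)
    define G1 G2 where "G1 \<theta> = (\<Sum>k\<in>K. \<phi> k * cnj (channel p q \<theta> k / ?s))"
      and "G2 \<theta> = (\<Sum>k\<in>K. \<phi> k * cnj (channel q p \<theta> (- k) / ?s))" for \<theta>
    \<comment> \<open>\<open>wave\<close> uses unnormalised states, so the factor
      \<open>1 / sqrt (2 * pi)\<close> of the observed site is moved into the amplitudes. It divides
      their square integrals by \<open>2 * pi\<close>, which explains the constant
      \<open>C\<close>.\<close>
    define F1 F2 where "F1 \<theta> = G1 \<theta> / ?s" and "F2 \<theta> = G2 \<theta> / ?s" for \<theta>
    have cG: "continuous_on {0..pi} G1" "continuous_on {0..pi} G2"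
      unfolding G1_def G2_def by (intro continuous_on_sum continuous_on_mult continuous_on_const continuous_on_cnj continuous_normalized)+
    have cF: "continuous_on {0..pi} F1" "continuous_on {0..pi} F2"
      unfolding F1_def F2_def by (intro continuous_intros cG; simp)+
    have synth: "synth K \<phi> \<theta> = two_sided G1 G2 \<theta>" for \<theta>
      by (auto simp: synth_def channels_def two_sided_def G1_def G2_def)
    have e: "cis (t * dispersion p q \<theta>) * (channels p q j \<theta> * synth K \<phi> \<theta>)
       = two_sided (\<lambda>\<theta>. cis (t * (- 4 * p\<^sup>2 * (sin (\<theta> / 2))\<^sup>2)) * (channel p q \<theta> j * F1 \<theta>))
          (\<lambda>\<theta>. cis (t * (- 4 * q\<^sup>2 * (sin (\<theta> / 2))\<^sup>2)) * (channel q p \<theta> (- j) * F2 \<theta>)) \<theta>" for t j \<theta>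
      unfolding synth by (simp add: channels_def dispersion_def two_sided_def F1_def F2_def)
    have c: "continuous_on {0..pi} (\<lambda>\<theta>. cis (t * (- 4 * p\<^sup>2 * (sin (\<theta> / 2))\<^sup>2)) * (channel p q \<theta> j * F1 \<theta>))"
      "continuous_on {0..pi} (\<lambda>\<theta>. cis (t * (- 4 * q\<^sup>2 * (sin (\<theta> / 2))\<^sup>2)) * (channel q p \<theta> (- j) * F2 \<theta>))" for t j
      by (intro continuous_on_mult continuous_on_cis continuous_on_const continuous_dispersion continuous_channels cF)+
    have evol: "evol K \<phi> t j = wave F1 F2 t j" for t j
      unfolding wave_def[OF cF] oscillation_def evol_def e by (rule two_sided_integral(2)[OF c])
    define S where "S = (\<Sum>k\<in>K. (cmod (\<phi> k))\<^sup>2)"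
    have S: "S = integral {0..pi} (\<lambda>\<theta>. (cmod (G1 \<theta>))\<^sup>2) + integral {0..pi} (\<lambda>\<theta>. (cmod (G2 \<theta>))\<^sup>2)"
    proof -
      have e2: "(cmod (synth K \<phi> \<theta>))\<^sup>2 = two_sided (\<lambda>\<theta>. (cmod (G1 \<theta>))\<^sup>2) (\<lambda>\<theta>. (cmod (G2 \<theta>))\<^sup>2) \<theta>" for \<theta>
        unfolding synth by (simp add: two_sided_def)
      have "S = (\<integral>\<theta>. two_sided (\<lambda>\<theta>. (cmod (G1 \<theta>))\<^sup>2) (\<lambda>\<theta>. (cmod (G2 \<theta>))\<^sup>2) \<theta> \<partial>circle)"
        unfolding S_def e2[symmetric] by (rule parseval[OF K, symmetric])
      then show ?thesis by (simp only:) (intro two_sided_integral(2) continuous_intros cG)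
    qed
    have F: "(cmod (F1 \<theta>))\<^sup>2 = (cmod (G1 \<theta>))\<^sup>2 / (2 * pi)" "(cmod (F2 \<theta>))\<^sup>2 = (cmod (G2 \<theta>))\<^sup>2 / (2 * pi)" for \<theta>
      by (simp_all add: F1_def F2_def norm_divide power_divide)
    have N: "integral {0..pi} (\<lambda>\<theta>. (cmod (F1 \<theta>))\<^sup>2) + integral {0..pi} (\<lambda>\<theta>. (cmod (F2 \<theta>))\<^sup>2) = S / (2 * pi)"
      unfolding F Henstock_Kurzweil_Integration.integral_divide S by (rule add_divide_distrib[symmetric])
    have "28672 * (48 * L * (S / (2 * pi))) ^ 3 = C * S ^ 3"
      unfolding C_def by (simp add: power_mult_distrib power_divide)
    then show ?thesis
      using strichartz_wave[OF cF] unfolding evol N L_def[symmetric] S_def[symmetric] by simp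
  qed
  show ?thesis by (rule that[OF C main])
qed

end

text \<open>Mirroring the line exchanges the media and thereby reduces the case of a faster right
  medium to \<open>two_media\<close>.\<close>

lemma spectral_representation_reflect:
  assumes "spectral_representation M a b \<Psi> \<Lambda> B L"
  shows "spectral_representation M b a (\<lambda>j. \<Psi> (- j)) \<Lambda> B L"
    "spectral_family.evol M (\<lambda>j. \<Psi> (- j)) \<Lambda> (uminus ` K) (\<lambda>k. \<phi> (- k)) t (- j) = spectral_family.evol M \<Psi> \<Lambda> K \<phi> t j"
proof -
  interpret spectral_representation M a b \<Psi> \<Lambda> B L by (rule assms)
  show r: "spectral_representation M b a (\<lambda>j. \<Psi> (- j)) \<Lambda> B L"
  proof unfold_locales
    show "complex_of_real b * (\<Psi> (- (j + 1)) x - 2 * \<Psi> (- j) x + \<Psi> (- (j - 1)) x) = complex_of_real (\<Lambda> x) * \<Psi> (- j) x"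
      if "j \<le> -1" "x \<in> space M" for j x
    proof -
      have "complex_of_real b * (\<Psi> (- j + 1) x - 2 * \<Psi> (- j) x + \<Psi> (- j - 1) x) = complex_of_real (\<Lambda> x) * \<Psi> (- j) x"
        by (rule right) (use that in auto)
      moreover have "- (j + 1) = - j - 1" "- (j - 1) = - j + 1" by simp_all
      ultimately show ?thesis by (simp only: add.commute diff_conv_add_uminus add.left_commute)
    qed
    show "complex_of_real a * (\<Psi> (- (j + 1)) x - 2 * \<Psi> (- j) x + \<Psi> (- (j - 1)) x) = complex_of_real (\<Lambda> x) * \<Psi> (- j) x"
      if "1 \<le> j" "x \<in> space M" for j x
    proof -
      have "complex_of_real a * (\<Psi> (- j + 1) x - 2 * \<Psi> (- j) x + \<Psi> (- j - 1) x) = complex_of_real (\<Lambda> x) * \<Psi> (- j) x"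
        by (rule left) (use that in auto)
      moreover have "- (j + 1) = - j - 1" "- (j - 1) = - j + 1" by simp_all
      ultimately show ?thesis by (simp only: add.commute diff_conv_add_uminus add.left_commute)
    qed
    show "complex_of_real b * (\<Psi> (- (- 1)) x - \<Psi> (- 0) x) = complex_of_real a * (\<Psi> (- 0) x - \<Psi> (- 1) x)" if "x \<in> space M" for x
      using arg_cong[OF flux[OF that], of uminus] by (simp add: algebra_simps)
  qed (use ab \<Psi>_bound \<Lambda>_bound orthonormal in auto)
  interpret r: spectral_representation M b a "\<lambda>j. \<Psi> (- j)" \<Lambda> B L by (rule r)
  show "r.evol (uminus ` K) (\<lambda>k. \<phi> (- k)) t (- j) = evol K \<phi> t j"
    unfolding evol_def r.evol_def synth_def r.synth_def by (subst sum.reindex) (simp_all add: inj_on_def)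
qed

theorem exists_spectral_representation:
  fixes a b :: real
  assumes "0 < a" "0 < b"
  obtains M :: "real measure" and \<Psi> \<Lambda> B L C where "spectral_representation M a b \<Psi> \<Lambda> B L" "0 \<le> C"
    "\<And>\<phi> K. finite K \<Longrightarrow> 0 \<notin> K \<Longrightarrow>
      (\<integral>\<^sup>+ t. (SUP j\<in>{j. j \<noteq> 0}. ennreal (cmod (spectral_family.evol M \<Psi> \<Lambda> K \<phi> t j) ^ 6)) \<partial>lborel)
        \<le> ennreal (C * (\<Sum>k\<in>K. (cmod (\<phi> k))\<^sup>2) ^ 3)"
proof (cases "b \<le> a")
  case True
  interpret two_media "sqrt a" "sqrt b" using assms True by unfold_locales auto
  have "spectral_representation circle a b (channels (sqrt a) (sqrt b)) (dispersion (sqrt a) (sqrt b)) 3 (4 * a)"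
    using spectral_representation assms by simp
  then show ?thesis by (rule strichartz_channels[OF that])
next
  case False
  interpret two_media "sqrt b" "sqrt a" using assms False by unfold_locales auto
  let ?\<Psi> = "channels (sqrt b) (sqrt a)" and ?\<Lambda> = "dispersion (sqrt b) (sqrt a)"
  have s: "spectral_representation circle b a ?\<Psi> ?\<Lambda> 3 (4 * b)"
    using spectral_representation assms by simp
  show ?thesis
  proof (rule strichartz_channels)
    fix C assume C: "0 \<le> C" "\<And>\<phi> K. finite K \<Longrightarrow> 0 \<notin> K \<Longrightarrow>
      (\<integral>\<^sup>+ t. (SUP j\<in>{j. j \<noteq> 0}. ennreal (cmod (spectral_family.evol circle ?\<Psi> ?\<Lambda> K \<phi> t j) ^ 6)) \<partial>lborel)
        \<le> ennreal (C * (\<Sum>k\<in>K. (cmod (\<phi> k))\<^sup>2) ^ 3)"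
    show ?thesis
    proof (rule that[OF spectral_representation_reflect(1)[OF s] C(1)])
      fix \<phi> :: "int \<Rightarrow> complex" and K :: "int set" assume K: "finite K" "0 \<notin> K"
      have im: "uminus ` uminus ` K = K" by (simp add: image_image)
      have e: "spectral_family.evol circle (\<lambda>j. ?\<Psi> (- j)) ?\<Lambda> K \<phi> t (- j) = spectral_family.evol circle ?\<Psi> ?\<Lambda> (uminus ` K) (\<lambda>k. \<phi> (- k)) t j" for t j
        using spectral_representation_reflect(2)[OF s, of "uminus ` K" "\<lambda>k. \<phi> (- k)" t j] unfolding im by simp
      have "(SUP j\<in>{j. j \<noteq> 0}. ennreal (cmod (spectral_family.evol circle (\<lambda>j. ?\<Psi> (- j)) ?\<Lambda> K \<phi> t j) ^ 6))
         \<le> (SUP j\<in>{j. j \<noteq> 0}. ennreal (cmod (spectral_family.evol circle ?\<Psi> ?\<Lambda> (uminus ` K) (\<lambda>k. \<phi> (- k)) t j) ^ 6))" for t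
      proof (rule SUP_mono)
        fix j :: int assume "j \<in> {j. j \<noteq> 0}"
        then show "\<exists>i\<in>{j. j \<noteq> 0}. ennreal (cmod (spectral_family.evol circle (\<lambda>j. ?\<Psi> (- j)) ?\<Lambda> K \<phi> t j) ^ 6)
          \<le> ennreal (cmod (spectral_family.evol circle ?\<Psi> ?\<Lambda> (uminus ` K) (\<lambda>k. \<phi> (- k)) t i) ^ 6)"
          using e[of t "- j"] by (intro bexI[of _ "- j"]) auto
      qed
      then have "(\<integral>\<^sup>+ t. (SUP j\<in>{j. j \<noteq> 0}. ennreal (cmod (spectral_family.evol circle (\<lambda>j. ?\<Psi> (- j)) ?\<Lambda> K \<phi> t j) ^ 6)) \<partial>lborel)
         \<le> (\<integral>\<^sup>+ t. (SUP j\<in>{j. j \<noteq> 0}. ennreal (cmod (spectral_family.evol circle ?\<Psi> ?\<Lambda> (uminus ` K) (\<lambda>k. \<phi> (- k)) t j) ^ 6)) \<partial>lborel)"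
        by (intro nn_integral_mono)
      also have "\<dots> \<le> ennreal (C * (\<Sum>k\<in>uminus ` K. (cmod (\<phi> (- k)))\<^sup>2) ^ 3)"
        by (rule C(2)) (use K in auto)
      also have "(\<Sum>k\<in>uminus ` K. (cmod (\<phi> (- k)))\<^sup>2) = (\<Sum>k\<in>K. (cmod (\<phi> k))\<^sup>2)"
        by (subst sum.reindex) (simp_all add: inj_on_def)
      finally show "(\<integral>\<^sup>+ t. (SUP j\<in>{j. j \<noteq> 0}. ennreal (cmod (spectral_family.evol circle (\<lambda>j. ?\<Psi> (- j)) ?\<Lambda> K \<phi> t j) ^ 6)) \<partial>lborel)
          \<le> ennreal (C * (\<Sum>k\<in>K. (cmod (\<phi> k))\<^sup>2) ^ 3)" .
    qed
  qed
qed

section \<open>Mixed norms\<close>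

lemma esssup_Zstar: "esssup (count_space Zstar) f = (SUP j\<in>Zstar. f j)" for f :: "int \<Rightarrow> ennreal"
proof (rule antisym)
  show "esssup (count_space Zstar) f \<le> (SUP j\<in>Zstar. f j)"
    by (rule esssup_I) (auto simp: AE_count_space intro: SUP_upper)
  show "(SUP j\<in>Zstar. f j) \<le> esssup (count_space Zstar) f"
    using esssup_AE[where M = "count_space Zstar" and f = f] by (auto simp: AE_count_space intro: SUP_least)
qed

lemma measurable_ennpow [measurable]: "(\<lambda>x. ennpow x c) \<in> borel_measurable borel"
  unfolding ennpow_def by measurable

lemma measurable_lr_enorm:
  assumes [measurable]: "\<And>j. (\<lambda>t. w t j) \<in> borel_measurable M"
  shows "(\<lambda>t. lr_enorm r (w t)) \<in> borel_measurable M"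
  unfolding lr_enorm_def Lp_enorm_def esssup_Zstar nn_integral_Zstar
  by (cases "r = \<infinity>") (simp_all, measurable)

text \<open>The weight \<theta> in
  \<open>1 / r = (1 - \<theta>) / 2 + \<theta> / \<infinity>\<close>, for interpolation between the
  l2 norm and the supremum norm.\<close>

definition interpolation_exponent :: "ereal \<Rightarrow> real" where
  "interpolation_exponent r = (if r = \<infinity> then 1 else 1 - 2 / real_of_ereal r)"

lemma ennpow_ennreal: "0 \<le> x \<Longrightarrow> ennpow (ennreal x) c = ennreal (x powr c)"
  by (simp add: ennpow_def)

lemma ennpow_mono: "x \<le> y \<Longrightarrow> 0 \<le> c \<Longrightarrow> ennpow x c \<le> ennpow y c"
  by (cases x; cases y) (auto simp: ennpow_def top_unique intro!: ennreal_leI powr_mono2)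

text \<open>Each term obeys \<open>cmod (w j) powr s \<le> G powr (s - 2) * (cmod (w
  j))\<^sup>2\<close>, and summation leaves the l2 norm. This is used at each fixed time.\<close>

lemma lr_enorm_interpolate:
  assumes r: "2 \<le> r" and G: "0 \<le> G" "G \<le> N" and w: "\<And>j. j \<noteq> 0 \<Longrightarrow> cmod (w j) \<le> G"
    and N: "\<And>n. (\<Sum>j\<in>window n. (cmod (w j))\<^sup>2) \<le> N\<^sup>2"
  shows "lr_enorm r w \<le> ennreal (G powr interpolation_exponent r * N powr (1 - interpolation_exponent r))"
proof (cases "r = \<infinity>")
  case True
  have "lr_enorm r w \<le> ennreal G"
    unfolding lr_enorm_def Lp_enorm_def esssup_Zstar using True w by (auto simp: Zstar_def intro!: SUP_least ennreal_leI)
  \<comment> \<open>\<open>0 powr 0\<close> is 0, so for \<open>N = 0\<close> the claim holds only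
    because \<open>G \<le> N\<close> forces \<open>G = 0\<close>.\<close>
  also have "ennreal G \<le> ennreal (G powr interpolation_exponent r * N powr (1 - interpolation_exponent r))"
    using True G by (auto simp: interpolation_exponent_def)
  finally show ?thesis .
next
  case False
  then obtain s where s: "r = ereal s" "2 \<le> s" using r by (cases r) auto
  have t: "interpolation_exponent r = 1 - 2 / s" by (simp add: interpolation_exponent_def s)
  have pw: "cmod (w j) powr s \<le> G powr (s - 2) * (cmod (w j))\<^sup>2" if "j \<noteq> 0" for j
  proof (cases "w j = 0")
    case False
    then have "cmod (w j) powr s = cmod (w j) powr (s - 2) * cmod (w j) powr 2"
      using powr_add[of "cmod (w j)" "s - 2" 2] by simp
    also have "\<dots> \<le> G powr (s - 2) * cmod (w j) powr 2"
      using w[OF that] s by (intro mult_right_mono powr_mono2) auto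
    finally show ?thesis using False by (simp add: powr_numeral)
  qed simp
  have E: "(\<integral>\<^sup>+ j. ennpow (ennreal (cmod (w j))) s \<partial>count_space Zstar) \<le> ennreal (G powr (s - 2) * N\<^sup>2)"
    unfolding nn_integral_Zstar
  proof (rule SUP_least)
    fix n
    have "(\<Sum>j\<in>window n. ennpow (ennreal (cmod (w j))) s) = ennreal (\<Sum>j\<in>window n. cmod (w j) powr s)"
      by (simp add: ennpow_ennreal sum_ennreal)
    also have "\<dots> \<le> ennreal (\<Sum>j\<in>window n. G powr (s - 2) * (cmod (w j))\<^sup>2)"
      by (intro ennreal_leI sum_mono pw) (auto simp: window_def)
    also have "\<dots> \<le> ennreal (G powr (s - 2) * N\<^sup>2)"
      unfolding sum_distrib_left[symmetric] by (intro ennreal_leI mult_left_mono N) simp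
    finally show "(\<Sum>j\<in>window n. ennpow (ennreal (cmod (w j))) s) \<le> ennreal (G powr (s - 2) * N\<^sup>2)" .
  qed
  have "lr_enorm r w = ennpow (\<integral>\<^sup>+ j. ennpow (ennreal (cmod (w j))) s \<partial>count_space Zstar) (1 / s)"
    unfolding lr_enorm_def Lp_enorm_def using False by (simp add: s)
  also have "\<dots> \<le> ennpow (ennreal (G powr (s - 2) * N\<^sup>2)) (1 / s)" using s by (intro ennpow_mono E) auto
  also have "\<dots> = ennreal ((G powr (s - 2) * N\<^sup>2) powr (1 / s))" by (rule ennpow_ennreal) simp
  also have "(G powr (s - 2) * N\<^sup>2) powr (1 / s) = G powr ((s - 2) / s) * N powr (2 / s)"
  proof -
    have "N\<^sup>2 = N powr 2" using G by simp
    then show ?thesis by (simp add: powr_mult powr_powr)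
  qed
  also have "(s - 2) / s = interpolation_exponent r" unfolding t using s by (simp add: diff_divide_distrib)
  also have "2 / s = 1 - interpolation_exponent r" unfolding t by simp
  finally show ?thesis .
qed

text \<open>Admissibility says exactly that \<open>1 / q\<close> is at most one sixth of the
  interpolation exponent, so the interpolated time integral contains at least the sixth power of the
  supremum norm.\<close>

lemma admissible_exponents:
  assumes q: "2 \<le> q" "q = ereal q'" and r: "2 \<le> r" and qr: "1 / q \<le> 1 / 3 * (1 / 2 - 1 / r)"
  shows "6 \<le> interpolation_exponent r * q'"
proof -
  have q': "2 \<le> q'" using q by simp
  have "1 / q' \<le> interpolation_exponent r / 6"
  proof (cases "r = \<infinity>")
    case True
    then show ?thesis using qr q q' by (simp add: interpolation_exponent_def one_ereal_def)
  next
    case False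
    then obtain s where s: "r = ereal s" "2 \<le> s" using r by (cases r) auto
    have "ereal (1 / q') \<le> ereal (1 / 3 * (1 / 2 - 1 / s))"
      using qr q q' s by (simp add: one_ereal_def numeral_eq_ereal)
    then show ?thesis using s by (simp add: interpolation_exponent_def)
  qed
  then show ?thesis using q' by (simp add: field_simps)
qed

lemma powr_le_add_one: "0 \<le> C \<Longrightarrow> 0 \<le> x \<Longrightarrow> x \<le> 1 \<Longrightarrow> C powr x \<le> 1 + C" for C x :: real
proof -
  assume C: "0 \<le> C" "0 \<le> x" "x \<le> 1"
  have "C powr x \<le> (1 + C) powr x" using C by (intro powr_mono2) auto
  also have "\<dots> \<le> (1 + C) powr 1" using C by (intro powr_mono) auto
  finally show ?thesis using C by simp
qed

text \<open>For finite \<open>q\<close>, interpolation puts \<open>G t powr (\<theta> * s)\<close>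
  with \<open>6 \<le> \<theta> * s\<close> under the time integral. Six powers are integrated by the
  endpoint bound, and the surplus is estimated by \<open>G t \<le> N\<close>; this is how pairs with
  strict inequality between the exponents are reached.\<close>

lemma mixed_norm_bound:
  assumes q: "2 \<le> q" and r: "2 \<le> r" and qr: "1 / q \<le> 1 / 3 * (1 / 2 - 1 / r)"
    and m: "\<And>j. (\<lambda>t. w t j) \<in> borel_measurable borel" and N: "0 \<le> N" and C: "0 \<le> C"
    and l2: "\<And>t J. finite J \<Longrightarrow> 0 \<notin> J \<Longrightarrow> (\<Sum>j\<in>J. (cmod (w t j))\<^sup>2) \<le> N\<^sup>2"
    and endpoint: "(\<integral>\<^sup>+ t. (SUP j\<in>{j. j \<noteq> 0}. ennreal (cmod (w t j) ^ 6)) \<partial>lborel) \<le> ennreal (C * N ^ 6)"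
  shows "LqLr_enorm q r w \<le> ennreal ((1 + C) * N)"
proof -
  define A where "A t = (SUP j\<in>{j. j \<noteq> 0}. ennreal (cmod (w t j) ^ 6))" for t
  \<comment> \<open>The supremum norm at time \<open>t\<close> as a real number. The l2 bound makes
    \<open>A t\<close> finite, so \<open>enn2real\<close> does not take its default value at
    infinity.\<close>
  define G where "G t = root 6 (enn2real (A t))" for t
  define \<theta> where "\<theta> = interpolation_exponent r"
  have wN: "cmod (w t j) \<le> N" if "j \<noteq> 0" for t j
    using l2[of "{j}" t] that N by (auto intro: power2_le_imp_le)
  have A: "A t \<le> ennreal (N ^ 6)" for t
    unfolding A_def by (intro SUP_least ennreal_leI power_mono wN) auto
  have Afin: "A t < top" for t using A[of t] by (rule le_less_trans) simp
  have G0: "0 \<le> G t" for t by (simp add: G_def)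
  have G6: "ennreal (G t ^ 6) = A t" for t using Afin by (simp add: G_def)
  have GN: "G t \<le> N" for t
  proof -
    have "ennreal (G t ^ 6) \<le> ennreal (N ^ 6)" using A[of t] unfolding G6 .
    then have "G t ^ 6 \<le> N ^ 6" using N by (simp add: ennreal_le_iff)
    then show ?thesis using N by (rule power_le_imp_le_base[of _ 5, simplified])
  qed
  have Gw: "cmod (w t j) \<le> G t" if "j \<noteq> 0" for t j
  proof -
    have "ennreal (cmod (w t j) ^ 6) \<le> A t" unfolding A_def using that by (intro SUP_upper) auto
    then have "cmod (w t j) ^ 6 \<le> G t ^ 6" unfolding G6[symmetric] using G0[of t] by (simp add: ennreal_le_iff)
    then show ?thesis using G0[of t] by (rule power_le_imp_le_base[of _ 5, simplified])
  qed
  have \<theta>: "0 \<le> \<theta>" "\<theta> \<le> 1"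
    using r unfolding \<theta>_def interpolation_exponent_def by (cases r; simp)+
  have lr: "lr_enorm r (w t) \<le> ennreal (G t powr \<theta> * N powr (1 - \<theta>))" for t
    unfolding \<theta>_def by (intro lr_enorm_interpolate r G0 GN Gw l2) auto
  have NN: "N powr \<theta> * N powr (1 - \<theta>) = N" using N by (simp flip: powr_add)
  show ?thesis
  proof (cases "q = \<infinity>")
    case True
    have "lr_enorm r (w t) \<le> ennreal N" for t
    proof (rule order_trans[OF lr ennreal_leI])
      have "G t powr \<theta> * N powr (1 - \<theta>) \<le> N powr \<theta> * N powr (1 - \<theta>)"
        by (intro mult_right_mono powr_mono2 \<theta> G0 GN) simp
      then show "G t powr \<theta> * N powr (1 - \<theta>) \<le> N" unfolding NN .
    qed
    moreover have "(\<lambda>t. lr_enorm r (w t)) \<in> borel_measurable lborel" by (intro measurable_lr_enorm) (simp add: m)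
    ultimately have "LqLr_enorm q r w \<le> ennreal N"
      unfolding LqLr_enorm_def Lp_enorm_def using True by (simp add: esssup_I)
    also have "\<dots> \<le> ennreal ((1 + C) * N)" using C N by (intro ennreal_leI) (simp add: algebra_simps)
    finally show ?thesis .
  next
    case False
    then obtain s where s: "q = ereal s" "2 \<le> s" using q by (cases q) auto
    have \<theta>s: "6 \<le> \<theta> * s" unfolding \<theta>_def by (rule admissible_exponents[OF q s(1) r qr])
    have pw: "ennpow (lr_enorm r (w t)) s \<le> A t * ennreal (N powr (s - 6))" for t
    proof -
      have "ennpow (lr_enorm r (w t)) s \<le> ennpow (ennreal (G t powr \<theta> * N powr (1 - \<theta>))) s"
        using s by (intro ennpow_mono lr) auto
      also have "\<dots> = ennreal (G t powr (\<theta> * s) * N powr ((1 - \<theta>) * s))"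
        by (simp add: ennpow_ennreal powr_mult powr_powr)
      also have "\<dots> \<le> ennreal (G t ^ 6 * N powr (s - 6))"
      proof (rule ennreal_leI, cases "G t = 0")
        case False
        then have G: "0 < G t" "0 < N" using G0[of t] GN[of t] by auto
        have "G t powr (\<theta> * s) = G t powr 6 * G t powr (\<theta> * s - 6)"
          using powr_add[of "G t" 6 "\<theta> * s - 6"] by simp
        also have "\<dots> \<le> G t powr 6 * N powr (\<theta> * s - 6)"
          using \<theta>s G GN[of t] by (intro mult_left_mono powr_mono2) auto
        also have "G t powr 6 = G t ^ 6" using G by (simp add: powr_numeral)
        finally have "G t powr (\<theta> * s) * N powr ((1 - \<theta>) * s) \<le> G t ^ 6 * N powr (\<theta> * s - 6) * N powr ((1 - \<theta>) * s)"
          by (rule mult_right_mono) simp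
        also have "\<dots> = G t ^ 6 * N powr (s - 6)" by (simp add: mult.assoc algebra_simps flip: powr_add)
        finally show "G t powr (\<theta> * s) * N powr ((1 - \<theta>) * s) \<le> G t ^ 6 * N powr (s - 6)" .
      qed simp
      also have "\<dots> = A t * ennreal (N powr (s - 6))" using G0[of t] by (simp add: ennreal_mult G6)
      finally show ?thesis .
    qed
    have [measurable]: "A \<in> borel_measurable lborel"
      unfolding A_def[abs_def] using m by (intro borel_measurable_SUP) (auto, measurable)
    have "(\<integral>\<^sup>+ t. ennpow (lr_enorm r (w t)) s \<partial>lborel) \<le> (\<integral>\<^sup>+ t. A t * ennreal (N powr (s - 6)) \<partial>lborel)"
      by (intro nn_integral_mono pw)
    also have "\<dots> = (\<integral>\<^sup>+ t. A t \<partial>lborel) * ennreal (N powr (s - 6))" by (rule nn_integral_multc) measurable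
    also have "\<dots> \<le> ennreal (C * N ^ 6) * ennreal (N powr (s - 6))"
      using endpoint unfolding A_def by (rule mult_right_mono) simp
    also have "\<dots> = ennreal (C * N powr s)"
    proof -
      have "N ^ 6 * N powr (s - 6) = N powr s"
      proof (cases "N = 0")
        case False
        then show ?thesis using N powr_add[of N 6 "s - 6"] by simp
      qed simp
      then show ?thesis using C N by (simp add: mult.assoc flip: ennreal_mult)
    qed
    finally have I: "(\<integral>\<^sup>+ t. ennpow (lr_enorm r (w t)) s \<partial>lborel) \<le> ennreal (C * N powr s)" .
    have "LqLr_enorm q r w = ennpow (\<integral>\<^sup>+ t. ennpow (lr_enorm r (w t)) s \<partial>lborel) (1 / s)"
      unfolding LqLr_enorm_def Lp_enorm_def using s by simp
    also have "\<dots> \<le> ennpow (ennreal (C * N powr s)) (1 / s)" using s by (intro ennpow_mono I) auto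
    also have "\<dots> = ennreal (C powr (1 / s) * N)"
      using C N s by (simp add: ennpow_ennreal powr_mult powr_powr)
    also have "\<dots> \<le> ennreal ((1 + C) * N)"
      using s C N by (intro ennreal_leI mult_right_mono powr_le_add_one) auto
    finally show ?thesis .
  qed
qed

theorem theorem1p2:
  fixes b1 b2 :: real and q r :: ereal
  assumes "b1 > 0" and "b2 > 0"
    and "2 \<le> q" and "q \<le> \<infinity>" and "2 \<le> r" and "r \<le> \<infinity>"
    and "1 / q \<le> 1 / 3 * (1 / 2 - 1 / r)"
  shows "\<exists>C::real. 0 \<le> C \<and>
    (\<forall>\<phi>. in_l2 \<phi> \<longrightarrow>
      (\<exists>u v. is_solution b1 b2 \<phi> u v) \<and>
      (\<forall>u v. is_solution b1 b2 \<phi> u v \<longrightarrow>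
        LqLr_enorm q r (glue u v) \<le> ennreal C * lr_enorm 2 \<phi>))"
proof -
  have ab: "0 < 1 / b1\<^sup>2" "0 < 1 / b2\<^sup>2" using assms by auto
  show ?thesis
  proof (rule exists_spectral_representation[OF ab])
    fix M :: "real measure" and \<Psi> \<Lambda> B L C
    assume rep: "spectral_representation M (1 / b1\<^sup>2) (1 / b2\<^sup>2) \<Psi> \<Lambda> B L" and C: "0 \<le> C"
      and st: "\<And>\<phi> K. finite K \<Longrightarrow> 0 \<notin> K \<Longrightarrow>
        (\<integral>\<^sup>+ t. (SUP j\<in>{j. j \<noteq> 0}. ennreal (cmod (spectral_family.evol M \<Psi> \<Lambda> K \<phi> t j) ^ 6)) \<partial>lborel)
          \<le> ennreal (C * (\<Sum>k\<in>K. (cmod (\<phi> k))\<^sup>2) ^ 3)"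
    interpret spectral_representation M "1 / b1\<^sup>2" "1 / b2\<^sup>2" \<Psi> \<Lambda> B L by (rule rep)
    show ?thesis
    proof (intro exI[of _ "1 + C"] conjI allI impI)
      show "0 \<le> 1 + C" using C by simp
      fix \<phi> assume "in_l2 \<phi>"
      then obtain N where N: "0 \<le> N" "lr_enorm 2 \<phi> = ennreal N" using in_l2_finite by blast
      have l2: "(\<Sum>j\<in>J. (cmod (\<phi> j))\<^sup>2) \<le> N\<^sup>2" if "finite J" "0 \<notin> J" for J
        using N that by (intro lr_enorm_2_sum_le) auto
      note sol = solution_exists[OF N(1) l2 refl refl]
      from sol show "\<exists>u v. is_solution b1 b2 \<phi> u v" by blast
      fix u v assume s: "is_solution b1 b2 \<phi> u v"
      have "LqLr_enorm q r (glue u v) \<le> ennreal ((1 + C) * N)"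
      proof (rule mixed_norm_bound[OF assms(3,5,7) _ N(1) C])
        \<comment> \<open>Uniqueness identifies an arbitrary solution with the constructed one, from
          which it inherits measurability in time and both estimates.\<close>
        have g: "glue u v t j = (if j = 0 then 0 else sol \<phi> t j)" for t j
          using solution_unique[OF N(1) l2 refl refl s, of j t] by (auto simp: glue_def)
        show "(\<lambda>t. glue u v t j) \<in> borel_measurable borel" for j
          unfolding g using sol_measurable[OF N(1) l2] by simp
        show "(\<Sum>j\<in>J. (cmod (glue u v t j))\<^sup>2) \<le> N\<^sup>2" if "finite J" "0 \<notin> J" for t J
        proof -
          have "(\<Sum>j\<in>J. (cmod (glue u v t j))\<^sup>2) = (\<Sum>j\<in>J. (cmod (sol \<phi> t j))\<^sup>2)"
            unfolding g using that by (intro sum.cong) auto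
          then show ?thesis using sol_bound[OF N(1) l2 that] by simp
        qed
        show "(\<integral>\<^sup>+ t. (SUP j\<in>{j. j \<noteq> 0}. ennreal (cmod (glue u v t j) ^ 6)) \<partial>lborel) \<le> ennreal (C * N ^ 6)"
        proof -
          have "(SUP j\<in>{j. j \<noteq> 0}. ennreal (cmod (glue u v t j) ^ 6)) = (SUP j\<in>{j. j \<noteq> 0}. ennreal (cmod (sol \<phi> t j) ^ 6))" for t
            unfolding g by (intro SUP_cong) auto
          then show ?thesis using sol_strichartz[OF N(1) l2 C st] by simp
        qed
      qed
      then show "LqLr_enorm q r (glue u v) \<le> ennreal (1 + C) * lr_enorm 2 \<phi>"
        unfolding N(2) using C N(1) by (simp add: ennreal_mult)
    qed
  qed
qed

end
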